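(* There exists an algorithm that, given an $n$-point metric space $(\mathcal{X},d)$ (with $1\le d(x,y)\le\Delta\le n^{c}$ for distinct points, $c$ a constant) accessed through the oracles of the weak-strong oracle model with corruption probability $\delta=1/3$, with high probability computes an $O(1)$-approximate solution to the $k$-means problem and to the $k$-median problem, using $O(k\log^2 n)$ strong oracle point queries and $O(nk\log^2 n)$ weak oracle queries. Furthermore, the algorithm runs in $O((nk+k^3)\cdot\mathrm{polylog}\, n)$ time.
   Context: Weak-strong oracle model: there is an unknown metric $d$ on a set $\mathcal{X}$ of $n$ points and a corruption probability $\delta$. Independently for each unordered pair $(x,y)$, with probability $\delta$ the pair is corrupted (randomness drawn once). A weak oracle query on $(x,y)$ returns $\tilde d(x,y)=d(x,y)$ if uncorrupted and an arbitrary value chosen by an adversary (knowing $d$ and the corrupted set) otherwise. A strong oracle point query on $x$ returns a symbol $\mathrm{SO}(x)$ from which, together with $\mathrm{SO}(y)$, the distance $d(x,y)$ can be computed. The $k$-median (resp. $k$-means) problem asks for $k$ centers $c_1,\dots,c_k\in\mathcal{X}$ and an assignment $\mathcal{C}$ of points to centers minimizing $\sum_{p\in\mathcal{X}} d(p,\mathcal{C}(p))$ (resp. $\sum_{p} d(p,\mathcal{C}(p))^2$). "With high probability" means with probability at least $1-1/\mathrm{poly}(n)$. *)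

theory Defs
  imports
    "HOL-Analysis.Abstract_Metric_Spaces"
    "HOL-Library.Discrete_Functions"
    "HOL-Probability.Probability"
begin

text \<open>
  The \<open>n\<close> points are numbered \<open>0, \<dots>, n - 1\<close>, and \<open>d\<close> is an arbitrary metric on \<open>{..<n}\<close>.
\<close>

record 's oracles =
  weak_oracle :: "nat \<Rightarrow> nat \<Rightarrow> real"
  strong_oracle :: "nat \<Rightarrow> 's"
  symbol_dist :: "'s \<Rightarrow> 's \<Rightarrow> real"

definition point_pairs :: "nat \<Rightarrow> nat set set" where
  "point_pairs n = {e. e \<subseteq> {..<n} \<and> card e = 2}"

definition corrupted_pairs_pmf :: "real \<Rightarrow> nat \<Rightarrow> nat set set pmf" where
  "corrupted_pairs_pmf \<delta> n =
     map_pmf (\<lambda>b. {e \<in> point_pairs n. b e})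
       (Pi_pmf (point_pairs n) False (\<lambda>_. bernoulli_pmf \<delta>))"

text \<open>
  The adversary \<open>A\<close> maps the whole corrupted set to the values reported on corrupted pairs. It
  will be quantified after the metric, hence may depend on it, but as the answers are fixed once
  it does not see the coins of the algorithm. Values are indexed by unordered pairs, and repeated
  queries get the same answer.
\<close>

definition weak_answers ::
  "(nat \<Rightarrow> nat \<Rightarrow> real) \<Rightarrow> nat set set \<Rightarrow> (nat set set \<Rightarrow> nat set \<Rightarrow> real) \<Rightarrow> nat \<Rightarrow> nat \<Rightarrow> real"
where
  "weak_answers d S A x y = (if {x, y} \<in> S then A S {x, y} else d x y)"

text \<open>The distance of two points can be computed from their symbols.\<close>

definition valid_symbols ::
  "nat \<Rightarrow> (nat \<Rightarrow> nat \<Rightarrow> real) \<Rightarrow> (nat \<Rightarrow> 's) \<Rightarrow> ('s \<Rightarrow> 's \<Rightarrow> real) \<Rightarrow> bool"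
where
  "valid_symbols n d SO sd \<longleftrightarrow> (\<forall>x<n. \<forall>y<n. sd (SO x) (SO y) = d x y)"

text \<open>
  A random-access machine with named, indirectly addressable arrays holding natural numbers
  (words), reals, or strong-oracle symbols. Words are charged by the logarithmic cost criterion,
  so that large words give no hidden parallelism; for words of \<open>O(log n)\<close> bits this agrees with the
  unit-cost word RAM up to a factor \<open>O(log n)\<close>. Real operations have unit cost, as distances are
  exact reals; reals can be compared but not rounded to words. Symbols are opaque: all one can do
  with them is to compute the distance of two of them.
\<close>

type_synonym name = string

datatype wexp =
    WConst nat
  | WGet name wexp
  | WPlus wexp wexp
  | WMinus wexp wexp
  | WTimes wexp wexp
  | WDiv wexp wexp
  | WMod wexp wexp

datatype rexp =
    OfWord wexp
  | RGet name wexp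
  | SymDist name wexp name wexp
  | RPlus rexp rexp
  | RMinus rexp rexp
  | RTimes rexp rexp
  | RDiv rexp rexp

datatype bexp =
    WLess wexp wexp
  | RLess rexp rexp
  | BNot bexp
  | BAnd bexp bexp

datatype com =
    Skip
  | WSet name wexp wexp
  | RSet name wexp rexp
  | Random name wexp wexp
  | WeakQuery name wexp wexp wexp
  | StrongQuery name wexp wexp
  | Seq com com
  | Cond bexp com com
  | While bexp com

record 's state =
  words :: "name \<Rightarrow> nat \<Rightarrow> nat"
  reals :: "name \<Rightarrow> nat \<Rightarrow> real"
  symbols :: "name \<Rightarrow> nat \<Rightarrow> 's option"
  time :: nat
  weak_queries :: nat
  strong_queries :: nat

definition upd :: "(name \<Rightarrow> nat \<Rightarrow> 'v) \<Rightarrow> name \<Rightarrow> nat \<Rightarrow> 'v \<Rightarrow> name \<Rightarrow> nat \<Rightarrow> 'v" where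
  "upd m a i v = m(a := (m a)(i := v))"

primrec wval :: "'s state \<Rightarrow> wexp \<Rightarrow> nat" where
  "wval s (WConst c) = c"
| "wval s (WGet a i) = words s a (wval s i)"
| "wval s (WPlus e f) = wval s e + wval s f"
| "wval s (WMinus e f) = wval s e - wval s f"
| "wval s (WTimes e f) = wval s e * wval s f"
| "wval s (WDiv e f) = wval s e div wval s f"
| "wval s (WMod e f) = wval s e mod wval s f"

primrec rval :: "'s oracles \<Rightarrow> 's state \<Rightarrow> rexp \<Rightarrow> real" where
  "rval orc s (OfWord e) = real (wval s e)"
| "rval orc s (RGet a i) = reals s a (wval s i)"
| "rval orc s (SymDist a i b j) =
     (case (symbols s a (wval s i), symbols s b (wval s j)) of
        (Some u, Some v) \<Rightarrow> symbol_dist orc u v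
      | _ \<Rightarrow> 0)"
| "rval orc s (RPlus e f) = rval orc s e + rval orc s f"
| "rval orc s (RMinus e f) = rval orc s e - rval orc s f"
| "rval orc s (RTimes e f) = rval orc s e * rval orc s f"
| "rval orc s (RDiv e f) = rval orc s e / rval orc s f"

primrec bval :: "'s oracles \<Rightarrow> 's state \<Rightarrow> bexp \<Rightarrow> bool" where
  "bval orc s (WLess e f) \<longleftrightarrow> wval s e < wval s f"
| "bval orc s (RLess e f) \<longleftrightarrow> rval orc s e < rval orc s f"
| "bval orc s (BNot b) \<longleftrightarrow> \<not> bval orc s b"
| "bval orc s (BAnd b c) \<longleftrightarrow> bval orc s b \<and> bval orc s c"

definition bit_length :: "nat \<Rightarrow> nat" where
  "bit_length w = Suc (floor_log w)"

text \<open>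
  Every node of a word expression is charged the length of its value; as the operands are nodes
  themselves, an operation is charged for its operands, addresses and result.
\<close>

primrec wcost :: "'s state \<Rightarrow> wexp \<Rightarrow> nat" where
  "wcost s (WConst c) = bit_length c"
| "wcost s (WGet a i) = wcost s i + bit_length (wval s (WGet a i))"
| "wcost s (WPlus e f) = wcost s e + wcost s f + bit_length (wval s (WPlus e f))"
| "wcost s (WMinus e f) = wcost s e + wcost s f + bit_length (wval s (WMinus e f))"
| "wcost s (WTimes e f) = wcost s e + wcost s f + bit_length (wval s (WTimes e f))"
| "wcost s (WDiv e f) = wcost s e + wcost s f + bit_length (wval s (WDiv e f))"
| "wcost s (WMod e f) = wcost s e + wcost s f + bit_length (wval s (WMod e f))"

primrec rcost :: "'s state \<Rightarrow> rexp \<Rightarrow> nat" where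
  "rcost s (OfWord e) = wcost s e + 1"
| "rcost s (RGet a i) = wcost s i + 1"
| "rcost s (SymDist a i b j) = wcost s i + wcost s j + 1"
| "rcost s (RPlus e f) = rcost s e + rcost s f + 1"
| "rcost s (RMinus e f) = rcost s e + rcost s f + 1"
| "rcost s (RTimes e f) = rcost s e + rcost s f + 1"
| "rcost s (RDiv e f) = rcost s e + rcost s f + 1"

primrec bcost :: "'s state \<Rightarrow> bexp \<Rightarrow> nat" where
  "bcost s (WLess e f) = wcost s e + wcost s f + 1"
| "bcost s (RLess e f) = rcost s e + rcost s f + 1"
| "bcost s (BNot b) = bcost s b + 1"
| "bcost s (BAnd b c) = bcost s b + bcost s c + 1"

definition charge :: "nat \<Rightarrow> 's state \<Rightarrow> 's state" where
  "charge t s = s\<lparr>time := time s + t\<rparr>"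

partial_function (spmf) while_spmf ::
  "('a \<Rightarrow> bool) \<Rightarrow> ('a \<Rightarrow> 'a spmf) \<Rightarrow> 'a \<Rightarrow> 'a spmf"
where
  "while_spmf g f s =
     (if g s then bind_spmf (f s) (\<lambda>t. while_spmf g f t) else return_spmf s)"

text \<open>
  The result is the distribution of final states; non-terminating runs are the missing mass.
  \<open>Random a i m\<close> stores a uniformly random element of \<open>{..<m}\<close> (and \<open>0\<close> if \<open>m = 0\<close>) in \<open>a[i]\<close>.
\<close>

primrec exec :: "'s oracles \<Rightarrow> com \<Rightarrow> 's state \<Rightarrow> 's state spmf" where
  "exec orc Skip = (\<lambda>s. return_spmf (charge 1 s))"
| "exec orc (WSet a i e) = (\<lambda>s. return_spmf (charge (wcost s i + wcost s e + 1)
     (s\<lparr>words := upd (words s) a (wval s i) (wval s e)\<rparr>)))"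
| "exec orc (RSet a i e) = (\<lambda>s. return_spmf (charge (wcost s i + rcost s e + 1)
     (s\<lparr>reals := upd (reals s) a (wval s i) (rval orc s e)\<rparr>)))"
| "exec orc (Random a i m) = (\<lambda>s. map_spmf (\<lambda>v. charge (wcost s i + wcost s m + 1)
     (s\<lparr>words := upd (words s) a (wval s i) v\<rparr>))
     (if wval s m = 0 then return_spmf 0 else spmf_of_set {..<wval s m}))"
| "exec orc (WeakQuery a i x y) = (\<lambda>s. return_spmf (charge (wcost s i + wcost s x + wcost s y + 1)
     (s\<lparr>reals := upd (reals s) a (wval s i) (weak_oracle orc (wval s x) (wval s y)),
        weak_queries := weak_queries s + 1\<rparr>)))"
| "exec orc (StrongQuery a i x) = (\<lambda>s. return_spmf (charge (wcost s i + wcost s x + 1)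
     (s\<lparr>symbols := upd (symbols s) a (wval s i) (Some (strong_oracle orc (wval s x))),
        strong_queries := strong_queries s + 1\<rparr>)))"
| "exec orc (Seq c1 c2) = (\<lambda>s. bind_spmf (exec orc c1 s) (exec orc c2))"
| "exec orc (Cond b c1 c2) = (\<lambda>s.
     if bval orc s b then exec orc c1 (charge (bcost s b) s) else exec orc c2 (charge (bcost s b) s))"
| "exec orc (While b c) = (\<lambda>s. map_spmf (\<lambda>t. charge (bcost t b) t)
     (while_spmf (\<lambda>t. bval orc t b) (\<lambda>t. exec orc c (charge (bcost t b) t)) s))"

text \<open>
  The exponent \<open>z\<close> selects the objective: \<open>z = 1\<close> is \<open>k\<close>-median, \<open>z = 2\<close> is \<open>k\<close>-means.
  A solution consists of centers \<open>ctr 0, \<dots>, ctr (k - 1)\<close> (possibly repeated) and an assignment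
  \<open>asg\<close> of the points to centers.
\<close>

definition clustering_solution :: "nat \<Rightarrow> nat \<Rightarrow> (nat \<Rightarrow> nat) \<Rightarrow> (nat \<Rightarrow> nat) \<Rightarrow> bool" where
  "clustering_solution n k ctr asg \<longleftrightarrow>
     ctr ` {..<k} \<subseteq> {..<n} \<and> asg ` {..<n} \<subseteq> ctr ` {..<k}"

definition clustering_cost ::
  "nat \<Rightarrow> (nat \<Rightarrow> nat \<Rightarrow> real) \<Rightarrow> nat \<Rightarrow> (nat \<Rightarrow> nat) \<Rightarrow> real"
where
  "clustering_cost z d n asg = (\<Sum>p<n. d p (asg p) ^ z)"

definition optimal_cost :: "nat \<Rightarrow> (nat \<Rightarrow> nat \<Rightarrow> real) \<Rightarrow> nat \<Rightarrow> nat \<Rightarrow> real" where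
  "optimal_cost z d n k =
     Inf {clustering_cost z d n asg | ctr asg. clustering_solution n k ctr asg}"

definition approx_solution ::
  "real \<Rightarrow> nat \<Rightarrow> (nat \<Rightarrow> nat \<Rightarrow> real) \<Rightarrow> nat \<Rightarrow> nat \<Rightarrow> (nat \<Rightarrow> nat) \<Rightarrow> (nat \<Rightarrow> nat) \<Rightarrow> bool"
where
  "approx_solution \<alpha> z d n k ctr asg \<longleftrightarrow>
     clustering_solution n k ctr asg \<and>
     clustering_cost z d n asg \<le> \<alpha> * optimal_cost z d n k"

text \<open>
  The inputs \<open>n\<close>, \<open>k\<close> and the objective \<open>z\<close> are passed in cell \<open>0\<close> of the word arrays of these
  names; the metric is accessible through the oracles only. The output is left in the word arrays
  \<open>centers\<close> and \<open>assignment\<close>.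
\<close>

definition initial_state :: "nat \<Rightarrow> nat \<Rightarrow> nat \<Rightarrow> 's state" where
  "initial_state n k z =
     \<lparr>words = upd (upd (upd (\<lambda>_ _. 0) ''n'' 0 n) ''k'' 0 k) ''z'' 0 z,
      reals = (\<lambda>_ _. 0), symbols = (\<lambda>_ _. None),
      time = 0, weak_queries = 0, strong_queries = 0\<rparr>"

text \<open>
  The corrupted set is drawn once, before and independently of the coins of the program.
\<close>

definition oracle_run ::
  "real \<Rightarrow> (nat \<Rightarrow> nat \<Rightarrow> real) \<Rightarrow> (nat set set \<Rightarrow> nat set \<Rightarrow> real) \<Rightarrow> (nat \<Rightarrow> 's) \<Rightarrow>
   ('s \<Rightarrow> 's \<Rightarrow> real) \<Rightarrow> com \<Rightarrow> nat \<Rightarrow> nat \<Rightarrow> nat \<Rightarrow> 's state spmf"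
where
  "oracle_run \<delta> d A SO sd P n k z =
     bind_spmf (spmf_of_pmf (corrupted_pairs_pmf \<delta> n))
       (\<lambda>S. exec \<lparr>weak_oracle = weak_answers d S A, strong_oracle = SO, symbol_dist = sd\<rparr> P
              (initial_state n k z))"

end

theory Submission
  imports Defs
begin

text \<open>
  Centers are found by adaptive sampling: points are drawn one at a time with probability roughly
  proportional to \<open>D\<^sup>z\<close>, where \<open>D\<close> estimates the distance to the centers found so far. A sampled
  point \<open>y\<close> becomes a center when some ball around it holds \<open>M = \<Theta>(log n)\<close> samples and is small
  compared to \<open>D y\<close>; the distance of \<open>x\<close> to \<open>y\<close> is then estimated by the median of the weak
  distances of \<open>x\<close> to the first \<open>m\<close> samples in this ball. As long as a ball is far from the earlier
  centers, \<open>D\<close> is almost constant on it, so that its first samples are almost uniform whatever the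
  adversary did; since the ball contains at least \<open>M\<close> points, about a third of its pairs with \<open>x\<close> are
  corrupted, and an exponential supermartingale shows that a majority of corrupted pairs among the
  \<open>m\<close> samples is unlikely. Unless the estimated cost is already \<open>O(OPT)\<close>, every draw hits with constant
  probability the core of an optimal cluster that still needs samples, which happens \<open>O(Mk)\<close>
  times at most; hence \<open>O(k log n)\<close> draws suffice. Single-swap local search on
  the samples, weighted by the number of points assigned to them, uses only distances known from
  the strong oracle and reduces them to \<open>k\<close> centers.

  The algorithm is written in a loop language whose cost can be read off the program text and
  whose semantics is a function, as only the draws of the main loop are random.
\<close>

text \<open>The weak answers are fixed before the coins, but the adversary knows the metric, and the
  choice of samples depends on earlier weak answers; so corruptions and samples cannot be treated as
  independent. The randomness is therefore split. The corrupted set enters only through one property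
  that holds with high probability: for every x, each ball with at least M points has at most 3/8 of
  its pairs with x corrupted. Given this, everything is a statement about the coins of the sampler,
  proved with two supermartingales, one for corrupted majorities and one for lack of progress. The
  former needs weights nearly constant on a far ball; adding 100 radii to every estimate provides
  this, since a median error of one radius becomes a relative error of one per cent. The bridge to
  the machine is a coupling of the run with an abstract random list of samples, from which estimates
  and swaps are computed deterministically. The case n <= k is separate: the additive error left by
  the local search is absorbed by OPT >= 1, which requires a point that is not a center.\<close>

lemma upd_apply: "upd m a i v b j = (if b = a \<and> j = i then v else m b j)"
  by (simp add: upd_def)

lemma upd_other: "b \<noteq> a \<Longrightarrow> upd m a i v b = m b"
  by (simp add: upd_def)

text \<open>The three counters are erased, so that the result of \<open>exec\<close> can be equated
  with that of \<open>dsem\<close>, which does not count.\<close>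

definition strip :: "'s state \<Rightarrow> 's state" where
  "strip s = s\<lparr>time := 0, weak_queries := 0, strong_queries := 0\<rparr>"

lemma strip_simps [simp]:
  "words (strip s) = words s" "reals (strip s) = reals s" "symbols (strip s) = symbols s"
  "strip (charge t s) = strip s"
  by (simp_all add: strip_def charge_def)

lemma charge_simps [simp]:
  "words (charge t s) = words s" "reals (charge t s) = reals s" "symbols (charge t s) = symbols s"
  "time (charge t s) = time s + t" "weak_queries (charge t s) = weak_queries s"
  "strong_queries (charge t s) = strong_queries s"
  by (simp_all add: charge_def)

lemma wval_cong: "words s = words t \<Longrightarrow> wval s e = wval t e"
  by (induction e) auto

lemma rval_cong:
  "words s = words t \<Longrightarrow> reals s = reals t \<Longrightarrow> symbols s = symbols t \<Longrightarrow> rval orc s e = rval orc t e"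
  by (induction e) (auto simp: wval_cong[of s t])

lemma bval_cong:
  "words s = words t \<Longrightarrow> reals s = reals t \<Longrightarrow> symbols s = symbols t \<Longrightarrow> bval orc s e = bval orc t e"
  by (induction e) (auto simp: wval_cong[of s t] rval_cong[of s t])

lemma val_strip [simp]:
  "wval (strip s) e = wval s e" "rval orc (strip s) r = rval orc s r" "bval orc (strip s) b = bval orc s b"
  "wval (charge c s) e = wval s e" "rval orc (charge c s) r = rval orc s r" "bval orc (charge c s) b = bval orc s b"
  by (rule wval_cong rval_cong bval_cong; simp)+

section \<open>A deterministic loop language and its functional semantics\<close>

datatype stm =
    NOP
  | WS name wexp wexp
  | RS name wexp rexp
  | WQ name wexp wexp wexp
  | SQ name wexp wexp
  | Then stm stm (infixr ";;" 60)
  | IF bexp stm stm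
  | FOR name name stm

abbreviation var :: "name \<Rightarrow> wexp" where "var a \<equiv> WGet a (WConst 0)"

primrec comp :: "stm \<Rightarrow> com" where
  "comp NOP = Skip"
| "comp (WS a i e) = WSet a i e"
| "comp (RS a i e) = RSet a i e"
| "comp (WQ a i x y) = WeakQuery a i x y"
| "comp (SQ a i x) = StrongQuery a i x"
| "comp (p ;; q) = Seq (comp p) (comp q)"
| "comp (IF b p q) = Cond b (comp p) (comp q)"
| "comp (FOR v b p) = Seq (WSet v (WConst 0) (WConst 0))
     (While (WLess (var v) (var b)) (Seq (comp p) (WSet v (WConst 0) (WPlus (var v) (WConst 1)))))"

definition wset :: "name \<Rightarrow> nat \<Rightarrow> nat \<Rightarrow> 's state \<Rightarrow> 's state" where
  "wset a i v s = s\<lparr>words := upd (words s) a i v\<rparr>"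

definition rset :: "name \<Rightarrow> nat \<Rightarrow> real \<Rightarrow> 's state \<Rightarrow> 's state" where
  "rset a i v s = s\<lparr>reals := upd (reals s) a i v\<rparr>"

definition sset :: "name \<Rightarrow> nat \<Rightarrow> 's \<Rightarrow> 's state \<Rightarrow> 's state" where
  "sset a i v s = s\<lparr>symbols := upd (symbols s) a i (Some v)\<rparr>"

lemma set_simps [simp]:
  "words (wset a i v s) = upd (words s) a i v"
  "reals (wset a i v s) = reals s" "symbols (wset a i v s) = symbols s"
  "words (rset a i r s) = words s"
  "reals (rset a i r s) = upd (reals s) a i r" "symbols (rset a i r s) = symbols s"
  "words (sset a i y s) = words s"
  "reals (sset a i y s) = reals s" "symbols (sset a i y s) = upd (symbols s) a i (Some y)"
  "strip (wset a i v s) = wset a i v (strip s)"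
  "strip (rset a i r s) = rset a i r (strip s)"
  "strip (sset a i y s) = sset a i y (strip s)"
  "strip (s\<lparr>weak_queries := c\<rparr>) = strip s" "strip (s\<lparr>strong_queries := c\<rparr>) = strip s"
  by (simp_all add: wset_def rset_def sset_def strip_def)

primrec dsem :: "'s oracles \<Rightarrow> stm \<Rightarrow> 's state \<Rightarrow> 's state" where
  "dsem orc NOP = (\<lambda>s. s)"
| "dsem orc (WS a i e) = (\<lambda>s. wset a (wval s i) (wval s e) s)"
| "dsem orc (RS a i e) = (\<lambda>s. rset a (wval s i) (rval orc s e) s)"
| "dsem orc (WQ a i x y) = (\<lambda>s. rset a (wval s i) (weak_oracle orc (wval s x) (wval s y)) s)"
| "dsem orc (SQ a i x) = (\<lambda>s. sset a (wval s i) (strong_oracle orc (wval s x)) s)"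
| "dsem orc (p ;; q) = (\<lambda>s. dsem orc q (dsem orc p s))"
| "dsem orc (IF b p q) = (\<lambda>s. if bval orc s b then dsem orc p s else dsem orc q s)"
| "dsem orc (FOR v b p) = (\<lambda>s. wset v 0 (words s b 0)
     (fold (\<lambda>i t. dsem orc p (wset v 0 i t)) [0..<words s b 0] s))"

primrec mods :: "stm \<Rightarrow> name set" where
  "mods NOP = {}"
| "mods (WS a i e) = {a}"
| "mods (RS a i e) = {a}"
| "mods (WQ a i x y) = {a}"
| "mods (SQ a i x) = {a}"
| "mods (p ;; q) = mods p \<union> mods q"
| "mods (IF b p q) = mods p \<union> mods q"
| "mods (FOR v b p) = insert v (mods p)"

definition agree :: "name set \<Rightarrow> 's state \<Rightarrow> 's state \<Rightarrow> bool" where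
  "agree X s t \<longleftrightarrow> (\<forall>a. a \<notin> X \<longrightarrow> words s a = words t a \<and> reals s a = reals t a \<and> symbols s a = symbols t a)"

lemma agree_refl [simp]: "agree X s s"
  by (simp add: agree_def)

lemma agree_trans: "agree X s t \<Longrightarrow> agree X t u \<Longrightarrow> agree X s u"
  by (simp add: agree_def)

lemma agree_mono: "agree X s t \<Longrightarrow> X \<subseteq> Y \<Longrightarrow> agree Y s t"
  by (auto simp: agree_def)

lemma agree_wset: "a \<in> X \<Longrightarrow> agree X (wset a i v s) t \<longleftrightarrow> agree X s t"
  unfolding agree_def set_simps by (metis upd_other)

lemma agree_sets: "a \<in> X \<Longrightarrow> agree X (wset a i v s) s" "a \<in> X \<Longrightarrow> agree X (rset a i r s) s"
  "a \<in> X \<Longrightarrow> agree X (sset a i y s) s"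
  unfolding agree_def set_simps by (metis upd_other)+

lemma fold_upt_invariant:
  assumes "I 0 s" "\<And>i t. i < B \<Longrightarrow> I i t \<Longrightarrow> I (Suc i) (f i t)"
  shows "I B (fold f [0..<B] s)"
  using assms(2) by (induction B) (auto simp: assms(1))

lemma dsem_agree: "agree (mods p) (dsem orc p s) s"
proof (induction p arbitrary: s)
  case (Then p q)
  then show ?case
    by simp (meson agree_mono agree_trans Un_upper1 Un_upper2)
next
  case (IF b p q)
  then show ?case by (auto intro: agree_mono)
next
  case (FOR v b p)
  have "agree (insert v (mods p)) (fold (\<lambda>i t. dsem orc p (wset v 0 i t)) [0..<words s b 0] s) s"
  proof (rule fold_upt_invariant)
    fix i and t :: "'a state"
    assume "agree (insert v (mods p)) t s"
    moreover have "agree (insert v (mods p)) (dsem orc p (wset v 0 i t)) (wset v 0 i t)"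
      using FOR agree_mono by blast
    ultimately show "agree (insert v (mods p)) (dsem orc p (wset v 0 i t)) s"
      by (metis agree_trans agree_wset insertI1)
  qed simp
  then show ?case by (simp add: agree_wset)
qed (auto intro: agree_sets)

lemma dsem_words: "a \<notin> mods p \<Longrightarrow> words (dsem orc p s) a = words s a"
  and dsem_reals: "a \<notin> mods p \<Longrightarrow> reals (dsem orc p s) a = reals s a"
  and dsem_symbols: "a \<notin> mods p \<Longrightarrow> symbols (dsem orc p s) a = symbols s a"
  using dsem_agree[of p orc s] by (auto simp: agree_def)

text \<open>Loop rule behind the loop specifications below. The \<open>agree\<close> premise of
  \<open>step\<close> recovers everything that the body does not write, so invariants only have to
  mention what changes; \<open>ignore\<close> absorbs the writes to the counter. With
  \<open>goal_cases\<close>, goal 3 is the initial state, goal 4 one iteration and goal 5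
  \<open>ignore\<close>.\<close>

lemma dsem_FOR:
  assumes v: "v \<notin> mods p"
    and B: "words s b 0 = B"
    and init: "I 0 s"
    and step: "\<And>i t. i < B \<Longrightarrow> I i t \<Longrightarrow> words t v 0 = i \<Longrightarrow> agree (insert v (mods p)) t s
                 \<Longrightarrow> I (Suc i) (dsem orc p t)"
    and ignore: "\<And>i t j. I i t \<Longrightarrow> I i (wset v 0 j t)"
  shows "I B (dsem orc (FOR v b p) s)"
proof -
  have "(\<lambda>i t. I i t \<and> agree (insert v (mods p)) t s) B
          (fold (\<lambda>i t. dsem orc p (wset v 0 i t)) [0..<B] s)"
  proof (rule fold_upt_invariant)
    show "I 0 s \<and> agree (insert v (mods p)) s s" using init by simp
    fix i t assume i: "i < B" and *: "I i t \<and> agree (insert v (mods p)) t s"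
    then have "agree (insert v (mods p)) (wset v 0 i t) s" by (simp add: agree_wset)
    moreover from this have "agree (insert v (mods p)) (dsem orc p (wset v 0 i t)) s"
      by (meson agree_mono agree_trans dsem_agree subset_insertI)
    ultimately show "I (Suc i) (dsem orc p (wset v 0 i t)) \<and>
        agree (insert v (mods p)) (dsem orc p (wset v 0 i t)) s"
      using step[of i "wset v 0 i t"] ignore[of i t i] i * by (simp add: upd_apply)
  qed
  then show ?thesis using ignore B by simp
qed

section \<open>Cost of compiled programs\<close>

lemma less_two_power_bit_length: "w < 2 ^ bit_length w"
  using floor_log_exp2_gt[of w] by (simp add: bit_length_def)

lemma bit_length_mono: "v \<le> w \<Longrightarrow> bit_length v \<le> bit_length w"
  by (simp add: bit_length_def floor_log_le_iff)

lemma bit_length_le: "w < 2 ^ k \<Longrightarrow> 1 \<le> k \<Longrightarrow> bit_length w \<le> k"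
proof -
  assume w: "w < 2 ^ k" and k: "1 \<le> k"
  show ?thesis
  proof (cases "w = 0")
    case False
    then have "2 ^ floor_log w \<le> w" by (simp add: floor_log_exp2_le)
    with w have "(2::nat) ^ floor_log w < 2 ^ k" by linarith
    then show ?thesis by (simp add: bit_length_def)
  qed (use k in \<open>simp add: bit_length_def\<close>)
qed

lemma bit_length_ge_1: "1 \<le> bit_length w"
  by (simp add: bit_length_def)

lemma bit_length_power: "1 \<le> k \<Longrightarrow> bit_length (V ^ k) \<le> k * bit_length V"
proof (rule bit_length_le)
  assume "1 \<le> k"
  then have "V ^ k < (2 ^ bit_length V) ^ k"
    by (intro power_strict_mono less_two_power_bit_length) auto
  then show "V ^ k < 2 ^ (k * bit_length V)" by (simp flip: power_mult add: mult.commute)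
  show "1 \<le> k * bit_length V" using \<open>1 \<le> k\<close> bit_length_ge_1[of V] by simp
qed

primrec wsz :: "wexp \<Rightarrow> nat" where
  "wsz (WConst c) = 1"
| "wsz (WGet a i) = wsz i + 1"
| "wsz (WPlus e f) = wsz e + wsz f + 1"
| "wsz (WMinus e f) = wsz e + wsz f + 1"
| "wsz (WTimes e f) = wsz e + wsz f + 1"
| "wsz (WDiv e f) = wsz e + wsz f + 1"
| "wsz (WMod e f) = wsz e + wsz f + 1"

primrec wmax :: "wexp \<Rightarrow> nat" where
  "wmax (WConst c) = c"
| "wmax (WGet a i) = wmax i"
| "wmax (WPlus e f) = max (wmax e) (wmax f)"
| "wmax (WMinus e f) = max (wmax e) (wmax f)"
| "wmax (WTimes e f) = max (wmax e) (wmax f)"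
| "wmax (WDiv e f) = max (wmax e) (wmax f)"
| "wmax (WMod e f) = max (wmax e) (wmax f)"

primrec rmax :: "rexp \<Rightarrow> nat" where
  "rmax (OfWord e) = wmax e"
| "rmax (RGet a i) = wmax i"
| "rmax (SymDist a i b j) = max (wmax i) (wmax j)"
| "rmax (RPlus e f) = max (rmax e) (rmax f)"
| "rmax (RMinus e f) = max (rmax e) (rmax f)"
| "rmax (RTimes e f) = max (rmax e) (rmax f)"
| "rmax (RDiv e f) = max (rmax e) (rmax f)"

primrec bmax :: "bexp \<Rightarrow> nat" where
  "bmax (WLess e f) = max (wmax e) (wmax f)"
| "bmax (RLess e f) = max (rmax e) (rmax f)"
| "bmax (BNot b) = bmax b"
| "bmax (BAnd b c) = max (bmax b) (bmax c)"

primrec rk :: "rexp \<Rightarrow> nat" where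
  "rk (OfWord e) = (wsz e)^2 + 1"
| "rk (RGet a i) = (wsz i)^2 + 1"
| "rk (SymDist a i b j) = (wsz i)^2 + (wsz j)^2 + 1"
| "rk (RPlus e f) = rk e + rk f + 1"
| "rk (RMinus e f) = rk e + rk f + 1"
| "rk (RTimes e f) = rk e + rk f + 1"
| "rk (RDiv e f) = rk e + rk f + 1"

primrec bk :: "bexp \<Rightarrow> nat" where
  "bk (WLess e f) = (wsz e)^2 + (wsz f)^2 + 1"
| "bk (RLess e f) = rk e + rk f + 1"
| "bk (BNot b) = bk b + 1"
| "bk (BAnd b c) = bk b + bk c + 1"

definition bnd :: "nat \<Rightarrow> 's state \<Rightarrow> bool" where
  "bnd V s \<longleftrightarrow> (\<forall>a i. words s a i \<le> V)"

lemma wsz_pos: "1 \<le> wsz e"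
  by (cases e) auto

text \<open>Products multiply the bounds and so add the exponents; a sum costs one factor 2 <= V,
  paid by the exponent of the node itself. The bit length of a value is thus at most
  \<open>wsz e\<close> times that of \<open>V\<close>.\<close>

lemma wval_bound:
  assumes "bnd V s" "2 \<le> V"
  shows "wmax e \<le> V \<Longrightarrow> wval s e \<le> V ^ wsz e"
proof (induction e)
  case (WGet a i)
  have "words s a (wval s i) \<le> V ^ 1" using assms by (simp add: bnd_def)
  also have "\<dots> \<le> V ^ wsz (WGet a i)" using assms by (intro power_increasing) auto
  finally show ?case by simp
next
  case (WPlus e f)
  have "wval s e + wval s f \<le> V ^ wsz e + V ^ wsz f" using WPlus by (simp add: add_mono)
  also have "V ^ wsz e + V ^ wsz f \<le> V ^ (wsz e + wsz f) + V ^ (wsz e + wsz f)"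
    using assms by (intro add_mono power_increasing) auto
  also have "\<dots> = 2 * V ^ (wsz e + wsz f)" by simp
  also have "\<dots> \<le> V * V ^ (wsz e + wsz f)" using assms by (intro mult_right_mono) auto
  finally show ?case by simp
next
  case (WMinus e f)
  have "wval s e - wval s f \<le> V ^ wsz e" using WMinus by simp
  also have "\<dots> \<le> V ^ wsz (WMinus e f)" using assms by (intro power_increasing) auto
  finally show ?case by simp
next
  case (WTimes e f)
  have "wval s e * wval s f \<le> V ^ wsz e * V ^ wsz f" using WTimes by (simp add: mult_mono)
  also have "\<dots> = V ^ (wsz e + wsz f)" by (simp add: power_add)
  also have "\<dots> \<le> V ^ wsz (WTimes e f)" using assms by (intro power_increasing) auto
  finally show ?case by simp
next
  case (WDiv e f)
  have "wval s e div wval s f \<le> V ^ wsz e" using WDiv by simp (meson div_le_dividend le_trans)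
  also have "\<dots> \<le> V ^ wsz (WDiv e f)" using assms by (intro power_increasing) auto
  finally show ?case by simp
next
  case (WMod e f)
  have "wval s e mod wval s f \<le> V ^ wsz e" using WMod by simp (meson mod_less_eq_dividend le_trans)
  also have "\<dots> \<le> V ^ wsz (WMod e f)" using assms by (intro power_increasing) auto
  finally show ?case by simp
qed simp

lemma bit_length_wval:
  assumes "bnd V s" "2 \<le> V" "wmax e \<le> V"
  shows "bit_length (wval s e) \<le> wsz e * bit_length V"
  using bit_length_mono[OF wval_bound[OF assms]] bit_length_power[OF wsz_pos[of e], of V] by linarith

lemma binary_node_cost:
  assumes "a \<le> x^2 * B" "b \<le> y^2 * B" "c \<le> (x + y + 1) * B"
  shows "a + b + c \<le> (x + y + 1)^2 * (B::nat)"
proof -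
  have "a + b + c \<le> (x^2 + y^2 + (x + y + 1)) * B"
    using assms by (simp add: algebra_simps)
  also have "\<dots> \<le> (x + y + 1)^2 * B"
    by (intro mult_right_mono) (auto simp: power2_eq_square algebra_simps)
  finally show ?thesis .
qed

text \<open>Each of the \<open>wsz e\<close> nodes is charged at most
  \<open>wsz e * bit_length V\<close>, hence the square.\<close>

lemma wcost_bound:
  assumes "bnd V s" "2 \<le> V"
  shows "wmax e \<le> V \<Longrightarrow> wcost s e \<le> (wsz e)^2 * bit_length V"
proof (induction e)
  case (WConst c)
  then show ?case by (simp add: bit_length_mono)
next
  case (WGet a i)
  have "bit_length (words s a (wval s i)) \<le> bit_length V"
    using assms by (intro bit_length_mono) (auto simp: bnd_def)
  moreover have "((wsz i)^2 + 1) * bit_length V \<le> (wsz i + 1)^2 * bit_length V"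
    by (intro mult_right_mono) (auto simp: power2_eq_square)
  ultimately show ?case using WGet by (simp add: algebra_simps)
next
  case (WPlus e f)
  then show ?case
    using binary_node_cost[of "wcost s e" "wsz e" "bit_length V" "wcost s f" "wsz f" "bit_length (wval s (WPlus e f))"]
      bit_length_wval[OF assms, of "WPlus e f"] by simp
next
  case (WMinus e f)
  then show ?case
    using binary_node_cost[of "wcost s e" "wsz e" "bit_length V" "wcost s f" "wsz f" "bit_length (wval s (WMinus e f))"]
      bit_length_wval[OF assms, of "WMinus e f"] by simp
next
  case (WTimes e f)
  then show ?case
    using binary_node_cost[of "wcost s e" "wsz e" "bit_length V" "wcost s f" "wsz f" "bit_length (wval s (WTimes e f))"]
      bit_length_wval[OF assms, of "WTimes e f"] by simp
next
  case (WDiv e f)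
  then show ?case
    using binary_node_cost[of "wcost s e" "wsz e" "bit_length V" "wcost s f" "wsz f" "bit_length (wval s (WDiv e f))"]
      bit_length_wval[OF assms, of "WDiv e f"] by simp
next
  case (WMod e f)
  then show ?case
    using binary_node_cost[of "wcost s e" "wsz e" "bit_length V" "wcost s f" "wsz f" "bit_length (wval s (WMod e f))"]
      bit_length_wval[OF assms, of "WMod e f"] by simp
qed

lemma rcost_bound:
  assumes "bnd V s" "2 \<le> V"
  shows "rmax e \<le> V \<Longrightarrow> rcost s e \<le> rk e * bit_length V"
proof (induction e)
  case (OfWord e)
  then show ?case using wcost_bound[OF assms, of e] bit_length_ge_1[of V] by (simp add: algebra_simps)
next
  case (RGet a i)
  then show ?case using wcost_bound[OF assms, of i] bit_length_ge_1[of V] by (simp add: algebra_simps)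
next
  case (SymDist a i b j)
  then show ?case using wcost_bound[OF assms, of i] wcost_bound[OF assms, of j] bit_length_ge_1[of V]
    by (simp add: algebra_simps)
qed (use bit_length_ge_1[of V] in \<open>simp_all add: algebra_simps\<close>)

lemma bcost_bound:
  assumes "bnd V s" "2 \<le> V"
  shows "bmax e \<le> V \<Longrightarrow> bcost s e \<le> bk e * bit_length V"
proof (induction e)
  case (WLess e f)
  then show ?case using wcost_bound[OF assms, of e] wcost_bound[OF assms, of f] bit_length_ge_1[of V]
    by (simp add: algebra_simps)
next
  case (RLess e f)
  then show ?case using rcost_bound[OF assms, of e] rcost_bound[OF assms, of f] bit_length_ge_1[of V]
    by (simp add: algebra_simps)
qed (use bit_length_ge_1[of V] in \<open>simp_all add: algebra_simps\<close>)

text \<open>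
  Syntactic criteria for all stored words to be at most \<open>V\<close>: sums and products have to be capped by
  the parameter \<open>''cap''\<close>, which truncated subtraction can express as \<open>e - (e - cap) = min e cap\<close>.
\<close>

primrec safe :: "nat \<Rightarrow> wexp \<Rightarrow> bool" where
  "safe V (WConst c) \<longleftrightarrow> c \<le> V"
| "safe V (WGet a i) \<longleftrightarrow> True"
| "safe V (WPlus e f) \<longleftrightarrow> False"
| "safe V (WMinus e f) \<longleftrightarrow> safe V e \<or> f = WMinus e (var ''cap'')"
| "safe V (WTimes e f) \<longleftrightarrow> False"
| "safe V (WDiv e f) \<longleftrightarrow> safe V e"
| "safe V (WMod e f) \<longleftrightarrow> safe V e"

definition clamp :: "wexp \<Rightarrow> wexp" where
  "clamp e = WMinus e (WMinus e (var ''cap''))"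

lemma wval_clamp [simp]: "wval s (clamp e) = min (wval s e) (words s ''cap'' 0)"
  by (simp add: clamp_def min_def)

lemma safe_clamp [simp]: "safe V (clamp e)"
  by (simp add: clamp_def)

lemma wmax_clamp [simp]: "wmax (clamp e) = wmax e"
  by (simp add: clamp_def)

lemma safe_bound: "bnd V s \<Longrightarrow> safe V e \<Longrightarrow> wval s e \<le> V"
proof (induction e)
  case (WMinus e f)
  then have "wval s e - (wval s e - words s ''cap'' 0) \<le> V"
    by (auto simp: bnd_def intro: le_trans[of _ "words s ''cap'' 0"])
  with WMinus show ?case by (auto intro: le_trans[of _ "wval s e"])
next
  case (WDiv e f)
  then show ?case by simp (meson div_le_dividend le_trans)
next
  case (WMod e f)
  then show ?case by simp (meson mod_less_eq_dividend le_trans)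
qed (auto simp: bnd_def)

text \<open>
  The arrays in \<open>X\<close> are parameters: they are never written, and cell \<open>0\<close> of every loop bound is
  one of them.
\<close>

primrec ok :: "name set \<Rightarrow> nat \<Rightarrow> stm \<Rightarrow> bool" where
  "ok X V NOP \<longleftrightarrow> True"
| "ok X V (WS a i e) \<longleftrightarrow> a \<notin> X \<and> wmax i \<le> V \<and> wmax e \<le> V \<and> safe V e"
| "ok X V (RS a i e) \<longleftrightarrow> a \<notin> X \<and> wmax i \<le> V \<and> rmax e \<le> V"
| "ok X V (WQ a i x y) \<longleftrightarrow> a \<notin> X \<and> wmax i \<le> V \<and> wmax x \<le> V \<and> wmax y \<le> V"
| "ok X V (SQ a i x) \<longleftrightarrow> a \<notin> X \<and> wmax i \<le> V \<and> wmax x \<le> V"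
| "ok X V (p ;; q) \<longleftrightarrow> ok X V p \<and> ok X V q"
| "ok X V (IF b p q) \<longleftrightarrow> bmax b \<le> V \<and> ok X V p \<and> ok X V q"
| "ok X V (FOR v b p) \<longleftrightarrow> v \<notin> X \<and> b \<in> X \<and> v \<notin> mods p \<and> ok X V p"

text \<open>The time of a statement is bounded by
  \<open>bit_length V * (kap p * nest \<rho> p)\<close>: \<open>kap\<close> adds up the constants of
  the program text, and \<open>nest\<close> is the largest product of nested loop bounds, each
  increased by one. A loop adds 27 per iteration (9 for the test, 18 for the increment) and 12 for
  initialization and last test; 30 times the increased bound covers both.\<close>

primrec kap :: "stm \<Rightarrow> nat" where
  "kap NOP = 1"
| "kap (WS a i e) = (wsz i)^2 + (wsz e)^2 + 1"
| "kap (RS a i e) = (wsz i)^2 + rk e + 1"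
| "kap (WQ a i x y) = (wsz i)^2 + (wsz x)^2 + (wsz y)^2 + 1"
| "kap (SQ a i x) = (wsz i)^2 + (wsz x)^2 + 1"
| "kap (p ;; q) = kap p + kap q"
| "kap (IF b p q) = bk b + kap p + kap q"
| "kap (FOR v b p) = kap p + 30"

primrec nest :: "(name \<Rightarrow> nat) \<Rightarrow> stm \<Rightarrow> nat" where
  "nest \<rho> NOP = 1"
| "nest \<rho> (WS a i e) = 1"
| "nest \<rho> (RS a i e) = 1"
| "nest \<rho> (WQ a i x y) = 1"
| "nest \<rho> (SQ a i x) = 1"
| "nest \<rho> (p ;; q) = max (nest \<rho> p) (nest \<rho> q)"
| "nest \<rho> (IF b p q) = max (nest \<rho> p) (nest \<rho> q)"
| "nest \<rho> (FOR v b p) = (\<rho> b + 1) * nest \<rho> p"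

primrec nweak :: "(name \<Rightarrow> nat) \<Rightarrow> stm \<Rightarrow> nat" where
  "nweak \<rho> NOP = 0"
| "nweak \<rho> (WS a i e) = 0"
| "nweak \<rho> (RS a i e) = 0"
| "nweak \<rho> (WQ a i x y) = 1"
| "nweak \<rho> (SQ a i x) = 0"
| "nweak \<rho> (p ;; q) = nweak \<rho> p + nweak \<rho> q"
| "nweak \<rho> (IF b p q) = nweak \<rho> p + nweak \<rho> q"
| "nweak \<rho> (FOR v b p) = \<rho> b * nweak \<rho> p"

primrec nstrong :: "(name \<Rightarrow> nat) \<Rightarrow> stm \<Rightarrow> nat" where
  "nstrong \<rho> NOP = 0"
| "nstrong \<rho> (WS a i e) = 0"
| "nstrong \<rho> (RS a i e) = 0"
| "nstrong \<rho> (WQ a i x y) = 0"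
| "nstrong \<rho> (SQ a i x) = 1"
| "nstrong \<rho> (p ;; q) = nstrong \<rho> p + nstrong \<rho> q"
| "nstrong \<rho> (IF b p q) = nstrong \<rho> p + nstrong \<rho> q"
| "nstrong \<rho> (FOR v b p) = \<rho> b * nstrong \<rho> p"

definition params :: "name set \<Rightarrow> nat \<Rightarrow> (name \<Rightarrow> nat) \<Rightarrow> 's state \<Rightarrow> bool" where
  "params X V \<rho> s \<longleftrightarrow> bnd V s \<and> (\<forall>b\<in>X. words s b 0 = \<rho> b)"

definition spends :: "nat \<Rightarrow> nat \<Rightarrow> nat \<Rightarrow> 's state \<Rightarrow> 's state \<Rightarrow> bool" where
  "spends c w q s t \<longleftrightarrow> time t \<le> time s + c \<and> weak_queries t \<le> weak_queries s + w \<and>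
     strong_queries t \<le> strong_queries s + q"

lemma spends_trans:
  "spends c w q s t \<Longrightarrow> spends c' w' q' t u \<Longrightarrow> spends (c + c') (w + w') (q + q') s u"
  by (auto simp: spends_def)

lemma spends_mono:
  "spends c w q s t \<Longrightarrow> c \<le> c' \<Longrightarrow> w \<le> w' \<Longrightarrow> q \<le> q' \<Longrightarrow> spends c' w' q' s t"
  by (auto simp: spends_def)

lemma params_charge [simp]: "params X V \<rho> (charge a s) = params X V \<rho> s"
  "params X V \<rho> (strip s) = params X V \<rho> s"
  by (simp_all add: params_def bnd_def)

lemma nest_ge_1: "1 \<le> nest \<rho> p"
  by (induction p) auto

lemma params_wset:
  "params X V \<rho> s \<Longrightarrow> v \<le> V \<Longrightarrow> a \<notin> X \<Longrightarrow> params X V \<rho> (wset a i v s)"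
  by (auto simp: params_def bnd_def upd_apply)

lemma counters_set [simp]:
  "time (wset a i v s) = time s" "weak_queries (wset a i v s) = weak_queries s"
  "strong_queries (wset a i v s) = strong_queries s"
  "time (rset a i r s) = time s" "weak_queries (rset a i r s) = weak_queries s"
  "strong_queries (rset a i r s) = strong_queries s"
  "time (sset a i y s) = time s" "weak_queries (sset a i y s) = weak_queries s"
  "strong_queries (sset a i y s) = strong_queries s"
  by (simp_all add: wset_def rset_def sset_def)

lemma exec_sets:
  "exec orc (WSet a i e) s = return_spmf (charge (wcost s i + wcost s e + 1) (wset a (wval s i) (wval s e) s))"
  "exec orc (RSet a i r) s = return_spmf (charge (wcost s i + rcost s r + 1) (rset a (wval s i) (rval orc s r) s))"
  "exec orc (WeakQuery a i x y) s = return_spmf (charge (wcost s i + wcost s x + wcost s y + 1)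
     (rset a (wval s i) (weak_oracle orc (wval s x) (wval s y)) s\<lparr>weak_queries := weak_queries s + 1\<rparr>))"
  "exec orc (StrongQuery a i x) s = return_spmf (charge (wcost s i + wcost s x + 1)
     (sset a (wval s i) (strong_oracle orc (wval s x)) s\<lparr>strong_queries := strong_queries s + 1\<rparr>))"
  by (simp_all add: wset_def rset_def sset_def)

lemma exec_WSet:
  assumes "params X V \<rho> s" "2 \<le> V" "wmax i \<le> V" "wmax e \<le> V" "wval s e \<le> V" "a \<notin> X"
  shows "\<exists>t. exec orc (WSet a i e) s = return_spmf t \<and> strip t = wset a (wval s i) (wval s e) (strip s) \<and>
      params X V \<rho> t \<and> spends (bit_length V * ((wsz i)^2 + (wsz e)^2 + 1)) 0 0 s t"
proof -
  have "bnd V s" using assms(1) by (simp add: params_def)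
  then have "wcost s i + wcost s e + 1 \<le> bit_length V * ((wsz i)^2 + (wsz e)^2 + 1)"
    using wcost_bound[of V s i] wcost_bound[of V s e] assms bit_length_ge_1[of V]
    by (simp add: algebra_simps)
  moreover have "params X V \<rho> (charge c (wset a (wval s i) (wval s e) s))" for c
    using params_wset[of X V \<rho> s "wval s e" a "wval s i"] assms by simp
  ultimately show ?thesis
    unfolding exec_sets by (auto simp: spends_def)
qed

lemma exec_While_stop:
  "\<not> bval orc s b \<Longrightarrow> exec orc (While b c) s = return_spmf (charge (bcost s b) s)"
  by (simp add: while_spmf.simps)

lemma exec_While_step:
  "bval orc s b \<Longrightarrow> exec orc (While b c) s =
     bind_spmf (exec orc c (charge (bcost s b) s)) (exec orc (While b c))"
  by (subst exec.simps, subst while_spmf.simps) (simp add: map_spmf_bind_spmf o_def)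

lemma loop_test_cost:
  assumes "params X V \<rho> s" "2 \<le> V"
  shows "bcost s (WLess (var v) (var b)) \<le> 9 * bit_length V"
  using bcost_bound[of V s "WLess (var v) (var b)"] assms by (simp add: params_def power2_eq_square)

text \<open>Compiled programs contain no \<open>Random\<close> and only bounded loops, so their
  distribution is a point mass. The word bound \<open>V\<close> is part of the induction because the
  cost of an instruction depends on the lengths of the stored words.\<close>

lemma exec_comp:
  assumes "2 \<le> V"
  shows "ok X V p \<Longrightarrow> params X V \<rho> s \<Longrightarrow>
    \<exists>t. exec orc (comp p) s = return_spmf t \<and> strip t = dsem orc p (strip s) \<and> params X V \<rho> t \<and>
      spends (bit_length V * (kap p * nest \<rho> p)) (nweak \<rho> p) (nstrong \<rho> p) s t"
proof (induction p arbitrary: s)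
  case NOP
  then show ?case using bit_length_ge_1[of V] by (auto simp: spends_def)
next
  case (WS a i e)
  then show ?case
    using exec_WSet[of X V \<rho> s i e a orc] assms safe_bound[of V s e] by (simp add: params_def)
next
  case (RS a i e)
  then have "wcost s i + rcost s e + 1 \<le> bit_length V * ((wsz i)^2 + rk e + 1)"
    using wcost_bound[of V s i] rcost_bound[of V s e] assms bit_length_ge_1[of V]
    by (simp add: algebra_simps params_def)
  with RS show ?case
    unfolding comp.simps exec_sets by (auto simp: spends_def params_def bnd_def)
next
  case (WQ a i x y)
  then have "wcost s i + wcost s x + wcost s y + 1 \<le> bit_length V * ((wsz i)^2 + (wsz x)^2 + (wsz y)^2 + 1)"
    using wcost_bound[of V s i] wcost_bound[of V s x] wcost_bound[of V s y] assms bit_length_ge_1[of V]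
    by (simp add: algebra_simps params_def)
  with WQ show ?case
    unfolding comp.simps exec_sets by (auto simp: spends_def params_def bnd_def)
next
  case (SQ a i x)
  then have "wcost s i + wcost s x + 1 \<le> bit_length V * ((wsz i)^2 + (wsz x)^2 + 1)"
    using wcost_bound[of V s i] wcost_bound[of V s x] assms bit_length_ge_1[of V]
    by (simp add: algebra_simps params_def)
  with SQ show ?case
    unfolding comp.simps exec_sets by (auto simp: spends_def params_def bnd_def)
next
  case (Then p q)
  obtain t where t: "exec orc (comp p) s = return_spmf t" "strip t = dsem orc p (strip s)" "params X V \<rho> t"
    "spends (bit_length V * (kap p * nest \<rho> p)) (nweak \<rho> p) (nstrong \<rho> p) s t"
    using Then by auto
  obtain u where u: "exec orc (comp q) t = return_spmf u" "strip u = dsem orc q (strip t)" "params X V \<rho> u"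
    "spends (bit_length V * (kap q * nest \<rho> q)) (nweak \<rho> q) (nstrong \<rho> q) t u"
    using Then t(3) by auto
  have "kap p * nest \<rho> p + kap q * nest \<rho> q \<le> kap (p ;; q) * nest \<rho> (p ;; q)"
    by (simp add: add_mult_distrib add_mono)
  then have "spends (bit_length V * (kap (p ;; q) * nest \<rho> (p ;; q))) (nweak \<rho> (p ;; q)) (nstrong \<rho> (p ;; q)) s u"
    by (intro spends_mono[OF spends_trans[OF t(4) u(4)]]) (auto simp flip: distrib_left)
  with t u show ?case by auto
next
  case (IF b p q)
  let ?r = "if bval orc s b then p else q"
  let ?s = "charge (bcost s b) s"
  have "params X V \<rho> ?s" using IF.prems by simp
  then obtain t where t: "exec orc (comp ?r) ?s = return_spmf t" "strip t = dsem orc ?r (strip s)"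
    "params X V \<rho> t"
    "spends (bit_length V * (kap ?r * nest \<rho> ?r)) (nweak \<rho> ?r) (nstrong \<rho> ?r) ?s t"
    using IF.IH(1)[of ?s] IF.IH(2)[of ?s] IF.prems by (cases "bval orc s b") auto
  have b: "bcost s b \<le> bk b * bit_length V"
    using bcost_bound[of V s b] IF.prems assms by (simp add: params_def)
  let ?m = "nest \<rho> (IF b p q)"
  have "kap ?r * nest \<rho> ?r + bk b \<le> (kap p + kap q) * ?m + bk b * ?m"
  proof (rule add_mono)
    show "kap ?r * nest \<rho> ?r \<le> (kap p + kap q) * ?m" by (intro mult_mono) auto
    have "1 \<le> ?m" by (rule nest_ge_1)
    then show "bk b \<le> bk b * ?m" by simp
  qed
  then have "bit_length V * (kap ?r * nest \<rho> ?r) + bit_length V * bk b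
      \<le> bit_length V * (kap (IF b p q) * ?m)"
    unfolding distrib_left[symmetric] by (intro mult_left_mono) (simp_all add: algebra_simps)
  with b have "spends (bit_length V * (kap (IF b p q) * ?m)) (nweak \<rho> (IF b p q)) (nstrong \<rho> (IF b p q)) s t"
    using t(4) by (auto simp: spends_def charge_def mult.commute split: if_splits)
  then show ?case using t by (cases "bval orc s b") auto
next
  case (FOR v b p)
  let ?B = "\<rho> b" let ?L = "bit_length V"
  let ?T = "?L * (kap p * nest \<rho> p)"
  let ?test = "WLess (var v) (var b)"
  let ?body = "Seq (comp p) (WSet v (WConst 0) (WPlus (var v) (WConst 1)))"
  from FOR.prems have v: "v \<notin> X" "b \<in> X" "v \<notin> mods p" "ok X V p" by auto
  have "\<rho> b = words s b 0" "bnd V s" using FOR.prems v by (auto simp: params_def)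
  then have BV: "?B \<le> V" by (simp add: bnd_def)
  \<comment> \<open>Induction on the number \<open>j\<close> of iterations still to run; the counter
    stands at \<open>?B - j\<close>.\<close>
  have main: "j \<le> ?B \<Longrightarrow> params X V \<rho> s' \<Longrightarrow> words s' v 0 = ?B - j \<Longrightarrow>
     \<exists>t. exec orc (While ?test ?body) s' = return_spmf t \<and>
       strip t = wset v 0 ?B (fold (\<lambda>i t. dsem orc p (wset v 0 i t)) [?B - j..<?B] (strip s')) \<and>
       params X V \<rho> t \<and> spends (j * (?T + 27 * ?L) + 9 * ?L) (j * nweak \<rho> p) (j * nstrong \<rho> p) s' t" for j s'
  proof (induction j arbitrary: s')
    case 0
    then have "\<not> bval orc s' ?test" using v by (simp add: params_def)
    then have 1: "exec orc (While ?test ?body) s' = return_spmf (charge (bcost s' ?test) s')"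
      by (rule exec_While_stop)
    have "wset v 0 ?B (strip s') = strip s'"
      using 0 by (simp add: wset_def upd_def strip_def fun_upd_idem)
    then show ?case
      unfolding 1 using loop_test_cost[OF 0(2) assms, of v b] 0
      by (intro exI[of _ "charge (bcost s' ?test) s'"]) (simp add: spends_def)
  next
    case (Suc j)
    then have tst: "bval orc s' ?test" using v by (simp add: params_def)
    let ?s = "charge (bcost s' ?test) s'"
    have ps: "params X V \<rho> ?s" using Suc by simp
    obtain t where t: "exec orc (comp p) ?s = return_spmf t" "strip t = dsem orc p (strip s')" "params X V \<rho> t"
      "spends ?T (nweak \<rho> p) (nstrong \<rho> p) ?s t"
      using FOR.IH[OF v(4) ps] by auto
    have tv: "words t v 0 = ?B - Suc j"
      using dsem_words[OF v(3), of orc "strip s'"] t(2) Suc(4) by (metis strip_simps(1))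
    have jV: "?B - j \<le> V" using BV by simp
    have k: "(wsz (WConst 0))\<^sup>2 + (wsz (WPlus (var v) (WConst 1)))\<^sup>2 + 1 = 18"
      by (simp add: power2_eq_square)
    obtain u where u: "exec orc (WSet v (WConst 0) (WPlus (var v) (WConst 1))) t = return_spmf u"
      "strip u = wset v 0 (?B - j) (strip t)" "params X V \<rho> u" "spends (18 * ?L) 0 0 t u"
      using exec_WSet[of X V \<rho> t "WConst 0" "WPlus (var v) (WConst 1)" v orc, unfolded k] t tv v assms jV Suc(2)
      by (auto simp: Suc_diff_Suc mult.commute simp del: exec.simps)
    have uv: "words u v 0 = ?B - j" using arg_cong[OF u(2), of words] by (simp add: upd_apply)
    obtain w where w: "exec orc (While ?test ?body) u = return_spmf w"
       "strip w = wset v 0 ?B (fold (\<lambda>i t. dsem orc p (wset v 0 i t)) [?B - j..<?B] (strip u))"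
       "params X V \<rho> w" "spends (j * (?T + 27 * ?L) + 9 * ?L) (j * nweak \<rho> p) (j * nstrong \<rho> p) u w"
      using Suc.IH[of u] u uv Suc.prems by auto
    have "exec orc (While ?test ?body) s' = return_spmf w"
      using t(1) u(1) w(1) unfolding exec_While_step[OF tst] by simp
    moreover have "strip w = wset v 0 ?B (fold (\<lambda>i t. dsem orc p (wset v 0 i t)) [?B - Suc j..<?B] (strip s'))"
    proof -
      let ?f = "\<lambda>i t. dsem orc p (wset v 0 i t)"
      have [simp]: "wset v 0 i (wset v 0 i' x) = wset v 0 i x" for i i' and x :: "'a state"
        by (simp add: wset_def upd_def)
      have sv: "wset v 0 (?B - Suc j) (strip s') = strip s'"
        using Suc(4) by (simp add: wset_def upd_def strip_def fun_upd_idem)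
      have "[?B - Suc j..<?B] = (?B - Suc j) # [?B - j..<?B]"
        using Suc(2) by (simp add: upt_conv_Cons Suc_diff_Suc)
      then have 1: "fold ?f [?B - Suc j..<?B] (strip s') = fold ?f [?B - j..<?B] (strip t)"
        using t(2) sv by simp
      \<comment> \<open>The increment at the end of the body is overwritten by the write that starts
        the next iteration of \<open>fold\<close>, or by the final write if no iteration is
        left.\<close>
      show ?thesis
      proof (cases j)
        case 0
        then show ?thesis unfolding 1 w(2) u(2) by simp
      next
        case (Suc j')
        then have "[?B - j..<?B] = (?B - j) # [Suc (?B - j)..<?B]"
          using \<open>Suc j \<le> ?B\<close> by (simp add: upt_conv_Cons)
        then show ?thesis unfolding 1 w(2) u(2) by simp
      qed
    qed
    moreover have "spends (Suc j * (?T + 27 * ?L) + 9 * ?L) (Suc j * nweak \<rho> p) (Suc j * nstrong \<rho> p) s' w"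
      using t(4) u(4) w(4) loop_test_cost[OF Suc(3) assms, of v b]
      by (simp add: spends_def charge_def)
    ultimately show ?case using w(3) by blast
  qed
  obtain t where t: "exec orc (WSet v (WConst 0) (WConst 0)) s = return_spmf t"
    "strip t = wset v 0 0 (strip s)" "params X V \<rho> t" "spends (3 * ?L) 0 0 s t"
    using exec_WSet[of X V \<rho> s "WConst 0" "WConst 0" v orc] FOR.prems v assms
    by (auto simp: mult.commute numeral_3_eq_3 simp del: exec.simps)
  have tv: "words t v 0 = 0" using arg_cong[OF t(2), of words] by (simp add: upd_apply)
  obtain u where u: "exec orc (While ?test ?body) t = return_spmf u"
     "strip u = wset v 0 ?B (fold (\<lambda>i t. dsem orc p (wset v 0 i t)) [0..<?B] (strip t))"
     "params X V \<rho> u" "spends (?B * (?T + 27 * ?L) + 9 * ?L) (?B * nweak \<rho> p) (?B * nstrong \<rho> p) t u"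
    using main[of ?B t] t tv by auto
  have "strip u = dsem orc (FOR v b p) (strip s)"
  proof (cases "?B")
    case 0
    with u(2) t(2) \<open>\<rho> b = words s b 0\<close> show ?thesis by (simp add: wset_def upd_def)
  next
    case (Suc j)
    then have "[0..<?B] = 0 # [1..<?B]" by (simp add: upt_rec)
    with u(2) t(2) \<open>\<rho> b = words s b 0\<close> show ?thesis by (simp add: wset_def upd_def)
  qed
  moreover have "spends (?L * (kap (FOR v b p) * nest \<rho> (FOR v b p))) (nweak \<rho> (FOR v b p)) (nstrong \<rho> (FOR v b p)) s u"
  proof (rule spends_mono[OF spends_trans[OF t(4) u(4)]])
    let ?N = "nest \<rho> p"
    have N: "1 \<le> ?N" by (rule nest_ge_1)
    have "3 + ?B * (kap p * ?N + 27) + 9 \<le> (?B + 1) * (kap p * ?N + 30)" by (simp add: algebra_simps)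
    also have "\<dots> \<le> (?B + 1) * (kap p * ?N + 30 * ?N)" using N by (intro mult_left_mono add_mono) auto
    finally have "?L * (3 + ?B * (kap p * ?N + 27) + 9) \<le> ?L * ((?B + 1) * (kap p * ?N + 30 * ?N))"
      by (rule mult_left_mono) simp
    then show "3 * ?L + (?B * (?T + 27 * ?L) + 9 * ?L) \<le> ?L * (kap (FOR v b p) * nest \<rho> (FOR v b p))"
      by (simp add: algebra_simps)
  qed auto
  ultimately show ?case using t(1) u by auto
qed

section \<open>Single-swap local search\<close>

lemma one_minus_inverse_power_le_half:
  assumes "1 \<le> (q::nat)"
  shows "(1 - 1 / real q) ^ q \<le> 1 / 2"
proof -
  have "1 - 1 / real q \<le> exp (- 1 / real q)" using exp_ge_add_one_self[of "- 1 / real q"] by simp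
  then have "(1 - 1 / real q) ^ q \<le> exp (- 1 / real q) ^ q"
    using assms by (intro power_mono) auto
  also have "\<dots> = exp (-1)" using assms by (simp flip: exp_of_nat_mult)
  also have "\<dots> \<le> 1 / 2"
    using exp_ge_add_one_self[of 1] by (simp add: exp_minus inverse_eq_divide divide_simps)
  finally show ?thesis .
qed

text \<open>
  Every slot \<open>g\<close> of the comparison solution gets a slot \<open>\<pi> g\<close> to be swapped out to which no other
  \<open>g'\<close> is attached by \<open>\<eta>\<close>: its own \<open>\<eta> g\<close> if this is not shared, and otherwise one of the slots
  outside the range of \<open>\<eta>\<close>, of which there are at least half as many as needed.
\<close>

lemma slot_matching:
  fixes \<eta> :: "nat \<Rightarrow> nat"
  assumes \<eta>: "\<And>g. g < k \<Longrightarrow> \<eta> g < k"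
  obtains \<pi> where "\<And>g. g < k \<Longrightarrow> \<pi> g < k"
    "\<And>g g'. g < k \<Longrightarrow> g' < k \<Longrightarrow> \<eta> g' = \<pi> g \<Longrightarrow> g' = g"
    "\<And>i. card {g. g < k \<and> \<pi> g = i} \<le> 2"
proof -
  define U where "U = {g. g < k \<and> (\<forall>g'<k. \<eta> g' = \<eta> g \<longrightarrow> g' = g)}"
  define W where "W = {g. g < k \<and> \<not> (\<forall>g'<k. \<eta> g' = \<eta> g \<longrightarrow> g' = g)}"
  define D where "D = {..<k} - \<eta> ` {..<k}"
  have fin: "finite U" "finite W" "finite D" by (auto simp: U_def W_def D_def)
  have UW: "{..<k} = U \<union> W" "U \<inter> W = {}" by (auto simp: U_def W_def)
  \<comment> \<open>A value taken on \<open>W\<close> has at least two preimages there, so the image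
    of \<open>W\<close> has at most half its size. Hence at least half as many slots as
    \<open>W\<close> has elements lie outside the range of \<eta>.\<close>
  have "card W = (\<Sum>i\<in>\<eta> ` W. card {g. g \<in> W \<and> \<eta> g = i})"
    using sum.image_gen[OF fin(2), of "\<lambda>_. 1::nat" \<eta>] by simp
  also have "\<dots> \<ge> (\<Sum>i\<in>\<eta> ` W. 2)"
  proof (rule sum_mono)
    fix i assume "i \<in> \<eta> ` W"
    then obtain g where g: "g \<in> W" "i = \<eta> g" by auto
    then obtain g' where g': "g' < k" "\<eta> g' = \<eta> g" "g' \<noteq> g" by (auto simp: W_def)
    then have "{g, g'} \<subseteq> {g. g \<in> W \<and> \<eta> g = i}" using g by (auto simp: W_def)
    then have "card {g, g'} \<le> card {g. g \<in> W \<and> \<eta> g = i}" by (intro card_mono) (auto simp: fin)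
    then show "2 \<le> card {g. g \<in> W \<and> \<eta> g = i}" using g' by simp
  qed
  finally have W2: "2 * card (\<eta> ` W) \<le> card W" by simp
  have "card (\<eta> ` {..<k}) \<le> card U + card (\<eta> ` W)"
    unfolding UW(1) image_Un using card_Un_le[of "\<eta> ` U" "\<eta> ` W"] card_image_le[OF fin(1), of \<eta>] by linarith
  moreover have "card (\<eta> ` {..<k}) + card D = k"
  proof -
    have "\<eta> ` {..<k} \<subseteq> {..<k}" using \<eta> by auto
    then have "card D = k - card (\<eta> ` {..<k})" "card (\<eta> ` {..<k}) \<le> k"
      unfolding D_def using card_mono[of "{..<k}" "\<eta> ` {..<k}"] by (auto simp: card_Diff_subset)
    then show ?thesis by simp
  qed
  moreover have "card U + card W = k"
    using card_Un_disjoint[OF fin(1,2) UW(2)] UW(1) by (metis card_lessThan)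
  ultimately have WD: "card W \<le> 2 * card D" using W2 by linarith
  obtain e where e: "bij_betw e W {0..<card W}" using ex_bij_betw_finite_nat[OF fin(2)] by blast
  obtain h where h: "bij_betw h {0..<card D} D" using ex_bij_betw_nat_finite[OF fin(3)] by blast
  \<comment> \<open>Halving the numbers of the elements of \<open>W\<close> assigns at most two of
    them to each free slot.\<close>
  define \<pi> where "\<pi> g = (if g \<in> W then h (e g div 2) else \<eta> g)" for g
  have piW: "\<pi> g \<in> D" if "g \<in> W" for g
  proof -
    have "e g < card W" using bij_betwE[OF e] that by auto
    then have "e g div 2 < card D" using WD by linarith
    then show ?thesis using bij_betwE[OF h] that by (simp add: \<pi>_def)
  qed
  have piU: "\<pi> g = \<eta> g" "g \<in> U" if "g < k" "g \<notin> W" for g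
    using that UW by (auto simp: \<pi>_def)
  show thesis
  proof
    show "\<pi> g < k" if "g < k" for g
      using piW[of g] piU[of g] \<eta> that by (cases "g \<in> W") (auto simp: D_def)
    show "g' = g" if "g < k" "g' < k" "\<eta> g' = \<pi> g" for g g'
    proof (cases "g \<in> W")
      case True
      then have "\<eta> g' \<in> D" using piW that by simp
      then show ?thesis using that by (metis D_def DiffE imageI lessThan_iff)
    next
      case False
      then show ?thesis using piU[OF that(1) False] that by (auto simp: U_def)
    qed
    show "card {g. g < k \<and> \<pi> g = i} \<le> 2" for i
    proof (cases "i \<in> D")
      case True
      have "{g. g < k \<and> \<pi> g = i} \<subseteq> {g \<in> W. \<pi> g = i}"
        using True piU by (auto simp: D_def)
      then have "card {g. g < k \<and> \<pi> g = i} \<le> card {g \<in> W. \<pi> g = i}"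
        by (intro card_mono) (auto simp: fin)
      also have "\<dots> = card (e ` {g \<in> W. \<pi> g = i})"
        using e by (intro card_image[symmetric]) (auto simp: bij_betw_def inj_on_def)
      also have "\<dots> \<le> card {2 * the_inv_into {0..<card D} h i, 2 * the_inv_into {0..<card D} h i + 1}"
      proof (rule card_mono)
        show "e ` {g \<in> W. \<pi> g = i} \<subseteq> {2 * the_inv_into {0..<card D} h i, 2 * the_inv_into {0..<card D} h i + 1}"
        proof
          fix j assume "j \<in> e ` {g \<in> W. \<pi> g = i}"
          then obtain g where g: "g \<in> W" "\<pi> g = i" "j = e g" by auto
          then have "j < card W" using bij_betwE[OF e] by auto
          then have "j div 2 \<in> {0..<card D}" using WD by auto
          moreover have "h (j div 2) = i" using g by (simp add: \<pi>_def)
          ultimately have "the_inv_into {0..<card D} h i = j div 2"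
            using h by (auto simp: bij_betw_def the_inv_into_f_f)
          then show "j \<in> {2 * the_inv_into {0..<card D} h i, 2 * the_inv_into {0..<card D} h i + 1}"
            by auto
        qed
      qed auto
      also have "\<dots> \<le> 2" by (simp add: card_insert_if)
      finally show ?thesis .
    next
      case False
      have "{g. g < k \<and> \<pi> g = i} \<subseteq> {g. g \<in> U \<and> \<eta> g = i}"
        using False piU piW by (metis (mono_tags, lifting) Collect_mono)
      also have "\<dots> \<subseteq> {SOME g. g \<in> U \<and> \<eta> g = i}"
      proof
        fix g assume "g \<in> {g. g \<in> U \<and> \<eta> g = i}"
        then have g: "g \<in> U \<and> \<eta> g = i" by simp
        then have "(SOME g. g \<in> U \<and> \<eta> g = i) \<in> U \<and> \<eta> (SOME g. g \<in> U \<and> \<eta> g = i) = i"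
          by (rule someI)
        then show "g \<in> {SOME g. g \<in> U \<and> \<eta> g = i}" using g by (auto simp: U_def)
      qed
      finally have "card {g. g < k \<and> \<pi> g = i} \<le> card {SOME g. g \<in> U \<and> \<eta> g = i}"
        by (rule card_mono[rotated]) auto
      then show ?thesis by simp
    qed
  qed
qed

definition nearest_dist :: "('p \<Rightarrow> 'p \<Rightarrow> real) \<Rightarrow> nat \<Rightarrow> (nat \<Rightarrow> 'p) \<Rightarrow> 'p \<Rightarrow> real" where
  "nearest_dist \<delta> k F p = Min ((\<lambda>i. \<delta> p (F i)) ` {..<k})"

lemma nearest_dist_le: "i < k \<Longrightarrow> nearest_dist \<delta> k F p \<le> \<delta> p (F i)"
  unfolding nearest_dist_def by (intro Min_le) auto

lemma nearest_dist_attained: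
  assumes "1 \<le> k"
  obtains i where "i < k" "nearest_dist \<delta> k F p = \<delta> p (F i)"
proof -
  have "nearest_dist \<delta> k F p \<in> (\<lambda>i. \<delta> p (F i)) ` {..<k}"
    unfolding nearest_dist_def using assms by (intro Min_in) (auto simp: lessThan_empty_iff)
  then show ?thesis using that by auto
qed

text \<open>The k swaps that put \<open>G g\<close> into slot \<open>\<pi> g\<close> are averaged.
  Points served by g in the comparison solution now pay at most what they pay there; a point whose
  own slot is removed moves to the slot nearest to its comparison center, at distance at most 2 * Q
  x + S x, and this slot is still present by the choice of \<pi>. As a slot is removed at most
  twice, the changes of the powers for x sum up to at most Q - S + 2 * (20 * Q + S / 4) = 41 * Q - S
  / 2, with S and Q the z-th powers of S x and Q x.\<close>

lemma swap_improvement: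
  fixes \<delta> :: "'p \<Rightarrow> 'p \<Rightarrow> real" and a :: "'x \<Rightarrow> 'p"
  assumes fin: "finite X" and k: "1 \<le> k" and z: "z \<in> {1, 2::nat}"
    and P: "\<And>x. x \<in> X \<Longrightarrow> a x \<in> P" "\<And>i. i < k \<Longrightarrow> F i \<in> P" "\<And>i. i < k \<Longrightarrow> G i \<in> P"
    and nonneg: "\<And>p q. p \<in> P \<Longrightarrow> q \<in> P \<Longrightarrow> 0 \<le> \<delta> p q"
    and sym: "\<And>p q. p \<in> P \<Longrightarrow> q \<in> P \<Longrightarrow> \<delta> p q = \<delta> q p"
    and tri: "\<And>p q r. p \<in> P \<Longrightarrow> q \<in> P \<Longrightarrow> r \<in> P \<Longrightarrow> \<delta> p r \<le> \<delta> p q + \<delta> q r"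
  defines "cost \<equiv> \<lambda>H. \<Sum>x\<in>X. nearest_dist \<delta> k H (a x) ^ z"
  shows "\<exists>i<k. \<exists>g<k. cost (F(i := G g)) \<le> cost F - (cost F / 2 - 41 * cost G) / real k"
proof -
  have "\<forall>p. \<exists>i. i < k \<and> nearest_dist \<delta> k F p = \<delta> p (F i)" using nearest_dist_attained[OF k] by metis
  then obtain f where f: "\<And>p. f p < k" "\<And>p. nearest_dist \<delta> k F p = \<delta> p (F (f p))" by metis
  have "\<forall>p. \<exists>i. i < k \<and> nearest_dist \<delta> k G p = \<delta> p (G i)" using nearest_dist_attained[OF k] by metis
  then obtain h where h: "\<And>p. h p < k" "\<And>p. nearest_dist \<delta> k G p = \<delta> p (G (h p))" by metis
  define \<eta> where "\<eta> g = f (G g)" for g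
  obtain \<pi> where \<pi>: "\<And>g. g < k \<Longrightarrow> \<pi> g < k"
    "\<And>g g'. g < k \<Longrightarrow> g' < k \<Longrightarrow> \<eta> g' = \<pi> g \<Longrightarrow> g' = g"
    "\<And>i. card {g. g < k \<and> \<pi> g = i} \<le> 2"
    using slot_matching[of k \<eta>] f(1) unfolding \<eta>_def by blast
  define S where "S x = nearest_dist \<delta> k F (a x)" for x
  define Q where "Q x = nearest_dist \<delta> k G (a x)" for x
  have S0: "0 \<le> S x" and Q0: "0 \<le> Q x" if "x \<in> X" for x
    unfolding S_def Q_def f(2) h(2) using nonneg P f(1) h(1) that by auto
  have nd0: "0 \<le> nearest_dist \<delta> k (F(i := G g)) (a x)" if "x \<in> X" "g < k" for x i g
  proof -
    obtain j where j: "j < k" "nearest_dist \<delta> k (F(i := G g)) (a x) = \<delta> (a x) ((F(i := G g)) j)"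
      by (rule nearest_dist_attained[OF k])
    moreover have "(F(i := G g)) j \<in> P" using P(2)[OF j(1)] P(3)[OF that(2)] by simp
    ultimately show ?thesis using nonneg[OF P(1)[OF that(1)]] by metis
  qed
  have grow: "S x ^ z \<le> (2 * Q x + S x) ^ z" if "x \<in> X" for x
    using S0[OF that] Q0[OF that] by (intro power_mono) auto
  have point: "nearest_dist \<delta> k (F(\<pi> g := G g)) (a x) ^ z \<le> S x ^ z +
      (if h (a x) = g then Q x ^ z - S x ^ z else 0) +
      (if f (a x) = \<pi> g then (2 * Q x + S x) ^ z - S x ^ z else 0)" if x: "x \<in> X" and g: "g < k" for x g
  proof -
    let ?F = "F(\<pi> g := G g)"
    consider "h (a x) = g" | "h (a x) \<noteq> g" "f (a x) = \<pi> g" | "h (a x) \<noteq> g" "f (a x) \<noteq> \<pi> g" by blast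
    then show ?thesis
    proof cases
      case 1
      have "nearest_dist \<delta> k ?F (a x) \<le> \<delta> (a x) (?F (\<pi> g))" using \<pi>(1)[OF g] by (rule nearest_dist_le)
      then have "nearest_dist \<delta> k ?F (a x) \<le> Q x" using 1 by (simp add: Q_def h(2))
      then have "nearest_dist \<delta> k ?F (a x) ^ z \<le> Q x ^ z" using nd0[OF x g] by (intro power_mono) auto
      then show ?thesis using 1 grow[OF x] by simp
    next
      case 2
      let ?o = "G (h (a x))"
      have "\<eta> (h (a x)) \<noteq> \<pi> g" using 2 \<pi>(2)[OF g h(1)] by blast
      then have "nearest_dist \<delta> k ?F (a x) \<le> \<delta> (a x) (F (\<eta> (h (a x))))"
        using nearest_dist_le[of "\<eta> (h (a x))" k \<delta> ?F "a x"] f(1) by (simp add: \<eta>_def)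
      also have "\<dots> \<le> \<delta> (a x) ?o + \<delta> ?o (F (\<eta> (h (a x))))"
        using P x h(1) f(1) by (intro tri) (auto simp: \<eta>_def)
      also have "\<delta> ?o (F (\<eta> (h (a x)))) \<le> \<delta> ?o (F (f (a x)))"
        using nearest_dist_le[OF f(1), of \<delta> F ?o "a x"] by (simp add: \<eta>_def f(2))
      also have "\<dots> \<le> \<delta> ?o (a x) + \<delta> (a x) (F (f (a x)))"
        using P x h(1) f(1) by (intro tri) auto
      also have "\<delta> ?o (a x) = \<delta> (a x) ?o" using P x h(1) by (intro sym) auto
      finally have "nearest_dist \<delta> k ?F (a x) \<le> 2 * Q x + S x" unfolding Q_def S_def f(2)[of "a x"] h(2)[of "a x"] by linarith
      then have "nearest_dist \<delta> k ?F (a x) ^ z \<le> (2 * Q x + S x) ^ z" using nd0[OF x g] by (intro power_mono) auto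
      then show ?thesis using 2 by simp
    next
      case 3
      have "nearest_dist \<delta> k ?F (a x) \<le> S x"
        using nearest_dist_le[OF f(1)[of "a x"], of \<delta> ?F "a x"] 3 by (simp add: S_def f(2))
      then have "nearest_dist \<delta> k ?F (a x) ^ z \<le> S x ^ z" using nd0[OF x g] by (intro power_mono) auto
      then show ?thesis using 3 by simp
    qed
  qed
  have young: "(2 * Q x + S x) ^ z - S x ^ z \<le> 20 * Q x ^ z + S x ^ z / 4" if "x \<in> X" for x
  proof -
    \<comment> \<open>For z = 2 this bounds the mixed term 4 * Q x * S x by 16 * (Q x)^2 + (S x)^2 /
      4.\<close>
    have "0 \<le> (4 * Q x - S x / 2)\<^sup>2" by simp
    then show ?thesis using z S0[OF that] Q0[OF that] by (auto simp: power2_eq_square algebra_simps)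
  qed
  have "(\<Sum>g<k. cost (F(\<pi> g := G g))) \<le> (\<Sum>g<k. \<Sum>x\<in>X. S x ^ z +
      (if h (a x) = g then Q x ^ z - S x ^ z else 0) +
      (if f (a x) = \<pi> g then (2 * Q x + S x) ^ z - S x ^ z else 0))"
    unfolding cost_def by (intro sum_mono point) auto
  also have "\<dots> = (\<Sum>x\<in>X. \<Sum>g<k. S x ^ z +
      (if h (a x) = g then Q x ^ z - S x ^ z else 0) +
      (if f (a x) = \<pi> g then (2 * Q x + S x) ^ z - S x ^ z else 0))" by (rule sum.swap)
  also have "\<dots> \<le> (\<Sum>x\<in>X. real k * S x ^ z + (Q x ^ z - S x ^ z) + 2 * (20 * Q x ^ z + S x ^ z / 4))"
  proof (rule sum_mono)
    fix x assume x: "x \<in> X"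
    let ?c = "(2 * Q x + S x) ^ z - S x ^ z"
    have "(\<Sum>g<k. if h (a x) = g then Q x ^ z - S x ^ z else 0) = Q x ^ z - S x ^ z"
      using h(1) by simp
    moreover have "(\<Sum>g<k. if f (a x) = \<pi> g then ?c else 0) = real (card {g. g < k \<and> \<pi> g = f (a x)}) * ?c"
    proof -
      have "{..<k} \<inter> {g. f (a x) = \<pi> g} = {g. g < k \<and> \<pi> g = f (a x)}" by auto
      then show ?thesis by (simp add: sum.If_cases)
    qed
    moreover have "real (card {g. g < k \<and> \<pi> g = f (a x)}) * ?c \<le> 2 * ?c"
      using \<pi>(3)[of "f (a x)"] grow[OF x] by (intro mult_right_mono) auto
    ultimately show "(\<Sum>g<k. S x ^ z + (if h (a x) = g then Q x ^ z - S x ^ z else 0) +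
        (if f (a x) = \<pi> g then ?c else 0)) \<le> real k * S x ^ z + (Q x ^ z - S x ^ z) + 2 * (20 * Q x ^ z + S x ^ z / 4)"
      using young[OF x] by (simp add: sum.distrib)
  qed
  also have "\<dots> = real k * cost F - (cost F / 2 - 41 * cost G)"
  proof -
    have "(\<Sum>x\<in>X. real k * S x ^ z + (Q x ^ z - S x ^ z) + 2 * (20 * Q x ^ z + S x ^ z / 4))
        = (\<Sum>x\<in>X. (real k - 1 / 2) * S x ^ z + 41 * Q x ^ z)" by (simp add: algebra_simps)
    also have "\<dots> = (real k - 1 / 2) * cost F + 41 * cost G"
      by (simp only: sum.distrib sum_distrib_left[symmetric] cost_def S_def Q_def)
    finally show ?thesis by (simp add: algebra_simps)
  qed
  finally have sum: "(\<Sum>g<k. cost (F(\<pi> g := G g))) \<le> real k * cost F - (cost F / 2 - 41 * cost G)" .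
  show ?thesis
  proof (rule ccontr)
    assume "\<not> ?thesis"
    then have "cost F - (cost F / 2 - 41 * cost G) / real k < cost (F(\<pi> g := G g))" if "g < k" for g
      using \<pi>(1)[OF that] that by (meson not_le)
    then have "(\<Sum>g<k. cost F - (cost F / 2 - 41 * cost G) / real k) < (\<Sum>g<k. cost (F(\<pi> g := G g)))"
      using k by (intro sum_strict_mono) (auto simp: lessThan_empty_iff)
    moreover have "(\<Sum>g<k. cost F - (cost F / 2 - 41 * cost G) / real k) = real k * cost F - (cost F / 2 - 41 * cost G)"
      using k by (simp add: field_simps)
    ultimately show False using sum by linarith
  qed
qed

text \<open>82 * Q = 2 * 41 * Q is the fixed point of the improvement step, and the excess over it
  shrinks by the factor 1 - 1 / (2 * k).\<close>

lemma local_search_decay: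
  assumes k: "1 \<le> k" and step: "S' \<le> S - (S / 2 - 41 * Q) / real k" and S: "S \<le> 82 * Q + c"
  shows "S' \<le> 82 * Q + (1 - 1 / real (2 * k)) * c"
proof -
  let ?q = "1 - 1 / real (2 * k)"
  have "0 \<le> ?q" using k by simp
  then have "?q * S \<le> ?q * (82 * Q + c)" using S by (rule mult_left_mono[rotated])
  moreover have "S' \<le> ?q * S + 41 * Q / real k" using step k by (simp add: field_simps)
  moreover have "?q * (82 * Q) + 41 * Q / real k = 82 * Q" using k by (simp add: field_simps)
  ultimately show ?thesis by (simp add: algebra_simps)
qed

section \<open>Adaptive sampling with weak distances\<close>

lemma length_filter_mono:
  "(\<And>x. x \<in> set xs \<Longrightarrow> P x \<Longrightarrow> Q x) \<Longrightarrow> length (filter P xs) \<le> length (filter Q xs)"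
  by (induction xs) (auto simp: le_SucI)

lemma card_le_length_filter:
  "card (set xs \<inter> {x. P x}) \<le> length (filter P xs)"
proof -
  have "set xs \<inter> {x. P x} = set (filter P xs)" by auto
  then show ?thesis by (simp only: card_length)
qed

text \<open>\<open>A\<close> contains the values of rank at least one half, and its least element is
  the median; ranks can be counted without sorting. Some value not above a given element of
  \<open>A\<close> is uncorrupted, which gives the lower bound; the largest uncorrupted value
  belongs to \<open>A\<close>, which gives the upper one.\<close>

lemma median_bounds:
  fixes f g :: "'a \<Rightarrow> real"
  assumes bad: "2 * length (filter (\<lambda>t. f t \<noteq> g t) T) < length T"
    and g: "\<And>t. t \<in> set T \<Longrightarrow> \<bar>g t - c\<bar> \<le> r"
  defines "A \<equiv> {f t |t. t \<in> set T \<and> length T \<le> 2 * length (filter (\<lambda>t'. f t' \<le> f t) T)}"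
  shows "\<forall>v\<in>A. c - r \<le> v" "\<exists>v\<in>A. v \<le> c + r"
proof -
  show "\<forall>v\<in>A. c - r \<le> v"
  proof
    fix v assume "v \<in> A"
    then obtain t where t: "t \<in> set T" "v = f t" "length T \<le> 2 * length (filter (\<lambda>t'. f t' \<le> f t) T)"
      by (auto simp: A_def)
    have "\<exists>t'\<in>set T. f t' \<le> f t \<and> f t' = g t'"
    proof (rule ccontr)
      assume "\<not> ?thesis"
      then have "length (filter (\<lambda>t'. f t' \<le> f t) T) \<le> length (filter (\<lambda>t. f t \<noteq> g t) T)"
        by (intro length_filter_mono) auto
      with t bad show False by linarith
    qed
    then obtain t' where "t' \<in> set T" "f t' \<le> f t" "f t' = g t'" by blast
    with g[of t'] t show "c - r \<le> v" by (auto simp: abs_le_iff)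
  qed
  let ?U = "{t \<in> set T. f t = g t}"
  have "?U \<noteq> {}"
  proof
    assume "?U = {}"
    then have "filter (\<lambda>t. f t \<noteq> g t) T = T" by (intro filter_True) auto
    with bad show False by simp
  qed
  then have "Max (f ` ?U) \<in> f ` ?U" by (intro Max_in) auto
  then obtain t where t: "t \<in> set T" "f t = g t" "Max (f ` ?U) = f t" by auto
  have "f t' \<le> f t" if "t' \<in> set T" "f t' = g t'" for t'
    using t that by (metis (mono_tags, lifting) Max_ge finite_imageI finite_set finite_subset mem_Collect_eq rev_image_eqI subsetI)
  then have "length (filter (\<lambda>t. \<not> f t \<noteq> g t) T) \<le> length (filter (\<lambda>t'. f t' \<le> f t) T)"
    by (intro length_filter_mono) auto
  then have "f t \<in> A" using bad sum_length_filter_compl[of "\<lambda>t. f t \<noteq> g t" T] t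
    unfolding A_def by (intro CollectI exI[of _ t]) simp
  then show "\<exists>v\<in>A. v \<le> c + r" using g[OF t(1)] t by (intro bexI[of _ "f t"]) (auto simp: abs_le_iff)
qed

section \<open>Integer sampling weights\<close>

text \<open>
  The machine cannot round reals to words, so \<open>16 * D\<^sup>z\<close> is approximated from above by a word that
  grows by a factor of about \<open>5 / 4\<close> per step.
\<close>

definition grow :: "real \<Rightarrow> nat \<Rightarrow> nat" where
  "grow g v = (if real v < g then v + v div 4 + 1 else v)"

definition round_up :: "nat \<Rightarrow> real \<Rightarrow> nat" where
  "round_up J g = (grow g ^^ J) 0"

text \<open>The floor loses at most 3/4, so v + 1 still grows by the factor 5/4 in each step that
  changes v; this is the last claim. The upper bound holds because the last change starts below
  \<open>g\<close>.\<close>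

lemma grow_power_bounds:
  "(grow g ^^ j) 0 < 2 ^ j" "real ((grow g ^^ j) 0) \<le> max 0 (5 / 4 * g + 1)"
  "g \<le> real ((grow g ^^ j) 0) \<or> (5 / 4) ^ j \<le> real ((grow g ^^ j) 0) + 1"
proof (induction j)
  case (Suc j)
  let ?v = "(grow g ^^ j) 0"
  have w: "(grow g ^^ Suc j) 0 = grow g ?v" by simp
  have quarter: "real (?v div 4) \<le> real ?v / 4" "real ?v / 4 \<le> real (?v div 4) + 3 / 4"
    by linarith+
  {
    case 1
    have "v < 2 ^ j \<Longrightarrow> grow g v < 2 * 2 ^ j" for v
      using div_le_dividend[of v 4] by (auto simp: grow_def)
    then show ?case using Suc(1) unfolding w by simp
  next
    case 2
    show ?case
    proof (cases "real ?v < g")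
      case True
      then show ?thesis using quarter unfolding w grow_def[of g ?v] by simp
    next
      case False
      then show ?thesis using Suc(2) unfolding w grow_def[of g ?v] by simp
    qed
  next
    case 3
    show ?case
    proof (cases "real ?v < g")
      case True
      then have "(5 / 4) ^ j \<le> real ?v + 1" using Suc(3) by linarith
      then have "5 / 4 * (5 / 4) ^ j \<le> 5 / 4 * (real ?v + 1)" by (intro mult_left_mono) auto
      also have "\<dots> \<le> real (?v + ?v div 4 + 1) + 1" using quarter by simp
      finally show ?thesis using True unfolding w grow_def[of g ?v] by simp
    qed (simp add: w grow_def[of g ?v])
  }
qed simp_all

lemma round_up_less: "round_up J g < 2 ^ J"
  by (simp add: round_up_def grow_power_bounds)

lemma round_up_nonpos: "g \<le> 0 \<Longrightarrow> round_up J g = 0"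
proof -
  assume "g \<le> 0"
  then have "(grow g ^^ j) 0 = 0" for j by (induction j) (auto simp: grow_def)
  then show ?thesis by (simp add: round_up_def)
qed

lemma round_up_bounds:
  assumes "0 \<le> g" "g + 1 \<le> (5 / 4) ^ J"
  shows "g \<le> real (round_up J g)" "real (round_up J g) \<le> 5 / 4 * g + 1"
  using grow_power_bounds[where g = g and j = J] assms by (auto simp: round_up_def)

text \<open>Inversion of the cumulative weights: the last x such that the weights before x sum up to
  at most \<open>u\<close>. Each x is hit by exactly \<open>w x\<close> values of \<open>u\<close>
  below the total weight.\<close>

primrec pick :: "(nat \<Rightarrow> nat) \<Rightarrow> nat \<Rightarrow> nat \<Rightarrow> nat" where
  "pick w 0 u = 0"
| "pick w (Suc x) u = (if sum w {..<x} \<le> u then x else pick w x u)"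

lemma sum_pick:
  fixes f :: "nat \<Rightarrow> real"
  shows "(\<Sum>u<sum w {..<n}. f (pick w n u)) = (\<Sum>x<n. real (w x) * f x)"
proof (induction n)
  case (Suc n)
  let ?s = "sum w {..<n}"
  have "(\<Sum>u<?s + w n. f (pick w (Suc n) u)) =
      (\<Sum>u<?s. f (pick w (Suc n) u)) + (\<Sum>u=?s..<?s + w n. f (pick w (Suc n) u))"
    by (metis (no_types, lifting) atLeast0LessThan le_add1 sum.atLeastLessThan_concat zero_le)
  also have "(\<Sum>u<?s. f (pick w (Suc n) u)) = (\<Sum>u<?s. f (pick w n u))"
    by (intro sum.cong) auto
  also have "(\<Sum>u=?s..<?s + w n. f (pick w (Suc n) u)) = real (w n) * f n"
    by simp
  finally show ?case using Suc by simp
qed simp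

lemma pick_less: "1 \<le> n \<Longrightarrow> pick w n u < n"
proof (induction n)
  case (Suc n)
  then show ?case by (cases n) (auto simp: less_SucI)
qed simp

section \<open>The sampling process and its distance estimates\<close>

text \<open>
  Histories are lists of sampled points, newest first. \<open>est h\<close> is the estimate of the distance to
  the centers obtained so far, and sampled points have estimate \<open>0\<close>.
\<close>

locale sampler =
  fixes n z \<mu> J :: nat and d wk :: "nat \<Rightarrow> nat \<Rightarrow> real" and Lam :: real
  assumes n2: "2 \<le> n" and z: "z \<in> {1, 2}" and \<mu>: "1 \<le> \<mu>"
    and metric: "Metric_space {..<n} d"
    and d_ge_1: "\<And>x y. x < n \<Longrightarrow> y < n \<Longrightarrow> x \<noteq> y \<Longrightarrow> 1 \<le> d x y"
    and d_le_Lam: "\<And>x y. x < n \<Longrightarrow> y < n \<Longrightarrow> d x y \<le> Lam"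
    and Lam: "100 \<le> Lam"
    and J: "16 * Lam ^ z + 1 \<le> (5 / 4) ^ J"
begin

definition m where "m = 2 * \<mu>"
text \<open>In a ball with at least 64 * m points, fewer than m sampled points make up at most
  1/64.\<close>

definition M where "M = 64 * m"

text \<open>Smallest distance to a sample at which the ball around \<open>y\<close> captures
  \<open>M\<close> samples. The default \<open>Lam\<close> keeps \<open>y\<close> from becoming a
  center, since no estimate exceeds \<open>Lam\<close>.\<close>

definition radius :: "nat \<Rightarrow> nat list \<Rightarrow> real" where
  "radius y h = Min (insert Lam {d y s |s. s \<in> set h \<and> M \<le> length (filter (\<lambda>s'. d y s' \<le> d y s) h)})"

text \<open>The oldest samples in the ball: as long as fewer than \<open>m\<close> of its points are
  sampled, almost the whole ball is still available to the next draw.\<close>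

definition witnesses :: "nat \<Rightarrow> nat list \<Rightarrow> nat list" where
  "witnesses y h = take m (filter (\<lambda>s. d y s \<le> radius y h) (rev h))"

text \<open>Weak distances of rank at least one half, shifted by 100 radii; the least of them is the
  shifted median. The shift turns an error of one radius into a relative error of one per
  cent.\<close>

definition candidates :: "nat \<Rightarrow> nat list \<Rightarrow> nat \<Rightarrow> real set" where
  "candidates y h x = {wk x t + 100 * radius y h |t. t \<in> set (witnesses y h) \<and>
     m \<le> 2 * length (filter (\<lambda>t'. wk x t' \<le> wk x t) (witnesses y h))}"

primrec est :: "nat list \<Rightarrow> nat \<Rightarrow> real" where
  "est [] x = Lam"
| "est (y # \<sigma>) x = (if x = y then 0
     else if 100 * radius y (y # \<sigma>) < est \<sigma> y then Min (insert (est \<sigma> x) (candidates y (y # \<sigma>) x))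
     else est \<sigma> x)"

abbreviation act :: "nat list \<Rightarrow> nat \<Rightarrow> bool" where
  "act \<sigma> y \<equiv> 100 * radius y (y # \<sigma>) < est \<sigma> y"

primrec asg :: "nat list \<Rightarrow> nat \<Rightarrow> nat" where
  "asg [] x = 0"
| "asg (y # \<sigma>) x = (if x = y then length \<sigma>
     else if act \<sigma> y \<and> (\<exists>v\<in>candidates y (y # \<sigma>) x. v < est \<sigma> x) then length \<sigma>
     else asg \<sigma> x)"

definition weight :: "nat list \<Rightarrow> nat \<Rightarrow> nat" where
  "weight h x = round_up J (16 * est h x ^ z)"

definition total :: "nat list \<Rightarrow> nat" where
  "total h = (\<Sum>x<n. weight h x)"

definition next_sample :: "nat list \<Rightarrow> nat pmf" where
  "next_sample h = map_pmf (pick (weight h) n)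
     (if total h = 0 then return_pmf 0 else pmf_of_set {..<total h})"

primrec process :: "nat \<Rightarrow> nat list pmf" where
  "process 0 = return_pmf []"
| "process (Suc t) = bind_pmf (process t) (\<lambda>h. map_pmf (\<lambda>y. y # h) (next_sample h))"

text \<open>All accuracy statements are deterministic consequences of this event; typicality of the
  corruptions serves to bound its probability.\<close>

primrec good :: "nat list \<Rightarrow> bool" where
  "good [] \<longleftrightarrow> True"
| "good (y # \<sigma>) \<longleftrightarrow> good \<sigma> \<and> (act \<sigma> y \<longrightarrow>
     (\<forall>x<n. 2 * length (filter (\<lambda>t. wk x t \<noteq> d x t) (witnesses y (y # \<sigma>))) < m))"

text \<open>
  Exact distances instead of medians make \<open>proxy\<close> 1-Lipschitz, whatever the adversary does; \<open>est\<close>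
  only agrees with it up to one per cent.
\<close>

primrec proxy :: "nat list \<Rightarrow> nat \<Rightarrow> real" where
  "proxy [] x = Lam"
| "proxy (y # \<sigma>) x = (if act \<sigma> y then min (proxy \<sigma> x) (d x y + 100 * radius y (y # \<sigma>)) else proxy \<sigma> x)"

text \<open>What holds throughout the support of \<open>process\<close>: in a good history sampled
  points have weight 0, so a repetition occurs only once all estimates have vanished.\<close>

primrec valid :: "nat list \<Rightarrow> bool" where
  "valid [] \<longleftrightarrow> True"
| "valid (y # \<sigma>) \<longleftrightarrow> valid \<sigma> \<and> y < n \<and> (good \<sigma> \<and> y \<in> set \<sigma> \<longrightarrow> (\<forall>x<n. est \<sigma> x \<le> 0))"

lemma d_nonneg: "0 \<le> d x y" and d_commute: "d x y = d y x" and d_self: "x < n \<Longrightarrow> d x x = 0"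
  and d_triangle: "x < n \<Longrightarrow> y < n \<Longrightarrow> w < n \<Longrightarrow> d x w \<le> d x y + d y w"
  using Metric_space.nonneg[OF metric] Metric_space.commute[OF metric]
    Metric_space.triangle[OF metric] Metric_space.zero[OF metric] by (blast, blast, simp, blast)

lemma finite_candidates [simp]: "finite (candidates y h x)"
  by (simp add: candidates_def)

lemma radius_bounds: "0 \<le> radius y h" "radius y h \<le> Lam"
  using Lam unfolding radius_def by (auto simp: d_nonneg intro!: Min_le)

lemma radius_le: "s \<in> set h \<Longrightarrow> M \<le> length (filter (\<lambda>s'. d y s' \<le> d y s) h) \<Longrightarrow> radius y h \<le> d y s"
  unfolding radius_def by (intro Min_le) auto

lemma radius_cases:
  "radius y h = Lam \<or> (\<exists>s\<in>set h. radius y h = d y s \<and> M \<le> length (filter (\<lambda>s'. d y s' \<le> radius y h) h))"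
proof -
  let ?A = "{d y s |s. s \<in> set h \<and> M \<le> length (filter (\<lambda>s'. d y s' \<le> d y s) h)}"
  have "radius y h \<in> insert Lam ?A" unfolding radius_def by (rule Min_in) auto
  then show ?thesis by auto
qed

lemma est_le_Lam: "est h x \<le> Lam"
proof (induction h)
  case (Cons y \<sigma>)
  have "Min (insert (est \<sigma> x) (candidates y (y # \<sigma>) x)) \<le> est \<sigma> x" by (intro Min_le) auto
  then have "Min (insert (est \<sigma> x) (candidates y (y # \<sigma>) x)) \<le> Lam" using Cons by linarith
  then show ?case using Cons Lam by (simp only: est.simps split: if_split) auto
qed simp

lemma act_radius:
  assumes "act \<sigma> y"
  obtains s where "s \<in> set (y # \<sigma>)" "radius y (y # \<sigma>) = d y s"
    "M \<le> length (filter (\<lambda>s'. d y s' \<le> radius y (y # \<sigma>)) (y # \<sigma>))"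
proof -
  have "radius y (y # \<sigma>) \<noteq> Lam" using est_le_Lam[of \<sigma> y] assms Lam by linarith
  then show ?thesis using radius_cases[of y "y # \<sigma>"] that by blast
qed

lemma m_pos: "2 \<le> m" "m \<le> M" "128 \<le> M"
  using \<mu> by (auto simp: m_def M_def)

lemma length_witnesses:
  assumes "act \<sigma> y"
  shows "length (witnesses y (y # \<sigma>)) = m"
proof -
  have "M \<le> length (filter (\<lambda>s'. d y s' \<le> radius y (y # \<sigma>)) (y # \<sigma>))" by (rule act_radius[OF assms])
  then show ?thesis using m_pos by (simp only: witnesses_def length_take rev_filter[symmetric] length_rev)
qed

text \<open>Witnesses lie within one radius of \<open>y\<close>, so the uncorrupted ones report d x
  y up to one radius, and hence so does the median.\<close>

lemma candidates_bounds:
  assumes act: "act \<sigma> y" and h: "set (y # \<sigma>) \<subseteq> {..<n}" and x: "x < n"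
    and bad: "2 * length (filter (\<lambda>t. wk x t \<noteq> d x t) (witnesses y (y # \<sigma>))) < m"
  shows "\<forall>v\<in>candidates y (y # \<sigma>) x. d x y + 99 * radius y (y # \<sigma>) \<le> v"
    "\<exists>v\<in>candidates y (y # \<sigma>) x. v \<le> d x y + 101 * radius y (y # \<sigma>)"
proof -
  let ?T = "witnesses y (y # \<sigma>)" let ?r = "radius y (y # \<sigma>)"
  have g: "\<bar>d x t - d x y\<bar> \<le> ?r" if "t \<in> set ?T" for t
  proof -
    have "t \<in> set (filter (\<lambda>s. d y s \<le> ?r) (rev (y # \<sigma>)))"
      using that unfolding witnesses_def by (rule in_set_takeD)
    then have "d y t \<le> ?r \<and> t \<in> set (y # \<sigma>)" by (simp only: set_filter set_rev mem_Collect_eq)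
    then have t: "d y t \<le> ?r" "t < n" "y < n" using h by auto
    then show ?thesis
      using d_triangle[of x y t] d_triangle[of x t y] d_commute[of t y] x by auto
  qed
  let ?A = "{wk x t |t. t \<in> set ?T \<and> length ?T \<le> 2 * length (filter (\<lambda>t'. wk x t' \<le> wk x t) ?T)}"
  have cand: "candidates y (y # \<sigma>) x = (\<lambda>v. v + 100 * ?r) ` ?A"
    unfolding candidates_def length_witnesses[OF act] by auto
  have "2 * length (filter (\<lambda>t. wk x t \<noteq> d x t) ?T) < length ?T" using bad length_witnesses[OF act] by simp
  note med = median_bounds[of "wk x" "d x", OF this, of "d x y" ?r, OF g]
  show "\<forall>v\<in>candidates y (y # \<sigma>) x. d x y + 99 * ?r \<le> v"
    using med(1) unfolding cand by force
  show "\<exists>v\<in>candidates y (y # \<sigma>) x. v \<le> d x y + 101 * ?r"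
    using med(2) unfolding cand by force
qed

text \<open>A candidate used for the minimum lies between d + 99 * r and d + 101 * r, while
  \<open>proxy\<close> uses d + 100 * r; minima preserve the ratio. The lower bound 100, which later
  makes rounding errors negligible, comes from radii of at least 1.\<close>

lemma est_accuracy:
  assumes "good h" "set h \<subseteq> {..<n}" "x < n"
  shows "if x \<in> set h then est h x = 0
    else 99 * proxy h x \<le> 100 * est h x \<and> 100 * est h x \<le> 101 * proxy h x \<and> 100 \<le> proxy h x"
  using assms
proof (induction h arbitrary: x)
  case Nil
  then show ?case using Lam by simp
next
  case (Cons y \<sigma>)
  let ?r = "radius y (y # \<sigma>)"
  have y: "y < n" and s: "good \<sigma>" "set \<sigma> \<subseteq> {..<n}" using Cons.prems by auto
  note IH = Cons.IH[OF s]
  show ?case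
  proof (cases "act \<sigma> y \<and> x \<noteq> y")
    case False
    then show ?thesis using IH[OF Cons.prems(3)] IH[OF y] Cons.prems
      by (cases "x = y") auto
  next
    case True
    then have act: "act \<sigma> y" and xy: "x \<noteq> y" by auto
    have bad: "2 * length (filter (\<lambda>t. wk x t \<noteq> d x t) (witnesses y (y # \<sigma>))) < m"
      using Cons.prems act by auto
    note c = candidates_bounds[OF act Cons.prems(2,3) bad]
    have "0 < est \<sigma> y" using act radius_bounds(1)[of y "y # \<sigma>"] by linarith
    then have ys: "y \<notin> set \<sigma>" using IH[OF y] by (auto split: if_splits)
    \<comment> \<open>A ball of radius below 1 contains no sample but \<open>y\<close> itself, too
      few for \<open>M\<close>.\<close>
    have r1: "1 \<le> ?r"
    proof (rule ccontr)
      assume r: "\<not> 1 \<le> ?r"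
      have "filter (\<lambda>s'. d y s' \<le> ?r) \<sigma> = []"
      proof (rule filter_False, rule ballI)
        fix s' assume "s' \<in> set \<sigma>"
        then have "1 \<le> d y s'" using d_ge_1[OF y, of s'] ys s by auto
        then show "\<not> d y s' \<le> ?r" using r by linarith
      qed
      then have "length (filter (\<lambda>s'. d y s' \<le> ?r) (y # \<sigma>)) \<le> 1" by simp
      moreover have "M \<le> length (filter (\<lambda>s'. d y s' \<le> ?r) (y # \<sigma>))" by (rule act_radius[OF act])
      ultimately show False using m_pos by linarith
    qed
    have e: "est (y # \<sigma>) x = Min (insert (est \<sigma> x) (candidates y (y # \<sigma>) x))" using xy act by simp
    obtain v where v: "v \<in> candidates y (y # \<sigma>) x" "v \<le> d x y + 101 * ?r" using c(2) by blast
    have dxy: "0 \<le> d x y" by (rule d_nonneg)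
    show ?thesis
    proof (cases "x \<in> set \<sigma>")
      case True
      have "est \<sigma> x = 0" using IH[OF Cons.prems(3)] True by simp
      moreover have "0 \<le> w" if "w \<in> candidates y (y # \<sigma>) x" for w
      proof -
        have "d x y + 99 * ?r \<le> w" using c(1) that by blast
        then show ?thesis using r1 dxy by linarith
      qed
      ultimately have "est (y # \<sigma>) x = 0" unfolding e by (intro Min_eqI) auto
      then show ?thesis using True by simp
    next
      case False
      then have I: "99 * proxy \<sigma> x \<le> 100 * est \<sigma> x" "100 * est \<sigma> x \<le> 101 * proxy \<sigma> x" "100 \<le> proxy \<sigma> x"
        using IH[OF Cons.prems(3)] by auto
      let ?e = "est (y # \<sigma>) x" let ?p = "d x y + 100 * ?r"
      have p: "proxy (y # \<sigma>) x = min (proxy \<sigma> x) ?p" using act by simp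
      have "?e \<le> est \<sigma> x" "?e \<le> v" unfolding e using v by (auto intro!: Min_le)
      then have up: "100 * ?e \<le> 101 * proxy (y # \<sigma>) x"
        unfolding p using I v(2) dxy by (auto simp: min_def)
      have "?e \<in> insert (est \<sigma> x) (candidates y (y # \<sigma>) x)" unfolding e by (rule Min_in) auto
      then have "?e = est \<sigma> x \<or> d x y + 99 * ?r \<le> ?e" using c(1) by blast
      moreover have "proxy (y # \<sigma>) x \<le> proxy \<sigma> x" "proxy (y # \<sigma>) x \<le> ?p"
        unfolding p by (rule min.cobounded1, rule min.cobounded2)
      ultimately have lo: "99 * proxy (y # \<sigma>) x \<le> 100 * ?e" using I(1) dxy by (elim disjE) argo+
      have "100 \<le> proxy (y # \<sigma>) x" unfolding p using I r1 dxy by simp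
      then show ?thesis using up lo False xy by simp
    qed
  qed
qed

lemma est_sampled: "good h \<Longrightarrow> set h \<subseteq> {..<n} \<Longrightarrow> x \<in> set h \<Longrightarrow> est h x = 0"
  using est_accuracy[of h x] by auto

lemma est_unsampled:
  assumes "good h" "set h \<subseteq> {..<n}" "x < n" "x \<notin> set h"
  shows "99 * proxy h x \<le> 100 * est h x" "100 * est h x \<le> 101 * proxy h x" "100 \<le> proxy h x" "99 \<le> est h x"
  using est_accuracy[OF assms(1-3)] assms(4) by auto

lemma est_nonneg: "good h \<Longrightarrow> set h \<subseteq> {..<n} \<Longrightarrow> x < n \<Longrightarrow> 0 \<le> est h x"
  using est_sampled[of h x] est_unsampled(4)[of h x] by (cases "x \<in> set h") auto

lemma est_antimono: "good \<sigma> \<Longrightarrow> set \<sigma> \<subseteq> {..<n} \<Longrightarrow> x < n \<Longrightarrow> est (y # \<sigma>) x \<le> est \<sigma> x"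
  using est_nonneg[of \<sigma> x] by auto

lemma est_le_proxy: 
  assumes "good h" "set h \<subseteq> {..<n}" "x < n"
  shows "100 * est h x \<le> 101 * proxy h x"
proof (cases "x \<in> set h")
  case True
  have "0 \<le> proxy h x" for h using Lam
    by (induction h) (auto intro!: add_nonneg_nonneg mult_nonneg_nonneg d_nonneg radius_bounds)
  then show ?thesis using est_sampled[OF assms(1,2) True] by simp
qed (use est_unsampled assms in auto)

lemma proxy_antimono: "proxy (y # \<sigma>) x \<le> proxy \<sigma> x"
  by simp

lemma proxy_lipschitz: "set h \<subseteq> {..<n} \<Longrightarrow> x < n \<Longrightarrow> x' < n \<Longrightarrow> proxy h x \<le> proxy h x' + d x x'"
proof (induction h)
  case Nil
  then show ?case by (simp add: d_nonneg)
next
  case (Cons y \<sigma>)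
  then show ?case using d_triangle[of x x' y] by (auto simp: min_def)
qed

lemma valid_set: "valid h \<Longrightarrow> set h \<subseteq> {..<n}"
  by (induction h) auto

lemma valid_distinct:
  "valid h \<Longrightarrow> good h \<Longrightarrow> x < n \<Longrightarrow> 0 < est h x \<Longrightarrow> distinct h"
proof (induction h)
  case (Cons y \<sigma>)
  then have "est (y # \<sigma>) x \<le> est \<sigma> x" by (intro est_antimono) (auto dest: valid_set)
  then have "0 < est \<sigma> x" using Cons.prems(4) by linarith
  then show ?case using Cons by force
qed simp

lemma good_unsampled_if_pos:
  "good h \<Longrightarrow> set h \<subseteq> {..<n} \<Longrightarrow> 0 < est h x \<Longrightarrow> x \<notin> set h"
  using est_sampled by force

text \<open>The estimate of an unsampled point is at least 99, so the additive 1 of the rounding is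
  below one hundredth of 16 * est^z, and 5/4 + 1/100 = 63/50.\<close>

lemma weight_bounds:
  assumes "good h" "set h \<subseteq> {..<n}" "x < n"
  shows "16 * est h x ^ z \<le> real (weight h x)" "real (weight h x) \<le> 63 / 50 * (16 * est h x ^ z)"
proof -
  have e0: "0 \<le> est h x" using est_nonneg assms by auto
  have "est h x ^ z \<le> Lam ^ z" using e0 est_le_Lam by (intro power_mono) auto
  then have J': "16 * est h x ^ z + 1 \<le> (5 / 4) ^ J" using J by linarith
  have g0: "0 \<le> 16 * est h x ^ z" using e0 by simp
  show "16 * est h x ^ z \<le> real (weight h x)"
    unfolding weight_def using round_up_bounds[OF g0 J'] by auto
  show "real (weight h x) \<le> 63 / 50 * (16 * est h x ^ z)"
  proof (cases "x \<in> set h")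
    case True
    then have "16 * est h x ^ z = 0" using est_sampled[OF assms(1,2)] z by auto
    then show ?thesis using round_up_nonpos[of "16 * est h x ^ z" J] by (simp only: weight_def)
  next
    case False
    then have "99 \<le> est h x" using est_unsampled assms by auto
    then have "99 ^ 1 \<le> est h x ^ z"
      using z by (auto simp: power2_eq_square intro: order_trans[of 99 "99 * est h x"] mult_right_mono)
    then show ?thesis unfolding weight_def using round_up_bounds[OF g0 J'] by auto
  qed
qed

lemma weight_sampled: "good h \<Longrightarrow> set h \<subseteq> {..<n} \<Longrightarrow> x \<in> set h \<Longrightarrow> weight h x = 0"
  using est_sampled[of h x] z round_up_nonpos[of "16 * est h x ^ z" J] by (auto simp: weight_def)

lemma total_pos:
  assumes "good h" "set h \<subseteq> {..<n}" "x < n" "0 < est h x"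
  shows "0 < total h"
proof -
  have "0 < 16 * est h x ^ z" using assms by simp
  then have "0 < weight h x" using weight_bounds(1)[OF assms(1-3)] by linarith
  then have "0 < weight h x \<and> weight h x \<le> total h"
    unfolding total_def using assms by (auto intro!: member_le_sum)
  then show ?thesis by linarith
qed

lemma set_next_sample:
  assumes "y \<in> set_pmf (next_sample h)"
  shows "y < n" "0 < total h \<Longrightarrow> 0 < weight h y"
proof -
  show "y < n" using assms n2 by (auto simp: next_sample_def pick_less)
  show "0 < weight h y" if t: "0 < total h"
  proof -
    obtain u where u: "u < total h" "y = pick (weight h) n u"
      using assms t by (auto simp: next_sample_def set_pmf_of_set lessThan_empty_iff)
    have "u < sum w {..<k} \<Longrightarrow> 0 < w (pick w k u)" for w k by (induction k) auto
    then show ?thesis using u by (simp add: total_def)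
  qed
qed

lemma process_valid: "h \<in> set_pmf (process t) \<Longrightarrow> valid h \<and> length h = t"
proof (induction t arbitrary: h)
  case (Suc t)
  then obtain \<sigma> y where h: "h = y # \<sigma>" "\<sigma> \<in> set_pmf (process t)" "y \<in> set_pmf (next_sample \<sigma>)" by auto
  then have v: "valid \<sigma>" "length \<sigma> = t" using Suc.IH by auto
  have "est \<sigma> x \<le> 0" if "good \<sigma>" "y \<in> set \<sigma>" "x < n" for x
  proof (rule ccontr)
    assume "\<not> est \<sigma> x \<le> 0"
    then have "0 < total \<sigma>" using total_pos[OF that(1) valid_set[OF v(1)] that(3)] by simp
    then have "0 < weight \<sigma> y" using set_next_sample h by blast
    then show False using weight_sampled[OF that(1) valid_set[OF v(1)] that(2)] by simp
  qed
  then show ?case using h v set_next_sample by auto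
qed simp

lemma nn_integral_next_sample:
  assumes "0 < total h" "\<And>y. y < n \<Longrightarrow> 0 \<le> f y"
  shows "(\<integral>\<^sup>+ y. ennreal (f y) \<partial>next_sample h) = ennreal ((\<Sum>y<n. real (weight h y) * f y) / real (total h))"
proof -
  have "(\<integral>\<^sup>+ y. ennreal (f y) \<partial>next_sample h) =
      (\<Sum>u<total h. ennreal (f (pick (weight h) n u))) / ennreal (real (total h))"
    unfolding next_sample_def using assms by (simp add: nn_integral_pmf_of_set lessThan_empty_iff ennreal_of_nat_eq_real_of_nat)
  also have "(\<Sum>u<total h. ennreal (f (pick (weight h) n u))) = ennreal (\<Sum>u<total h. f (pick (weight h) n u))"
    using assms n2 by (intro sum_ennreal) (auto simp: pick_less)
  also have "(\<Sum>u<total h. f (pick (weight h) n u)) = (\<Sum>y<n. real (weight h y) * f y)"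
    unfolding total_def by (rule sum_pick)
  finally show ?thesis
    using assms(1) divide_ennreal[OF sum_nonneg[of "{..<n}" "\<lambda>y. real (weight h y) * f y"], of "real (total h)"]
      assms(2) by simp
qed

text \<open>The hypothesis can be restricted to \<open>valid\<close> histories because
  \<open>process\<close> reaches no others. Both potentials below are used in this way, through
  Markov's inequality.\<close>

lemma process_supermartingale:
  assumes "\<And>\<sigma>. valid \<sigma> \<Longrightarrow> (\<integral>\<^sup>+ y. ennreal (f (y # \<sigma>)) \<partial>next_sample \<sigma>) \<le> ennreal (f \<sigma>)"
  shows "(\<integral>\<^sup>+ h. ennreal (f h) \<partial>process t) \<le> ennreal (f [])"
proof (induction t)
  case (Suc t)
  have "(\<integral>\<^sup>+ h. ennreal (f h) \<partial>process (Suc t)) =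
      (\<integral>\<^sup>+ \<sigma>. (\<integral>\<^sup>+ y. ennreal (f (y # \<sigma>)) \<partial>next_sample \<sigma>) \<partial>process t)"
    by (simp add: nn_integral_bind_pmf)
  also have "\<dots> \<le> (\<integral>\<^sup>+ \<sigma>. ennreal (f \<sigma>) \<partial>process t)"
    using process_valid assms by (intro nn_integral_mono_AE) (auto simp: AE_measure_pmf_iff)
  finally show ?case using Suc by simp
qed simp

lemma process_markov:
  assumes "\<And>\<sigma>. valid \<sigma> \<Longrightarrow> (\<integral>\<^sup>+ y. ennreal (f (y # \<sigma>)) \<partial>next_sample \<sigma>) \<le> ennreal (f \<sigma>)"
    and "f [] = 1" "0 < \<theta>"
  shows "measure (process t) {h. \<theta> \<le> f h} \<le> 1 / \<theta>"
proof -
  have "emeasure (process t) {h \<in> UNIV. 1 \<le> ennreal (1 / \<theta>) * ennreal (f h)}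
      \<le> ennreal (1 / \<theta>) * (\<integral>\<^sup>+ h. ennreal (f h) \<partial>process t)"
    using nn_integral_Markov_inequality[of "\<lambda>h. ennreal (f h)" UNIV "measure_pmf (process t)" "ennreal (1 / \<theta>)"]
    by simp
  also have "\<dots> \<le> ennreal (1 / \<theta>) * ennreal 1"
    using process_supermartingale[of f t, OF assms(1)] assms(2) by (intro mult_left_mono) auto
  finally have "emeasure (process t) {h. 1 \<le> ennreal (1 / \<theta>) * ennreal (f h)} \<le> ennreal (1 / \<theta>)" by simp
  moreover have "{h. \<theta> \<le> f h} \<subseteq> {h. 1 \<le> ennreal (1 / \<theta>) * ennreal (f h)}"
    using assms(3) by (auto simp: ennreal_mult'[symmetric] ennreal_1[symmetric] field_simps simp del: ennreal_1)
  ultimately have "emeasure (process t) {h. \<theta> \<le> f h} \<le> ennreal (1 / \<theta>)"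
    using emeasure_mono[of "{h. \<theta> \<le> f h}" "{h. 1 \<le> ennreal (1 / \<theta>) * ennreal (f h)}" "measure_pmf (process t)"]
    by (auto intro: order_trans)
  then show ?thesis using assms(3) by (simp add: measure_pmf.emeasure_eq_measure)
qed

end

section \<open>Corrupted majorities among the witnesses\<close>

context sampler
begin

definition mball :: "nat \<Rightarrow> real \<Rightarrow> nat set" where
  "mball q r = {y. y < n \<and> d q y \<le> r}"

text \<open>The situation in which drawing \<open>q\<close> next makes it a center if its radius
  turns out to be \<open>r\<close>. Once it fails it never returns; as it includes
  \<open>good\<close>, the potential below is frozen from the first failure on.\<close>

definition far :: "nat list \<Rightarrow> nat \<Rightarrow> real \<Rightarrow> bool" where
  "far \<sigma> q r \<longleftrightarrow> good \<sigma> \<and> q \<notin> set \<sigma> \<and> 100 * r < est \<sigma> q"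

text \<open>
  Exponential potential for the number of corrupted pairs \<open>(x, y)\<close> among the first \<open>m\<close> samples \<open>y\<close>
  in a ball: at least \<open>m / 2\<close> of them raise it to \<open>(625 / 624) ^ \<mu>\<close>, as \<open>25 / 24 * (25 / 26) = 625 / 624\<close>.
\<close>

primrec bad_potential :: "nat \<Rightarrow> real \<Rightarrow> nat \<Rightarrow> nat list \<Rightarrow> real" where
  "bad_potential q r x [] = 1"
| "bad_potential q r x (y # \<sigma>) = bad_potential q r x \<sigma> *
     (if far \<sigma> q r \<and> d q y \<le> r \<and> length (filter (\<lambda>s. d q s \<le> r) \<sigma>) < m
      then (if wk x y \<noteq> d x y then 25 / 24 else 25 / 26) else 1)"

lemma bad_potential_pos: "0 < bad_potential q r x h"
  by (induction h) auto

text \<open>\<open>proxy\<close> is 1-Lipschitz and at \<open>q\<close> at least about 99 * r, so it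
  varies little in the ball: the estimates differ by a factor of at most 21/20, their powers by
  441/400, and rounding contributes 63/50. The product is below 3/2.\<close>

lemma weight_ratio:
  assumes v: "valid \<sigma>" and far: "far \<sigma> q r" and r: "0 \<le> r" and q: "q < n"
    and y: "y \<in> mball q r" "y \<notin> set \<sigma>" and y': "y' \<in> mball q r" "y' \<notin> set \<sigma>"
  shows "2 * real (weight \<sigma> y) \<le> 3 * real (weight \<sigma> y')"
proof -
  have g: "good \<sigma>" "set \<sigma> \<subseteq> {..<n}" using far v by (auto simp: far_def dest: valid_set)
  have yn: "y < n" "d q y \<le> r" "y' < n" "d q y' \<le> r" using y y' by (auto simp: mball_def)
  note q' = est_unsampled[OF g q]
  have p: "10000 * r \<le> 101 * proxy \<sigma> q"
    using q' far by (auto simp: far_def)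
  have "proxy \<sigma> y \<le> proxy \<sigma> q + r" "proxy \<sigma> q \<le> proxy \<sigma> y' + r"
    using proxy_lipschitz[OF g(2), of y q] proxy_lipschitz[OF g(2), of q y'] yn q d_commute[of y q] by auto
  then have e: "est \<sigma> y \<le> 21 / 20 * est \<sigma> y'"
    using est_unsampled[OF g yn(1) y(2)] est_unsampled[OF g yn(3) y'(2)] p by linarith
  have e0: "0 \<le> est \<sigma> y" "0 \<le> est \<sigma> y'" using est_nonneg g yn by auto
  have "est \<sigma> y ^ z \<le> (21 / 20 * est \<sigma> y') ^ z" using e e0 by (intro power_mono) auto
  also have "\<dots> \<le> 441 / 400 * est \<sigma> y' ^ z" using z e0 by (auto simp: power2_eq_square)
  finally have "est \<sigma> y ^ z \<le> 441 / 400 * est \<sigma> y' ^ z" .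
  moreover have "0 \<le> est \<sigma> y' ^ z" using e0 by simp
  ultimately show ?thesis
    using weight_bounds[OF g yn(1)] weight_bounds[OF g yn(3)] by linarith
qed

text \<open>At most 24/64 of the ball is corrupted and 1/64 sampled, so at least 39/64 is
  uncorrupted and unsampled. With the weight ratio 3/2, the corrupted mass is at most 3/2 * 24/39 =
  12/13 of the uncorrupted one, and the gain 1/24 and the loss 1/26 balance for exactly this
  ratio.\<close>

lemma bad_potential_step:
  assumes v: "valid \<sigma>" and q: "q < n" and r: "0 \<le> r" and M: "M \<le> card (mball q r)"
    and typical: "8 * card {y \<in> mball q r. wk x y \<noteq> d x y} \<le> 3 * card (mball q r)"
  shows "(\<integral>\<^sup>+ y. ennreal (bad_potential q r x (y # \<sigma>)) \<partial>next_sample \<sigma>) \<le> ennreal (bad_potential q r x \<sigma>)"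
proof (cases "far \<sigma> q r \<and> length (filter (\<lambda>s. d q s \<le> r) \<sigma>) < m")
  case False
  then have "bad_potential q r x (y # \<sigma>) = bad_potential q r x \<sigma>" for y by auto
  then show ?thesis by (simp add: measure_pmf.emeasure_space_1 del: bad_potential.simps)
next
  case True
  then have far: "far \<sigma> q r" and len: "length (filter (\<lambda>s. d q s \<le> r) \<sigma>) < m" by auto
  have g: "good \<sigma>" "set \<sigma> \<subseteq> {..<n}" using far v by (auto simp: far_def dest: valid_set)
  have "0 < est \<sigma> q" using far r by (auto simp: far_def)
  then have t: "0 < total \<sigma>" using total_pos[OF g q] by simp
  let ?B = "mball q r"
  let ?f = "\<lambda>y. if y \<in> ?B then (if wk x y \<noteq> d x y then 25 / 24 else 25 / 26) else 1 :: real"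
  let ?w = "\<lambda>y. real (weight \<sigma> y)"
  define Ub where "Ub = {y \<in> ?B. y \<notin> set \<sigma> \<and> wk x y \<noteq> d x y}"
  define Ug where "Ug = {y \<in> ?B. y \<notin> set \<sigma> \<and> wk x y = d x y}"
  define S where "S = ?B \<inter> set \<sigma>"
  have finB: "finite ?B" by (simp add: mball_def)
  have fin: "finite Ub" "finite Ug" "finite S" using finB by (auto simp: Ub_def Ug_def S_def)
  have B: "?B = Ub \<union> Ug \<union> S" "(Ub \<union> Ug) \<inter> S = {}" "Ub \<inter> Ug = {}" by (auto simp: Ub_def Ug_def S_def)
  have cB: "card ?B = card Ub + card Ug + card S"
    unfolding B(1) using card_Un_disjoint[of "Ub \<union> Ug" S] card_Un_disjoint[of Ub Ug] fin B by simp
  have "card S \<le> length (filter (\<lambda>s. d q s \<le> r) \<sigma>)"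
  proof -
    have "S = set (filter (\<lambda>s. d q s \<le> r) \<sigma>)" using g by (auto simp: S_def mball_def)
    then show ?thesis by (simp only: card_length)
  qed
  then have "64 * card S \<le> card ?B" using len M by (simp add: M_def)
  moreover have "8 * card Ub \<le> 3 * card ?B"
  proof -
    have "card Ub \<le> card {y \<in> ?B. wk x y \<noteq> d x y}" using finB by (intro card_mono) (auto simp: Ub_def)
    then show ?thesis using typical by linarith
  qed
  ultimately have cU: "39 * card Ub \<le> 24 * card Ug" using cB by linarith
  \<comment> \<open>Summing over all pairs of a corrupted and an uncorrupted point turns the
    pointwise weight ratio into one between total weights.\<close>
  have "(\<Sum>b\<in>Ub. \<Sum>g\<in>Ug. 2 * ?w b) \<le> (\<Sum>b\<in>Ub. \<Sum>g\<in>Ug. 3 * ?w g)"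
    using weight_ratio[OF v far r q] by (intro sum_mono) (auto simp: Ub_def Ug_def)
  then have pair: "2 * real (card Ug) * sum ?w Ub \<le> 3 * real (card Ub) * sum ?w Ug"
    by (simp flip: sum_distrib_left)
  have "13 * sum ?w Ub \<le> 12 * sum ?w Ug"
  proof (cases "card Ug = 0")
    case True
    then have "Ub = {}" using cU fin by auto
    then show ?thesis by (simp add: sum_nonneg)
  next
    case False
    have "39 * real (card Ub) \<le> 24 * real (card Ug)" using cU by linarith
    then have "39 * real (card Ub) * (3 * sum ?w Ug) \<le> 24 * real (card Ug) * (3 * sum ?w Ug)"
      by (intro mult_right_mono) (auto simp: sum_nonneg)
    then have "real (card Ug) * (78 * sum ?w Ub) \<le> real (card Ug) * (72 * sum ?w Ug)"
      using pair by (simp add: algebra_simps)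
    then show ?thesis using False by simp
  qed
  have wS: "?w y = 0" if "y \<in> S" for y using that weight_sampled[OF g] by (auto simp: S_def)
  have "(\<Sum>y<n. ?w y * ?f y) - (\<Sum>y<n. ?w y) = (\<Sum>y<n. ?w y * (?f y - 1))"
    by (simp add: sum_subtractf right_diff_distrib)
  also have "\<dots> = (\<Sum>y\<in>?B. ?w y * (?f y - 1))"
    by (rule sum.mono_neutral_right) (auto simp: mball_def)
  also have "\<dots> = (\<Sum>y\<in>Ub \<union> Ug. ?w y * (?f y - 1))"
    using wS B fin by (intro sum.mono_neutral_right) (auto simp: finB)
  also have "\<dots> = (\<Sum>y\<in>Ub. ?w y * (?f y - 1)) + (\<Sum>y\<in>Ug. ?w y * (?f y - 1))"
    using B fin by (intro sum.union_disjoint) auto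
  also have "(\<Sum>y\<in>Ub. ?w y * (?f y - 1)) = sum ?w Ub * (1 / 24)"
    unfolding sum_distrib_right by (rule sum.cong) (auto simp: Ub_def)
  also have "(\<Sum>y\<in>Ug. ?w y * (?f y - 1)) = sum ?w Ug * (- 1 / 26)"
    unfolding sum_distrib_right by (rule sum.cong) (auto simp: Ug_def)
  also have "sum ?w Ub * (1 / 24) + sum ?w Ug * (- 1 / 26) \<le> 0"
    using \<open>13 * sum ?w Ub \<le> 12 * sum ?w Ug\<close> by simp
  finally have le: "(\<Sum>y<n. ?w y * ?f y) \<le> real (total \<sigma>)" by (simp add: total_def)
  have nonneg: "0 \<le> bad_potential q r x \<sigma> * ?f y" for y
    using bad_potential_pos[of q r x \<sigma>] by auto
  have "(\<integral>\<^sup>+ y. ennreal (bad_potential q r x (y # \<sigma>)) \<partial>next_sample \<sigma>) =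
      (\<integral>\<^sup>+ y. ennreal (bad_potential q r x \<sigma> * ?f y) \<partial>next_sample \<sigma>)"
    using True set_next_sample(1)
    by (intro nn_integral_cong_AE) (auto simp: AE_measure_pmf_iff mball_def)
  also have "\<dots> = ennreal ((\<Sum>y<n. ?w y * (bad_potential q r x \<sigma> * ?f y)) / real (total \<sigma>))"
    using t nonneg by (rule nn_integral_next_sample)
  also have "\<dots> \<le> ennreal (bad_potential q r x \<sigma>)"
  proof (rule ennreal_leI)
    have "(\<Sum>y<n. ?w y * (bad_potential q r x \<sigma> * ?f y)) = bad_potential q r x \<sigma> * (\<Sum>y<n. ?w y * ?f y)"
      unfolding sum_distrib_left by (rule sum.cong) auto
    also have "\<dots> \<le> bad_potential q r x \<sigma> * real (total \<sigma>)"
      using le bad_potential_pos[of q r x \<sigma>] by (intro mult_left_mono) auto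
    finally show "(\<Sum>y<n. ?w y * (bad_potential q r x \<sigma> * ?f y)) / real (total \<sigma>) \<le> bad_potential q r x \<sigma>"
      using t by (simp add: divide_le_eq)
  qed
  finally show ?thesis .
qed

lemma far_antimono: "far (y # \<sigma>) q r \<Longrightarrow> set (y # \<sigma>) \<subseteq> {..<n} \<Longrightarrow> q < n \<Longrightarrow> far \<sigma> q r"
  using est_antimono[of \<sigma> q y] by (auto simp: far_def simp del: est.simps)

text \<open>A ball that is far now was far at every earlier draw, so each of its first
  \<open>m\<close> samples has contributed its factor.\<close>

lemma bad_potential_eq:
  assumes "far \<sigma> q r" "set \<sigma> \<subseteq> {..<n}" "q < n"
  shows "bad_potential q r x (y # \<sigma>) =
    (let T = take m (filter (\<lambda>s. d q s \<le> r) (rev (y # \<sigma>))) in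
      (25 / 24) ^ length (filter (\<lambda>t. wk x t \<noteq> d x t) T) *
      (25 / 26) ^ (length T - length (filter (\<lambda>t. wk x t \<noteq> d x t) T)))"
  using assms
proof (induction \<sigma> arbitrary: y)
  case Nil
  then show ?case using m_pos by (cases m) (auto simp: Let_def)
next
  case (Cons y' \<sigma>)
  have "far \<sigma> q r" using far_antimono Cons.prems by blast
  then have IH: "bad_potential q r x (y' # \<sigma>) =
    (let T = take m (filter (\<lambda>s. d q s \<le> r) (rev (y' # \<sigma>))) in
      (25 / 24) ^ length (filter (\<lambda>t. wk x t \<noteq> d x t) T) *
      (25 / 26) ^ (length T - length (filter (\<lambda>t. wk x t \<noteq> d x t) T)))"
    using Cons by auto
  define h where "h = y' # \<sigma>"
  define L where "L = filter (\<lambda>s. d q s \<le> r) (rev h)"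
  have len: "length (filter (\<lambda>s. d q s \<le> r) h) = length L" by (simp add: L_def flip: rev_filter)
  have L': "filter (\<lambda>s. d q s \<le> r) (rev (y # h)) = L @ (if d q y \<le> r then [y] else [])"
    by (simp add: L_def)
  let ?bad = "\<lambda>t. wk x t \<noteq> d x t"
  have le: "length (filter ?bad L) \<le> length L" by simp
  have step: "bad_potential q r x (y # h) = bad_potential q r x h *
     (if d q y \<le> r \<and> length L < m then (if ?bad y then 25 / 24 else 25 / 26) else 1)"
    using Cons.prems(1) by (simp add: h_def[symmetric] len)
  have IH': "bad_potential q r x h = (25 / 24) ^ length (filter ?bad (take m L)) *
      (25 / 26) ^ (length (take m L) - length (filter ?bad (take m L)))"
    using IH by (simp only: h_def[symmetric] L_def Let_def)
  show ?case
  proof (cases "d q y \<le> r \<and> length L < m")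
    case True
    then have "take m (L @ [y]) = L @ [y]" "take m L = L" by auto
    then show ?thesis unfolding h_def[symmetric] L' step IH' using True le by (simp add: Let_def Suc_diff_le)
  next
    case False
    then have t: "take m (L @ (if d q y \<le> r then [y] else [])) = take m L" by auto
    show ?thesis unfolding h_def[symmetric] L' step IH' t Let_def
      by (simp only: False if_False mult_1_right)
  qed
qed

text \<open>At the first center with too many corrupted witnesses for some x, the ball was far just
  before, so the closed form applies, with at least \<mu> of the 2 * \<mu> witnesses corrupted. The
  samples were distinct until then, hence the ball contains at least \<open>M\<close>
  points.\<close>

lemma not_good_potential:
  assumes "valid h" "\<not> good h"
  shows "\<exists>q\<in>set h. \<exists>q'<n. \<exists>x<n. M \<le> card (mball q (d q q')) \<and> (625 / 624) ^ \<mu> \<le> bad_potential q (d q q') x h"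
  using assms
proof (induction h)
  case (Cons y \<sigma>)
  show ?case
  proof (cases "good \<sigma>")
    case False
    then obtain q q' x where *: "q \<in> set \<sigma>" "q' < n" "x < n" "M \<le> card (mball q (d q q'))"
      "(625 / 624) ^ \<mu> \<le> bad_potential q (d q q') x \<sigma>" using Cons by auto
    \<comment> \<open>Goodness has failed already, so the potential no longer changes.\<close>
    then have "bad_potential q (d q q') x (y # \<sigma>) = bad_potential q (d q q') x \<sigma>" by (simp add: far_def)
    then show ?thesis using * by (intro bexI[of _ q] exI[of _ q'] conjI exI[of _ x]) auto
  next
    case True
    have v: "valid \<sigma>" "y < n" "set \<sigma> \<subseteq> {..<n}" using Cons.prems valid_set by auto
    obtain x where act: "act \<sigma> y" and x: "x < n"
      "m \<le> 2 * length (filter (\<lambda>t. wk x t \<noteq> d x t) (witnesses y (y # \<sigma>)))"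
      using True Cons.prems by (auto simp: not_less)
    obtain q' where q': "q' \<in> set (y # \<sigma>)" "radius y (y # \<sigma>) = d y q'"
      "M \<le> length (filter (\<lambda>s'. d y s' \<le> radius y (y # \<sigma>)) (y # \<sigma>))" by (rule act_radius[OF act])
    let ?r = "d y q'"
    have pos: "0 < est \<sigma> y" using act radius_bounds(1)[of y "y # \<sigma>"] by linarith
    have ys: "y \<notin> set \<sigma>" using good_unsampled_if_pos[OF True v(3) pos] .
    have dist: "distinct (y # \<sigma>)" using valid_distinct[OF v(1) True v(2) pos] ys by simp
    have far: "far \<sigma> y ?r" using True ys act q'(2) by (simp add: far_def)
    have "card (set (filter (\<lambda>s'. d y s' \<le> ?r) (y # \<sigma>))) = length (filter (\<lambda>s'. d y s' \<le> ?r) (y # \<sigma>))"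
      using dist by (intro distinct_card distinct_filter)
    moreover have "set (filter (\<lambda>s'. d y s' \<le> ?r) (y # \<sigma>)) \<subseteq> mball y ?r" using v by (auto simp: mball_def)
    then have "card (set (filter (\<lambda>s'. d y s' \<le> ?r) (y # \<sigma>))) \<le> card (mball y ?r)"
      by (intro card_mono) (auto simp: mball_def)
    ultimately have cB: "M \<le> card (mball y ?r)" using q' by simp
    let ?T = "witnesses y (y # \<sigma>)"
    let ?b = "length (filter (\<lambda>t. wk x t \<noteq> d x t) ?T)"
    have "?b \<le> length ?T" by (rule length_filter_le)
    then have b: "?b \<le> m" "\<mu> \<le> ?b" using length_witnesses[OF act] x by (auto simp: m_def)
    have "bad_potential y ?r x (y # \<sigma>) = (25 / 24) ^ ?b * (25 / 26) ^ (m - ?b)"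
    proof -
      have T: "take m (filter (\<lambda>s. d y s \<le> ?r) (rev (y # \<sigma>))) = ?T"
        by (simp only: witnesses_def q'(2))
      show ?thesis by (simp only: bad_potential_eq[OF far v(3,2)] Let_def T length_witnesses[OF act])
    qed
    moreover have "(625 / 624 :: real) ^ \<mu> \<le> (25 / 24) ^ ?b * (25 / 26) ^ (m - ?b)"
    proof -
      \<comment> \<open>The product increases with the number of corrupted witnesses, so \<mu> of
        each kind is the worst case.\<close>
      have e: "m - ?b = \<mu> - (?b - \<mu>)" "?b = \<mu> + (?b - \<mu>)" using b by (auto simp: m_def)
      have "(625 / 624 :: real) ^ \<mu> = (25 / 24) ^ \<mu> * (25 / 26) ^ \<mu>" by (simp flip: power_mult_distrib)
      also have "\<dots> \<le> (25 / 24) ^ ?b * (25 / 26) ^ (m - ?b)"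
        using b e by (intro mult_mono power_increasing power_decreasing) auto
      finally show ?thesis .
    qed
    ultimately show ?thesis using q'(1) x(1) cB v
      by (intro bexI[of _ y] exI[of _ q'] conjI exI[of _ x]) auto
  qed
qed simp

end

text \<open>All that is assumed about the weak answers. A ball is described by its center and a
  point on its boundary, which leaves n^3 conditions for union bounds.\<close>

locale typical_sampler = sampler +
  assumes typical: "\<And>q q' x. q < n \<Longrightarrow> q' < n \<Longrightarrow> x < n \<Longrightarrow> M \<le> card (mball q (d q q')) \<Longrightarrow>
    8 * card {y \<in> mball q (d q q'). wk x y \<noteq> d x y} \<le> 3 * card (mball q (d q q'))"
begin

lemma prob_not_good: "measure (process t) {h. \<not> good h} \<le> real n ^ 3 / (625 / 624) ^ \<mu>"
proof -
  let ?\<theta> = "(625 / 624 :: real) ^ \<mu>"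
  let ?I = "{p \<in> {..<n} \<times> {..<n} \<times> {..<n}. M \<le> card (mball (fst p) (d (fst p) (fst (snd p))))}"
  let ?E = "\<lambda>p. {h. ?\<theta> \<le> bad_potential (fst p) (d (fst p) (fst (snd p))) (snd (snd p)) h}"
  have finI: "finite ?I" by (rule finite_subset[of _ "{..<n} \<times> {..<n} \<times> {..<n}"]) auto
  have cI: "card ?I \<le> n ^ 3"
    using card_mono[of "{..<n} \<times> {..<n} \<times> {..<n}" ?I] by (simp add: card_cartesian_product power3_eq_cube)
  have "measure (process t) {h. \<not> good h} \<le> measure (process t) (\<Union>p\<in>?I. ?E p)"
  proof (rule measure_pmf.finite_measure_mono_AE)
    show "AE h in process t. h \<in> {h. \<not> good h} \<longrightarrow> h \<in> (\<Union>p\<in>?I. ?E p)"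
    proof (intro AE_pmfI impI)
      fix h assume "h \<in> set_pmf (process t)" "h \<in> {h. \<not> good h}"
      then obtain q q' x where *: "q \<in> set h" "q' < n" "x < n" "M \<le> card (mball q (d q q'))"
        "?\<theta> \<le> bad_potential q (d q q') x h" "set h \<subseteq> {..<n}"
        using not_good_potential[of h] process_valid[of h t] valid_set[of h] by auto
      then have "(q, q', x) \<in> ?I" "h \<in> ?E (q, q', x)" by auto
      then show "h \<in> (\<Union>p\<in>?I. ?E p)" by blast
    qed
  qed auto
  also have "\<dots> \<le> (\<Sum>p\<in>?I. measure (process t) (?E p))"
    using finI by (intro measure_pmf.finite_measure_subadditive_finite) auto
  also have "\<dots> \<le> (\<Sum>p\<in>?I. 1 / ?\<theta>)"
  proof (intro sum_mono process_markov)
    fix p \<sigma> assume "p \<in> ?I" "valid \<sigma>"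
    then show "(\<integral>\<^sup>+ y. ennreal (bad_potential (fst p) (d (fst p) (fst (snd p))) (snd (snd p)) (y # \<sigma>)) \<partial>next_sample \<sigma>)
       \<le> ennreal (bad_potential (fst p) (d (fst p) (fst (snd p))) (snd (snd p)) \<sigma>)"
      using typical by (intro bad_potential_step) (auto simp: d_nonneg)
  qed auto
  also have "\<dots> = real (card ?I) / ?\<theta>" by simp
  also have "\<dots> \<le> real n ^ 3 / ?\<theta>" using cI by (intro divide_right_mono) (auto simp flip: of_nat_power)
  finally show ?thesis .
qed

end

section \<open>Covering the clusters of a comparison solution\<close>

lemma power_z_add:
  fixes a b :: real
  assumes "z \<in> {1, 2::nat}" "0 \<le> a" "0 \<le> b"
  shows "(a + b) ^ z \<le> 2 * (a ^ z + b ^ z)"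
proof -
  have "0 \<le> (a - b)\<^sup>2" by simp
  then show ?thesis using assms by (auto simp: power2_eq_square algebra_simps)
qed

lemma power_z_add3:
  fixes a b c :: real
  assumes "z \<in> {1, 2::nat}" "0 \<le> a" "0 \<le> b" "0 \<le> c"
  shows "(a + b + c) ^ z \<le> 3 * (a ^ z + b ^ z + c ^ z)"
proof -
  have "0 \<le> (a - b)\<^sup>2 + (a - c)\<^sup>2 + (b - c)\<^sup>2" by simp
  then show ?thesis using assms by (auto simp: power2_eq_square algebra_simps)
qed

lemma power_z_mult:
  fixes a c :: real
  assumes "z \<in> {1, 2::nat}" "0 \<le> a" "1 \<le> c"
  shows "(c * a) ^ z \<le> c\<^sup>2 * a ^ z"
proof -
  have "c * a \<le> c * (c * a)" using mult_right_mono[of 1 c "c * a"] assms by simp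
  then show ?thesis using assms by (auto simp: power2_eq_square mult_ac)
qed

locale comparison = sampler +
  fixes ao :: "nat \<Rightarrow> nat" and k :: nat
  assumes ao: "\<And>x. x < n \<Longrightarrow> ao x < n" and k: "card (ao ` {..<n}) \<le> k"
begin

definition cluster :: "nat \<Rightarrow> nat set" where "cluster j = {x. x < n \<and> ao x = j}"
definition ccost :: "nat \<Rightarrow> real" where "ccost j = (\<Sum>x\<in>cluster j. d x j ^ z)"
definition opt :: real where "opt = (\<Sum>x<n. d x (ao x) ^ z)"

text \<open>At least half of a large cluster is core, so with fewer than \<open>M\<close> core
  points sampled, at least a quarter of the cluster is unsampled core.\<close>

definition small :: "nat \<Rightarrow> bool" where "small j \<longleftrightarrow> card (cluster j) < 4 * M"

text \<open>
  Sampling \<open>M\<close> points of the core of a large cluster makes its estimates comparable to its cost,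
  whereas the points of a small cluster have to be sampled one by one.
\<close>

definition core :: "nat \<Rightarrow> nat set" where
  "core j = (if small j then cluster j
     else {x \<in> cluster j. real (card (cluster j)) * d x j ^ z \<le> 2 * ccost j})"

definition cap :: "nat \<Rightarrow> nat" where "cap j = (if small j then 4 * M else M)"

definition hits :: "nat list \<Rightarrow> nat \<Rightarrow> nat" where "hits \<sigma> j = card (set \<sigma> \<inter> core j)"

definition progress :: "nat list \<Rightarrow> nat \<Rightarrow> bool" where
  "progress \<sigma> y \<longleftrightarrow> y < n \<and> y \<notin> set \<sigma> \<and> y \<in> core (ao y) \<and> hits \<sigma> (ao y) < cap (ao y)"

definition uncovered :: "nat list \<Rightarrow> real" where "uncovered \<sigma> = (\<Sum>x<n. est \<sigma> x ^ z)"

primrec progress_count :: "nat list \<Rightarrow> nat" where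
  "progress_count [] = 0"
| "progress_count (y # \<sigma>) = progress_count \<sigma> + (if progress \<sigma> y then 1 else 0)"

lemma finite_cluster [simp]: "finite (cluster j)"
  by (simp add: cluster_def)

lemma core_subset: "core j \<subseteq> cluster j"
  by (auto simp: core_def)

lemma finite_core [simp]: "finite (core j)"
  using finite_subset[OF core_subset] by simp

lemma ccost_nonneg: "0 \<le> ccost j"
  unfolding ccost_def by (intro sum_nonneg zero_le_power d_nonneg)

lemma opt_eq: "opt = (\<Sum>j\<in>ao ` {..<n}. ccost j)"
proof -
  have "opt = (\<Sum>j\<in>ao ` {..<n}. \<Sum>x\<in>{x \<in> {..<n}. ao x = j}. d x (ao x) ^ z)"
    unfolding opt_def by (rule sum.image_gen) simp
  also have "\<dots> = (\<Sum>j\<in>ao ` {..<n}. ccost j)"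
    unfolding ccost_def cluster_def by (intro sum.cong) auto
  finally show ?thesis .
qed

lemma opt_nonneg: "0 \<le> opt"
  unfolding opt_def by (intro sum_nonneg zero_le_power d_nonneg)

text \<open>Markov's inequality for the cost of a random point of the cluster.\<close>

lemma large_core:
  assumes "\<not> small j"
  shows "card (cluster j) \<le> 2 * card (core j)"
proof -
  let ?O = "cluster j" let ?U = "?O - core j"
  have "card ?O = card (core j) + card ?U"
    using core_subset[of j] card_mono[OF finite_cluster core_subset, of j] by (simp add: card_Diff_subset)
  moreover have "2 * card ?U \<le> card ?O"
  proof (rule ccontr)
    assume *: "\<not> 2 * card ?U \<le> card ?O"
    then have "?U \<noteq> {}" by (metis card.empty mult_0_right zero_le)
    then have "(\<Sum>x\<in>?U. 2 * ccost j) < (\<Sum>x\<in>?U. real (card ?O) * d x j ^ z)"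
      using assms by (intro sum_strict_mono) (auto simp: core_def)
    also have "\<dots> \<le> real (card ?O) * ccost j"
      unfolding sum_distrib_left[symmetric] ccost_def
      by (intro mult_left_mono sum_mono2) (auto simp: d_nonneg)
    also have "\<dots> \<le> real (2 * card ?U) * ccost j"
      using * ccost_nonneg by (intro mult_right_mono) auto
    finally show False by simp
  qed
  ultimately show ?thesis by linarith
qed

text \<open>At the draw of y that completes \<open>M\<close> samples in Y, the ball of radius 2 *
  \<rho> around y contains all of them. Either y becomes a center, so that \<open>proxy\<close> at x
  is at most d x y + 200 * \<rho>, or its estimate is at most 200 * \<rho> already and the Lipschitz
  property carries this over to x. The one per cent error and d x y <= d x j + \<rho> lead to
  204.\<close>

lemma proxy_covered:
  assumes "good h" "set h \<subseteq> {..<n}" "j < n" "x < n"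
    and Y: "\<And>y. y \<in> Y \<Longrightarrow> d y j \<le> \<rho>" and M: "M \<le> card (set h \<inter> Y)"
  shows "proxy h x \<le> d x j + 204 * \<rho>"
  using assms(1,2) M
proof (induction h)
  case Nil
  then show ?case using m_pos by simp
next
  case (Cons y \<sigma>)
  have s: "good \<sigma>" "set \<sigma> \<subseteq> {..<n}" "y < n" using Cons.prems by auto
  show ?case
  proof (cases "M \<le> card (set \<sigma> \<inter> Y)")
    case True
    then show ?thesis using Cons.IH s proxy_antimono[of y \<sigma> x] by linarith
  next
    case False
    then have y: "y \<in> Y" "y \<notin> set \<sigma>" using Cons.prems(3) by (auto simp: Int_insert_left insert_absorb split: if_splits)
    let ?h = "y # \<sigma>"
    let ?S = "set ?h \<inter> Y"
    have ne: "?S \<noteq> {}" "finite ?S" using y by auto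
    then have "Max (d y ` ?S) \<in> d y ` ?S" by (intro Max_in) auto
    then obtain s where s': "s \<in> ?S" "Max (d y ` ?S) = d y s" by auto
    have "?S \<subseteq> set ?h \<inter> {s'. d y s' \<le> d y s}" using ne s'(2) by (auto simp flip: s'(2))
    then have "card ?S \<le> card (set ?h \<inter> {s'. d y s' \<le> d y s})" by (intro card_mono) auto
    then have "M \<le> length (filter (\<lambda>s'. d y s' \<le> d y s) ?h)"
      using card_le_length_filter[of ?h "\<lambda>s'. d y s' \<le> d y s"] Cons.prems(3) by linarith
    then have "radius y ?h \<le> d y s" using s'(1) by (intro radius_le) auto
    moreover have sn: "s < n" using s'(1) Cons.prems(2) by auto
    then have "d y s \<le> d y j + d j s" using d_triangle[of y j s] s assms by simp
    ultimately have rad: "radius y ?h \<le> 2 * \<rho>"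
      using Y[OF y(1)] Y[of s] s'(1) d_commute[of j s] by auto
    have xy: "d x y \<le> d x j + \<rho>"
      using d_triangle[of x j y] assms s Y[OF y(1)] d_commute[of j y] by auto
    have r0: "0 \<le> \<rho>" using Y[OF y(1)] d_nonneg[of y j] by linarith
    show ?thesis
    proof (cases "act \<sigma> y")
      case True
      then have "proxy ?h x \<le> d x y + 100 * radius y ?h" by simp
      then show ?thesis using rad xy r0 by linarith
    next
      case False
      then have "99 * proxy \<sigma> y \<le> 20000 * \<rho>" using est_unsampled(1)[OF s y(2)] rad by linarith
      then have "proxy \<sigma> x \<le> d x j + 204 * \<rho>"
        using proxy_lipschitz[OF s(2) assms(4) s(3)] xy r0 by linarith
      then show ?thesis using False by simp
    qed
  qed
qed

text \<open>Estimates are at most 2 * d x j + 408 * \<rho> for the largest core distance \<rho>, and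
  membership in the core bounds the size of the cluster times \<rho>^z by twice its cost. This
  yields 8 + 2 * 332928 <= 700000.\<close>

lemma covered_cluster:
  assumes g: "good \<sigma>" "set \<sigma> \<subseteq> {..<n}" and j: "j < n" and large: "\<not> small j" and hits: "M \<le> hits \<sigma> j"
  shows "(\<Sum>x\<in>cluster j. est \<sigma> x ^ z) \<le> 700000 * ccost j"
proof -
  have "core j \<noteq> {}" using hits m_pos by (auto simp: hits_def)
  then have "Max ((\<lambda>x. d x j) ` core j) \<in> (\<lambda>x. d x j) ` core j" by (intro Max_in) auto
  then obtain w where w: "w \<in> core j" "Max ((\<lambda>x. d x j) ` core j) = d w j" by auto
  define \<rho> where "\<rho> = d w j"
  have \<rho>: "d y j \<le> \<rho>" if "y \<in> core j" for y
    using that by (auto simp: \<rho>_def simp flip: w(2))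
  have \<rho>0: "0 \<le> \<rho>" by (simp add: \<rho>_def d_nonneg)
  have cost: "real (card (cluster j)) * \<rho> ^ z \<le> 2 * ccost j"
    using w(1) large by (simp add: core_def \<rho>_def)
  have "est \<sigma> x ^ z \<le> 8 * d x j ^ z + 332928 * \<rho> ^ z" if x: "x \<in> cluster j" for x
  proof -
    have xn: "x < n" using x by (simp add: cluster_def)
    have "proxy \<sigma> x \<le> d x j + 204 * \<rho>"
      using proxy_covered[OF g j xn \<rho>] hits by (simp add: hits_def)
    then have "est \<sigma> x \<le> 2 * d x j + 408 * \<rho>"
      using est_le_proxy[OF g xn] d_nonneg[of x j] \<rho>0 by linarith
    then have "est \<sigma> x ^ z \<le> (2 * d x j + 408 * \<rho>) ^ z"
      using est_nonneg[OF g xn] by (intro power_mono) auto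
    also have "\<dots> \<le> 2 * ((2 * d x j) ^ z + (408 * \<rho>) ^ z)"
      using z \<rho>0 d_nonneg[of x j] by (intro power_z_add) auto
    also have "\<dots> \<le> 2 * (2\<^sup>2 * d x j ^ z + 408\<^sup>2 * \<rho> ^ z)"
      using z \<rho>0 d_nonneg[of x j] by (intro mult_left_mono add_mono power_z_mult) auto
    finally show ?thesis by simp
  qed
  then have "(\<Sum>x\<in>cluster j. est \<sigma> x ^ z) \<le> (\<Sum>x\<in>cluster j. 8 * d x j ^ z + 332928 * \<rho> ^ z)"
    by (intro sum_mono) auto
  also have "\<dots> = 8 * ccost j + 332928 * (real (card (cluster j)) * \<rho> ^ z)"
    by (simp add: sum.distrib ccost_def sum_distrib_left)
  finally show ?thesis using cost ccost_nonneg[of j] by linarith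
qed

text \<open>Averaging over all pairs of a cluster point x and an unsampled core point y: est x <= 2
  * (est y + d x j + d y j), whose z-th power costs 12 per term. The unsampled core is at least a
  quarter of the cluster, hence 48 = 4 * 12, and the core condition gives 36 = 12 + 2 * 12.\<close>

lemma uncovered_cluster:
  assumes g: "good \<sigma>" "set \<sigma> \<subseteq> {..<n}" and j: "j < n" and large: "\<not> small j" and hits: "hits \<sigma> j < M"
  shows "(\<Sum>x\<in>cluster j. est \<sigma> x ^ z) \<le> 36 * ccost j + 48 * (\<Sum>y\<in>core j - set \<sigma>. est \<sigma> y ^ z)"
proof -
  define U where "U = core j - set \<sigma>"
  let ?O = "cluster j"
  let ?\<phi> = "\<Sum>x\<in>?O. est \<sigma> x ^ z" let ?p = "\<Sum>y\<in>U. est \<sigma> y ^ z"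
  have finU: "finite U" by (simp add: U_def)
  have "card (core j) \<le> card U + hits \<sigma> j"
  proof -
    have "core j = U \<union> (set \<sigma> \<inter> core j)" by (auto simp: U_def)
    then show ?thesis unfolding hits_def by (metis card_Un_le)
  qed
  then have cU: "card ?O \<le> 4 * card U" using large_core[OF large] hits large by (simp add: small_def)
  have cO: "0 < card ?O" using large m_pos by (simp add: small_def)
  have point: "est \<sigma> x ^ z \<le> 12 * est \<sigma> y ^ z + 12 * d x j ^ z + 12 * d y j ^ z" if x: "x \<in> ?O" and y: "y \<in> U" for x y
  proof -
    have xn: "x < n" and yn: "y < n" and ys: "y \<notin> set \<sigma>"
      using x y core_subset[of j] by (auto simp: cluster_def U_def)
    have "proxy \<sigma> x \<le> proxy \<sigma> y + d x y" using proxy_lipschitz[OF g(2) xn yn] .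
    moreover have "d x y \<le> d x j + d y j" using d_triangle[OF xn j yn] d_commute[of j y] by simp
    ultimately have "est \<sigma> x \<le> 2 * (est \<sigma> y + d x j + d y j)"
      using est_le_proxy[OF g xn] est_unsampled[OF g yn ys] d_nonneg[of x j] d_nonneg[of y j] by argo
    then have "est \<sigma> x ^ z \<le> (2 * (est \<sigma> y + d x j + d y j)) ^ z"
      using est_nonneg[OF g xn] by (intro power_mono) auto
    also have "\<dots> \<le> 2\<^sup>2 * (est \<sigma> y + d x j + d y j) ^ z"
      using z est_nonneg[OF g yn] d_nonneg[of x j] d_nonneg[of y j] by (intro power_z_mult) auto
    also have "\<dots> \<le> 2\<^sup>2 * (3 * (est \<sigma> y ^ z + d x j ^ z + d y j ^ z))"
      using z est_nonneg[OF g yn] d_nonneg[of x j] d_nonneg[of y j] by (intro mult_left_mono power_z_add3) auto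
    finally show ?thesis by simp
  qed
  have "real (card U) * ?\<phi> = (\<Sum>x\<in>?O. \<Sum>y\<in>U. est \<sigma> x ^ z)" by (simp add: sum_distrib_left)
  also have "\<dots> \<le> (\<Sum>x\<in>?O. \<Sum>y\<in>U. 12 * est \<sigma> y ^ z + 12 * d x j ^ z + 12 * d y j ^ z)"
    by (intro sum_mono point)
  also have "\<dots> = real (card ?O) * (12 * ?p) + real (card U) * (12 * ccost j)
      + 12 * (\<Sum>y\<in>U. real (card ?O) * d y j ^ z)"
    by (simp add: sum.distrib ccost_def sum_distrib_left mult_ac)
  also have "(\<Sum>y\<in>U. real (card ?O) * d y j ^ z) \<le> (\<Sum>y\<in>U. 2 * ccost j)"
    using large by (intro sum_mono) (auto simp: U_def core_def)
  also have "real (card ?O) * (12 * ?p) \<le> real (4 * card U) * (12 * ?p)"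
    using cU est_nonneg[OF g] core_subset[of j]
    by (intro mult_right_mono mult_nonneg_nonneg sum_nonneg zero_le_power) (auto simp: U_def cluster_def)
  finally have "real (card U) * ?\<phi> \<le> real (card U) * (36 * ccost j + 48 * ?p)"
    by (simp add: algebra_simps)
  moreover have "0 < card U" using cU cO by linarith
  ultimately show ?thesis by (simp add: U_def)
qed

text \<open>In a small cluster every unsampled point is a progress point. A large cluster is either
  covered, or it is charged to its unsampled core, which consists of progress points.\<close>

lemma uncovered_bound:
  assumes g: "good \<sigma>" "set \<sigma> \<subseteq> {..<n}"
  shows "uncovered \<sigma> \<le> 700000 * opt + 48 * (\<Sum>y | progress \<sigma> y. est \<sigma> y ^ z)"
proof -
  let ?C = "ao ` {..<n}"
  define A where "A = {y. progress \<sigma> y}"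
  have A: "A \<subseteq> {..<n}" by (auto simp: A_def progress_def)
  then have finA: "finite A" using finite_subset by blast
  have nonneg: "0 \<le> est \<sigma> x ^ z" if "x < n" for x using est_nonneg[OF g that] by simp
  have each: "(\<Sum>x\<in>cluster j. est \<sigma> x ^ z) \<le> 700000 * ccost j + 48 * (\<Sum>y\<in>{y \<in> A. ao y = j}. est \<sigma> y ^ z)"
    if j: "j \<in> ?C" for j
  proof -
    have jn: "j < n" using j ao by auto
    have p0: "0 \<le> (\<Sum>y\<in>{y \<in> A. ao y = j}. est \<sigma> y ^ z)" using A nonneg by (intro sum_nonneg) auto
    consider "small j" | "\<not> small j" "M \<le> hits \<sigma> j" | "\<not> small j" "hits \<sigma> j < M" by linarith
    then show ?thesis
    proof cases
      case 1
      have "hits \<sigma> j \<le> card (cluster j)" unfolding hits_def using core_subset[of j] by (intro card_mono) auto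
      then have "hits \<sigma> j < cap j" using 1 by (simp add: cap_def small_def)
      then have sub: "cluster j - set \<sigma> \<subseteq> {y \<in> A. ao y = j}"
        using 1 by (auto simp: A_def progress_def cluster_def core_def)
      have "(\<Sum>x\<in>cluster j. est \<sigma> x ^ z) = (\<Sum>x\<in>cluster j - set \<sigma>. est \<sigma> x ^ z)"
        using est_sampled[OF g] z by (intro sum.mono_neutral_right) auto
      also have "\<dots> \<le> (\<Sum>y\<in>{y \<in> A. ao y = j}. est \<sigma> y ^ z)"
        using sub finA A nonneg by (intro sum_mono2) auto
      finally show ?thesis using p0 ccost_nonneg[of j] by linarith
    next
      case 2
      then show ?thesis using covered_cluster[OF g jn] p0 by fastforce
    next
      case 3
      then have sub: "core j - set \<sigma> \<subseteq> {y \<in> A. ao y = j}"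
        using core_subset[of j] by (auto simp: A_def progress_def cluster_def cap_def)
      have "(\<Sum>y\<in>core j - set \<sigma>. est \<sigma> y ^ z) \<le> (\<Sum>y\<in>{y \<in> A. ao y = j}. est \<sigma> y ^ z)"
        using sub finA A nonneg by (intro sum_mono2) auto
      then show ?thesis using uncovered_cluster[OF g jn 3] ccost_nonneg[of j] by linarith
    qed
  qed
  have "uncovered \<sigma> = (\<Sum>j\<in>?C. \<Sum>x\<in>cluster j. est \<sigma> x ^ z)"
    unfolding uncovered_def by (subst sum.image_gen[of _ _ ao]) (auto simp: cluster_def intro!: sum.cong)
  also have "\<dots> \<le> (\<Sum>j\<in>?C. 700000 * ccost j + 48 * (\<Sum>y\<in>{y \<in> A. ao y = j}. est \<sigma> y ^ z))"
    by (intro sum_mono each)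
  also have "\<dots> = 700000 * opt + 48 * (\<Sum>j\<in>?C. \<Sum>y\<in>{y \<in> A. ao y = j}. est \<sigma> y ^ z)"
    by (simp add: opt_eq sum.distrib sum_distrib_left)
  also have "(\<Sum>j\<in>?C. \<Sum>y\<in>{y \<in> A. ao y = j}. est \<sigma> y ^ z) = (\<Sum>y\<in>A. est \<sigma> y ^ z)"
    using finA A by (intro sum.group) auto
  finally show ?thesis by (simp add: A_def)
qed

text \<open>Each progress draw raises the sum of min (cap j) (hits j) over the clusters, to which a
  cluster contributes at most 4 * M.\<close>

lemma progress_count_le: "progress_count \<sigma> \<le> 4 * M * k"
proof -
  let ?C = "ao ` {..<n}"
  let ?s = "\<lambda>\<sigma>. \<Sum>j\<in>?C. min (cap j) (hits \<sigma> j)"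
  have mono: "hits \<sigma> j \<le> hits (y # \<sigma>) j" for \<sigma> y j
    unfolding hits_def by (intro card_mono) auto
  have "progress_count \<sigma> \<le> ?s \<sigma>"
  proof (induction \<sigma>)
    case (Cons y \<sigma>)
    show ?case
    proof (cases "progress \<sigma> y")
      case True
      let ?j = "ao y"
      have y: "?j \<in> ?C" "y \<notin> set \<sigma>" "y \<in> core ?j" "hits \<sigma> ?j < cap ?j" using True by (auto simp: progress_def)
      then have "hits (y # \<sigma>) ?j = Suc (hits \<sigma> ?j)" by (simp add: hits_def Int_insert_left)
      then have "Suc (min (cap ?j) (hits \<sigma> ?j)) \<le> min (cap ?j) (hits (y # \<sigma>) ?j)" using y by simp
      then have "Suc (?s \<sigma>) \<le> ?s (y # \<sigma>)"
        using y(1) mono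
        by (subst (1 2) sum.remove[of _ ?j]) (auto intro!: add_mono sum_mono min.mono simp flip: add_Suc simp del: min_Suc_Suc)
      then show ?thesis using Cons True by simp
    next
      case False
      have "?s \<sigma> \<le> ?s (y # \<sigma>)" using mono by (intro sum_mono min.mono) auto
      then show ?thesis using Cons False by simp
    qed
  qed simp
  also have "?s \<sigma> \<le> (\<Sum>j\<in>?C. 4 * M)" by (intro sum_mono) (auto simp: cap_def min_le_iff_disj)
  also have "\<dots> \<le> 4 * M * k" using k by simp
  finally show ?thesis .
qed

text \<open>1400000 is twice the constant of \<open>uncovered_bound\<close>, so that in a stalled
  state at least half of the estimated cost is charged to progress points.\<close>

definition stalled :: "nat list \<Rightarrow> bool" where
  "stalled \<sigma> \<longleftrightarrow> good \<sigma> \<and> 1400000 * opt < uncovered \<sigma>"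

text \<open>In a stalled state a draw makes progress with probability at least 16 / (24 * 96) =
  1/144, so halving at progress has expected factor at most 287/288, which is normalized away. The
  value 0 after a state that is not stalled keeps the supermartingale property there.\<close>

primrec stall_potential :: "nat list \<Rightarrow> real" where
  "stall_potential [] = 1"
| "stall_potential (y # \<sigma>) = (if stalled \<sigma>
     then stall_potential \<sigma> * ((if progress \<sigma> y then 1 / 2 else 1) * (288 / 287)) else 0)"

lemma stall_potential_nonneg: "0 \<le> stall_potential h"
  by (induction h) auto

lemma stall_potential_step:
  assumes v: "valid \<sigma>"
  shows "(\<integral>\<^sup>+ y. ennreal (stall_potential (y # \<sigma>)) \<partial>next_sample \<sigma>) \<le> ennreal (stall_potential \<sigma>)"
proof (cases "stalled \<sigma>")
  case True
  have g: "good \<sigma>" "set \<sigma> \<subseteq> {..<n}" using True v by (auto simp: stalled_def dest: valid_set)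
  let ?w = "\<lambda>y. real (weight \<sigma> y)"
  let ?A = "{y. progress \<sigma> y}"
  have A: "?A \<subseteq> {..<n}" by (auto simp: progress_def)
  have unc: "1400000 * opt < uncovered \<sigma>" using True by (simp add: stalled_def)
  have F0: "0 < uncovered \<sigma>" using unc opt_nonneg by linarith
  have "uncovered \<sigma> \<le> 96 * (\<Sum>y\<in>?A. est \<sigma> y ^ z)" using uncovered_bound[OF g] unc by linarith
  moreover have "16 * (\<Sum>y\<in>?A. est \<sigma> y ^ z) \<le> sum ?w ?A"
    unfolding sum_distrib_left using A weight_bounds(1)[OF g] by (intro sum_mono) auto
  moreover have "real (total \<sigma>) \<le> 24 * uncovered \<sigma>"
  proof -
    have "?w y \<le> 24 * est \<sigma> y ^ z" if "y < n" for y
    proof -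
      have "0 \<le> est \<sigma> y ^ z" using est_nonneg[OF g that] by simp
      then show ?thesis using weight_bounds(2)[OF g that] by linarith
    qed
    then show ?thesis unfolding total_def uncovered_def sum_distrib_left of_nat_sum by (intro sum_mono) auto
  qed
  ultimately have prog: "real (total \<sigma>) \<le> 144 * sum ?w ?A" by linarith
  have t: "0 < total \<sigma>"
  proof -
    have "0 < (\<Sum>x<n. 16 * est \<sigma> x ^ z)" using F0 by (simp add: uncovered_def flip: sum_distrib_left)
    also have "\<dots> \<le> real (total \<sigma>)"
      unfolding total_def of_nat_sum using weight_bounds(1)[OF g] by (intro sum_mono) auto
    finally show ?thesis by simp
  qed
  let ?f = "\<lambda>y. (if progress \<sigma> y then 1 / 2 else 1) * (288 / 287) :: real"
  have "(\<integral>\<^sup>+ y. ennreal (stall_potential (y # \<sigma>)) \<partial>next_sample \<sigma>) =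
      (\<integral>\<^sup>+ y. ennreal (stall_potential \<sigma> * ?f y) \<partial>next_sample \<sigma>)" using True by simp
  also have "\<dots> = ennreal ((\<Sum>y<n. ?w y * (stall_potential \<sigma> * ?f y)) / real (total \<sigma>))"
    using t stall_potential_nonneg by (intro nn_integral_next_sample) auto
  also have "\<dots> \<le> ennreal (stall_potential \<sigma>)"
  proof (rule ennreal_leI)
    have "(\<Sum>y<n. ?w y * ?f y) = (288 / 287) * (\<Sum>y<n. ?w y - (if progress \<sigma> y then ?w y / 2 else 0))"
      unfolding sum_distrib_left by (intro sum.cong) auto
    also have "(\<Sum>y<n. ?w y - (if progress \<sigma> y then ?w y / 2 else 0)) = real (total \<sigma>) - sum ?w ?A / 2"
    proof -
      have "(\<Sum>y<n. if progress \<sigma> y then ?w y / 2 else 0) = (\<Sum>y\<in>{..<n} \<inter> ?A. ?w y / 2)"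
        by (simp add: sum.If_cases)
      also have "{..<n} \<inter> ?A = ?A" using A by auto
      finally show ?thesis by (simp add: sum_subtractf total_def sum_divide_distrib)
    qed
    finally have le: "(\<Sum>y<n. ?w y * ?f y) \<le> real (total \<sigma>)" using prog by simp
    have "(\<Sum>y<n. ?w y * (stall_potential \<sigma> * ?f y)) = stall_potential \<sigma> * (\<Sum>y<n. ?w y * ?f y)"
      unfolding sum_distrib_left by (rule sum.cong) auto
    also have "\<dots> \<le> stall_potential \<sigma> * real (total \<sigma>)"
      using le stall_potential_nonneg[of \<sigma>] by (intro mult_left_mono) auto
    finally show "(\<Sum>y<n. ?w y * (stall_potential \<sigma> * ?f y)) / real (total \<sigma>) \<le> stall_potential \<sigma>"
      using t by (simp add: divide_le_eq)
  qed
  finally show ?thesis .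
qed simp

lemma stalled_antimono:
  assumes "stalled (y # \<sigma>)" "set (y # \<sigma>) \<subseteq> {..<n}"
  shows "stalled \<sigma>"
proof -
  have g: "good \<sigma>" "set \<sigma> \<subseteq> {..<n}" "good (y # \<sigma>)" using assms by (auto simp: stalled_def)
  have "uncovered (y # \<sigma>) \<le> uncovered \<sigma>"
    unfolding uncovered_def
    using est_antimono[OF g(1,2)] est_nonneg[OF g(3) assms(2)] by (intro sum_mono power_mono) auto
  then show ?thesis using assms(1) g by (auto simp: stalled_def simp del: good.simps)
qed

lemma stall_potential_eq:
  "stalled h \<Longrightarrow> set h \<subseteq> {..<n} \<Longrightarrow> stall_potential h = (1 / 2) ^ progress_count h * (288 / 287) ^ length h"
proof (induction h)
  case (Cons y \<sigma>)
  have "stalled \<sigma>" using stalled_antimono Cons.prems by blast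
  then show ?case using Cons by simp
qed simp

text \<open>A history that is still stalled has been halved at most 4 * M * k times, which bounds
  its potential from below.\<close>

lemma prob_stalled: "measure (process t) {h. stalled h} \<le> 2 ^ (4 * M * k) * (287 / 288) ^ t"
proof -
  let ?\<theta> = "(1 / 2) ^ (4 * M * k) * (288 / 287 :: real) ^ t"
  have "measure (process t) {h. stalled h} \<le> measure (process t) {h. ?\<theta> \<le> stall_potential h}"
  proof (rule measure_pmf.finite_measure_mono_AE)
    show "AE h in process t. h \<in> {h. stalled h} \<longrightarrow> h \<in> {h. ?\<theta> \<le> stall_potential h}"
    proof (intro AE_pmfI impI)
      fix h assume h: "h \<in> set_pmf (process t)" "h \<in> {h. stalled h}"
      then have "stall_potential h = (1 / 2) ^ progress_count h * (288 / 287) ^ t"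
        using stall_potential_eq[of h] process_valid[of h t] valid_set[of h] by auto
      moreover have "(1 / 2 :: real) ^ (4 * M * k) \<le> (1 / 2) ^ progress_count h"
        using progress_count_le by (intro power_decreasing) auto
      ultimately show "h \<in> {h. ?\<theta> \<le> stall_potential h}" by simp
    qed
  qed auto
  also have "\<dots> \<le> 1 / ?\<theta>"
    using stall_potential_step by (intro process_markov) auto
  also have "1 / ?\<theta> = 2 ^ (4 * M * k) * (287 / 288) ^ t"
    by (simp add: power_divide field_simps)
  finally show ?thesis .
qed

text \<open>The recorded index is that of x itself or of the sample whose candidate last lowered the
  estimate, and candidates are at least the distance. The default index 0 stands for the oldest
  sample, at distance at most \<open>Lam\<close>, the initial estimate.\<close>

lemma asg_bound:
  assumes "valid h" "good h" "h \<noteq> []" "x < n"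
  shows "asg h x < length h \<and> d x (rev h ! asg h x) \<le> 2 * est h x"
  using assms
proof (induction h)
  case (Cons y \<sigma>)
  have s: "valid \<sigma>" "good \<sigma>" "y < n" "set \<sigma> \<subseteq> {..<n}" using Cons.prems valid_set by auto
  let ?h = "y # \<sigma>"
  have last: "rev ?h ! length \<sigma> = y" by (simp add: nth_append)
  have e0: "0 \<le> est ?h x" using Cons.prems by (intro est_nonneg) (auto dest: valid_set)
  consider "x = y" | "x \<noteq> y" "act \<sigma> y" "\<exists>v\<in>candidates y ?h x. v < est \<sigma> x"
    | "x \<noteq> y" "\<not> (act \<sigma> y \<and> (\<exists>v\<in>candidates y ?h x. v < est \<sigma> x))" by blast
  then show ?case
  proof cases
    case 1
    then have "asg ?h x = length \<sigma>" by simp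
    then show ?thesis using e0 last d_self[OF Cons.prems(4)] 1 by simp
  next
    case 2
    let ?C = "candidates y ?h x"
    have a: "asg ?h x = length \<sigma>" using 2 by simp
    have bad: "2 * length (filter (\<lambda>t. wk x t \<noteq> d x t) (witnesses y ?h)) < m" using Cons.prems 2 by auto
    have c: "\<forall>v\<in>?C. d x y + 99 * radius y ?h \<le> v"
      using candidates_bounds(1)[OF 2(2) _ Cons.prems(4) bad] s by auto
    obtain v where v: "v \<in> ?C" "v < est \<sigma> x" using 2 by blast
    have e: "est ?h x = Min (insert (est \<sigma> x) ?C)" using 2 by simp
    have "est ?h x \<in> insert (est \<sigma> x) ?C" unfolding e by (rule Min_in) auto
    moreover have "est ?h x \<le> v" unfolding e using v by (intro Min_le) auto
    ultimately have "est ?h x \<in> ?C" using v by auto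
    then have "d x y \<le> est ?h x" using c radius_bounds(1)[of y ?h] by fastforce
    then show ?thesis using a e0 last by simp
  next
    case 3
    have e: "est ?h x = est \<sigma> x"
    proof (cases "act \<sigma> y")
      case True
      then have "Min (insert (est \<sigma> x) (candidates y ?h x)) = est \<sigma> x"
        using 3 by (intro Min_eqI) (auto simp: not_less)
      then show ?thesis using 3 by (simp del: Min_insert)
    qed (use 3 in simp)
    have a: "asg ?h x = asg \<sigma> x" using 3 by auto
    show ?thesis
    proof (cases "\<sigma> = []")
      case True
      then have "rev ?h ! asg ?h x = y" using a by simp
      moreover have "d x y \<le> 2 * est ?h x" using e True d_le_Lam[OF Cons.prems(4) s(3)] Lam by simp
      ultimately show ?thesis using a True by simp
    next
      case False
      then have IH: "asg \<sigma> x < length \<sigma>" "d x (rev \<sigma> ! asg \<sigma> x) \<le> 2 * est \<sigma> x" using Cons s by auto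
      then have "rev ?h ! asg ?h x = rev \<sigma> ! asg \<sigma> x" using a by (simp add: nth_append)
      then show ?thesis using IH a e by simp
    qed
  qed
qed simp

end

section \<open>Corrupted neighbours\<close>

lemma finite_point_pairs: "finite (point_pairs n)"
  by (rule finite_subset[of _ "Pow {..<n}"]) (auto simp: point_pairs_def)

lemma corrupted_card_binomial:
  assumes "E \<subseteq> point_pairs n" "0 \<le> \<delta>" "\<delta> \<le> 1"
  shows "map_pmf (\<lambda>S. card (S \<inter> E)) (corrupted_pairs_pmf \<delta> n) = binomial_pmf (card E) \<delta>"
proof -
  have finE: "finite E" using assms(1) finite_point_pairs finite_subset by blast
  have "binomial_pmf (card E) \<delta> = map_pmf (\<lambda>f. card {x \<in> E. f x}) (Pi_pmf E False (\<lambda>_. bernoulli_pmf \<delta>))"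
    using assms finE by (intro binomial_pmf_altdef') auto
  also have "Pi_pmf E False (\<lambda>_. bernoulli_pmf \<delta>) =
      map_pmf (\<lambda>f x. if x \<in> E then f x else False) (Pi_pmf (point_pairs n) False (\<lambda>_. bernoulli_pmf \<delta>))"
    using assms(1) finite_point_pairs by (rule Pi_pmf_subset[rotated])
  finally show ?thesis
    unfolding corrupted_pairs_pmf_def pmf.map_comp o_def using assms(1)
    by (auto intro!: map_pmf_cong arg_cong[of _ _ card])
qed

text \<open>Pairs with x are corrupted independently, so Hoeffding's inequality applies with
  deviation 3/8 - 1/3 = 1/24 per point, and 2 / 24^2 = 1/288.\<close>

lemma prob_corrupted_neighbours:
  assumes B: "B \<subseteq> {..<n}" and x: "x < n"
  shows "measure (corrupted_pairs_pmf (1 / 3) n) {S. 3 * card B < 8 * card {y \<in> B. {x, y} \<in> S}}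
    \<le> exp (- real (card B) / 288)"
proof -
  define E where "E = (\<lambda>y. {x, y}) ` (B - {x})"
  let ?p = "corrupted_pairs_pmf (1 / 3) n"
  have finB: "finite B" using B finite_subset by blast
  have E: "E \<subseteq> point_pairs n" using B x by (auto simp: E_def point_pairs_def card_insert_if)
  have inj: "inj_on (\<lambda>y. {x, y}) (B - {x})" by (auto simp: inj_on_def doubleton_eq_iff)
  have cE: "card E \<le> card B" unfolding E_def using finB by (intro le_trans[OF card_image_le card_mono]) auto
  have "card {y \<in> B. {x, y} \<in> S} = card (S \<inter> E)" if "S \<in> set_pmf ?p" for S
  proof -
    have "e \<in> point_pairs n" if "e \<in> S" for e
      using that \<open>S \<in> set_pmf ?p\<close> by (auto simp: corrupted_pairs_pmf_def)
    \<comment> \<open>The point x may lie in \<open>B\<close>, but {x, x} is a singleton and hence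
      no point pair.\<close>
    then have "{x, x} \<notin> S" by (force simp: point_pairs_def)
    then have "S \<inter> E = (\<lambda>y. {x, y}) ` {y \<in> B. {x, y} \<in> S}" unfolding E_def by blast
    moreover have "inj_on (\<lambda>y. {x, y}) {y \<in> B. {x, y} \<in> S}" by (auto simp: inj_on_def doubleton_eq_iff)
    ultimately show ?thesis by (simp add: card_image)
  qed
  then have "measure ?p {S. 3 * card B < 8 * card {y \<in> B. {x, y} \<in> S}} \<le>
      measure ?p ((\<lambda>S. card (S \<inter> E)) -` {i. 3 * card B < 8 * i})"
    by (intro measure_pmf.finite_measure_mono_AE AE_pmfI) auto
  also have "\<dots> = measure (binomial_pmf (card E) (1 / 3)) {i. 3 * card B < 8 * i}"
    by (simp flip: corrupted_card_binomial[OF E])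
  also have "\<dots> \<le> exp (- real (card B) / 288)"
  proof (cases "card E = 0")
    case True
    then show ?thesis by (simp add: binomial_pmf_0 indicator_def)
  next
    case False
    interpret binomial_distribution "card E" "1 / 3" by unfold_locales auto
    have "{i. 3 * card B < 8 * i} \<subseteq> {i. real i \<ge> real (card E) * (1 / 3) + real (card B) / 24}"
      using cE by auto
    then have "measure (binomial_pmf (card E) (1 / 3)) {i. 3 * card B < 8 * i} \<le>
        measure (binomial_pmf (card E) (1 / 3)) {i. real i \<ge> real (card E) * (1 / 3) + real (card B) / 24}"
      by (intro measure_pmf.finite_measure_mono) auto
    also have "\<dots> \<le> exp (- 2 * (real (card B) / 24)\<^sup>2 / real (card E))"
      using False by (intro prob_ge) auto
    also have "\<dots> \<le> exp (- real (card B) / 288)"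
    proof -
      have "real (card B) * real (card E) \<le> real (card B) * real (card B)" using cE by (intro mult_left_mono) auto
      then show ?thesis using False by (simp add: field_simps power2_eq_square)
    qed
    finally show ?thesis .
  qed
  finally show ?thesis .
qed

section \<open>The sampling program\<close>

text \<open>Expressions cannot branch, so the exponent enters arithmetically: r * (r * (z - 1) + (2
  - z)) is r for z = 1 and r^2 for z = 2.\<close>

definition rpow :: "rexp \<Rightarrow> rexp" where
  "rpow r = RTimes r (RPlus (RTimes r (OfWord (WMinus (var ''z'') (WConst 1))))
     (OfWord (WMinus (WConst 2) (var ''z''))))"

lemma rval_rpow:
  assumes "words s ''z'' 0 = z" "z \<in> {1, 2}"
  shows "rval orc s (rpow r) = rval orc s r ^ z"
  using assms by (auto simp: rpow_def power2_eq_square)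

abbreviation sdist :: "wexp \<Rightarrow> wexp \<Rightarrow> rexp" where
  "sdist i j \<equiv> SymDist ''sym'' i ''sym'' j"

abbreviation incr :: "name \<Rightarrow> stm" where
  "incr a \<equiv> WS a (WConst 0) (clamp (WPlus (var a) (WConst 1)))"

definition round_prog :: stm where
  "round_prog = FOR ''j'' ''J'' (IF (RLess (OfWord (var ''v'')) (RGet ''g'' (WConst 0)))
     (WS ''v'' (WConst 0) (clamp (WPlus (WPlus (var ''v'') (WDiv (var ''v'') (WConst 4))) (WConst 1)))) NOP)"

definition weights_prog :: stm where
  "weights_prog = WS ''tot'' (WConst 0) (WConst 0) ;; FOR ''x'' ''n'' (
     RS ''g'' (WConst 0) (RTimes (OfWord (WConst 16)) (rpow (RGet ''D'' (var ''x'')))) ;;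
     WS ''v'' (WConst 0) (WConst 0) ;; round_prog ;;
     WS ''wt'' (var ''x'') (var ''v'') ;;
     WS ''tot'' (WConst 0) (clamp (WPlus (var ''tot'') (var ''v''))))"

definition scan_prog :: stm where
  "scan_prog = WS ''y'' (WConst 0) (WConst 0) ;; WS ''acc'' (WConst 0) (WConst 0) ;; FOR ''x'' ''n'' (
     IF (BNot (WLess (var ''u'') (var ''acc''))) (WS ''y'' (WConst 0) (var ''x'')) NOP ;;
     WS ''acc'' (WConst 0) (clamp (WPlus (var ''acc'') (WGet ''wt'' (var ''x'')))))"

text \<open>\<open>wk\<close> is a matrix in row-major order, with a row of length \<open>N\<close>
  per point and a column per draw.\<close>

definition query_prog :: stm where
  "query_prog = WS ''smp'' (var ''t'') (var ''y'') ;; SQ ''sym'' (var ''t'') (var ''y'') ;;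
     FOR ''x'' ''n'' (WQ ''wk'' (WPlus (WTimes (var ''x'') (var ''N'')) (var ''t'')) (var ''x'') (var ''y''))"

text \<open>Loop bounds have to be parameters, so the loops over samples run through all
  \<open>N\<close> indices and skip those after the current draw \<open>t\<close>.\<close>

definition count_prog :: stm where
  "count_prog = WS ''cnt'' (WConst 0) (WConst 0) ;; FOR ''j'' ''N'' (
     IF (BAnd (BNot (WLess (var ''t'') (var ''j'')))
           (BNot (RLess (sdist (var ''t'') (var ''i'')) (sdist (var ''t'') (var ''j''))))) (incr ''cnt'') NOP)"

definition radius_prog :: stm where
  "radius_prog = RS ''best'' (WConst 0) (OfWord (var ''lam'')) ;; FOR ''i'' ''N'' (
     IF (BNot (WLess (var ''t'') (var ''i''))) (count_prog ;;
       IF (BAnd (BNot (WLess (var ''cnt'') (var ''M'')))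
            (RLess (sdist (var ''t'') (var ''i'')) (RGet ''best'' (WConst 0))))
         (RS ''best'' (WConst 0) (sdist (var ''t'') (var ''i''))) NOP) NOP)"

definition witness_prog :: stm where
  "witness_prog = WS ''c'' (WConst 0) (WConst 0) ;; FOR ''j'' ''N'' (
     IF (BAnd (BNot (WLess (var ''t'') (var ''j''))) (BAnd (WLess (var ''c'') (var ''m''))
          (BNot (RLess (RGet ''best'' (WConst 0)) (sdist (var ''t'') (var ''j''))))))
       (WS ''T'' (var ''c'') (var ''j'') ;; incr ''c'') NOP)"

abbreviation wk_at :: "name \<Rightarrow> rexp" where
  "wk_at a \<equiv> RGet ''wk'' (WPlus (WTimes (var ''x'') (var ''N'')) (WGet ''T'' (var a)))"

abbreviation cand_exp :: rexp where
  "cand_exp \<equiv> RPlus (wk_at ''a'') (RTimes (OfWord (WConst 100)) (RGet ''best'' (WConst 0)))"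

definition rank_prog :: stm where
  "rank_prog = WS ''cnt'' (WConst 0) (WConst 0) ;; FOR ''b'' ''m'' (
     IF (BNot (RLess (wk_at ''a'') (wk_at ''b''))) (incr ''cnt'') NOP)"

definition relax_prog :: stm where
  "relax_prog = FOR ''a'' ''m'' (rank_prog ;;
     IF (BAnd (BNot (WLess (WPlus (var ''cnt'') (var ''cnt'')) (var ''m'')))
          (RLess cand_exp (RGet ''D'' (var ''x''))))
       (RS ''D'' (var ''x'') cand_exp ;; WS ''A'' (var ''x'') (var ''t'')) NOP)"

text \<open>Relaxation also touches the new sample; the two final writes give it estimate 0 and its
  own index.\<close>

definition step_prog :: stm where
  "step_prog = scan_prog ;; query_prog ;; radius_prog ;;
     IF (RLess (RTimes (OfWord (WConst 100)) (RGet ''best'' (WConst 0))) (RGet ''D'' (var ''y'')))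
       (witness_prog ;; FOR ''x'' ''n'' relax_prog) NOP ;;
     RS ''D'' (var ''y'') (OfWord (WConst 0)) ;; WS ''A'' (var ''y'') (var ''t'')"

lemma sampling_mods [simp]:
  "mods round_prog = {''j'', ''v''}"
  "mods weights_prog = {''tot'', ''x'', ''g'', ''v'', ''j'', ''wt''}"
  "mods scan_prog = {''y'', ''acc'', ''x''}"
  "mods query_prog = {''smp'', ''sym'', ''x'', ''wk''}"
  "mods count_prog = {''cnt'', ''j''}"
  "mods radius_prog = {''best'', ''i'', ''cnt'', ''j''}"
  "mods witness_prog = {''c'', ''j'', ''T''}"
  "mods rank_prog = {''cnt'', ''b''}"
  "mods relax_prog = {''a'', ''cnt'', ''b'', ''D'', ''A''}"
  by (auto simp: round_prog_def weights_prog_def scan_prog_def query_prog_def count_prog_def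
      radius_prog_def witness_prog_def rank_prog_def relax_prog_def)

section \<open>Correctness of the sampling program\<close>

lemma agreeD:
  "agree X t s \<Longrightarrow> a \<notin> X \<Longrightarrow> words t a = words s a"
  "agree X t s \<Longrightarrow> a \<notin> X \<Longrightarrow> reals t a = reals s a"
  "agree X t s \<Longrightarrow> a \<notin> X \<Longrightarrow> symbols t a = symbols s a"
  by (auto simp: agree_def)

lemma index_eq:
  assumes "i < N" "j < N"
  shows "x * N + i = y * N + j \<longleftrightarrow> x = y \<and> i = (j::nat)"
proof
  assume e: "x * N + i = y * N + j"
  have "(x * N + i) div N = x" "(x * N + i) mod N = i" "(y * N + j) div N = y" "(y * N + j) mod N = j"
    using assms by auto
  then show "x = y \<and> i = j" unfolding e by simp
qed simp

text \<open>\<open>V\<close> is large enough that clamping never changes a stored value: prefix sums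
  of weights are at most n * 2^J, and counters are at most N, M or n.\<close>

locale machine = sampler +
  fixes k N Itr L V :: nat and SO :: "nat \<Rightarrow> 's" and sd :: "'s \<Rightarrow> 's \<Rightarrow> real"
  assumes L: "Lam = real L"
    and V: "n * 2 ^ J \<le> V" "N \<le> V" "2 * M \<le> V"
    and valid_sd: "\<And>x y. x < n \<Longrightarrow> y < n \<Longrightarrow> sd (SO x) (SO y) = d x y"
    and k: "1 \<le> k" and N: "1 \<le> N"
begin

definition orc where "orc = \<lparr>weak_oracle = wk, strong_oracle = SO, symbol_dist = sd\<rparr>"

lemma orc_simps [simp]: "weak_oracle orc = wk" "strong_oracle orc = SO" "symbol_dist orc = sd"
  by (simp_all add: orc_def)

definition pars :: "'s state \<Rightarrow> bool" where
  "pars s \<longleftrightarrow> words s ''n'' 0 = n \<and> words s ''k'' 0 = k \<and> words s ''z'' 0 = z \<and> words s ''N'' 0 = N \<and>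
     words s ''m'' 0 = m \<and> words s ''M'' 0 = M \<and> words s ''J'' 0 = J \<and> words s ''I'' 0 = Itr \<and>
     words s ''lam'' 0 = L \<and> words s ''cap'' 0 = V"

lemma pars_agree:
  "agree X t s \<Longrightarrow> X \<inter> {''n'', ''k'', ''z'', ''N'', ''m'', ''M'', ''J'', ''I'', ''lam'', ''cap''} = {} \<Longrightarrow> pars s \<Longrightarrow> pars t"
  by (auto simp: pars_def agree_def)

lemma pars_wset [simp]:
  "a \<notin> {''n'', ''k'', ''z'', ''N'', ''m'', ''M'', ''J'', ''I'', ''lam'', ''cap''} \<Longrightarrow> pars (wset a i v s) = pars s"
  "pars (rset a i r s) = pars s" "pars (sset a i y s) = pars s"
  by (auto simp: pars_def upd_other)

lemma two_J_le_V: "2 ^ J \<le> V"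
proof -
  have "1 * 2 ^ J \<le> n * 2 ^ J" using n2 by (intro mult_right_mono) auto
  then show ?thesis using V(1) by linarith
qed

lemma round_spec:
  assumes "pars s" "words s ''v'' 0 = 0"
  shows "words (dsem orc round_prog s) ''v'' 0 = round_up J (reals s ''g'' 0)"
proof -
  let ?g = "reals s ''g'' 0"
  let ?I = "\<lambda>i t. words t ''v'' 0 = (grow ?g ^^ i) 0"
  have "?I J (dsem orc round_prog s)"
    unfolding round_prog_def
  proof (rule dsem_FOR[where I = ?I], goal_cases)
    case (4 i t)
    then have i: "i < J" "?I i t" and ag: "agree {''j'', ''v''} t s" by simp_all
    have cap: "words t ''cap'' 0 = V" and g: "reals t ''g'' 0 = ?g"
      using ag assms(1) by (auto simp: agreeD pars_def)
    let ?v = "(grow ?g ^^ i) 0"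
    have "?v < 2 ^ i" by (rule grow_power_bounds)
    then have "?v + ?v div 4 + 1 \<le> 2 ^ Suc i" by simp
    also have "(2::nat) ^ Suc i \<le> 2 ^ J" using i by (intro power_increasing) auto
    also have "\<dots> \<le> V" by (rule two_J_le_V)
    finally show ?case
      using i(2) cap g by (auto simp: upd_apply grow_def[of ?g "(grow ?g ^^ i) 0"])
  qed (use assms in \<open>auto simp: pars_def upd_apply\<close>)
  then show ?thesis by (simp add: round_up_def)
qed

lemma weight_le: "weight h x \<le> 2 ^ J"
  using round_up_less[of J] by (auto simp: weight_def less_imp_le)

lemma weight_sum_le: "i \<le> n \<Longrightarrow> sum (weight h) {..<i} \<le> V"
proof -
  assume "i \<le> n"
  have "sum (weight h) {..<i} \<le> (\<Sum>x<i. 2 ^ J)" by (intro sum_mono weight_le)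
  also have "\<dots> \<le> n * 2 ^ J" using \<open>i \<le> n\<close> by simp
  finally show ?thesis using V(1) by simp
qed

lemma weights_spec:
  assumes p: "pars s" and D: "\<And>x. x < n \<Longrightarrow> reals s ''D'' x = est h x"
  shows "\<forall>x<n. words (dsem orc weights_prog s) ''wt'' x = weight h x"
    "words (dsem orc weights_prog s) ''tot'' 0 = total h"
proof -
  let ?I = "\<lambda>i t. (\<forall>x<i. words t ''wt'' x = weight h x) \<and> words t ''tot'' 0 = sum (weight h) {..<i}"
  have "?I n (dsem orc weights_prog s)"
    unfolding weights_prog_def dsem.simps(6)
  proof (rule dsem_FOR[where I = ?I], goal_cases)
    case (4 i t)
    then have i: "i < n" "?I i t" "words t ''x'' 0 = i"
      and ag: "agree {''x'', ''g'', ''v'', ''j'', ''wt'', ''tot''} t (wset ''tot'' 0 0 s)" by (simp_all add: insert_commute)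
    have pt: "pars t" using pars_agree[OF ag] p by simp
    have Di: "reals t ''D'' i = est h i" using agreeD(2)[OF ag, of "''D''"] D[OF i(1)] by simp
    define t1 where "t1 = wset ''v'' 0 0 (rset ''g'' 0 (16 * est h i ^ z) t)"
    define t2 where "t2 = dsem orc round_prog t1"
    have "rval orc t (rpow (RGet ''D'' (var ''x''))) = est h i ^ z"
      using rval_rpow[of t z orc "RGet ''D'' (var ''x'')"] pt z i(3) Di by (simp add: pars_def)
    note rp = this
    have v: "words t2 ''v'' 0 = weight h i"
      unfolding t2_def using round_spec[of t1] pt by (simp add: t1_def upd_apply weight_def)
    have oth: "words t2 a = words t a" if "a \<notin> {''j'', ''v'', ''g''}" for a
      using that by (simp add: t2_def dsem_words t1_def upd_other)
    have "sum (weight h) {..<Suc i} \<le> V" using i(1) by (intro weight_sum_le) auto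
    then show ?case
      using i(2,3) v pt rp oth by (simp add: t1_def[symmetric] t2_def[symmetric] upd_apply pars_def less_Suc_eq)
  qed (use p in \<open>auto simp: pars_def upd_apply\<close>)
  then show "\<forall>x<n. words (dsem orc weights_prog s) ''wt'' x = weight h x"
    "words (dsem orc weights_prog s) ''tot'' 0 = total h" by (auto simp: total_def)
qed

lemma scan_spec:
  assumes p: "pars s" and w: "\<And>x. x < n \<Longrightarrow> words s ''wt'' x = weight h x" and u: "words s ''u'' 0 = u"
  shows "words (dsem orc scan_prog s) ''y'' 0 = pick (weight h) n u"
proof -
  let ?I = "\<lambda>i t. words t ''y'' 0 = pick (weight h) i u \<and> words t ''acc'' 0 = sum (weight h) {..<i}"
  have "?I n (dsem orc scan_prog s)"
    unfolding scan_prog_def dsem.simps(6)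
  proof (rule dsem_FOR[where I = ?I], goal_cases)
    case (4 i t)
    note i = 4(1-3) and ag = 4(4)
    have *: "words t ''cap'' 0 = V" "words t ''wt'' i = weight h i" "words t ''u'' 0 = u"
      using ag p w[OF i(1)] u by (auto simp: agree_def pars_def upd_other)
    have "sum (weight h) {..<Suc i} \<le> V" using i(1) by (intro weight_sum_le) auto
    then show ?case
      using i * by (auto simp: upd_apply)
  qed (use p in \<open>auto simp: pars_def upd_apply\<close>)
  then show ?thesis by simp
qed

end

context machine
begin

lemma query_spec:
  assumes p: "pars s" and y: "words s ''y'' 0 = y" and t: "words s ''t'' 0 = t" "t < N"
  defines "s' \<equiv> dsem orc query_prog s"
  shows "words s' ''smp'' = (words s ''smp'')(t := y)"
    "symbols s' ''sym'' = (symbols s ''sym'')(t := Some (SO y))"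
    "\<And>x j. x < n \<Longrightarrow> j < N \<Longrightarrow>
       reals s' ''wk'' (x * N + j) = (if j = t then wk x y else reals s ''wk'' (x * N + j))"
proof -
  let ?I = "\<lambda>i u. words u ''smp'' = (words s ''smp'')(t := y) \<and>
    symbols u ''sym'' = (symbols s ''sym'')(t := Some (SO y)) \<and>
    (\<forall>x j. j < N \<longrightarrow> reals u ''wk'' (x * N + j) = (if j = t \<and> x < i then wk x y else reals s ''wk'' (x * N + j)))"
  have "?I n s'"
    unfolding s'_def query_prog_def dsem.simps(6)
  proof (rule dsem_FOR[where I = ?I], goal_cases)
    case (4 i u)
    have "words u ''N'' 0 = N" "words u ''t'' 0 = t" "words u ''y'' 0 = y"
      using 4(4) p y t by (auto simp: agree_def pars_def upd_other)
    then show ?case using 4(1-3) t(2) index_eq[OF t(2), of _ i]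
      by (auto simp: upd_apply less_Suc_eq index_eq fun_eq_iff)
  qed (use p y t in \<open>auto simp: pars_def upd_apply upd_def fun_eq_iff\<close>)
  then show "words s' ''smp'' = (words s ''smp'')(t := y)"
    "symbols s' ''sym'' = (symbols s ''sym'')(t := Some (SO y))"
    "\<And>x j. x < n \<Longrightarrow> j < N \<Longrightarrow>
       reals s' ''wk'' (x * N + j) = (if j = t then wk x y else reals s ''wk'' (x * N + j))" by auto
qed

definition holds_symbols :: "nat list \<Rightarrow> 's state \<Rightarrow> bool" where
  "holds_symbols h s \<longleftrightarrow> (\<forall>i<length h. symbols s ''sym'' i = Some (SO (rev h ! i)))"

lemma holds_symbols_cong: "symbols t ''sym'' = symbols s ''sym'' \<Longrightarrow> holds_symbols h t = holds_symbols h s"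
  by (simp add: holds_symbols_def)

lemma rval_sdist:
  assumes "holds_symbols h s" "set h \<subseteq> {..<n}" "wval s e < length h" "wval s f < length h"
  shows "rval orc s (sdist e f) = d (rev h ! wval s e) (rev h ! wval s f)"
proof -
  have "rev h ! i < n" if "i < length h" for i
    using that assms(2) nth_mem[of i "rev h"] by auto
  then show ?thesis using assms valid_sd by (simp add: holds_symbols_def)
qed

lemma rev_Cons_last: "rev (y # \<sigma>) ! length \<sigma> = y"
  by (simp add: nth_append)

lemma count_spec:
  assumes p: "pars s" and h: "set (y # \<sigma>) \<subseteq> {..<n}" "holds_symbols (y # \<sigma>) s" "length \<sigma> < N"
    and t: "words s ''t'' 0 = length \<sigma>" and i: "words s ''i'' 0 = i" "i \<le> length \<sigma>"
  shows "words (dsem orc count_prog s) ''cnt'' 0 =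
    length (filter (\<lambda>s'. d y s' \<le> d y (rev (y # \<sigma>) ! i)) (y # \<sigma>))"
proof -
  let ?h = "y # \<sigma>"
  let ?r = "d y (rev ?h ! i)"
  let ?S = "\<lambda>j. {j'. j' < j \<and> j' \<le> length \<sigma> \<and> d y (rev ?h ! j') \<le> ?r}"
  let ?I = "\<lambda>j u. words u ''cnt'' 0 = card (?S j)"
  have "?I N (dsem orc count_prog s)"
    unfolding count_prog_def dsem.simps(6)
  proof (rule dsem_FOR[where I = ?I], goal_cases)
    case (4 j u)
    have ag: "agree {''cnt'', ''j''} u s" using 4(4) by (auto simp: agree_def upd_other)
    have u: "words u ''t'' 0 = length \<sigma>" "words u ''i'' 0 = i" "words u ''cap'' 0 = V" "holds_symbols ?h u"
      using ag p t i h holds_symbols_cong[of u s] by (auto simp: agree_def pars_def)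
    have S: "?S (Suc j) = (if j \<le> length \<sigma> \<and> d y (rev ?h ! j) \<le> ?r then insert j (?S j) else ?S j)"
      by (auto simp: less_Suc_eq)
    define C where "C = card (?S j)"
    define q where "q = rev ?h ! j"
    define r where "r = ?r"
    have "card (?S j) \<le> card {..<j}" by (intro card_mono) auto
    then have CV: "C < V" using 4(1) V(2) by (simp add: C_def)
    have cS: "card (?S (Suc j)) = (if j \<le> length \<sigma> \<and> d y q \<le> r then Suc C else C)"
      unfolding S C_def q_def r_def by simp
    have cj: "words u ''cnt'' 0 = C" using 4(2) by (simp only: C_def)
    show ?case
    proof (cases "j \<le> length \<sigma>")
      case True
      have "rval orc u (sdist (var ''t'') (var ''i'')) = r"
        "rval orc u (sdist (var ''t'') (var ''j'')) = d y q"
        using rval_sdist[OF u(4) h(1), of "var ''t''" "var ''i''"]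
          rval_sdist[OF u(4) h(1), of "var ''t''" "var ''j''"] u 4(3) True i(2)
        by (simp_all add: rev_Cons_last q_def r_def del: rev.simps rval.simps)
      then show ?thesis using CV cj 4(3) u True unfolding cS
        by (auto simp: upd_apply not_less simp del: rval.simps(3))
    next
      case False
      then show ?thesis using cj 4(3) u unfolding cS by (simp add: not_less del: rval.simps(3))
    qed
  qed (use p in \<open>auto simp: pars_def upd_apply\<close>)
  also have "?S N = {j. j < length (rev ?h) \<and> d y (rev ?h ! j) \<le> ?r}" using h(3) by auto
  also have "card \<dots> = length (filter (\<lambda>s'. d y s' \<le> ?r) (rev ?h))"
    by (rule length_filter_conv_card[symmetric])
  also have "\<dots> = length (filter (\<lambda>s'. d y s' \<le> ?r) ?h)" by (simp only: rev_filter[symmetric] length_rev)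
  finally show ?thesis .
qed

lemma radius_spec:
  assumes p: "pars s" and h: "set (y # \<sigma>) \<subseteq> {..<n}" "holds_symbols (y # \<sigma>) s" "length \<sigma> < N"
    and t: "words s ''t'' 0 = length \<sigma>"
  shows "reals (dsem orc radius_prog s) ''best'' 0 = radius y (y # \<sigma>)"
proof -
  let ?h = "y # \<sigma>"
  let ?d = "\<lambda>i. d y (rev ?h ! i)"
  let ?P = "\<lambda>i. i \<le> length \<sigma> \<and> M \<le> length (filter (\<lambda>s'. d y s' \<le> ?d i) ?h)"
  let ?S = "\<lambda>i. insert Lam (?d ` {i'. i' < i \<and> ?P i'})"
  let ?I = "\<lambda>i u. reals u ''best'' 0 = Min (?S i)"
  have "?I N (dsem orc radius_prog s)"
    unfolding radius_prog_def dsem.simps(6)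
  proof (rule dsem_FOR[where I = ?I], goal_cases)
    case (4 i u)
    have ag: "agree {''best'', ''i'', ''cnt'', ''j''} u s" using 4(4) by (auto simp: agree_def upd_other)
    have u: "pars u" "words u ''t'' 0 = length \<sigma>" "holds_symbols ?h u"
      using ag p t h holds_symbols_cong[of u s] pars_agree[OF ag] by (auto simp: agree_def)
    have S: "?S (Suc i) = (if ?P i then insert (?d i) (?S i) else ?S i)"
      by (auto simp: less_Suc_eq)
    define B where "B = Min (?S i)"
    define c where "c = length (filter (\<lambda>s'. d y s' \<le> ?d i) ?h)"
    define r where "r = ?d i"
    have M: "Min (?S (Suc i)) = (if i \<le> length \<sigma> \<and> M \<le> c then min r B else B)"
      unfolding S B_def c_def r_def by (simp add: Min_insert2)
    have ui: "reals u ''best'' 0 = B" using 4(2) by (simp only: B_def)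
    show ?case
    proof (cases "i \<le> length \<sigma>")
      case True
      define u1 where "u1 = dsem orc count_prog u"
      have cu: "words u1 ''cnt'' 0 = c"
        unfolding u1_def c_def by (rule count_spec[OF u(1) h(1) u(3) h(3) u(2) 4(3) True])
      have u1: "words u1 ''t'' 0 = length \<sigma>" "words u1 ''i'' 0 = i" "words u1 ''M'' 0 = M"
        "reals u1 ''best'' 0 = B" "holds_symbols ?h u1"
        using u ui 4(3) holds_symbols_cong[of u1 u]
        by (simp_all add: u1_def dsem_words dsem_reals dsem_symbols pars_def)
      have "rval orc u1 (sdist (var ''t'') (var ''i'')) = r"
        using rval_sdist[OF u1(5) h(1), of "var ''t''" "var ''i''"] u1 True
        by (simp_all add: rev_Cons_last r_def del: rev.simps rval.simps)
      then show ?thesis using cu u1 u(2) True 4(3) unfolding M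
        by (auto simp: upd_apply not_less u1_def[symmetric] min_def simp del: rval.simps(3))
    next
      case False
      then show ?thesis using 4(3) u ui unfolding M by (simp add: not_less del: rval.simps(3))
    qed
  qed (use p L in \<open>auto simp: pars_def upd_apply\<close>)
  also have "?S N = insert Lam {d y s |s. s \<in> set ?h \<and> M \<le> length (filter (\<lambda>s'. d y s' \<le> d y s) ?h)}"
  proof -
    have "set ?h = {rev ?h ! i |i. i \<le> length \<sigma>}"
      by (subst set_rev[symmetric], subst set_conv_nth) (simp add: less_Suc_eq_le del: rev.simps)
    then show ?thesis using h(3) by (auto simp del: rev.simps)
  qed
  finally show ?thesis by (simp only: radius_def)
qed

text \<open>\<open>T\<close> holds indices of draws rather than points, as these address the columns
  of \<open>wk\<close>.\<close>

lemma witness_spec: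
  assumes p: "pars s" and h: "set (y # \<sigma>) \<subseteq> {..<n}" "holds_symbols (y # \<sigma>) s" "length \<sigma> < N"
    and t: "words s ''t'' 0 = length \<sigma>" and r: "reals s ''best'' 0 = radius y (y # \<sigma>)"
  shows "\<forall>a<length (witnesses y (y # \<sigma>)). words (dsem orc witness_prog s) ''T'' a \<le> length \<sigma> \<and>
    rev (y # \<sigma>) ! words (dsem orc witness_prog s) ''T'' a = witnesses y (y # \<sigma>) ! a"
proof -
  let ?h = "y # \<sigma>"
  let ?r = "radius y ?h"
  let ?W = "\<lambda>j. take m (filter (\<lambda>s. d y s \<le> ?r) (take j (rev ?h)))"
  let ?I = "\<lambda>j u. words u ''c'' 0 = length (?W j) \<and>
    (\<forall>a<length (?W j). words u ''T'' a \<le> length \<sigma> \<and> rev ?h ! words u ''T'' a = ?W j ! a)"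
  have "?I N (dsem orc witness_prog s)"
    unfolding witness_prog_def dsem.simps(6)
  proof (rule dsem_FOR[where I = ?I], goal_cases)
    case (4 j u)
    have ag: "agree {''c'', ''j'', ''T''} u s" using 4(4) by (auto simp: agree_def upd_other)
    have u: "words u ''t'' 0 = length \<sigma>" "words u ''m'' 0 = m" "words u ''cap'' 0 = V" "holds_symbols ?h u"
      "reals u ''best'' 0 = ?r"
      using ag p t h r holds_symbols_cong[of u s] by (auto simp: agree_def pars_def)
    show ?case
    proof (cases "j \<le> length \<sigma>")
      case True
      have sd: "rval orc u (sdist (var ''t'') (var ''j'')) = d y (rev ?h ! j)"
        using rval_sdist[OF u(4) h(1), of "var ''t''" "var ''j''"] u 4(3) True
        by (simp_all add: rev_Cons_last del: rev.simps rval.simps)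
      have tk: "take (Suc j) (rev ?h) = take j (rev ?h) @ [rev ?h ! j]"
        using True by (intro take_Suc_conv_app_nth) simp
      define F where "F = filter (\<lambda>s. d y s \<le> ?r) (take j (rev ?h))"
      define q where "q = rev ?h ! j"
      have W: "?W j = take m F" "?W (Suc j) = take m (F @ (if d y q \<le> ?r then [q] else []))"
        unfolding tk by (simp_all add: F_def q_def)
      show ?thesis
      proof (cases "d y q \<le> ?r \<and> length F < m")
        case T: True
        then have "length F < V" using V(3) m_pos by linarith
        then show ?thesis using 4(2,3) u True T sd unfolding W
          by (auto simp: upd_apply nth_append less_Suc_eq q_def[symmetric] simp del: rev.simps rval.simps(3))
      next
        case F: False
        then have "take m (F @ (if d y q \<le> ?r then [q] else [])) = take m F" by auto
        moreover have "\<not> (length (take m F) < m \<and> d y q \<le> ?r)" using F by auto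
        ultimately show ?thesis using 4(2,3) u True sd unfolding W
          by (auto simp: q_def[symmetric] simp del: rev.simps rval.simps(3) length_take)
      qed
    next
      case False
      then have "take (Suc j) (rev ?h) = rev ?h" "take j (rev ?h) = rev ?h" by (auto simp del: rev.simps)
      then show ?thesis using 4(2,3) u False by (simp add: not_less del: rev.simps rval.simps(3))
    qed
  qed (use p in \<open>auto simp: pars_def upd_apply\<close>)
  moreover have "take N (rev ?h) = rev ?h" using h(3) by (auto simp del: rev.simps)
  ultimately show ?thesis by (simp only: witnesses_def) blast
qed

lemma rank_spec:
  assumes p: "pars s" and W: "length W = m"
    and wk: "\<And>b. b < m \<Longrightarrow> reals s ''wk'' (words s ''x'' 0 * N + words s ''T'' b) = wk x (W ! b)"
    and a: "words s ''a'' 0 = a" "a < m"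
  shows "words (dsem orc rank_prog s) ''cnt'' 0 = length (filter (\<lambda>t'. wk x t' \<le> wk x (W ! a)) W)"
proof -
  let ?S = "\<lambda>i. {b. b < i \<and> wk x (W ! b) \<le> wk x (W ! a)}"
  let ?I = "\<lambda>i u. words u ''cnt'' 0 = card (?S i)"
  have "?I m (dsem orc rank_prog s)"
    unfolding rank_prog_def dsem.simps(6)
  proof (rule dsem_FOR[where I = ?I], goal_cases)
    case (4 b u)
    have ag: "agree {''cnt'', ''b''} u s" using 4(4) by (auto simp: agree_def upd_other)
    then have e: "words u ''x'' = words s ''x''" "words u ''T'' = words s ''T''" "reals u ''wk'' = reals s ''wk''"
      "words u ''a'' = words s ''a''" "words u ''N'' 0 = N" "words u ''cap'' 0 = V"
      using p by (auto simp: agree_def pars_def)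
    have S: "?S (Suc b) = (if wk x (W ! b) \<le> wk x (W ! a) then insert b (?S b) else ?S b)"
      by (auto simp: less_Suc_eq)
    define C where "C = card (?S b)"
    have "card (?S b) \<le> card {..<b}" by (intro card_mono) auto
    then have CV: "C < V" using 4(1) V(3) m_pos by (simp add: C_def)
    have cS: "card (?S (Suc b)) = (if wk x (W ! b) \<le> wk x (W ! a) then Suc C else C)"
      unfolding S C_def by simp
    show ?case using 4(2)[folded C_def] 4(3) e a wk[OF 4(1)] wk[OF a(2)] CV unfolding cS
      by (auto simp: upd_apply not_less)
  qed (use p in \<open>auto simp: pars_def upd_apply\<close>)
  also have "?S m = {b. b < length W \<and> wk x (W ! b) \<le> wk x (W ! a)}" by (simp add: W)
  also have "card \<dots> = length (filter (\<lambda>t'. wk x t' \<le> wk x (W ! a)) W)"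
    by (rule length_filter_conv_card[symmetric])
  finally show ?thesis .
qed

text \<open>Candidates are compared with the running minimum, yet \<open>A\<close> changes exactly
  if some candidate is below the initial estimate: the first such candidate lowers it, and all later
  writes store the same \<open>t\<close>.\<close>

lemma relax_spec:
  assumes p: "pars s" and act: "length (witnesses y h) = m" and x: "words s ''x'' 0 = x"
    and wk: "\<And>b. b < m \<Longrightarrow> reals s ''wk'' (x * N + words s ''T'' b) = wk x (witnesses y h ! b)"
    and r: "reals s ''best'' 0 = radius y h"
  defines "s' \<equiv> dsem orc relax_prog s"
  shows "reals s' ''D'' = (reals s ''D'')(x := Min (insert (reals s ''D'' x) (candidates y h x)))"
    "words s' ''A'' = (words s ''A'')(x := if \<exists>v\<in>candidates y h x. v < reals s ''D'' x then words s ''t'' 0 else words s ''A'' x)"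
proof -
  let ?W = "witnesses y h"
  let ?c = "\<lambda>a. wk x (?W ! a) + 100 * radius y h"
  let ?P = "\<lambda>a. m \<le> 2 * length (filter (\<lambda>t'. wk x t' \<le> wk x (?W ! a)) ?W)"
  let ?C = "\<lambda>i. ?c ` {a. a < i \<and> ?P a}"
  let ?D = "reals s ''D'' x"
  let ?I = "\<lambda>i u. reals u ''D'' = (reals s ''D'')(x := Min (insert ?D (?C i))) \<and>
    words u ''A'' = (words s ''A'')(x := if \<exists>v\<in>?C i. v < ?D then words s ''t'' 0 else words s ''A'' x)"
  have "?I m s'"
    unfolding s'_def relax_prog_def
  proof (rule dsem_FOR[where I = ?I], goal_cases)
    case (4 a u)
    have ag: "agree {''a'', ''cnt'', ''b'', ''D'', ''A''} u s" using 4(4) by (auto simp: agree_def)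
    then have e: "words u ''x'' = words s ''x''" "words u ''T'' = words s ''T''" "reals u ''wk'' = reals s ''wk''"
      "words u ''t'' = words s ''t''" "reals u ''best'' = reals s ''best''"
      by (auto simp: agree_def)
    have pu: "pars u" using pars_agree[OF ag] p by simp
    define u1 where "u1 = dsem orc rank_prog u"
    have "words (dsem orc rank_prog u) ''cnt'' 0 = length (filter (\<lambda>t'. wk x t' \<le> wk x (?W ! a)) ?W)"
      using rank_spec[OF pu act, of x a] 4(1,3) e wk x by simp
    then have cnt: "words u1 ''cnt'' 0 = length (filter (\<lambda>t'. wk x t' \<le> wk x (?W ! a)) ?W)"
      by (simp add: u1_def)
    have u1: "words u1 ''x'' 0 = x" "words u1 ''a'' 0 = a" "words u1 ''N'' 0 = N" "words u1 ''m'' 0 = m"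
      "reals u1 ''wk'' (x * N + words u1 ''T'' a) = wk x (?W ! a)" "reals u1 ''best'' 0 = radius y h"
      "words u1 ''t'' 0 = words s ''t'' 0" "reals u1 ''D'' = reals u ''D''" "words u1 ''A'' = words u ''A''"
      using pu e x r 4(1,3) wk by (simp_all add: u1_def dsem_words dsem_reals pars_def)
    have C: "?C (Suc a) = (if ?P a then insert (?c a) (?C a) else ?C a)" by (auto simp: less_Suc_eq)
    have M: "Min (insert ?D (?C (Suc a))) =
        (if ?P a then min (?c a) (Min (insert ?D (?C a))) else Min (insert ?D (?C a)))"
      unfolding C by (simp add: insert_commute[of ?D "?c a"])
    have E: "(\<exists>v\<in>?C (Suc a). v < ?D) \<longleftrightarrow> (?P a \<and> ?c a < ?D) \<or> (\<exists>v\<in>?C a. v < ?D)" unfolding C by auto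
    have lt: "\<not> (\<exists>v\<in>?C a. v < ?D) \<Longrightarrow> Min (insert ?D (?C a)) = ?D"
      by (intro Min_eqI) (auto simp: not_less)
    have le: "Min (insert ?D (?C a)) \<le> ?D" by (intro Min_le) auto
    have Du: "reals u1 ''D'' = (reals s ''D'')(x := Min (insert ?D (?C a)))"
      "words u1 ''A'' = (words s ''A'')(x := if \<exists>v\<in>?C a. v < ?D then words s ''t'' 0 else words s ''A'' x)"
      using 4(2) u1 by auto
    define Q where "Q = Min (insert ?D (?C a))"
    define B where "B \<longleftrightarrow> (\<exists>v\<in>?C a. v < ?D)"
    define R where "R \<longleftrightarrow> ?P a"
    define c where "c = ?c a"
    have QB: "\<not> B \<Longrightarrow> Q = ?D" "Q \<le> ?D" unfolding Q_def B_def by (rule lt, assumption) (rule le)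
    have D1: "reals u1 ''D'' = (reals s ''D'')(x := Q)"
      and A1: "words u1 ''A'' = (words s ''A'')(x := if B then words s ''t'' 0 else words s ''A'' x)"
      using Du by (simp_all only: Q_def B_def)
    have cand: "rval orc u1 cand_exp = c" using u1 by (simp add: c_def)
    have tst: "bval orc u1 (BAnd (BNot (WLess (WPlus (var ''cnt'') (var ''cnt'')) (var ''m'')))
          (RLess cand_exp (RGet ''D'' (var ''x'')))) \<longleftrightarrow> R \<and> c < Q"
      using u1(1,4) cnt cand D1 by (simp add: R_def not_less mult_2)
    show ?case
      unfolding M E dsem.simps u1_def[symmetric] tst Q_def[symmetric] B_def[symmetric] R_def[symmetric] c_def[symmetric]
    proof (cases "R \<and> c < Q", goal_cases)
      case 1
      then have "c < ?D" "min c Q = c" using QB by auto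
      then show ?case using 1 D1 A1 u1(1,7) by (simp add: cand upd_def del: rval.simps)
    next
      case 2
      then have "(R \<and> c < ?D \<or> B) = B" "(if R then min c Q else Q) = Q" using QB by auto
      then show ?case using 2 D1 A1 by (auto simp del: rval.simps)
    qed
  qed (use p in \<open>auto simp: pars_def upd_other\<close>)
  moreover have "?C m = candidates y h x"
    unfolding candidates_def using act by (auto simp: set_conv_nth)
  ultimately show "reals s' ''D'' = (reals s ''D'')(x := Min (insert (reals s ''D'' x) (candidates y h x)))"
    "words s' ''A'' = (words s ''A'')(x := if \<exists>v\<in>candidates y h x. v < reals s ''D'' x then words s ''t'' 0 else words s ''A'' x)"
    by auto
qed

definition hist :: "nat list \<Rightarrow> 's state \<Rightarrow> bool" where
  "hist h s \<longleftrightarrow> set h \<subseteq> {..<n} \<and> (\<forall>i<length h. words s ''smp'' i = rev h ! i) \<and> holds_symbols h s \<and>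
     (\<forall>x<n. \<forall>i<length h. reals s ''wk'' (x * N + i) = wk x (rev h ! i)) \<and>
     (\<forall>x<n. reals s ''D'' x = est h x \<and> words s ''A'' x = asg h x)"

lemma step_spec:
  assumes p: "pars s" and hist: "hist \<sigma> s" and t: "words s ''t'' 0 = length \<sigma>" "length \<sigma> < N"
    and w: "\<And>x. x < n \<Longrightarrow> words s ''wt'' x = weight \<sigma> x" and u: "words s ''u'' 0 = u"
  shows "hist (pick (weight \<sigma>) n u # \<sigma>) (dsem orc step_prog s)"
proof -
  define y where "y = pick (weight \<sigma>) n u"
  let ?h = "y # \<sigma>" let ?t = "length \<sigma>"
  have yn: "y < n" using n2 by (simp add: y_def pick_less)
  have h: "set ?h \<subseteq> {..<n}" using hist yn by (simp add: hist_def)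
  define s1 where "s1 = dsem orc scan_prog s"
  define s2 where "s2 = dsem orc query_prog s1"
  define s3 where "s3 = dsem orc radius_prog s2"
  define s4 where "s4 = (if act \<sigma> y then dsem orc (witness_prog ;; FOR ''x'' ''n'' relax_prog) s3 else s3)"
  have p1: "pars s1" using p pars_agree[OF dsem_agree[of scan_prog orc s]] by (simp add: s1_def)
  have p2: "pars s2" using p1 pars_agree[OF dsem_agree[of query_prog orc s1]] by (simp add: s2_def)
  have p3: "pars s3" using p2 pars_agree[OF dsem_agree[of radius_prog orc s2]] by (simp add: s3_def)
  have y1: "words s1 ''y'' 0 = y" "words s1 ''t'' 0 = ?t"
    using scan_spec[OF p w u] t by (auto simp: s1_def y_def dsem_words)
  note q = query_spec[OF p1 y1 t(2), folded s2_def]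
  have s2: "words s2 ''y'' 0 = y" "words s2 ''t'' 0 = ?t" "reals s2 ''D'' = reals s ''D''" "words s2 ''A'' = words s ''A''"
    using y1 by (simp_all add: s2_def s1_def dsem_words dsem_reals)
  have nth: "rev ?h ! i = (if i = ?t then y else rev \<sigma> ! i)" if "i < Suc ?t" for i
    using that by (auto simp: nth_append)
  have smp: "words s2 ''smp'' i = rev ?h ! i" if "i < Suc ?t" for i
    using that hist nth[OF that] q(1) by (auto simp: hist_def s1_def dsem_words)
  have sym: "holds_symbols ?h s2"
    unfolding holds_symbols_def
  proof (intro allI impI)
    fix i assume "i < length ?h"
    then have i: "i < Suc ?t" by simp
    show "symbols s2 ''sym'' i = Some (SO (rev ?h ! i))"
      using i hist q(2) unfolding nth[OF i] by (auto simp: hist_def holds_symbols_def s1_def dsem_symbols)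
  qed
  have wk2: "reals s2 ''wk'' (x * N + i) = wk x (rev ?h ! i)" if "x < n" "i < Suc ?t" for x i
    using that hist t(2) q(3)[of x i] nth[OF that(2)] by (auto simp: hist_def s1_def dsem_reals)
  have best: "reals s3 ''best'' 0 = radius y ?h"
    unfolding s3_def by (rule radius_spec[OF p2 h sym t(2) s2(2)])
  have s3: "words s3 ''y'' 0 = y" "words s3 ''t'' 0 = ?t" "reals s3 ''D'' = reals s ''D''"
    "words s3 ''A'' = words s ''A''" "words s3 ''smp'' = words s2 ''smp''" "reals s3 ''wk'' = reals s2 ''wk''"
    "symbols s3 ''sym'' = symbols s2 ''sym''"
    using s2 by (simp_all add: s3_def dsem_words dsem_reals dsem_symbols)
  have "reals s3 ''D'' y = est \<sigma> y" using s3 hist yn by (simp add: hist_def)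
  have mods4: "agree {''c'', ''j'', ''T'', ''x'', ''a'', ''cnt'', ''b'', ''D'', ''A''} s4 s3"
    using dsem_agree[of "witness_prog ;; FOR ''x'' ''n'' relax_prog" orc s3]
    by (auto simp: s4_def agree_def simp del: dsem.simps)
  have s4: "words s4 ''y'' 0 = y" "words s4 ''t'' 0 = ?t"
    using agreeD(1)[OF mods4] s3 by simp_all
  have "reals s3 ''D'' y = est \<sigma> y" using s3 hist yn by (simp add: hist_def)
  then have "bval orc s3 (RLess (RTimes (OfWord (WConst 100)) (RGet ''best'' (WConst 0))) (RGet ''D'' (var ''y''))) \<longleftrightarrow> act \<sigma> y"
    using best s3(1) by (simp del: est.simps)
  then have if4: "dsem orc (IF (RLess (RTimes (OfWord (WConst 100)) (RGet ''best'' (WConst 0))) (RGet ''D'' (var ''y'')))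
       (witness_prog ;; FOR ''x'' ''n'' relax_prog) NOP) s3 = s4"
    by (simp only: s4_def dsem.simps(7) dsem.simps(1))
  have "dsem orc step_prog s = dsem orc (WS ''A'' (var ''y'') (var ''t'')) (dsem orc (RS ''D'' (var ''y'') (OfWord (WConst 0))) s4)"
    unfolding step_prog_def by (simp only: dsem.simps(6) s1_def[symmetric] s2_def[symmetric] s3_def[symmetric] if4)
  then have step: "dsem orc step_prog s = wset ''A'' y ?t (rset ''D'' y 0 s4)"
    using s4 by simp
  have DA: "reals s4 ''D'' x = est ?h x \<and> words s4 ''A'' x = asg ?h x" if x: "x < n" "x \<noteq> y" for x
  proof (cases "act \<sigma> y")
    case False
    then show ?thesis using x s3 hist by (simp add: s4_def hist_def del: est.simps) simp
  next
    case True
    let ?C = "candidates y ?h"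
    define s5 where "s5 = dsem orc witness_prog s3"
    have sym3: "holds_symbols ?h s3" using sym s3(7) holds_symbols_cong by blast
    note wit = witness_spec[OF p3 h sym3 t(2) s3(2) best, folded s5_def, unfolded length_witnesses[OF True]]
    have p5: "pars s5" using p3 pars_agree[OF dsem_agree[of witness_prog orc s3]] by (simp add: s5_def)
    have s5: "reals s5 ''D'' = reals s ''D''" "words s5 ''A'' = words s ''A''" "words s5 ''t'' 0 = ?t"
      "reals s5 ''best'' 0 = radius y ?h" "reals s5 ''wk'' = reals s2 ''wk''"
      using s3 best by (simp_all add: s5_def dsem_words dsem_reals)
    let ?I = "\<lambda>i v. \<forall>x<n. reals v ''D'' x = (if x < i then Min (insert (est \<sigma> x) (?C x)) else est \<sigma> x) \<and>
      words v ''A'' x = (if x < i \<and> (\<exists>c\<in>?C x. c < est \<sigma> x) then ?t else asg \<sigma> x)"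
    have "?I n (dsem orc (FOR ''x'' ''n'' relax_prog) s5)"
    proof (rule dsem_FOR[where I = ?I], goal_cases)
      case (4 i v)
      have ag: "agree {''x'', ''a'', ''cnt'', ''b'', ''D'', ''A''} v s5" using 4(4) by (auto simp: agree_def)
      then have v: "reals v ''best'' 0 = radius y ?h" "words v ''t'' 0 = ?t"
        "words v ''T'' = words s5 ''T''" "reals v ''wk'' = reals s5 ''wk''" using s5 by (auto simp: agree_def)
      have pv: "pars v" using pars_agree[OF ag] p5 by simp
      have "reals v ''wk'' (i * N + words v ''T'' b) = wk i (witnesses y ?h ! b)" if "b < m" for b
        using wk2[OF 4(1), of "words v ''T'' b"] wit that v s5 by (simp add: less_Suc_eq_le del: rev.simps)
      note r = relax_spec[OF pv length_witnesses[OF True] 4(3) this v(1)]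
      show ?case using 4(1,2) r v(2) by (auto simp: less_Suc_eq simp del: Min_insert)
    qed (use p5 s5 hist in \<open>auto simp: pars_def hist_def upd_apply\<close>)
    then show ?thesis using x True by (simp add: s4_def s5_def del: Min_insert dsem.simps(8))
  qed
  show ?thesis
    unfolding y_def[symmetric] step hist_def
  proof (intro conjI allI impI)
    show "holds_symbols ?h (wset ''A'' y ?t (rset ''D'' y 0 s4))"
      using sym s3(7) agreeD(3)[OF mods4, of "''sym''"] holds_symbols_cong[of "wset ''A'' y ?t (rset ''D'' y 0 s4)" s2]
      by simp
    fix x assume x: "x < n"
    show "reals (wset ''A'' y ?t (rset ''D'' y 0 s4)) ''D'' x = est ?h x"
      using DA[OF x] by (cases "x = y") (simp_all add: upd_apply del: est.simps, simp)
    show "words (wset ''A'' y ?t (rset ''D'' y 0 s4)) ''A'' x = asg ?h x"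
      using DA[OF x] by (cases "x = y") (simp_all add: upd_apply del: asg.simps, simp)
    fix i assume "i < length ?h"
    then show "reals (wset ''A'' y ?t (rset ''D'' y 0 s4)) ''wk'' (x * N + i) = wk x (rev ?h ! i)"
      using wk2[OF x, of i] s3(6) agreeD(2)[OF mods4, of "''wk''"] by (simp add: upd_other)
  next
    fix i assume "i < length ?h"
    then show "words (wset ''A'' y ?t (rset ''D'' y 0 s4)) ''smp'' i = rev ?h ! i"
      using smp[of i] s3(5) agreeD(1)[OF mods4, of "''smp''"] by (simp add: upd_other)
  qed (rule h)
qed

end

section \<open>The local search program\<close>

text \<open>Exceeds the z-th powers of all distances, and serves as infinity for empty
  minima.\<close>

abbreviation big_exp :: rexp where
  "big_exp \<equiv> RPlus (RTimes (OfWord (var ''lam'')) (OfWord (var ''lam''))) (OfWord (WConst 1))"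

abbreviation slot_dist :: rexp where
  "slot_dist \<equiv> rpow (sdist (var ''j'') (WGet ''F'' (var ''i'')))"

definition count_points_prog :: stm where
  "count_points_prog = FOR ''x'' ''n'' (WS ''w'' (WGet ''A'' (var ''x''))
     (clamp (WPlus (WGet ''w'' (WGet ''A'' (var ''x''))) (WConst 1))))"

definition near1_prog :: stm where
  "near1_prog = RS ''d1'' (var ''j'') big_exp ;; FOR ''i'' ''k'' (
     RS ''dd'' (WConst 0) slot_dist ;;
     IF (RLess (RGet ''dd'' (WConst 0)) (RGet ''d1'' (var ''j'')))
       (RS ''d1'' (var ''j'') (RGet ''dd'' (WConst 0)) ;; WS ''id'' (var ''j'') (var ''i'')) NOP)"

text \<open>Second nearest refers to slots: another slot holding the same sample survives the
  removal of the nearest one. The nested negations say that \<open>i\<close> differs from the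
  nearest slot.\<close>

definition near2_prog :: stm where
  "near2_prog = RS ''d2'' (var ''j'') big_exp ;; FOR ''i'' ''k'' (
     RS ''dd'' (WConst 0) slot_dist ;;
     IF (BAnd (BNot (BAnd (BNot (WLess (var ''i'') (WGet ''id'' (var ''j''))))
           (BNot (WLess (WGet ''id'' (var ''j'')) (var ''i'')))))
         (RLess (RGet ''dd'' (WConst 0)) (RGet ''d2'' (var ''j''))))
       (RS ''d2'' (var ''j'') (RGet ''dd'' (WConst 0))) NOP)"

definition near_prog :: stm where
  "near_prog = FOR ''j'' ''N'' (near1_prog ;; near2_prog)"

definition cost_prog :: stm where
  "cost_prog = RS ''bc'' (WConst 0) (OfWord (WConst 0)) ;; FOR ''j'' ''N''
     (RS ''bc'' (WConst 0) (RPlus (RGet ''bc'' (WConst 0))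
        (RTimes (OfWord (WGet ''w'' (var ''j''))) (RGet ''d1'' (var ''j'')))))"

definition clear_prog :: stm where
  "clear_prog = FOR ''i'' ''k'' (RS ''loss'' (var ''i'') (OfWord (WConst 0)))"

definition min_prog :: "name \<Rightarrow> name \<Rightarrow> stm" where
  "min_prog a b = RS a (WConst 0) (RGet ''dd'' (WConst 0)) ;;
     IF (RLess (RGet b (var ''j'')) (RGet ''dd'' (WConst 0))) (RS a (WConst 0) (RGet b (var ''j''))) NOP"

lemma min_prog_spec:
  "a \<noteq> ''dd'' \<Longrightarrow> a \<noteq> b \<Longrightarrow>
    dsem orc (min_prog a b) s = rset a 0 (min (reals s ''dd'' 0) (reals s b (words s ''j'' 0))) s"
  by (auto simp: min_prog_def rset_def upd_def min_def)

text \<open>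
  One pass over the samples \<open>j\<close> yields the costs of swapping in \<open>o\<close> for every slot at once: \<open>base\<close> is the
  cost when nothing is swapped out, and \<open>loss i\<close> what the samples nearest to slot \<open>i\<close> pay in addition
  for falling back to their second nearest center \<open>d2\<close>.
\<close>

definition swap_cost_prog :: stm where
  "swap_cost_prog = RS ''base'' (WConst 0) (OfWord (WConst 0)) ;; clear_prog ;; FOR ''j'' ''N'' (
     RS ''dd'' (WConst 0) (rpow (sdist (var ''j'') (var ''o''))) ;;
     min_prog ''mn'' ''d1'' ;; min_prog ''mm'' ''d2'' ;;
     RS ''base'' (WConst 0) (RPlus (RGet ''base'' (WConst 0)) (RTimes (OfWord (WGet ''w'' (var ''j''))) (RGet ''mn'' (WConst 0)))) ;;
     RS ''loss'' (WGet ''id'' (var ''j'')) (RPlus (RGet ''loss'' (WGet ''id'' (var ''j'')))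
       (RTimes (OfWord (WGet ''w'' (var ''j''))) (RMinus (RGet ''mm'' (WConst 0)) (RGet ''mn'' (WConst 0))))))"

abbreviation swap_exp :: rexp where
  "swap_exp \<equiv> RPlus (RGet ''base'' (WConst 0)) (RGet ''loss'' (var ''i''))"

definition choose_prog :: stm where
  "choose_prog = FOR ''i'' ''k'' (IF (RLess swap_exp (RGet ''bc'' (WConst 0)))
     (RS ''bc'' (WConst 0) swap_exp ;; WS ''bi'' (WConst 0) (var ''i'') ;; WS ''bo'' (WConst 0) (var ''o'')) NOP)"

text \<open>The search starts from the swap of slot 0 with its own content, so that nothing changes
  if no swap lowers the cost.\<close>

definition improve_prog :: stm where
  "improve_prog = near_prog ;; cost_prog ;; WS ''bi'' (WConst 0) (WConst 0) ;;
     WS ''bo'' (WConst 0) (WGet ''F'' (WConst 0)) ;; FOR ''o'' ''N'' (swap_cost_prog ;; choose_prog) ;;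
     WS ''F'' (var ''bi'') (var ''bo'')"

definition centers_prog :: stm where
  "centers_prog = FOR ''i'' ''k'' (WS ''centers'' (var ''i'') (WGet ''smp'' (WGet ''F'' (var ''i''))))"

abbreviation asg_dist :: rexp where
  "asg_dist \<equiv> sdist (WGet ''A'' (var ''x'')) (WGet ''F'' (var ''i''))"

definition assign_prog :: stm where
  "assign_prog = RS ''dd'' (WConst 0) big_exp ;; FOR ''i'' ''k'' (
     IF (RLess asg_dist (RGet ''dd'' (WConst 0)))
       (RS ''dd'' (WConst 0) asg_dist ;; WS ''assignment'' (var ''x'') (WGet ''smp'' (WGet ''F'' (var ''i'')))) NOP)"

definition cluster_prog :: stm where
  "cluster_prog = count_points_prog ;; FOR ''it'' ''I'' improve_prog ;; centers_prog ;; FOR ''x'' ''n'' assign_prog"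

lemma cluster_mods [simp]:
  "mods (min_prog a b) = {a}"
  "mods count_points_prog = {''x'', ''w''}"
  "mods near1_prog = {''d1'', ''i'', ''dd'', ''id''}"
  "mods near2_prog = {''d2'', ''i'', ''dd''}"
  "mods near_prog = {''j'', ''d1'', ''d2'', ''i'', ''dd'', ''id''}"
  "mods cost_prog = {''bc'', ''j''}"
  "mods clear_prog = {''i'', ''loss''}"
  "mods swap_cost_prog = {''base'', ''i'', ''loss'', ''j'', ''dd'', ''mn'', ''mm''}"
  "mods choose_prog = {''i'', ''bc'', ''bi'', ''bo''}"
  "mods improve_prog = {''j'', ''d1'', ''d2'', ''i'', ''dd'', ''id'', ''bc'', ''bi'', ''bo'', ''o'',
     ''base'', ''loss'', ''mn'', ''mm'', ''F''}"
  "mods centers_prog = {''i'', ''centers''}"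
  "mods assign_prog = {''dd'', ''i'', ''assignment''}"
  by (auto simp: min_prog_def count_points_prog_def near1_prog_def near2_prog_def near_prog_def cost_prog_def clear_prog_def
      swap_cost_prog_def choose_prog_def improve_prog_def centers_prog_def assign_prog_def)

section \<open>Correctness of the local search program\<close>

context machine
begin

definition sampled :: "nat list \<Rightarrow> 's state \<Rightarrow> bool" where
  "sampled h s \<longleftrightarrow> pars s \<and> set h \<subseteq> {..<n} \<and> length h = N \<and> holds_symbols h s"

lemma sampled_agree:
  "agree X t s \<Longrightarrow> X \<inter> {''n'', ''k'', ''z'', ''N'', ''m'', ''M'', ''J'', ''I'', ''lam'', ''cap'', ''sym''} = {} \<Longrightarrow>
    sampled h s \<Longrightarrow> sampled h t"
  using pars_agree[of X t s] holds_symbols_cong[of t s] agreeD(3)[of X t s "''sym''"]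
  by (auto simp: sampled_def)

lemma sampled_sets [simp]:
  "a \<notin> {''n'', ''k'', ''z'', ''N'', ''m'', ''M'', ''J'', ''I'', ''lam'', ''cap''} \<Longrightarrow> sampled h (wset a i v s) = sampled h s"
  "sampled h (rset a i r s) = sampled h s"
  by (simp_all add: sampled_def holds_symbols_def)

definition dz :: "nat list \<Rightarrow> nat \<Rightarrow> nat \<Rightarrow> real" where
  "dz h i j = d (rev h ! i) (rev h ! j) ^ z"

definition big :: real where "big = Lam * Lam + 1"

lemma history_nth: "set h \<subseteq> {..<n} \<Longrightarrow> i < length h \<Longrightarrow> rev h ! i < n"
  using nth_mem[of i "rev h"] by auto

lemma dz_less_big: "set h \<subseteq> {..<n} \<Longrightarrow> i < length h \<Longrightarrow> j < length h \<Longrightarrow> dz h i j < big"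
proof -
  assume *: "set h \<subseteq> {..<n}" "i < length h" "j < length h"
  have "d (rev h ! i) (rev h ! j) \<le> Lam" using * history_nth by (intro d_le_Lam) auto
  then have "dz h i j \<le> Lam ^ z" unfolding dz_def by (intro power_mono d_nonneg)
  also have "\<dots> \<le> Lam * Lam" using z Lam mult_right_mono[of 1 Lam Lam] by (auto simp: power2_eq_square)
  finally show ?thesis by (simp add: big_def)
qed

lemma rval_dz:
  assumes "sampled h s" "wval s e < N" "wval s f < N"
  shows "rval orc s (rpow (sdist e f)) = dz h (wval s e) (wval s f)"
  using rval_rpow[of s z orc "sdist e f"] rval_sdist[of h s e f] assms z
  by (simp add: sampled_def pars_def dz_def del: rval.simps)

lemma rval_big: "sampled h s \<Longrightarrow> rval orc s big_exp = big"
  unfolding big_def using L by (simp add: sampled_def pars_def)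

lemma count_points_spec:
  assumes "sampled h s" "words s ''w'' = (\<lambda>_. 0)"
  shows "words (dsem orc count_points_prog s) ''w'' j = card {x. x < n \<and> words s ''A'' x = j}"
proof -
  let ?S = "\<lambda>i j. {x. x < i \<and> words s ''A'' x = j}"
  let ?I = "\<lambda>i u. \<forall>j. words u ''w'' j = card (?S i j)"
  have "?I n (dsem orc count_points_prog s)"
    unfolding count_points_prog_def
  proof (rule dsem_FOR[where I = ?I], goal_cases)
    case (4 i u)
    have ag: "agree {''x'', ''w''} u s" using 4(4) by simp
    have u: "words u ''A'' = words s ''A''" "words u ''cap'' 0 = V"
      using ag assms by (auto simp: agree_def sampled_def pars_def)
    let ?a = "words s ''A'' i"
    have S: "?S (Suc i) j = (if j = ?a then insert i (?S i j) else ?S i j)" for j by (auto simp: less_Suc_eq)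
    have c: "card (?S (Suc i) j) = (if j = ?a then Suc (card (?S i j)) else card (?S i j))" for j
      unfolding S by simp
    have "card (?S (Suc i) ?a) \<le> card {..<n}" using 4(1) by (intro card_mono) auto
    then have "Suc (card (?S i ?a)) \<le> n" unfolding c by simp
    moreover have "n \<le> n * 2 ^ J" by simp
    ultimately have "Suc (card (?S i ?a)) \<le> V" using V(1) by linarith
    then show ?case unfolding c using 4(2,3) u by (simp add: upd_apply)
  qed (use assms in \<open>auto simp: sampled_def pars_def upd_apply\<close>)
  then show ?thesis by simp
qed

lemma near1_spec:
  assumes s: "sampled h s" and F: "\<And>i. i < k \<Longrightarrow> words s ''F'' i < N" and j: "words s ''j'' 0 = j" "j < N"
  defines "s' \<equiv> dsem orc near1_prog s"
  shows "\<exists>i<k. words s' ''id'' = (words s ''id'')(j := i) \<and>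
     dz h j (words s ''F'' i) = Min ((\<lambda>i. dz h j (words s ''F'' i)) ` {..<k}) \<and>
     reals s' ''d1'' = (reals s ''d1'')(j := Min ((\<lambda>i. dz h j (words s ''F'' i)) ` {..<k}))"
proof -
  let ?e = "\<lambda>i. dz h j (words s ''F'' i)"
  let ?I = "\<lambda>i u. reals u ''d1'' = (reals s ''d1'')(j := if i = 0 then big else Min (?e ` {..<i})) \<and>
     (if i = 0 then words u ''id'' = words s ''id''
      else (\<exists>i'<i. words u ''id'' = (words s ''id'')(j := i') \<and> ?e i' = Min (?e ` {..<i})))"
  have eb: "?e i < big" if "i < k" for i
    using dz_less_big[of h j "words s ''F'' i"] s F[OF that] j by (simp add: sampled_def)
  have "?I k s'"
    unfolding s'_def near1_prog_def dsem.simps(6)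
  proof (rule dsem_FOR[where I = ?I], goal_cases)
    case (4 i u)
    have ag: "agree {''i'', ''dd'', ''d1'', ''id''} u s"
      using 4(4) by (auto simp: agree_def upd_other)
    have su: "sampled h u" using sampled_agree[OF ag] s by simp
    have u: "words u ''F'' = words s ''F''" "words u ''j'' 0 = j" using ag j by (auto simp: agree_def)
    have e: "rval orc u slot_dist = ?e i"
      using rval_dz[OF su, of "var ''j''" "WGet ''F'' (var ''i'')"] u 4(3) F[OF 4(1)] j(2)
      by (simp del: rval.simps)
    define Q where "Q = (if i = 0 then big else Min (?e ` {..<i}))"
    have D: "reals u ''d1'' = (reals s ''d1'')(j := Q)" using 4(2) by (simp only: Q_def)
    have M: "Min (?e ` {..<Suc i}) = (if ?e i < Q then ?e i else Q)"
    proof (cases "i = 0")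
      case True
      then show ?thesis using eb[OF 4(1)] by (simp add: Q_def lessThan_Suc)
    next
      case False
      then have "Min (?e ` {..<Suc i}) = min (?e i) (Min (?e ` {..<i}))"
        by (simp add: lessThan_Suc lessThan_empty_iff)
      then show ?thesis using False by (simp add: Q_def min_def)
    qed
    show ?case
    proof (cases "?e i < Q")
      case True
      then show ?thesis using 4(3) e D u unfolding M
        by (auto simp: upd_def fun_eq_iff simp del: rval.simps(3) intro!: exI[of _ i] split: if_splits)
           (use 4(2) in \<open>auto split: if_splits\<close>)
    next
      case False
      have "i \<noteq> 0"
      proof
        assume "i = 0"
        then show False using False eb[OF 4(1)] by (simp add: Q_def)
      qed
      then obtain i' where "i' < i" "words u ''id'' = (words s ''id'')(j := i')" "?e i' = Q"
        using 4(2) by (auto simp: Q_def)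
      then show ?thesis using 4(3) e D u False unfolding M
        by (auto simp: upd_apply upd_other simp del: rval.simps(3) intro!: exI[of _ i'])
    qed
  qed (use s rval_big[OF s] j in \<open>auto simp: sampled_def pars_def upd_other upd_def fun_eq_iff simp del: rval.simps\<close>)
  then show ?thesis using k by auto
qed

lemma near2_spec:
  assumes s: "sampled h s" and F: "\<And>i. i < k \<Longrightarrow> words s ''F'' i < N" and j: "words s ''j'' 0 = j" "j < N"
  shows "reals (dsem orc near2_prog s) ''d2'' = (reals s ''d2'')
    (j := Min (insert big ((\<lambda>i. dz h j (words s ''F'' i)) ` ({..<k} - {words s ''id'' j}))))"
proof -
  let ?e = "\<lambda>i. dz h j (words s ''F'' i)"
  let ?q = "words s ''id'' j"
  let ?S = "\<lambda>i. insert big (?e ` ({..<i} - {?q}))"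
  let ?I = "\<lambda>i u. reals u ''d2'' = (reals s ''d2'')(j := Min (?S i))"
  show ?thesis
    unfolding near2_prog_def dsem.simps(6)
  proof (rule dsem_FOR[where I = ?I], goal_cases)
    case (4 i u)
    have ag: "agree {''i'', ''dd'', ''d2''} u s" using 4(4) by (auto simp: agree_def upd_other)
    have su: "sampled h u" using sampled_agree[OF ag] s by simp
    have u: "words u ''F'' = words s ''F''" "words u ''j'' 0 = j" "words u ''id'' = words s ''id''"
      using ag j by (auto simp: agree_def)
    have e: "rval orc u slot_dist = ?e i"
      using rval_dz[OF su, of "var ''j''" "WGet ''F'' (var ''i'')"] u 4(3) F[OF 4(1)] j(2)
      by (simp del: rval.simps)
    define Q where "Q = Min (?S i)"
    have D: "reals u ''d2'' = (reals s ''d2'')(j := Q)" using 4(2) by (simp only: Q_def)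
    have S: "?S (Suc i) = (if i \<noteq> ?q then insert (?e i) (?S i) else ?S i)" by (auto simp: less_Suc_eq)
    have M: "Min (?S (Suc i)) = (if i \<noteq> ?q \<and> ?e i < Q then ?e i else Q)"
    proof (cases "i = ?q")
      case False
      then have "Min (?S (Suc i)) = min (?e i) Q"
        unfolding S Q_def by (simp only: if_True not_False_eq_True) (rule Min_insert, auto)
      then show ?thesis using False by (simp add: min_def)
    next
      case True
      then have "?S (Suc i) = ?S i" using S by simp
      then show ?thesis using True by (simp add: Q_def)
    qed
    have neq: "(\<not> (\<not> a < b \<and> \<not> b < a)) = (a \<noteq> b)" for a b :: nat by auto
    show ?case unfolding M using 4(3) e D u
      by (auto simp: upd_def fun_eq_iff neq simp del: rval.simps(3) de_Morgan_conj not_less)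
  qed (use s rval_big[OF s] j in \<open>auto simp: sampled_def pars_def upd_other upd_def fun_eq_iff simp del: rval.simps\<close>)
qed

lemma near_spec:
  assumes s: "sampled h s" and F: "\<And>i. i < k \<Longrightarrow> words s ''F'' i < N"
  defines "s' \<equiv> dsem orc near_prog s" and "e \<equiv> \<lambda>j i. dz h j (words s ''F'' i)"
  shows "\<forall>j<N. words s' ''id'' j < k \<and> e j (words s' ''id'' j) = Min (e j ` {..<k}) \<and>
    reals s' ''d1'' j = Min (e j ` {..<k}) \<and>
    reals s' ''d2'' j = Min (insert big (e j ` ({..<k} - {words s' ''id'' j})))"
proof -
  let ?I = "\<lambda>i u. \<forall>j<i. words u ''id'' j < k \<and> e j (words u ''id'' j) = Min (e j ` {..<k}) \<and>
    reals u ''d1'' j = Min (e j ` {..<k}) \<and>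
    reals u ''d2'' j = Min (insert big (e j ` ({..<k} - {words u ''id'' j})))"
  show ?thesis
    unfolding s'_def near_prog_def
  proof (rule dsem_FOR[where I = ?I], goal_cases)
    case (4 j u)
    have ag: "agree {''j'', ''d1'', ''d2'', ''i'', ''dd'', ''id''} u s" using 4(4) by (auto simp: agree_def)
    have su: "sampled h u" using sampled_agree[OF ag] s by simp
    have uF: "words u ''F'' = words s ''F''" using ag by (auto simp: agree_def)
    define v where "v = dsem orc near1_prog u"
    have sv: "sampled h v" using sampled_agree[OF dsem_agree[of near1_prog orc u]] su by (simp add: v_def)
    have vF: "words v ''F'' = words s ''F''" "words v ''j'' = words u ''j''" "reals v ''d2'' = reals u ''d2''"
      using uF by (simp_all add: v_def dsem_words dsem_reals)
    obtain i where i: "i < k" "words v ''id'' = (words u ''id'')(j := i)" "e j i = Min (e j ` {..<k})"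
      "reals v ''d1'' = (reals u ''d1'')(j := Min (e j ` {..<k}))"
      using near1_spec[OF su _ 4(3,1)] F uF by (auto simp: v_def e_def)
    define w where "w = dsem orc near2_prog v"
    have d2: "reals w ''d2'' = (reals v ''d2'')(j := Min (insert big (e j ` ({..<k} - {i}))))"
      unfolding w_def using near2_spec[OF sv, of j] F vF 4(1,3) i(2) by (simp add: e_def del: Min_insert)
    have w: "words w ''id'' = words v ''id''" "reals w ''d1'' = reals v ''d1''"
      by (simp_all add: w_def dsem_words dsem_reals)
    show ?case
      unfolding dsem.simps(6) v_def[symmetric] w_def[symmetric]
      using 4(2) d2 w i vF(3) by (auto simp: less_Suc_eq simp del: Min_insert)
  qed (use s in \<open>auto simp: sampled_def pars_def upd_other\<close>)
qed

definition index_cost :: "nat list \<Rightarrow> (nat \<Rightarrow> nat) \<Rightarrow> (nat \<Rightarrow> nat) \<Rightarrow> real" where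
  "index_cost h w H = (\<Sum>j<N. real (w j) * Min ((\<lambda>i. dz h j (H i)) ` {..<k}))"

text \<open>The new center may be closer, and if slot i was the nearest one, the point falls back to
  the second nearest. For k = 1 the latter is replaced by \<open>big\<close>, which loses against
  x.\<close>

lemma swap_min:
  fixes e :: "nat \<Rightarrow> real"
  assumes q: "q < k" "e q = Min (e ` {..<k})" and i: "i < k" and x: "x < big"
  shows "Min ((e(i := x)) ` {..<k}) =
    min x (if q = i then Min (insert big (e ` ({..<k} - {q}))) else Min (e ` {..<k}))"
proof -
  have "{..<k} = insert i ({..<k} - {i})" using i by auto
  then have "(e(i := x)) ` {..<k} = insert x (e ` ({..<k} - {i}))"
    by (metis (no_types, lifting) Diff_iff fun_upd_apply image_cong image_insert insertI1)
  then have L: "Min ((e(i := x)) ` {..<k}) = Min (insert x (e ` ({..<k} - {i})))" by simp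
  show ?thesis
  proof (cases "q = i")
    case True
    show ?thesis
    proof (cases "{..<k} - {i} = {}")
      case empty: True
      show ?thesis unfolding L True empty using x by (simp add: min_def)
    next
      case False
      then have "Min (insert y (e ` ({..<k} - {i}))) = min y (Min (e ` ({..<k} - {i})))" for y
        by (intro Min_insert) auto
      then show ?thesis unfolding L True using x by (simp add: min_def)
    qed
  next
    case False
    have "e q \<in> e ` ({..<k} - {i})" using False q(1) by auto
    moreover have "e q \<le> v" if "v \<in> e ` ({..<k} - {i})" for v
      using that unfolding q(2) by (intro Min_le) auto
    ultimately have "Min (e ` ({..<k} - {i})) = e q" by (intro Min_eqI) auto
    moreover have "e ` ({..<k} - {i}) \<noteq> {}" using False q by auto
    ultimately show ?thesis unfolding L using False q by simp
  qed
qed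

lemma cost_spec:
  assumes s: "sampled h s"
  shows "reals (dsem orc cost_prog s) ''bc'' 0 = (\<Sum>j<N. real (words s ''w'' j) * reals s ''d1'' j)"
proof -
  let ?I = "\<lambda>i u. reals u ''bc'' 0 = (\<Sum>j<i. real (words s ''w'' j) * reals s ''d1'' j)"
  show ?thesis
    unfolding cost_prog_def dsem.simps(6)
  proof (rule dsem_FOR[where I = ?I], goal_cases)
    case (4 i u)
    have "words u ''w'' = words s ''w''" "reals u ''d1'' = reals s ''d1''"
      using 4(4) by (auto simp: agree_def upd_other)
    then show ?case using 4(2,3) by (simp add: upd_apply)
  qed (use s in \<open>auto simp: sampled_def pars_def upd_apply\<close>)
qed

lemma clear_spec:
  assumes s: "sampled h s"
  shows "\<forall>i<k. reals (dsem orc clear_prog s) ''loss'' i = 0"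
proof -
  let ?I = "\<lambda>i u. \<forall>i'<i. reals u ''loss'' i' = 0"
  show ?thesis
    unfolding clear_prog_def
    by (rule dsem_FOR[where I = ?I]) (use s in \<open>auto simp: sampled_def pars_def upd_apply less_Suc_eq\<close>)
qed

lemma swap_cost_spec:
  assumes s: "sampled h s" and ow: "words s ''o'' 0 = x" "x < N"
    and id: "\<And>j. j < N \<Longrightarrow> words s ''id'' j < k"
  defines "s' \<equiv> dsem orc swap_cost_prog s"
  shows "\<forall>i<k. reals s' ''base'' 0 + reals s' ''loss'' i =
    (\<Sum>j<N. real (words s ''w'' j) * min (dz h j x) (if words s ''id'' j = i then reals s ''d2'' j else reals s ''d1'' j))"
proof -
  let ?w = "\<lambda>j. real (words s ''w'' j)"
  let ?a = "\<lambda>j. min (dz h j x) (reals s ''d1'' j)"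
  let ?b = "\<lambda>j. min (dz h j x) (reals s ''d2'' j)"
  let ?I = "\<lambda>j u. reals u ''base'' 0 = (\<Sum>j'<j. ?w j' * ?a j') \<and>
    (\<forall>i<k. reals u ''loss'' i = (\<Sum>j'<j. if words s ''id'' j' = i then ?w j' * (?b j' - ?a j') else 0))"
  have "?I N s'"
    unfolding s'_def swap_cost_prog_def dsem.simps(6)
  proof (rule dsem_FOR[where I = ?I], goal_cases)
    case (4 j u)
    have ag: "agree {''j'', ''dd'', ''mn'', ''mm'', ''base'', ''loss'', ''i''} u s"
      by (rule agree_trans[OF agree_mono[OF 4(4)] agree_trans[OF agree_mono[OF dsem_agree[of clear_prog]]]])
         (auto intro: agree_sets)
    have su: "sampled h u" using sampled_agree[OF ag] s by simp
    have u: "words u ''w'' = words s ''w''" "reals u ''d1'' = reals s ''d1''" "reals u ''d2'' = reals s ''d2''"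
      "words u ''id'' = words s ''id''" "words u ''o'' 0 = x"
      using ag ow by (auto simp: agree_def)
    have e: "rval orc u (rpow (sdist (var ''j'') (var ''o''))) = dz h j x"
      using rval_dz[OF su, of "var ''j''" "var ''o''"] u 4(1,3) ow(2) by (simp del: rval.simps)
    show ?case using 4(2,3) e u id[OF 4(1)]
      by (auto simp: min_prog_spec upd_apply simp del: rval.simps(3))
  next
    case 2
    then show ?case using s by (auto simp: sampled_def pars_def dsem_words upd_apply)
  next
    case 3
    show ?case using clear_spec[of h "rset ''base'' 0 0 s"] s by (simp add: dsem_reals upd_apply)
  qed (auto simp: upd_apply)
  then have I: "?I N s'" .
  show ?thesis
  proof (intro allI impI)
    fix i assume "i < k"
    then have "reals s' ''base'' 0 + reals s' ''loss'' i =
        (\<Sum>j<N. ?w j * ?a j + (if words s ''id'' j = i then ?w j * (?b j - ?a j) else 0))"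
      using I by (simp add: sum.distrib)
    also have "\<dots> = (\<Sum>j<N. ?w j * min (dz h j x) (if words s ''id'' j = i then reals s ''d2'' j else reals s ''d1'' j))"
      by (intro sum.cong) (auto simp: algebra_simps)
    finally show "reals s' ''base'' 0 + reals s' ''loss'' i =
        (\<Sum>j<N. ?w j * min (dz h j x) (if words s ''id'' j = i then reals s ''d2'' j else reals s ''d1'' j))" .
  qed
qed

lemma choose_spec:
  assumes s: "sampled h s" and ow: "words s ''o'' 0 = x"
  defines "s' \<equiv> dsem orc choose_prog s" and "c \<equiv> \<lambda>i. reals s ''base'' 0 + reals s ''loss'' i"
  shows "reals s' ''bc'' 0 \<le> reals s ''bc'' 0 \<and> (\<forall>i<k. reals s' ''bc'' 0 \<le> c i) \<and>
    ((reals s' ''bc'' 0 = reals s ''bc'' 0 \<and> words s' ''bi'' 0 = words s ''bi'' 0 \<and> words s' ''bo'' 0 = words s ''bo'' 0) \<or>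
     (\<exists>i<k. reals s' ''bc'' 0 = c i \<and> words s' ''bi'' 0 = i \<and> words s' ''bo'' 0 = x))"
proof -
  let ?I = "\<lambda>i u. reals u ''bc'' 0 \<le> reals s ''bc'' 0 \<and> (\<forall>i'<i. reals u ''bc'' 0 \<le> c i') \<and>
    ((reals u ''bc'' 0 = reals s ''bc'' 0 \<and> words u ''bi'' 0 = words s ''bi'' 0 \<and> words u ''bo'' 0 = words s ''bo'' 0) \<or>
     (\<exists>i<k. reals u ''bc'' 0 = c i \<and> words u ''bi'' 0 = i \<and> words u ''bo'' 0 = x))"
  show ?thesis
    unfolding s'_def choose_prog_def
  proof (rule dsem_FOR[where I = ?I], goal_cases)
    case (4 i u)
    have u: "reals u ''base'' = reals s ''base''" "reals u ''loss'' = reals s ''loss''" "words u ''o'' 0 = x"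
      using 4(4) ow by (auto simp: agree_def)
    have e: "rval orc u swap_exp = c i" using u 4(3) by (simp add: c_def)
    show ?case
    proof (cases "c i < reals u ''bc'' 0")
      case True
      then have "dsem orc (IF (RLess swap_exp (RGet ''bc'' (WConst 0)))
         (RS ''bc'' (WConst 0) swap_exp ;; WS ''bi'' (WConst 0) (var ''i'') ;; WS ''bo'' (WConst 0) (var ''o'')) NOP) u
         = wset ''bo'' 0 x (wset ''bi'' 0 i (rset ''bc'' 0 (c i) u))"
        using e u(3) 4(3) by (simp add: upd_other del: rval.simps(4))
      then show ?thesis using True 4(1,2) by (simp add: upd_apply less_Suc_eq) force
    next
      case False
      then have "dsem orc (IF (RLess swap_exp (RGet ''bc'' (WConst 0)))
         (RS ''bc'' (WConst 0) swap_exp ;; WS ''bi'' (WConst 0) (var ''i'') ;; WS ''bo'' (WConst 0) (var ''o'')) NOP) u = u"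
        using e by (simp del: rval.simps(4))
      then show ?thesis using False 4(2) by (auto simp: less_Suc_eq)
    qed
  qed (use s in \<open>auto simp: sampled_def pars_def upd_apply\<close>)
qed

text \<open>The invariant couples \<open>bc\<close> with the recorded swap: it is the exact cost of
  this swap, and no larger than that of any swap tried so far.\<close>

lemma improve_spec:
  assumes s: "sampled h s" and F: "\<And>i. i < k \<Longrightarrow> words s ''F'' i < N"
  defines "F' \<equiv> words (dsem orc improve_prog s) ''F''"
  shows "\<forall>i<k. F' i < N"
    "i < k \<Longrightarrow> x < N \<Longrightarrow> index_cost h (words s ''w'') F' \<le> index_cost h (words s ''w'') ((words s ''F'')(i := x))"
proof -
  let ?F = "words s ''F''" let ?w = "words s ''w''"
  let ?c = "index_cost h ?w"
  define s1 where "s1 = dsem orc near_prog s"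
  define s2 where "s2 = dsem orc cost_prog s1"
  define s3 where "s3 = wset ''bo'' 0 (?F 0) (wset ''bi'' 0 0 s2)"
  let ?body = "swap_cost_prog ;; choose_prog"
  have s1: "sampled h s1" using sampled_agree[OF dsem_agree[of near_prog orc s]] s by (simp add: s1_def)
  have s2: "sampled h s2" using sampled_agree[OF dsem_agree[of cost_prog orc s1]] s1 by (simp add: s2_def)
  have s3: "sampled h s3" using s2 by (simp add: s3_def)
  note near = near_spec[OF s F, folded s1_def]
  have k0: "0 < k" using k by simp
  have w: "words s1 ''w'' = ?w" "words s2 ''F'' = ?F" by (simp_all add: s1_def s2_def dsem_words)
  have r: "words s3 ''w'' = ?w" "words s3 ''F'' = ?F" "words s3 ''id'' = words s1 ''id''" "reals s3 ''d1'' = reals s1 ''d1''"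
     "reals s3 ''d2'' = reals s1 ''d2''" "reals s3 ''bc'' = reals s2 ''bc''" "words s3 ''bi'' 0 = 0" "words s3 ''bo'' 0 = ?F 0"
    by (simp_all add: s3_def s2_def s1_def dsem_words dsem_reals upd_other upd_apply)
  have bc: "reals s2 ''bc'' 0 = ?c ?F"
    using cost_spec[OF s1] near w by (simp add: s2_def index_cost_def)
  let ?I = "\<lambda>x u. words u ''bi'' 0 < k \<and> words u ''bo'' 0 < N \<and>
     reals u ''bc'' 0 = ?c (?F(words u ''bi'' 0 := words u ''bo'' 0)) \<and>
     (\<forall>x'<x. \<forall>i<k. reals u ''bc'' 0 \<le> ?c (?F(i := x')))"
  define s4 where "s4 = dsem orc (FOR ''o'' ''N'' ?body) s3"
  have I: "?I N s4"
    unfolding s4_def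
  proof (rule dsem_FOR[where I = ?I], goal_cases)
    case (4 x u)
    have ag: "agree {''o'', ''base'', ''i'', ''loss'', ''j'', ''dd'', ''mn'', ''mm'', ''bc'', ''bi'', ''bo''} u s3"
      using 4(4) by (auto simp: agree_def)
    have su: "sampled h u" using sampled_agree[OF ag] s3 by simp
    have u: "words u ''w'' = ?w" "words u ''id'' = words s1 ''id''" "reals u ''d1'' = reals s1 ''d1''" "reals u ''d2'' = reals s1 ''d2''"
      using ag r by (auto simp: agree_def)
    define v where "v = dsem orc swap_cost_prog u"
    have sv: "sampled h v" using sampled_agree[OF dsem_agree[of swap_cost_prog orc u]] su by (simp add: v_def)
    have v: "words v ''o'' 0 = x" "reals v ''bc'' = reals u ''bc''" "words v ''bi'' = words u ''bi''" "words v ''bo'' = words u ''bo''"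
      using 4(3) by (simp_all add: v_def dsem_words dsem_reals)
    have c: "reals v ''base'' 0 + reals v ''loss'' i = ?c (?F(i := x))" if i: "i < k" for i
    proof -
      have "\<And>j. j < N \<Longrightarrow> words u ''id'' j < k" using near u by simp
      then have "reals v ''base'' 0 + reals v ''loss'' i =
        (\<Sum>j<N. real (?w j) * min (dz h j x) (if words u ''id'' j = i then reals u ''d2'' j else reals u ''d1'' j))"
        unfolding v_def using swap_cost_spec[OF su 4(3) 4(1)] u(1) i by simp
      also have "\<dots> = ?c (?F(i := x))"
        unfolding index_cost_def
      proof (intro sum.cong refl arg_cong2[of _ _ _ _ "(*)"])
        fix j assume "j \<in> {..<N}"
        then have j: "j < N" by simp
        let ?e = "\<lambda>i. dz h j (?F i)"
        have n: "words s1 ''id'' j < k" "?e (words s1 ''id'' j) = Min (?e ` {..<k})"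
          "reals s1 ''d1'' j = Min (?e ` {..<k})"
          "reals s1 ''d2'' j = Min (insert big (?e ` ({..<k} - {words s1 ''id'' j})))"
          using near j by blast+
        have "dz h j x < big" using dz_less_big[of h j x] su j 4(1) by (simp add: sampled_def)
        note m = swap_min[OF n(1,2) i this]
        have "?e(i := dz h j x) = (\<lambda>i'. dz h j ((?F(i := x)) i'))" by auto
        then show "min (dz h j x) (if words u ''id'' j = i then reals u ''d2'' j else reals u ''d1'' j) =
            Min ((\<lambda>i'. dz h j ((?F(i := x)) i')) ` {..<k})"
          using m n(3,4) u by (simp del: Min_insert)
      qed
      finally show ?thesis .
    qed
    note ch = choose_spec[OF sv v(1)]
    have "reals (dsem orc choose_prog v) ''bc'' 0 \<le> ?c (?F(i := x'))" if "x' < Suc x" "i < k" for x' i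
    proof (cases "x' = x")
      case True
      show ?thesis using conjunct1[OF conjunct2[OF ch], rule_format, OF that(2)] c[OF that(2)]
        unfolding True by linarith
    next
      case False
      then have "x' < x" using that by simp
      then have "reals u ''bc'' 0 \<le> ?c (?F(i := x'))" using 4(2) that by blast
      then show ?thesis using conjunct1[OF ch] unfolding v(2) by linarith
    qed
    moreover have "words (dsem orc choose_prog v) ''bi'' 0 < k \<and> words (dsem orc choose_prog v) ''bo'' 0 < N \<and>
      reals (dsem orc choose_prog v) ''bc'' 0 =
        ?c (?F(words (dsem orc choose_prog v) ''bi'' 0 := words (dsem orc choose_prog v) ''bo'' 0))"
      using conjunct2[OF conjunct2[OF ch]]
    proof (elim disjE exE conjE, goal_cases)
      case 1
      then show ?case using 4(2) v(2-4) by (simp del: fun_upd_apply)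
    next
      case (2 i)
      then show ?case using c[of i] 4(1) by (simp del: fun_upd_apply)
    qed
    ultimately show ?case by (simp add: v_def[symmetric] del: fun_upd_apply)
  next
    case 3
    show ?case using r bc k0 F[OF k0] by simp
  qed (use s3 in \<open>auto simp: sampled_def pars_def upd_other\<close>)
  have s4F: "words s4 ''F'' = ?F" using r(2) by (simp add: s4_def dsem_words del: dsem.simps)
  have F': "F' = ?F(words s4 ''bi'' 0 := words s4 ''bo'' 0)"
    unfolding F'_def improve_prog_def dsem.simps(6) s1_def[symmetric] s2_def[symmetric]
    using s4F w(2) by (simp add: s3_def s4_def upd_def fun_eq_iff del: dsem.simps(8))
  show "\<forall>i<k. F' i < N" using I F unfolding F' by simp
  show "?c F' \<le> ?c (?F(i := x))" if "i < k" "x < N"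
    using I that unfolding F' by metis
qed

definition hdist :: "nat list \<Rightarrow> nat \<Rightarrow> nat \<Rightarrow> real" where
  "hdist h i j = d (rev h ! i) (rev h ! j)"

definition slots_cost :: "nat list \<Rightarrow> (nat \<Rightarrow> nat) \<Rightarrow> (nat \<Rightarrow> nat) \<Rightarrow> real" where
  "slots_cost h a H = (\<Sum>x<n. nearest_dist (hdist h) k H (a x) ^ z)"

lemma nearest_dist_nonneg: "0 \<le> nearest_dist (hdist h) k H j"
proof -
  obtain i where "nearest_dist (hdist h) k H j = hdist h j (H i)" by (rule nearest_dist_attained[OF k])
  then show ?thesis by (simp add: hdist_def d_nonneg)
qed

lemma Min_dz: "Min ((\<lambda>i. dz h j (H i)) ` {..<k}) = nearest_dist (hdist h) k H j ^ z"
proof (rule Min_eqI)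
  obtain i where i: "i < k" "nearest_dist (hdist h) k H j = hdist h j (H i)" by (rule nearest_dist_attained[OF k])
  then show "nearest_dist (hdist h) k H j ^ z \<in> (\<lambda>i. dz h j (H i)) ` {..<k}"
    by (auto simp: dz_def hdist_def)
  fix y assume "y \<in> (\<lambda>i. dz h j (H i)) ` {..<k}"
  then obtain i where "i < k" "y = hdist h j (H i) ^ z" by (auto simp: dz_def hdist_def)
  then show "nearest_dist (hdist h) k H j ^ z \<le> y"
    using nearest_dist_le[of i k "hdist h" H j] nearest_dist_nonneg by (auto intro: power_mono)
qed simp

lemma index_cost_eq:
  assumes a: "\<And>x. x < n \<Longrightarrow> a x < N" and w: "\<And>j. w j = card {x. x < n \<and> a x = j}"
  shows "index_cost h w H = slots_cost h a H"
proof -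
  let ?g = "\<lambda>j. nearest_dist (hdist h) k H j ^ z"
  have "index_cost h w H = (\<Sum>j<N. \<Sum>x\<in>{x \<in> {..<n}. a x = j}. ?g (a x))"
    unfolding index_cost_def Min_dz w by (intro sum.cong) auto
  also have "\<dots> = slots_cost h a H"
    unfolding slots_cost_def using a by (intro sum.group) auto
  finally show ?thesis .
qed

lemma centers_spec:
  assumes s: "sampled h s"
  shows "\<forall>i<k. words (dsem orc centers_prog s) ''centers'' i = words s ''smp'' (words s ''F'' i)"
proof -
  let ?I = "\<lambda>i u. \<forall>i'<i. words u ''centers'' i' = words s ''smp'' (words s ''F'' i')"
  show ?thesis
    unfolding centers_prog_def
  proof (rule dsem_FOR[where I = ?I], goal_cases)
    case (4 i u)
    then have "words u ''smp'' = words s ''smp''" "words u ''F'' = words s ''F''" by (auto simp: agree_def)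
    then show ?case using 4(2,3) by (auto simp: upd_apply less_Suc_eq)
  qed (use s in \<open>auto simp: sampled_def pars_def upd_apply\<close>)
qed

lemma assign_spec:
  assumes s: "sampled h s" and F: "\<And>i. i < k \<Longrightarrow> words s ''F'' i < N" and x: "words s ''x'' 0 = x"
    and a: "words s ''A'' x < N"
  defines "s' \<equiv> dsem orc assign_prog s"
  shows "\<exists>i<k. words s' ''assignment'' = (words s ''assignment'')(x := words s ''smp'' (words s ''F'' i)) \<and>
     hdist h (words s ''A'' x) (words s ''F'' i) = nearest_dist (hdist h) k (words s ''F'') (words s ''A'' x)"
proof -
  let ?a = "words s ''A'' x"
  let ?e = "\<lambda>i. hdist h ?a (words s ''F'' i)"
  let ?v = "\<lambda>i. words s ''smp'' (words s ''F'' i)"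
  let ?I = "\<lambda>i u. reals u ''dd'' 0 = (if i = 0 then big else Min (?e ` {..<i})) \<and>
     (i > 0 \<longrightarrow> (\<exists>i'<i. words u ''assignment'' = (words s ''assignment'')(x := ?v i') \<and> ?e i' = Min (?e ` {..<i})))
     \<and> (i = 0 \<longrightarrow> words u ''assignment'' = words s ''assignment'')"
  have eb: "?e i < big" if "i < k" for i
  proof -
    have "?e i \<le> Lam" unfolding hdist_def
      using s F[OF that] a by (intro d_le_Lam history_nth) (auto simp: sampled_def)
    also have "Lam \<le> Lam * Lam" using Lam mult_right_mono[of 1 Lam Lam] by simp
    finally show ?thesis by (simp add: big_def)
  qed
  have "?I k s'"
    unfolding s'_def assign_prog_def dsem.simps(6)
  proof (rule dsem_FOR[where I = ?I], goal_cases)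
    case (4 i u)
    have ag: "agree {''i'', ''dd'', ''assignment''} u s" using 4(4) by (auto simp: agree_def upd_other)
    have su: "sampled h u" using sampled_agree[OF ag] s by simp
    have u: "words u ''F'' = words s ''F''" "words u ''x'' 0 = x" "words u ''A'' = words s ''A''" "words u ''smp'' = words s ''smp''"
      using ag x by (auto simp: agree_def)
    have e: "rval orc u asg_dist = ?e i"
      using rval_sdist[of h u "WGet ''A'' (var ''x'')" "WGet ''F'' (var ''i'')"] u 4(3) F[OF 4(1)] a su
      by (simp add: sampled_def hdist_def del: rval.simps)
    define Q where "Q = (if i = 0 then big else Min (?e ` {..<i}))"
    have D: "reals u ''dd'' 0 = Q" using 4(2) by (simp only: Q_def)
    have M: "Min (?e ` {..<Suc i}) = (if ?e i < Q then ?e i else Q)"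
    proof (cases "i = 0")
      case True
      then show ?thesis using eb[OF 4(1)] by (simp add: Q_def lessThan_Suc)
    next
      case False
      then have "Min (?e ` {..<Suc i}) = min (?e i) (Min (?e ` {..<i}))"
        by (simp add: lessThan_Suc lessThan_empty_iff)
      then show ?thesis using False by (simp add: Q_def min_def)
    qed
    have before: "\<exists>v. words u ''assignment'' = (words s ''assignment'')(x := v)"
      using 4(2) by (cases "i = 0") (auto intro: exI[of _ "words s ''assignment'' x"])
    show ?case
    proof (cases "?e i < Q")
      case True
      then have "dsem orc (IF (RLess asg_dist (RGet ''dd'' (WConst 0)))
       (RS ''dd'' (WConst 0) asg_dist ;; WS ''assignment'' (var ''x'') (WGet ''smp'' (WGet ''F'' (var ''i'')))) NOP) u =
         wset ''assignment'' x (?v i) (rset ''dd'' 0 (?e i) u)"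
        using e D u 4(3) by (simp del: rval.simps(3))
      then show ?thesis using before True unfolding M
        by (auto simp: upd_def intro!: exI[of _ i])
    next
      case False
      then have st: "dsem orc (IF (RLess asg_dist (RGet ''dd'' (WConst 0)))
       (RS ''dd'' (WConst 0) asg_dist ;; WS ''assignment'' (var ''x'') (WGet ''smp'' (WGet ''F'' (var ''i'')))) NOP) u = u"
        using e D by (simp del: rval.simps(3))
      have i0: "i \<noteq> 0"
      proof
        assume "i = 0"
        then show False using False eb[OF 4(1)] by (simp add: Q_def)
      qed
      then obtain i' where "i' < i" "words u ''assignment'' = (words s ''assignment'')(x := ?v i')" "?e i' = Q"
        using 4(2) by (auto simp: Q_def)
      then show ?thesis using D False unfolding st M by (auto intro!: exI[of _ i'])
    qed
  qed (use s rval_big[OF s] in \<open>auto simp: sampled_def pars_def upd_other upd_apply simp del: rval.simps\<close>)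
  then show ?thesis using k by (auto simp: nearest_dist_def)
qed

lemma slots_cost_le:
  assumes h: "set h \<subseteq> {..<n}" "length h = N" and a: "\<And>x. x < n \<Longrightarrow> a x < N" and F: "\<And>i. i < k \<Longrightarrow> F i < N"
  shows "slots_cost h a F \<le> real n * Lam ^ z"
proof -
  have "nearest_dist (hdist h) k F (a x) ^ z \<le> Lam ^ z" if "x < n" for x
  proof -
    have "nearest_dist (hdist h) k F (a x) \<le> hdist h (a x) (F 0)" using k by (intro nearest_dist_le) auto
    also have "\<dots> \<le> Lam" unfolding hdist_def using h a[OF that] F[of 0] k by (intro d_le_Lam history_nth) auto
    finally show ?thesis using nearest_dist_nonneg by (intro power_mono)
  qed
  then have "slots_cost h a F \<le> (\<Sum>x<n. Lam ^ z)" unfolding slots_cost_def by (intro sum_mono) auto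
  then show ?thesis by simp
qed

text \<open>The swap performed is the best of all, in particular no worse than the one found by
  averaging.\<close>

lemma improve_decay:
  assumes h: "set h \<subseteq> {..<n}" "length h = N" and a: "\<And>x. x < n \<Longrightarrow> a x < N"
    and F: "\<And>i. i < k \<Longrightarrow> F i < N" and G: "\<And>i. i < k \<Longrightarrow> G i < N"
    and F': "\<And>i x. i < k \<Longrightarrow> x < N \<Longrightarrow> slots_cost h a F' \<le> slots_cost h a (F(i := x))"
    and c: "slots_cost h a F \<le> 82 * slots_cost h a G + c"
  shows "slots_cost h a F' \<le> 82 * slots_cost h a G + (1 - 1 / real (2 * k)) * c"
proof -
  have tri: "hdist h p r \<le> hdist h p q + hdist h q r" if "p < N" "q < N" "r < N" for p q r
    unfolding hdist_def using that h by (intro d_triangle history_nth) auto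
  have "\<exists>i<k. \<exists>g<k. slots_cost h a (F(i := G g)) \<le>
      slots_cost h a F - (slots_cost h a F / 2 - 41 * slots_cost h a G) / real k"
    unfolding slots_cost_def
    using swap_improvement[of "{..<n}" k z a "{..<N}" F G "hdist h"] k z a F G tri
    by (auto simp: hdist_def d_nonneg d_commute)
  then obtain i g where ig: "i < k" "g < k" "slots_cost h a (F(i := G g)) \<le>
      slots_cost h a F - (slots_cost h a F / 2 - 41 * slots_cost h a G) / real k" by blast
  then have "slots_cost h a F' \<le> slots_cost h a F - (slots_cost h a F / 2 - 41 * slots_cost h a G) / real k"
    using F'[OF ig(1) G[OF ig(2)]] by linarith
  then show ?thesis using local_search_decay[OF k _ c] by blast
qed

text \<open>All slots start with sample 0, as the array is initially zero, at a cost of at most n *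
  Lam^z; this is the excess that decays. The bound holds against every \<open>G\<close>, because the
  slots to compare with are determined only later, from an optimal solution.\<close>

lemma cluster_spec:
  assumes s: "sampled h s" and w0: "words s ''w'' = (\<lambda>_. 0)" and F0: "words s ''F'' = (\<lambda>_. 0)"
    and a: "\<And>x. x < n \<Longrightarrow> words s ''A'' x = a x \<and> a x < N"
    and smp: "\<And>i. i < N \<Longrightarrow> words s ''smp'' i = rev h ! i"
  defines "s' \<equiv> dsem orc cluster_prog s"
  shows "\<exists>F. (\<forall>i<k. F i < N \<and> words s' ''centers'' i = rev h ! F i) \<and>
    (\<forall>x<n. \<exists>i<k. words s' ''assignment'' x = rev h ! F i \<and>
        hdist h (a x) (F i) = nearest_dist (hdist h) k F (a x)) \<and>
    (\<forall>G. (\<forall>i<k. G i < N) \<longrightarrow> slots_cost h a F \<le>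
        82 * slots_cost h a G + (1 - 1 / real (2 * k)) ^ Itr * (real n * Lam ^ z))"
proof -
  let ?q = "1 - 1 / real (2 * k)"
  have h: "set h \<subseteq> {..<n}" "length h = N" using s by (auto simp: sampled_def)
  have aN: "\<And>x. x < n \<Longrightarrow> a x < N" using a by blast
  define s1 where "s1 = dsem orc count_points_prog s"
  have s1: "sampled h s1" using sampled_agree[OF dsem_agree[of count_points_prog orc s]] s by (simp add: s1_def)
  have w1: "words s1 ''w'' j = card {x. x < n \<and> a x = j}" for j
    using count_points_spec[OF s w0, of j] a by (simp add: s1_def cong: conj_cong)
  have F1: "words s1 ''F'' = (\<lambda>_. 0)" using F0 by (simp add: s1_def dsem_words)
  let ?J = "\<lambda>i u. (\<forall>j<k. words u ''F'' j < N) \<and> (\<forall>G. (\<forall>i<k. G i < N) \<longrightarrow>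
     slots_cost h a (words u ''F'') \<le> 82 * slots_cost h a G + ?q ^ i * (real n * Lam ^ z))"
  define s2 where "s2 = dsem orc (FOR ''it'' ''I'' improve_prog) s1"
  have ag2: "agree (insert ''it'' (mods improve_prog)) s2 s1"
    unfolding s2_def using dsem_agree[of "FOR ''it'' ''I'' improve_prog" orc s1] by simp
  have s2: "sampled h s2" using sampled_agree[OF ag2] s1 by simp
  have J: "?J Itr s2"
    unfolding s2_def
  proof (rule dsem_FOR[where I = ?J], goal_cases)
    case 3
    have "slots_cost h a (words s1 ''F'') \<le> real n * Lam ^ z"
      using N F1 by (intro slots_cost_le h aN) auto
    moreover have "0 \<le> slots_cost h a G" for G
      unfolding slots_cost_def by (intro sum_nonneg zero_le_power nearest_dist_nonneg)
    ultimately show ?case using N F1 by (auto intro: add_increasing)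
  next
    case (4 i u)
    have su: "sampled h u" using sampled_agree[OF 4(4)] s1 by simp
    have wu: "words u ''w'' = words s1 ''w''" using 4(4) by (simp add: agree_def)
    have Fu: "\<And>j. j < k \<Longrightarrow> words u ''F'' j < N" using 4(2) by blast
    have cost: "index_cost h (words u ''w'') H = slots_cost h a H" for H
      using index_cost_eq[of a "words u ''w''" h H] aN w1 wu by simp
    note imp = improve_spec[OF su Fu, unfolded cost]
    show ?case
    proof (intro conjI allI impI)
      show "words (dsem orc improve_prog u) ''F'' j < N" if "j < k" for j using imp(1) that by simp
      fix G :: "nat \<Rightarrow> nat" assume G: "\<forall>i<k. G i < N"
      then have "slots_cost h a (words u ''F'') \<le> 82 * slots_cost h a G + ?q ^ i * (real n * Lam ^ z)" using 4(2) by blast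
      note improve_decay[OF h aN Fu _ imp(2) this]
      then show "slots_cost h a (words (dsem orc improve_prog u) ''F'') \<le>
          82 * slots_cost h a G + ?q ^ Suc i * (real n * Lam ^ z)" using G by (simp add: mult.assoc)
    qed
  qed (use s1 in \<open>auto simp: sampled_def pars_def upd_other\<close>)
  let ?F = "words s2 ''F''"
  have FN: "\<And>i. i < k \<Longrightarrow> ?F i < N" using J by blast
  have A2: "words s2 ''A'' = words s ''A''" "words s2 ''smp'' = words s ''smp''"
    using agreeD(1)[OF ag2, of "''A''"] agreeD(1)[OF ag2, of "''smp''"] by (simp_all add: s1_def dsem_words)
  define s3 where "s3 = dsem orc centers_prog s2"
  have s3: "sampled h s3" using sampled_agree[OF dsem_agree[of centers_prog orc s2]] s2 by (simp add: s3_def)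
  have c3: "\<And>i. i < k \<Longrightarrow> words s3 ''centers'' i = rev h ! ?F i"
    using centers_spec[OF s2] FN smp A2(2) by (simp add: s3_def)
  have r3: "words s3 ''F'' = ?F" "words s3 ''A'' = words s ''A''" "words s3 ''smp'' = words s ''smp''"
    using A2 by (simp_all add: s3_def dsem_words)
  let ?K = "\<lambda>i u. \<forall>x<i. \<exists>j<k. words u ''assignment'' x = rev h ! ?F j \<and>
        hdist h (a x) (?F j) = nearest_dist (hdist h) k ?F (a x)"
  have s': "s' = dsem orc (FOR ''x'' ''n'' assign_prog) s3"
    by (simp only: s'_def cluster_prog_def dsem.simps(6) s1_def s2_def s3_def)
  have K: "?K n s'"
    unfolding s'
  proof (rule dsem_FOR[where I = ?K], goal_cases)
    case (4 x u)
    have su: "sampled h u" using sampled_agree[OF 4(4)] s3 by simp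
    have u: "words u ''F'' = ?F" "words u ''A'' = words s ''A''" "words u ''smp'' = words s ''smp''"
      using 4(4) r3 by (auto simp: agree_def)
    have "\<exists>i<k. words (dsem orc assign_prog u) ''assignment'' = (words u ''assignment'')(x := words u ''smp'' (?F i)) \<and>
     hdist h (a x) (?F i) = nearest_dist (hdist h) k ?F (a x)"
      using assign_spec[OF su _ 4(3)] FN u a[OF 4(1)] by simp
    then show ?case using 4(2) FN smp u by (auto simp: less_Suc_eq)
  qed (use s3 in \<open>auto simp: sampled_def pars_def upd_other\<close>)
  have "words s' ''centers'' = words s3 ''centers''" unfolding s' by (simp add: dsem_words del: dsem.simps)
  then show ?thesis using FN c3 K J by (intro exI[of _ ?F]) simp
qed

end

section \<open>The main loop\<close>

definition main_body :: com where
  "main_body = Seq (comp weights_prog) (Seq (Random ''u'' (WConst 0) (var ''tot''))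
     (Seq (comp step_prog) (WSet ''t'' (WConst 0) (WPlus (var ''t'') (WConst 1)))))"

definition main_loop :: com where
  "main_loop = While (WLess (var ''t'') (var ''N'')) main_body"

lemma exec_Random:
  "exec orc (Random a i m) s = map_spmf (\<lambda>v. charge (wcost s i + wcost s m + 1) (wset a (wval s i) v s))
     (spmf_of_pmf (if wval s m = 0 then return_pmf 0 else pmf_of_set {..<wval s m}))"
  by (auto simp: wset_def lessThan_empty_iff spmf_of_set_def simp del: spmf_of_pmf_pmf_of_set)

context sampler
begin

text \<open>\<open>process\<close> recurses on its last draw, a while loop on its first;
  \<open>continue\<close> has the latter shape.\<close>

primrec continue :: "nat \<Rightarrow> nat list \<Rightarrow> nat list pmf" where
  "continue 0 h = return_pmf h"
| "continue (Suc j) h = bind_pmf (next_sample h) (\<lambda>y. continue j (y # h))"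

lemma continue_process: "bind_pmf (process t) (continue j) = process (t + j)"
proof (induction j arbitrary: t)
  case 0
  then show ?case by (simp add: bind_return_pmf')
next
  case (Suc j)
  have "continue (Suc j) = (\<lambda>h. bind_pmf (next_sample h) (\<lambda>y. continue j (y # h)))" by (rule ext) simp
  then have "bind_pmf (process t) (continue (Suc j)) = bind_pmf (process (Suc t)) (continue j)"
    by (simp only: process.simps bind_assoc_pmf bind_map_pmf)
  then show ?case unfolding Suc[of "Suc t"] by (simp only: add_Suc add_Suc_right)
qed

end

definition param_names :: "name set" where
  "param_names = {''n'', ''k'', ''z'', ''N'', ''m'', ''M'', ''J'', ''I'', ''lam'', ''cap''}"

context machine
begin

definition rho :: "name \<Rightarrow> nat" where
  "rho = (\<lambda>_. 0)(''n'' := n, ''k'' := k, ''z'' := z, ''N'' := N, ''m'' := m, ''M'' := M, ''J'' := J,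
     ''I'' := Itr, ''lam'' := L, ''cap'' := V)"

abbreviation par :: "'s state \<Rightarrow> bool" where "par s \<equiv> params param_names V rho s"

lemma par_pars: "par s \<Longrightarrow> pars s"
  by (auto simp: params_def param_names_def pars_def rho_def)

lemma V_ge: "100 \<le> V"
  using V(3) m_pos by linarith

lemma ok_sampling: "ok param_names V weights_prog" "ok param_names V step_prog"
  using V_ge
  by (simp_all add: weights_prog_def round_prog_def rpow_def step_prog_def scan_prog_def query_prog_def
      radius_prog_def count_prog_def witness_prog_def relax_prog_def rank_prog_def param_names_def)

lemma ok_cluster: "ok param_names V cluster_prog"
  using V_ge
  by (simp add: cluster_prog_def count_points_prog_def improve_prog_def near_prog_def near1_prog_def near2_prog_def
      rpow_def cost_prog_def swap_cost_prog_def clear_prog_def min_prog_def choose_prog_def centers_prog_def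
      assign_prog_def param_names_def)

text \<open>\<open>w\<close> and \<open>F\<close> belong to the clustering phase, which starts from
  zero arrays.\<close>

definition loop_inv :: "nat list \<Rightarrow> 's state \<Rightarrow> bool" where
  "loop_inv h s \<longleftrightarrow> par s \<and> hist h s \<and> valid h \<and> words s ''t'' 0 = length h \<and>
     words s ''w'' = (\<lambda>_. 0) \<and> words s ''F'' = (\<lambda>_. 0)"

lemma hist_strip [simp]: "hist h (strip s) = hist h s" "pars (strip s) = pars s"
  by (simp_all add: hist_def holds_symbols_def pars_def)

lemma hist_cong:
  "words s ''smp'' = words t ''smp'' \<Longrightarrow> symbols s ''sym'' = symbols t ''sym'' \<Longrightarrow> reals s ''wk'' = reals t ''wk'' \<Longrightarrow>
   reals s ''D'' = reals t ''D'' \<Longrightarrow> words s ''A'' = words t ''A'' \<Longrightarrow> hist h s = hist h t"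
  by (simp add: hist_def holds_symbols_def)

text \<open>40 covers the draw of \<open>u\<close> (6), the increment of \<open>t\<close> (18) and
  one test of the main loop (9).\<close>

definition body_time :: nat where
  "body_time = bit_length V * (kap weights_prog * nest rho weights_prog + kap step_prog * nest rho step_prog + 40)"

definition body_weak :: nat where "body_weak = nweak rho weights_prog + nweak rho step_prog"
definition body_strong :: nat where "body_strong = nstrong rho weights_prog + nstrong rho step_prog"

text \<open>The body is deterministic once the word \<open>u\<close> is drawn, and
  \<open>pick\<close> maps the same \<open>u\<close> to the next sample. Both sides are images of
  one distribution of \<open>u\<close>, which is the coupling. 9 * bit_length V is withheld for the
  loop test.\<close>

lemma main_body_rel:
  assumes inv: "loop_inv \<sigma> s" and len: "length \<sigma> < N"
  shows "rel_spmf (\<lambda>s' h. (\<exists>y. h = y # \<sigma>) \<and> loop_inv h s' \<and> spends (body_time - 9 * bit_length V) body_weak body_strong s s')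
    (exec orc main_body s) (spmf_of_pmf (map_pmf (\<lambda>y. y # \<sigma>) (next_sample \<sigma>)))"
proof -
  let ?BL = "bit_length V"
  let ?P = "if total \<sigma> = 0 then return_pmf 0 else pmf_of_set {..<total \<sigma>}"
  have V2: "2 \<le> V" using V_ge by simp
  have par: "par s" and hist: "hist \<sigma> s" and val: "valid \<sigma>" and t: "words s ''t'' 0 = length \<sigma>"
    and w0: "words s ''w'' = (\<lambda>_. 0)" "words s ''F'' = (\<lambda>_. 0)" using inv by (auto simp: loop_inv_def)
  obtain s1 where s1: "exec orc (comp weights_prog) s = return_spmf s1"
    "strip s1 = dsem orc weights_prog (strip s)" "par s1"
    "spends (?BL * (kap weights_prog * nest rho weights_prog)) (nweak rho weights_prog) (nstrong rho weights_prog) s s1"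
    using exec_comp[OF V2 ok_sampling(1) par] by blast
  have ag1: "words s1 a = words s a" "reals s1 a = reals s a" "symbols s1 a = symbols s a"
    if "a \<notin> mods weights_prog" for a
    using that arg_cong[OF s1(2), of "\<lambda>s. words s a"] arg_cong[OF s1(2), of "\<lambda>s. reals s a"]
      arg_cong[OF s1(2), of "\<lambda>s. symbols s a"] by (simp_all add: dsem_words dsem_reals dsem_symbols)
  have D: "\<And>x. x < n \<Longrightarrow> reals (strip s) ''D'' x = est \<sigma> x" using hist by (simp add: hist_def)
  have "\<forall>x<n. words (strip s1) ''wt'' x = weight \<sigma> x" "words (strip s1) ''tot'' 0 = total \<sigma>"
    unfolding s1(2) using weights_spec[of "strip s" \<sigma>] par_pars[OF par] D by auto
  then have wt: "\<And>x. x < n \<Longrightarrow> words s1 ''wt'' x = weight \<sigma> x" and tot: "words s1 ''tot'' 0 = total \<sigma>" by auto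
  have hist1: "hist \<sigma> s1" using hist hist_cong[of s1 s \<sigma>] ag1 by simp
  define s2 where "s2 u = charge (wcost s1 (WConst 0) + wcost s1 (var ''tot'') + 1) (wset ''u'' 0 u s1)" for u
  have rnd: "exec orc (Random ''u'' (WConst 0) (var ''tot'')) s1 = map_spmf s2 (spmf_of_pmf ?P)"
    unfolding exec_Random s2_def using tot by simp
  have "\<exists>s4. exec orc (Seq (comp step_prog) (WSet ''t'' (WConst 0) (WPlus (var ''t'') (WConst 1)))) (s2 u) = return_spmf s4 \<and>
      loop_inv (pick (weight \<sigma>) n u # \<sigma>) s4 \<and> spends (body_time - 9 * ?BL) body_weak body_strong s s4"
    if u: "u \<in> set_pmf ?P" for u
  proof -
    have uV: "u \<le> V"
    proof (cases "total \<sigma> = 0")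
      case False
      then have "u < total \<sigma>" using u by (simp add: set_pmf_of_set lessThan_empty_iff)
      also have "total \<sigma> \<le> V" using weight_sum_le[of n \<sigma>] by (simp add: total_def)
      finally show ?thesis by simp
    qed (use u in simp)
    have par2: "par (s2 u)" using params_wset[OF s1(3) uV, of "''u''" 0] by (simp add: s2_def param_names_def)
    have "bnd V s1" using s1(3) by (simp add: params_def)
    then have c: "wcost s1 (WConst 0) + wcost s1 (var ''tot'') + 1 \<le> 6 * ?BL"
      using wcost_bound[of V s1 "WConst 0"] wcost_bound[of V s1 "var ''tot''"] V2 bit_length_ge_1[of V]
      by (simp add: power2_eq_square)
    then have sp2: "spends (6 * ?BL) 0 0 s1 (s2 u)" by (simp add: s2_def spends_def)
    obtain s3 where s3: "exec orc (comp step_prog) (s2 u) = return_spmf s3"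
      "strip s3 = dsem orc step_prog (strip (s2 u))" "par s3"
      "spends (?BL * (kap step_prog * nest rho step_prog)) (nweak rho step_prog) (nstrong rho step_prog) (s2 u) s3"
      using exec_comp[OF V2 ok_sampling(2) par2] by blast
    have w2: "words (s2 u) a = words s1 a" if "a \<noteq> ''u''" for a using that by (simp add: s2_def upd_other)
    have hist2: "hist \<sigma> (s2 u)" using hist1 hist_cong[of "s2 u" s1 \<sigma>] w2 by (simp add: s2_def)
    have "hist (pick (weight \<sigma>) n u # \<sigma>) (strip s3)"
      unfolding s3(2)
    proof (rule step_spec)
      show "pars (strip (s2 u))" using par_pars[OF par2] by simp
      show "hist \<sigma> (strip (s2 u))" using hist2 by simp
      show "words (strip (s2 u)) ''t'' 0 = length \<sigma>" using t by (simp add: w2 ag1)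
      show "words (strip (s2 u)) ''wt'' x = weight \<sigma> x" if "x < n" for x using wt[OF that] by (simp add: w2)
      show "words (strip (s2 u)) ''u'' 0 = u" by (simp add: s2_def upd_apply)
    qed (rule len)
    then have hist3: "hist (pick (weight \<sigma>) n u # \<sigma>) s3" by simp
    have mods: "mods step_prog = {''y'', ''acc'', ''x'', ''smp'', ''sym'', ''wk'', ''best'', ''i'', ''cnt'', ''j'', ''c'', ''T'', ''a'', ''b'', ''D'', ''A''}"
      by (auto simp: step_prog_def)
    have w3: "words s3 a = words s a" if "a \<notin> mods step_prog" "a \<notin> mods weights_prog" "a \<noteq> ''u''" for a
      using that arg_cong[OF s3(2), of "\<lambda>s. words s a"] by (simp add: dsem_words w2 ag1 del: sampling_mods)
    have t3: "words s3 ''t'' 0 = length \<sigma>" "words s3 ''w'' = (\<lambda>_. 0)" "words s3 ''F'' = (\<lambda>_. 0)"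
      using t w0 by (simp_all add: w3 mods)
    have k18: "(wsz (WConst 0))\<^sup>2 + (wsz (WPlus (var ''t'') (WConst 1)))\<^sup>2 + 1 = 18" by (simp add: power2_eq_square)
    have tV: "wval s3 (WPlus (var ''t'') (WConst 1)) \<le> V" using t3 len V(2) by simp
    obtain s4 where s4: "exec orc (WSet ''t'' (WConst 0) (WPlus (var ''t'') (WConst 1))) s3 = return_spmf s4"
      "strip s4 = wset ''t'' (wval s3 (WConst 0)) (wval s3 (WPlus (var ''t'') (WConst 1))) (strip s3)" "par s4"
      "spends (?BL * 18) 0 0 s3 s4"
      using exec_WSet[OF s3(3) V2 _ _ tV, of "WConst 0" "''t''" orc, unfolded k18] V_ge
      by (auto simp: param_names_def simp del: exec.simps)
    have w4: "words s4 a = words s3 a" if "a \<noteq> ''t''" for a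
      using that arg_cong[OF s4(2), of "\<lambda>s. words s a"] by (simp add: upd_other)
    have r4: "reals s4 = reals s3" "symbols s4 = symbols s3"
      using arg_cong[OF s4(2), of reals] arg_cong[OF s4(2), of symbols] by simp_all
    have t4: "words s4 ''t'' 0 = Suc (length \<sigma>)"
      using arg_cong[OF s4(2), of words] t3 by (simp add: upd_apply)
    have "hist (pick (weight \<sigma>) n u # \<sigma>) s4"
      using hist3 hist_cong[of s4 s3] w4 r4 by simp
    moreover have "valid (pick (weight \<sigma>) n u # \<sigma>)"
    proof -
      have "pick (weight \<sigma>) n u \<in> set_pmf (next_sample \<sigma>)" using u by (auto simp: next_sample_def)
      then have y: "pick (weight \<sigma>) n u < n" "0 < total \<sigma> \<Longrightarrow> 0 < weight \<sigma> (pick (weight \<sigma>) n u)"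
        by (simp_all add: set_next_sample)
      have "est \<sigma> x \<le> 0" if g: "good \<sigma>" "pick (weight \<sigma>) n u \<in> set \<sigma>" "x < n" for x
      proof (rule ccontr)
        assume "\<not> est \<sigma> x \<le> 0"
        then have "0 < total \<sigma>" using total_pos[OF g(1) valid_set[OF val] g(3)] by simp
        then show False using y weight_sampled[OF g(1) valid_set[OF val] g(2)] by simp
      qed
      then show ?thesis using val y by simp
    qed
    ultimately have "loop_inv (pick (weight \<sigma>) n u # \<sigma>) s4"
      using s4(3) t4 t3 w4 by (simp add: loop_inv_def)
    moreover have "spends (body_time - 9 * ?BL) body_weak body_strong s s4"
    proof (rule spends_mono[OF spends_trans[OF spends_trans[OF spends_trans[OF s1(4) sp2] s3(4)] s4(4)]])
      show "?BL * (kap weights_prog * nest rho weights_prog) + 6 * ?BL + ?BL * (kap step_prog * nest rho step_prog) + ?BL * 18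
        \<le> body_time - 9 * ?BL" by (simp add: body_time_def distrib_left)
    qed (simp_all add: body_weak_def body_strong_def)
    ultimately show ?thesis using s3(1) s4(1) by (intro exI[of _ s4]) (simp del: exec.simps(2))
  qed
  then obtain g where g: "\<And>u. u \<in> set_pmf ?P \<Longrightarrow>
      exec orc (Seq (comp step_prog) (WSet ''t'' (WConst 0) (WPlus (var ''t'') (WConst 1)))) (s2 u) = return_spmf (g u) \<and>
      loop_inv (pick (weight \<sigma>) n u # \<sigma>) (g u) \<and> spends (body_time - 9 * ?BL) body_weak body_strong s (g u)"
    by metis
  have "exec orc main_body s = bind_spmf (map_spmf s2 (spmf_of_pmf ?P))
      (exec orc (Seq (comp step_prog) (WSet ''t'' (WConst 0) (WPlus (var ''t'') (WConst 1)))))"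
    unfolding main_body_def using s1(1) rnd by (simp del: exec.simps(2,4) map_spmf_of_pmf)
  also have "\<dots> = bind_pmf ?P (\<lambda>u. exec orc (Seq (comp step_prog) (WSet ''t'' (WConst 0) (WPlus (var ''t'') (WConst 1)))) (s2 u))"
    by (simp add: bind_map_pmf del: exec.simps)
  also have "\<dots> = bind_pmf ?P (\<lambda>u. return_spmf (g u))"
    using g by (intro bind_pmf_cong) auto
  finally have "exec orc main_body s = spmf_of_pmf (map_pmf g ?P)" by (simp add: bind_pmf_return_spmf)
  moreover have "map_pmf (\<lambda>y. y # \<sigma>) (next_sample \<sigma>) = map_pmf (\<lambda>u. pick (weight \<sigma>) n u # \<sigma>) ?P"
    unfolding next_sample_def by (simp add: pmf.map_comp o_def)
  ultimately show ?thesis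
    using g by (auto simp: pmf.rel_map intro!: rel_pmf_reflI)
qed

lemma main_loop_rel:
  "loop_inv \<sigma> s \<Longrightarrow> length \<sigma> + j = N \<Longrightarrow>
    rel_spmf (\<lambda>s' h. loop_inv h s' \<and> length h = N \<and>
        spends (j * body_time + 9 * bit_length V) (j * body_weak) (j * body_strong) s s')
      (exec orc main_loop s) (spmf_of_pmf (continue j \<sigma>))"
proof (induction j arbitrary: \<sigma> s)
  case 0
  let ?b = "WLess (var ''t'') (var ''N'')"
  have V2: "2 \<le> V" using V_ge by simp
  have par: "par s" and t: "words s ''t'' 0 = N" using 0 by (auto simp: loop_inv_def)
  have "\<not> bval orc s ?b" using t par_pars[OF par] by (simp add: pars_def)
  then have e: "exec orc main_loop s = return_spmf (charge (bcost s ?b) s)"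
    unfolding main_loop_def by (rule exec_While_stop)
  have "loop_inv \<sigma> (charge (bcost s ?b) s)"
    using 0(1) hist_cong[of "charge (bcost s ?b) s" s \<sigma>] by (simp add: loop_inv_def)
  moreover have "spends (9 * bit_length V) 0 0 s (charge (bcost s ?b) s)"
    using loop_test_cost[OF par V2, of "''t''" "''N''"] by (simp add: spends_def)
  ultimately show ?case using 0 unfolding e by simp
next
  case (Suc j)
  let ?b = "WLess (var ''t'') (var ''N'')"
  have V2: "2 \<le> V" using V_ge by simp
  have par: "par s" and t: "words s ''t'' 0 = length \<sigma>" using Suc.prems by (auto simp: loop_inv_def)
  have "bval orc s ?b" using t par_pars[OF par] Suc.prems by (simp add: pars_def)
  let ?s = "charge (bcost s ?b) s"
  have e: "exec orc main_loop s = bind_spmf (exec orc main_body ?s) (exec orc main_loop)"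
    unfolding main_loop_def using \<open>bval orc s ?b\<close> by (rule exec_While_step)
  have inv: "loop_inv \<sigma> ?s" using Suc.prems(1) hist_cong[of ?s s \<sigma>] by (simp add: loop_inv_def)
  have sp: "spends (9 * bit_length V) 0 0 s ?s"
    using loop_test_cost[OF par V2, of "''t''" "''N''"] by (simp add: spends_def)
  have c: "spmf_of_pmf (continue (Suc j) \<sigma>) =
      bind_spmf (spmf_of_pmf (map_pmf (\<lambda>y. y # \<sigma>) (next_sample \<sigma>))) (\<lambda>h. spmf_of_pmf (continue j h))"
    by (simp add: bind_map_pmf spmf_of_pmf_bind)
  show ?case
    unfolding e c
  proof (rule rel_spmf_bindI[OF main_body_rel[OF inv]])
    show "length \<sigma> < N" using Suc.prems by simp
    fix s' h assume *: "(\<exists>y. h = y # \<sigma>) \<and> loop_inv h s' \<and>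
       spends (body_time - 9 * bit_length V) body_weak body_strong ?s s'"
    have b9: "9 * bit_length V \<le> body_time" by (simp add: body_time_def distrib_left)
    have "spends (body_time + c) (body_weak + w) (body_strong + q) s s''" if "spends c w q s' s''" for c w q s''
      using spends_trans[OF spends_trans[OF sp conjunct2[OF conjunct2[OF *]]] that] b9 by simp
    then show "rel_spmf (\<lambda>s' h. loop_inv h s' \<and> length h = N \<and>
        spends (Suc j * body_time + 9 * bit_length V) (Suc j * body_weak) (Suc j * body_strong) s s')
      (exec orc main_loop s') (spmf_of_pmf (continue j h))"
      using Suc.IH[of h s'] * Suc.prems by (auto elim!: rel_spmf_mono simp: add.assoc)
  qed
qed

text \<open>All that the analysis needs to know about the final memory; the rest depends on the
  history alone.\<close>

definition tail_rel :: "'s state \<Rightarrow> nat list \<Rightarrow> bool" where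
  "tail_rel s h \<longleftrightarrow> valid h \<and> length h = N \<and>
    (\<exists>F. (\<forall>i<k. F i < N \<and> words s ''centers'' i = rev h ! F i) \<and>
      (\<forall>x<n. \<exists>i<k. words s ''assignment'' x = rev h ! F i \<and>
        (asg h x < N \<longrightarrow> hdist h (asg h x) (F i) = nearest_dist (hdist h) k F (asg h x))) \<and>
      ((\<forall>x<n. asg h x < N) \<longrightarrow> (\<forall>G. (\<forall>i<k. G i < N) \<longrightarrow> slots_cost h (asg h) F \<le>
        82 * slots_cost h (asg h) G + (1 - 1 / real (2 * k)) ^ Itr * (real n * Lam ^ z))))"

lemma asg_less: "h \<noteq> [] \<Longrightarrow> asg h x < length h"
proof -
  have "asg h x < max 1 (length h)" by (induction h) auto
  then show "h \<noteq> [] \<Longrightarrow> asg h x < length h" by (cases h) auto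
qed

lemma run_rel:
  assumes "loop_inv [] s"
  shows "rel_spmf (\<lambda>s' h. tail_rel s' h \<and>
      spends (N * body_time + 9 * bit_length V + bit_length V * (kap cluster_prog * nest rho cluster_prog))
        (N * body_weak + nweak rho cluster_prog) (N * body_strong + nstrong rho cluster_prog) s s')
    (exec orc (Seq main_loop (comp cluster_prog)) s) (spmf_of_pmf (process N))"
proof -
  have V2: "2 \<le> V" using V_ge by simp
  have c: "process N = continue N []" using continue_process[of 0 N] by (simp add: bind_return_pmf)
  have "rel_spmf (\<lambda>s' h. tail_rel s' h \<and>
      spends (N * body_time + 9 * bit_length V + bit_length V * (kap cluster_prog * nest rho cluster_prog))
        (N * body_weak + nweak rho cluster_prog) (N * body_strong + nstrong rho cluster_prog) s s')
    (bind_spmf (exec orc main_loop s) (exec orc (comp cluster_prog)))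
    (bind_spmf (spmf_of_pmf (continue N [])) return_spmf)"
  proof (rule rel_spmf_bindI[OF main_loop_rel[OF assms]])
    fix s' h assume *: "loop_inv h s' \<and> length h = N \<and>
       spends (N * body_time + 9 * bit_length V) (N * body_weak) (N * body_strong) s s'"
    then have inv: "loop_inv h s'" and len: "length h = N" by auto
    have par: "par s'" using inv by (simp add: loop_inv_def)
    obtain s'' where s'': "exec orc (comp cluster_prog) s' = return_spmf s''"
      "strip s'' = dsem orc cluster_prog (strip s')" "par s''"
      "spends (bit_length V * (kap cluster_prog * nest rho cluster_prog)) (nweak rho cluster_prog) (nstrong rho cluster_prog) s' s''"
      using exec_comp[OF V2 ok_cluster par] by blast
    have "h \<noteq> []" using len N by auto
    then have a: "asg h x < N" for x using asg_less[of h x] len by simp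
    have "sampled h (strip s')" using inv len par_pars[OF par]
      by (auto simp: sampled_def loop_inv_def hist_def holds_symbols_def)
    from cluster_spec[OF this, of "asg h"] have "tail_rel (strip s'') h"
      using inv len a unfolding s''(2) tail_rel_def by (auto simp: loop_inv_def hist_def)
    then have "tail_rel s'' h" by (simp add: tail_rel_def)
    moreover have "spends (N * body_time + 9 * bit_length V + bit_length V * (kap cluster_prog * nest rho cluster_prog))
        (N * body_weak + nweak rho cluster_prog) (N * body_strong + nstrong rho cluster_prog) s s''"
      using * s''(4) spends_trans by blast
    ultimately show "rel_spmf (\<lambda>s' h. tail_rel s' h \<and>
      spends (N * body_time + 9 * bit_length V + bit_length V * (kap cluster_prog * nest rho cluster_prog))
        (N * body_weak + nweak rho cluster_prog) (N * body_strong + nstrong rho cluster_prog) s s')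
     (exec orc (comp cluster_prog) s') (return_spmf h)" unfolding s''(1) by simp
  qed simp
  then show ?thesis unfolding c by (simp add: spmf_of_pmf_bind[symmetric])
qed

section \<open>Quality of the solution\<close>

text \<open>The assignment of points to samples costs S <= 4 * 1400000 * OPT. Moving each comparison
  center to its nearest sample gives slots G of cost at most 8 * S + 8 * OPT, so the local search
  ends with at most 656 * S + 656 * OPT + 1, and the triangle inequality combines both to 1314 * S +
  1312 * OPT + 2. OPT >= 1 absorbs the additive term.\<close>

lemma approximation:
  assumes cmp: "comparison n z \<mu> J d Lam ao k" and co: "\<And>i. i < k \<Longrightarrow> co i < n" and aco: "\<And>x. x < n \<Longrightarrow> ao x \<in> co ` {..<k}"
    and h: "tail_rel s h" "good h" and unc: "(\<Sum>x<n. est h x ^ z) \<le> 1400000 * (\<Sum>x<n. d x (ao x) ^ z)"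
    and opt1: "1 \<le> (\<Sum>x<n. d x (ao x) ^ z)" and Itr: "(1 - 1 / real (2 * k)) ^ Itr * (real n * Lam ^ z) \<le> 1"
  shows "clustering_solution n k (words s ''centers'') (words s ''assignment'')"
    "clustering_cost z d n (words s ''assignment'') \<le> 8000000000 * (\<Sum>x<n. d x (ao x) ^ z)"
proof -
  interpret comparison n z \<mu> J d wk Lam ao k by (rule cmp)
  let ?opt = "\<Sum>x<n. d x (ao x) ^ z"
  let ?p = "\<lambda>j. rev h ! j" let ?a = "asg h"
  have val: "valid h" and len: "length h = N" using h by (auto simp: tail_rel_def)
  have hn: "set h \<subseteq> {..<n}" using val by (rule valid_set)
  have ne: "h \<noteq> []" using len N by auto
  have aN: "?a x < N" for x using asg_less[OF ne, of x] len by simp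
  obtain F where F: "\<And>i. i < k \<Longrightarrow> F i < N" "\<And>i. i < k \<Longrightarrow> words s ''centers'' i = ?p (F i)"
    and as: "\<And>x. x < n \<Longrightarrow> \<exists>i<k. words s ''assignment'' x = ?p (F i) \<and> hdist h (?a x) (F i) = nearest_dist (hdist h) k F (?a x)"
    and ls: "\<And>G. (\<forall>i<k. G i < N) \<Longrightarrow> slots_cost h ?a F \<le>
        82 * slots_cost h ?a G + (1 - 1 / real (2 * k)) ^ Itr * (real n * Lam ^ z)"
    using h(1) aN unfolding tail_rel_def by metis
  have pn: "?p j < n" if "j < N" for j using history_nth[OF hn, of j] that len by simp
  show "clustering_solution n k (words s ''centers'') (words s ''assignment'')"
    unfolding clustering_solution_def
  proof (intro conjI subsetI)
    fix y assume "y \<in> words s ''centers'' ` {..<k}"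
    then show "y \<in> {..<n}" using F pn by auto
  next
    fix y assume "y \<in> words s ''assignment'' ` {..<n}"
    then obtain x where "x < n" "y = words s ''assignment'' x" by auto
    with as[of x] obtain i where "i < k" "y = ?p (F i)" by auto
    then show "y \<in> words s ''centers'' ` {..<k}" using F(2)[of i] by (intro image_eqI[of _ _ i]) auto
  qed
  define S where "S = (\<Sum>x<n. d x (?p (?a x)) ^ z)"
  have "S \<le> (\<Sum>x<n. 4 * est h x ^ z)"
    unfolding S_def
  proof (rule sum_mono)
    fix x assume "x \<in> {..<n}"
    then have "d x (?p (?a x)) \<le> 2 * est h x" "0 \<le> est h x"
      using asg_bound[OF val h(2) ne] est_nonneg[OF h(2) hn] by auto
    then have "d x (?p (?a x)) ^ z \<le> (2 * est h x) ^ z" by (intro power_mono d_nonneg)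
    also have "\<dots> \<le> 2\<^sup>2 * est h x ^ z" using z \<open>0 \<le> est h x\<close> by (intro power_z_mult) auto
    finally show "d x (?p (?a x)) ^ z \<le> 4 * est h x ^ z" by simp
  qed
  then have S: "S \<le> 5600000 * ?opt" using unc by (simp flip: sum_distrib_left)
  have "\<exists>j<N. \<forall>j'<N. d (?p j) c \<le> d (?p j') c" for c
  proof -
    have "Min ((\<lambda>j. d (?p j) c) ` {..<N}) \<in> (\<lambda>j. d (?p j) c) ` {..<N}"
      using N by (intro Min_in) (auto simp: lessThan_empty_iff)
    then obtain j where j: "j < N" "Min ((\<lambda>j. d (?p j) c) ` {..<N}) = d (?p j) c" by auto
    then show ?thesis by (intro exI[of _ j]) (auto simp flip: j(2))
  qed
  then obtain near where near: "\<And>c. near c < N" "\<And>c j'. j' < N \<Longrightarrow> d (?p (near c)) c \<le> d (?p j') c" by metis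
  define G where "G i = near (co i)" for i
  have "slots_cost h ?a G \<le> (\<Sum>x<n. 8 * d x (?p (?a x)) ^ z + 8 * d x (ao x) ^ z)"
    unfolding slots_cost_def
  proof (rule sum_mono)
    fix x assume "x \<in> {..<n}"
    then have x: "x < n" by simp
    obtain i where i: "i < k" "ao x = co i" using aco[OF x] by auto
    let ?q = "?p (?a x)" let ?g = "?p (G i)"
    have n': "?q < n" "?g < n" "co i < n" using pn aN near(1) co i by (auto simp: G_def)
    have "nearest_dist (hdist h) k G (?a x) \<le> d ?q ?g" using nearest_dist_le[OF i(1), of "hdist h" G] by (simp add: hdist_def)
    also have "\<dots> \<le> d ?q (co i) + d (co i) ?g" using n' by (intro d_triangle) auto
    also have "d (co i) ?g \<le> d ?q (co i)" using near(2)[OF aN] d_commute[of "co i" ?g] by (simp add: G_def)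
    also have "d ?q (co i) \<le> d ?q x + d x (co i)" using n' x by (intro d_triangle) auto
    finally have "nearest_dist (hdist h) k G (?a x) \<le> 2 * (d x ?q + d x (ao x))" using d_commute[of ?q x] i by simp
    then have "nearest_dist (hdist h) k G (?a x) ^ z \<le> (2 * (d x ?q + d x (ao x))) ^ z"
      using nearest_dist_nonneg by (intro power_mono) auto
    also have "\<dots> \<le> 2\<^sup>2 * (d x ?q + d x (ao x)) ^ z" using z d_nonneg by (intro power_z_mult) auto
    also have "\<dots> \<le> 2\<^sup>2 * (2 * (d x ?q ^ z + d x (ao x) ^ z))"
      using z d_nonneg by (intro mult_left_mono power_z_add) auto
    finally show "nearest_dist (hdist h) k G (?a x) ^ z \<le> 8 * d x ?q ^ z + 8 * d x (ao x) ^ z" by simp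
  qed
  then have "slots_cost h ?a G \<le> 8 * S + 8 * ?opt" by (simp add: S_def sum.distrib sum_distrib_left)
  moreover have "slots_cost h ?a F \<le> 82 * slots_cost h ?a G + 1" using ls[of G] near(1) Itr by (simp add: G_def)
  ultimately have cF: "slots_cost h ?a F \<le> 656 * S + 656 * ?opt + 1" by linarith
  have "clustering_cost z d n (words s ''assignment'') \<le>
      (\<Sum>x<n. 2 * d x (?p (?a x)) ^ z + 2 * nearest_dist (hdist h) k F (?a x) ^ z)"
    unfolding clustering_cost_def
  proof (rule sum_mono)
    fix x assume "x \<in> {..<n}"
    then have x: "x < n" by simp
    obtain i where i: "i < k" "words s ''assignment'' x = ?p (F i)" "hdist h (?a x) (F i) = nearest_dist (hdist h) k F (?a x)"
      using as[OF x] by blast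
    have "d x (?p (F i)) \<le> d x (?p (?a x)) + d (?p (?a x)) (?p (F i))"
      using x pn aN F i by (intro d_triangle) auto
    then have "d x (words s ''assignment'' x) \<le> d x (?p (?a x)) + nearest_dist (hdist h) k F (?a x)"
      using i by (simp add: hdist_def)
    then have "d x (words s ''assignment'' x) ^ z \<le> (d x (?p (?a x)) + nearest_dist (hdist h) k F (?a x)) ^ z"
      by (intro power_mono d_nonneg)
    also have "\<dots> \<le> 2 * (d x (?p (?a x)) ^ z + nearest_dist (hdist h) k F (?a x) ^ z)"
      using z d_nonneg nearest_dist_nonneg by (intro power_z_add) auto
    finally show "d x (words s ''assignment'' x) ^ z \<le>
        2 * d x (?p (?a x)) ^ z + 2 * nearest_dist (hdist h) k F (?a x) ^ z" by simp
  qed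
  also have "\<dots> = 2 * S + 2 * slots_cost h ?a F"
    by (simp add: S_def slots_cost_def sum.distrib sum_distrib_left)
  finally show "clustering_cost z d n (words s ''assignment'') \<le> 8000000000 * ?opt"
    using cF S opt1 by linarith
qed

end

section \<open>The complete program\<close>

text \<open>The machine has no logarithm, so the least power of two \<open>p\<close> that is at
  least n is found by doubling, together with its exponent \<open>ell\<close>. \<open>cap\<close> is
  n + n here, which \<open>p\<close> does not exceed.\<close>

definition size_prog :: stm where
  "size_prog = WS ''p'' (WConst 0) (WConst 1) ;; FOR ''x'' ''n'' (
     IF (WLess (var ''p'') (var ''n''))
       (WS ''p'' (WConst 0) (clamp (WPlus (var ''p'') (var ''p''))) ;; incr ''ell'') NOP)"

primrec wpow :: "nat \<Rightarrow> wexp" where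
  "wpow 0 = WConst 1"
| "wpow (Suc j) = WTimes (var ''p'') (wpow j)"

text \<open>Has to bound everything stored later. The dominating requirement is the total weight n *
  2^J, at most 2^20 * p^(8 * E + 1).\<close>

definition cap_exp :: "nat \<Rightarrow> wexp" where
  "cap_exp E = WTimes (WConst (10 ^ 9 * (E + 1))) (wpow (8 * E + 2))"

text \<open>
  The choice \<open>m = 2 * \<mu>\<close> with \<open>\<mu> = 6 * 624 * ell\<close> gives \<open>(625 / 624) ^ \<mu> \<ge> 2 ^ (6 * ell) \<ge> n ^ 6\<close>, and
  \<open>N = 5 * 288 * M * k\<close> gives \<open>2 ^ (4 * M * k) * (287 / 288) ^ N \<le> 2 ^ - (M * k)\<close>.
\<close>

definition param_prog :: "nat \<Rightarrow> stm" where
  "param_prog E =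
     WS ''m'' (WConst 0) (clamp (WTimes (WConst 7488) (var ''ell''))) ;;
     WS ''M'' (WConst 0) (clamp (WTimes (WConst 64) (var ''m''))) ;;
     WS ''N'' (WConst 0) (clamp (WTimes (WConst 1440) (WTimes (var ''M'') (var ''k'')))) ;;
     WS ''J'' (WConst 0) (clamp (WTimes (WConst 4) (WPlus (WTimes (WConst (2 * E)) (var ''ell'')) (WConst 5)))) ;;
     WS ''I'' (WConst 0) (clamp (WTimes (WTimes (WConst 2) (var ''k'')) (WTimes (var ''ell'') (WConst (2 * E + 1))))) ;;
     WS ''lam'' (WConst 0) (clamp (wpow E)) ;;
     FOR ''x'' ''n'' (RS ''D'' (var ''x'') (OfWord (var ''lam'')))"

definition trivial_prog :: stm where
  "trivial_prog = FOR ''x'' ''n'' (WS ''centers'' (var ''x'') (var ''x'') ;; WS ''assignment'' (var ''x'') (var ''x''))"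

definition prog :: "nat \<Rightarrow> com" where
  "prog E = Seq (WSet ''cap'' (WConst 0) (WPlus (var ''n'') (var ''n'')))
     (Cond (WLess (var ''k'') (var ''n''))
       (Seq (comp size_prog) (Seq (WSet ''cap'' (WConst 0) (cap_exp E)) (Seq (comp (param_prog E))
         (Seq main_loop (comp cluster_prog)))))
       (comp trivial_prog))"

lemma wpow_simps: "wval s (wpow j) = words s ''p'' 0 ^ j" "wmax (wpow j) = 1"
  by (induction j) auto

lemma size_spec:
  fixes orc :: "'s oracles"
  assumes "words s ''n'' 0 = n" "words s ''cap'' 0 = n + n" "words s ''ell'' 0 = 0" "2 \<le> n"
  defines "s' \<equiv> dsem orc size_prog s"
  shows "words s' ''p'' 0 = 2 ^ words s' ''ell'' 0" "n \<le> 2 ^ words s' ''ell'' 0" "2 ^ words s' ''ell'' 0 < 2 * n"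
proof -
  let ?I = "\<lambda>i u. words u ''p'' 0 = 2 ^ words u ''ell'' 0 \<and> words u ''ell'' 0 \<le> i \<and> words u ''p'' 0 < 2 * n \<and>
    (n \<le> words u ''p'' 0 \<or> words u ''ell'' 0 = i)"
  have I: "?I n s'"
    unfolding s'_def size_prog_def dsem.simps(6)
  proof (rule dsem_FOR[where I = ?I], goal_cases)
    case (4 i u)
    have u: "words u ''n'' 0 = n" "words u ''cap'' 0 = n + n"
      using 4(4) assms by (auto simp: agree_def upd_other)
    then show ?case using 4(1,2) by (auto simp: upd_apply)
  qed (use assms in \<open>auto simp: upd_apply\<close>)
  moreover have "n < 2 ^ n" by simp
  ultimately show "words s' ''p'' 0 = 2 ^ words s' ''ell'' 0" "n \<le> 2 ^ words s' ''ell'' 0" "2 ^ words s' ''ell'' 0 < 2 * n"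
    by auto
qed

lemma init_spec:
  assumes "words s ''n'' 0 = n"
  shows "\<forall>x<n. reals (dsem orc (FOR ''x'' ''n'' (RS ''D'' (var ''x'') (OfWord (var ''lam'')))) s) ''D'' x = real (words s ''lam'' 0)"
proof -
  let ?I = "\<lambda>i u. \<forall>x<i. reals u ''D'' x = real (words s ''lam'' 0)"
  show ?thesis
  proof (rule dsem_FOR[where I = ?I], goal_cases)
    case (4 i u)
    then have "words u ''lam'' = words s ''lam''" by (auto simp: agree_def)
    then show ?case using 4(2,3) by (auto simp: upd_apply less_Suc_eq)
  qed (use assms in \<open>auto simp: upd_apply\<close>)
qed

lemma trivial_spec:
  assumes "words s ''n'' 0 = n"
  shows "\<forall>x<n. words (dsem orc trivial_prog s) ''centers'' x = x \<and> words (dsem orc trivial_prog s) ''assignment'' x = x"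
    "\<forall>x\<ge>n. words (dsem orc trivial_prog s) ''centers'' x = words s ''centers'' x"
proof -
  let ?I = "\<lambda>i u. (\<forall>x<i. words u ''centers'' x = x \<and> words u ''assignment'' x = x) \<and>
    (\<forall>x\<ge>i. words u ''centers'' x = words s ''centers'' x)"
  have "?I n (dsem orc trivial_prog s)"
    unfolding trivial_prog_def
    by (rule dsem_FOR[where I = ?I]) (use assms in \<open>auto simp: upd_apply less_Suc_eq\<close>)
  then show "\<forall>x<n. words (dsem orc trivial_prog s) ''centers'' x = x \<and> words (dsem orc trivial_prog s) ''assignment'' x = x"
    "\<forall>x\<ge>n. words (dsem orc trivial_prog s) ''centers'' x = words s ''centers'' x" by auto
qed

section \<open>Parameters and startup\<close>

text \<open>The factor in \<open>N = cN * (ell * k)\<close>: \<open>690094080 = 1440 * 64 * 7488\<close>.\<close>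

definition cN :: nat where "cN = 690094080"

text \<open>The condition 7 <= E makes the distance bound \<open>Lam\<close> at least 2^7 >= 100
  even for n = 2.\<close>

locale problem =
  fixes n k z E :: nat and d :: "nat \<Rightarrow> nat \<Rightarrow> real" and SO :: "nat \<Rightarrow> 's" and sd :: "'s \<Rightarrow> 's \<Rightarrow> real"
    and A :: "nat set set \<Rightarrow> nat set \<Rightarrow> real"
  assumes n2: "2 \<le> n" and k1: "1 \<le> k" and kn: "k < n" and z: "z \<in> {1, 2}"
    and metric: "Metric_space {..<n} d"
    and d_ge_1: "\<And>x y. x < n \<Longrightarrow> y < n \<Longrightarrow> x \<noteq> y \<Longrightarrow> 1 \<le> d x y"
    and d_le: "\<And>x y. x < n \<Longrightarrow> y < n \<Longrightarrow> x \<noteq> y \<Longrightarrow> d x y \<le> real n ^ E"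
    and E7: "7 \<le> E"
    and valid: "valid_symbols n d SO sd"
begin

definition ell :: nat where "ell = (SOME l. n \<le> 2 ^ l \<and> 2 ^ l < 2 * n)"

lemma ell_unique:
  assumes "n \<le> 2 ^ l" "2 ^ l < 2 * n"
  shows "l = ell"
proof -
  have e: "n \<le> 2 ^ ell \<and> 2 ^ ell < 2 * n"
    unfolding ell_def by (rule someI[of _ l]) (use assms in simp)
  have less: "a \<le> b" if "n \<le> 2 ^ b" "2 ^ a < 2 * n" for a b :: nat
  proof -
    have "(2::nat) ^ a < 2 ^ Suc b" using that by simp
    then have "a < Suc b" by (rule power_less_imp_less_exp[rotated]) simp
    then show ?thesis by simp
  qed
  show ?thesis using less[of l ell] less[of ell l] assms e by (simp add: antisym)
qed

lemma ell: "n \<le> 2 ^ ell" "2 ^ ell < 2 * n" "1 \<le> ell" "ell < 2 ^ ell" "k < 2 ^ ell"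
proof -
  \<comment> \<open>That a suitable exponent exists is read off from a run of
    \<open>size_prog\<close>.\<close>
  let ?s = "dsem (undefined :: 's oracles) size_prog (wset ''cap'' 0 (n + n) (strip (initial_state n k z)))"
  have "words ?s ''ell'' 0 = ell"
    by (rule ell_unique; rule size_spec) (use n2 in \<open>auto simp: initial_state_def upd_apply\<close>)
  moreover have "n \<le> 2 ^ words ?s ''ell'' 0 \<and> 2 ^ words ?s ''ell'' 0 < 2 * n"
    using n2 by (intro conjI size_spec) (auto simp: initial_state_def upd_apply)
  ultimately show *: "n \<le> 2 ^ ell" "2 ^ ell < 2 * n" by auto
  show "1 \<le> ell" using * n2 by (cases ell) auto
  show "ell < 2 ^ ell" by simp
  show "k < 2 ^ ell" using kn * by simp
qed

definition Lm :: nat where "Lm = (2 ^ ell) ^ E"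
text \<open>As (5/4)^4 >= 2, the power (5/4)^J is at least 2^(2 * E * ell + 5) = 32 * Lam^2, enough
  for the range of \<open>round_up\<close>.\<close>

definition Jn :: nat where "Jn = 4 * (2 * E * ell + 5)"
definition Nn :: nat where "Nn = cN * (ell * k)"
text \<open>Every 2 * k swaps at least halve the excess, and the initial excess is at most n * Lam^2
  <= 2^(ell * (2 * E + 1)), so it ends at 1 or below.\<close>

definition In :: nat where "In = 2 * k * (ell * (2 * E + 1))"
definition Vn :: nat where "Vn = 10 ^ 9 * (E + 1) * (2 ^ ell) ^ (8 * E + 2)"

lemma le_Vn:
  assumes "a \<le> 10 ^ 9 * (E + 1) * (2 ^ ell) ^ j" "j \<le> 8 * E + 2"
  shows "a \<le> Vn"
  using assms(1) power_increasing[OF assms(2), of "2 ^ ell :: nat"] unfolding Vn_def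
  by (meson le_trans mult_le_mono2 one_le_numeral one_le_power)

lemma Nn_le: "Nn \<le> Vn"
proof (rule le_Vn[of _ 2])
  have "ell * k \<le> 2 ^ ell * 2 ^ ell" using ell by (intro mult_le_mono) auto
  then have "cN * (ell * k) \<le> 10 ^ 9 * (E + 1) * (2 ^ ell * 2 ^ ell)"
    by (rule mult_le_mono[rotated]) (simp add: cN_def)
  then show "Nn \<le> 10 ^ 9 * (E + 1) * (2 ^ ell) ^ 2" by (simp add: Nn_def power2_eq_square)
qed simp

lemma J_power: "n * 2 ^ Jn \<le> Vn"
proof -
  have "Jn = 20 + ell * (8 * E)" by (simp add: Jn_def algebra_simps)
  then have "(2::nat) ^ Jn = 2 ^ 20 * (2 ^ ell) ^ (8 * E)" by (simp only: power_add power_mult)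
  then have "n * 2 ^ Jn \<le> 2 ^ ell * (2 ^ 20 * (2 ^ ell) ^ (8 * E))" using ell(1) by simp
  also have "\<dots> = 2 ^ 20 * (2 ^ ell) ^ (8 * E + 1)" by simp
  also have "\<dots> \<le> 10 ^ 9 * (E + 1) * (2 ^ ell) ^ (8 * E + 1)" by (intro mult_right_mono) auto
  finally show ?thesis by (rule le_Vn) simp
qed

lemma machine: "machine n z (3744 * ell) Jn d (real Lm) k Nn Lm Vn SO sd"
proof -
  interpret Metric_space "{..<n}" d by (rule metric)
  have sampler: "sampler n z (3744 * ell) Jn d (real Lm)"
  proof unfold_locales
  show "2 \<le> n" by (rule n2)
  show "z \<in> {1, 2}" by (rule z)
  show "1 \<le> 3744 * ell" using ell by simp
  show "1 \<le> d x y" if "x < n" "y < n" "x \<noteq> y" for x y using d_ge_1 that by blast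
  have L: "real Lm = (2 ^ ell) ^ E" by (simp add: Lm_def)
  have L7: "(2::real) ^ 7 \<le> real Lm"
  proof -
    have "(2::real) ^ 7 \<le> 2 ^ (ell * E)" using ell(3) E7 mult_le_mono[of 1 ell 7 E] by (intro power_increasing) auto
    then show ?thesis by (simp add: L flip: power_mult)
  qed
  then show "100 \<le> real Lm" by simp
  show "d x y \<le> real Lm" if "x < n" "y < n" for x y
  proof (cases "x = y")
    case True
    then have "d x y = 0" using Metric_space.zero[OF metric, of x y] that by simp
    then show ?thesis by simp
  next
    case False
    have "real n \<le> real (2 ^ ell)" using ell(1) by (simp only: of_nat_le_iff)
    then have "real n ^ E \<le> (2 ^ ell) ^ E" by (intro power_mono) simp_all
    then show ?thesis using d_le[OF that False] L by linarith
  qed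
  show "16 * real Lm ^ z + 1 \<le> (5 / 4) ^ Jn"
  proof -
    have "real Lm ^ z \<le> real Lm ^ 2" using z L7 by (intro power_increasing) auto
    moreover have "1 \<le> real Lm ^ 2" using L7 by simp
    ultimately have "16 * real Lm ^ z + 1 \<le> 32 * real Lm ^ 2" by linarith
    also have "\<dots> = 2 ^ (2 * E * ell + 5)" unfolding L by (simp add: mult_ac power_add flip: power_mult)
    also have "\<dots> \<le> ((5 / 4) ^ 4) ^ (2 * E * ell + 5)" by (intro power_mono) (auto simp: power_divide)
    also have "\<dots> = (5 / 4) ^ Jn" by (simp only: Jn_def power_mult)
    finally show ?thesis .
  qed
  qed
  interpret sa: sampler n z "3744 * ell" Jn d d "real Lm" by (rule sampler)
  show ?thesis
  proof unfold_locales
  show "1 \<le> k" by (rule k1)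
  show "real Lm = real Lm" ..
  show "n * 2 ^ Jn \<le> Vn" by (rule J_power)
  show "Nn \<le> Vn" by (rule Nn_le)
  have M: "sampler.M (3744 * ell) = 479232 * ell"
    by (simp add: sa.M_def sa.m_def)
  show "2 * sampler.M (3744 * ell) \<le> Vn"
  proof -
    have "2 * (479232 * ell) \<le> Nn" using k1 by (simp add: Nn_def cN_def)
    then show ?thesis using Nn_le unfolding M by linarith
  qed
  show "sd (SO x) (SO y) = d x y" if "x < n" "y < n" for x y using valid that by (simp add: valid_symbols_def)
  show "1 \<le> Nn" using ell(3) k1 by (simp add: Nn_def cN_def)
  qed
qed

text \<open>38 = 27 + 9 + 2 for the first write to \<open>cap\<close>, the comparison of k with n,
  and the second write apart from \<open>cap_exp\<close>.\<close>

definition start_time :: nat where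
  "start_time = bit_length Vn * (38 + (wsz (cap_exp E))\<^sup>2 + (kap size_prog + kap (param_prog E)) * (n + 1))"

end

locale corrupted_problem = problem +
  fixes S :: "nat set set"
begin

sublocale m: machine n z "3744 * ell" Jn d "weak_answers d S A" "real Lm" k Nn In Lm Vn SO sd
  by (rule machine)

lemma startup:
  defines "s0 \<equiv> initial_state n k z"
  shows "\<exists>t. exec m.orc (prog E) s0 = exec m.orc (Seq main_loop (comp cluster_prog)) t \<and>
    m.loop_inv [] t \<and> spends start_time 0 0 s0 t"
proof -
  let ?BL = "bit_length Vn"
  \<comment> \<open>\<open>cap\<close> changes between the compiled pieces, so it is a parameter
    within each of them but not throughout.\<close>
  let ?X = "{''n'', ''k'', ''z''}" let ?Y = "insert ''cap'' ?X"
  define \<rho> where "\<rho> c = (\<lambda>_. 0)(''n'' := n, ''k'' := k, ''z'' := z, ''cap'' := c)" for c :: nat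
  have V2: "2 \<le> Vn" using m.V_ge by simp
  have n2V: "n + n \<le> Vn"
    by (rule le_Vn[of _ 1]) (use ell(1) in \<open>auto intro: order_trans[of _ "2 * 2 ^ ell"]\<close>)
  have p0: "params ?X Vn (\<rho> 0) s0"
    using n2V kn z V2 by (auto simp: params_def bnd_def s0_def initial_state_def upd_apply \<rho>_def)
  have "wval s0 (WPlus (var ''n'') (var ''n'')) = n + n" by (simp add: s0_def initial_state_def upd_apply)
  then obtain s1 where s1: "exec m.orc (WSet ''cap'' (WConst 0) (WPlus (var ''n'') (var ''n''))) s0 = return_spmf s1"
    "strip s1 = wset ''cap'' 0 (n + n) (strip s0)" "params ?X Vn (\<rho> 0) s1"
    "spends (?BL * ((wsz (WConst 0))\<^sup>2 + (wsz (WPlus (var ''n'') (var ''n'')))\<^sup>2 + 1)) 0 0 s0 s1"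
    using exec_WSet[OF p0 V2, of "WConst 0" "WPlus (var ''n'') (var ''n'')" "''cap''" m.orc] n2V
    by (auto simp del: exec.simps)
  have w1: "words s1 a i = (if a = ''cap'' \<and> i = 0 then n + n else words s0 a i)" for a i
    using arg_cong[OF s1(2), of words] by (simp add: upd_apply)
  let ?c = "bcost s1 (WLess (var ''k'') (var ''n''))"
  have c: "?c \<le> 9 * ?BL" by (rule loop_test_cost[OF s1(3) V2])
  have b: "bval m.orc s1 (WLess (var ''k'') (var ''n''))"
    using kn by (simp add: w1 s0_def initial_state_def upd_apply)
  let ?s1 = "charge ?c s1"
  have "params ?Y Vn (\<rho> (n + n)) s1"
    using s1(3) by (auto simp: params_def w1 \<rho>_def)
  then have p1: "params ?Y Vn (\<rho> (n + n)) ?s1" by simp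
  have ok1: "ok ?Y Vn size_prog" using V2 by (simp add: size_prog_def)
  obtain s2 where s2: "exec m.orc (comp size_prog) ?s1 = return_spmf s2" "strip s2 = dsem m.orc size_prog (strip s1)"
    "params ?Y Vn (\<rho> (n + n)) s2" "spends (?BL * (kap size_prog * nest (\<rho> (n + n)) size_prog)) (nweak (\<rho> (n + n)) size_prog) (nstrong (\<rho> (n + n)) size_prog) ?s1 s2"
    using exec_comp[OF V2 ok1 p1, of m.orc] by auto
  have pre: "words (strip s1) ''n'' 0 = n" "words (strip s1) ''cap'' 0 = n + n" "words (strip s1) ''ell'' 0 = 0"
    by (auto simp: w1 s0_def initial_state_def upd_apply)
  note sz = size_spec[OF pre n2, of m.orc, folded s2(2)]
  have l2: "words s2 ''ell'' 0 = ell" using sz(2,3) by (intro ell_unique) auto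
  have p2: "words s2 ''p'' 0 = 2 ^ ell" using sz(1) l2 by simp
  have w2: "words s2 a = words s1 a" "reals s2 a = reals s1 a" "symbols s2 a = symbols s1 a" if "a \<notin> {''p'', ''ell'', ''x''}" for a
    using that arg_cong[OF s2(2), of "\<lambda>s. words s a"] arg_cong[OF s2(2), of "\<lambda>s. reals s a"]
      arg_cong[OF s2(2), of "\<lambda>s. symbols s a"] by (simp_all add: dsem_words dsem_reals dsem_symbols size_prog_def del: dsem.simps)
  have p2': "params ?X Vn (\<rho> 0) s2" using s2(3) by (auto simp: params_def \<rho>_def)
  have cv: "wval s2 (cap_exp E) = Vn" by (simp add: cap_exp_def wpow_simps p2 Vn_def)
  have cm: "wmax (cap_exp E) \<le> Vn"
  proof -
    have "10 ^ 9 * (E + 1) \<le> Vn" by (rule le_Vn[of _ 0]) auto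
    then show ?thesis using V2 by (simp add: cap_exp_def wpow_simps)
  qed
  obtain s3 where s3: "exec m.orc (WSet ''cap'' (WConst 0) (cap_exp E)) s2 = return_spmf s3"
    "strip s3 = wset ''cap'' 0 Vn (strip s2)" "params ?X Vn (\<rho> 0) s3"
    "spends (?BL * ((wsz (WConst 0))\<^sup>2 + (wsz (cap_exp E))\<^sup>2 + 1)) 0 0 s2 s3"
    using exec_WSet[OF p2' V2 _ cm, of "WConst 0" "''cap''" m.orc] cv
    by (auto simp del: exec.simps)
  have w3: "words s3 a i = (if a = ''cap'' \<and> i = 0 then Vn else words s2 a i)" for a i
    using arg_cong[OF s3(2), of words] by (simp add: upd_apply)
  have r3: "reals s3 = reals s2" "symbols s3 = symbols s2"
    using arg_cong[OF s3(2), of reals] arg_cong[OF s3(2), of symbols] by simp_all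
  have p3: "params ?Y Vn (\<rho> Vn) s3"
    using s3(3) by (auto simp: params_def w3 \<rho>_def)
  have E1: "10 ^ 9 * (E + 1) \<le> Vn" by (rule le_Vn[of _ 0]) auto
  have ok3: "ok ?Y Vn (param_prog E)" using E1 by (simp add: param_prog_def wpow_simps)
  obtain s4 where s4: "exec m.orc (comp (param_prog E)) s3 = return_spmf s4" "strip s4 = dsem m.orc (param_prog E) (strip s3)"
    "params ?Y Vn (\<rho> Vn) s4" "spends (?BL * (kap (param_prog E) * nest (\<rho> Vn) (param_prog E))) (nweak (\<rho> Vn) (param_prog E)) (nstrong (\<rho> Vn) (param_prog E)) s3 s4"
    using exec_comp[OF V2 ok3 p3, of m.orc] by auto
  have m: "7488 * ell \<le> Vn" "479232 * ell \<le> Vn"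
  proof -
    have "479232 * ell \<le> Nn" using k1 by (simp add: Nn_def cN_def)
    then show "479232 * ell \<le> Vn" "7488 * ell \<le> Vn" using Nn_le by linarith+
  qed
  have JV: "Jn \<le> Vn"
  proof (rule le_Vn[of _ 1])
    have "Jn \<le> (8 * E + 20) * ell" using ell(3) by (simp add: Jn_def algebra_simps)
    also have "\<dots> \<le> 10 ^ 9 * (E + 1) * (2 ^ ell) ^ 1" using ell(4) by (intro mult_le_mono) auto
    finally show "Jn \<le> 10 ^ 9 * (E + 1) * (2 ^ ell) ^ 1" .
  qed simp
  have IV: "In \<le> Vn"
  proof (rule le_Vn[of _ 2])
    have "In = (4 * E + 2) * (k * ell)" by (simp add: In_def algebra_simps)
    also have "\<dots> \<le> 10 ^ 9 * (E + 1) * (2 ^ ell * 2 ^ ell)" using ell(4,5) by (intro mult_le_mono) auto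
    finally show "In \<le> 10 ^ 9 * (E + 1) * (2 ^ ell) ^ 2" by (simp add: power2_eq_square)
  qed simp
  have LV: "Lm \<le> Vn"
    by (rule le_Vn[of _ E]) (auto simp: Lm_def)
  have MM: "m.m = 7488 * ell" "m.M = 479232 * ell" by (simp_all add: m.m_def m.M_def)
  have k3: "words s3 ''k'' 0 = k" "words s3 ''cap'' 0 = Vn" "words s3 ''ell'' 0 = ell" "words s3 ''p'' 0 = 2 ^ ell"
    using p3 l2 p2 by (auto simp: params_def \<rho>_def w3)
  have NN: "1440 * (479232 * ell * k) = Nn" "1440 * (64 * (7488 * ell) * k) = Nn" by (simp_all add: Nn_def cN_def)
  have JN: "4 * (2 * E * ell + 5) = Jn" "2 * k * (ell * (2 * E + 1)) = In" "(2 ^ ell) ^ E = Lm"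
    by (simp_all add: Jn_def In_def Lm_def)
  let ?six = "WS ''m'' (WConst 0) (clamp (WTimes (WConst 7488) (var ''ell''))) ;;
     WS ''M'' (WConst 0) (clamp (WTimes (WConst 64) (var ''m''))) ;;
     WS ''N'' (WConst 0) (clamp (WTimes (WConst 1440) (WTimes (var ''M'') (var ''k'')))) ;;
     WS ''J'' (WConst 0) (clamp (WTimes (WConst 4) (WPlus (WTimes (WConst (2 * E)) (var ''ell'')) (WConst 5)))) ;;
     WS ''I'' (WConst 0) (clamp (WTimes (WTimes (WConst 2) (var ''k'')) (WTimes (var ''ell'') (WConst (2 * E + 1))))) ;;
     WS ''lam'' (WConst 0) (clamp (wpow E))"
  let ?ini = "FOR ''x'' ''n'' (RS ''D'' (var ''x'') (OfWord (var ''lam'')))"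
  have cs: "dsem m.orc (WS a (WConst 0) (clamp e)) v = wset a 0 r v"
    if "words v ''cap'' 0 = Vn" "wval v e = r" "r \<le> Vn" for a e r and v :: "'a state"
    using that by (simp add: min_absorb1)
  define v0 where "v0 = strip s3"
  define v1 where "v1 = wset ''m'' 0 (7488 * ell) v0"
  define v2 where "v2 = wset ''M'' 0 (479232 * ell) v1"
  define v3 where "v3 = wset ''N'' 0 Nn v2"
  define v4 where "v4 = wset ''J'' 0 Jn v3"
  define v5 where "v5 = wset ''I'' 0 In v4"
  define u where "u = wset ''lam'' 0 Lm v5"
  have k0: "words v0 ''k'' 0 = k" "words v0 ''cap'' 0 = Vn" "words v0 ''ell'' 0 = ell" "words v0 ''p'' 0 = 2 ^ ell"
    using k3 by (simp_all add: v0_def)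
  note vs = v1_def v2_def v3_def v4_def v5_def
  have "dsem m.orc (WS ''m'' (WConst 0) (clamp (WTimes (WConst 7488) (var ''ell'')))) v0 = v1"
    unfolding v1_def by (rule cs) (simp_all add: k0 m)
  moreover have "dsem m.orc (WS ''M'' (WConst 0) (clamp (WTimes (WConst 64) (var ''m'')))) v1 = v2"
    unfolding v2_def by (rule cs) (simp_all add: k0 m v1_def upd_apply)
  moreover have "dsem m.orc (WS ''N'' (WConst 0) (clamp (WTimes (WConst 1440) (WTimes (var ''M'') (var ''k''))))) v2 = v3"
    unfolding v3_def by (rule cs) (use NN(1) Nn_le in \<open>simp_all add: k0 v1_def v2_def upd_apply\<close>)
  moreover have "dsem m.orc (WS ''J'' (WConst 0) (clamp (WTimes (WConst 4) (WPlus (WTimes (WConst (2 * E)) (var ''ell'')) (WConst 5))))) v3 = v4"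
    unfolding v4_def by (rule cs) (use JN(1) JV in \<open>simp_all add: k0 v1_def v2_def v3_def upd_apply\<close>)
  moreover have "dsem m.orc (WS ''I'' (WConst 0) (clamp (WTimes (WTimes (WConst 2) (var ''k'')) (WTimes (var ''ell'') (WConst (2 * E + 1)))))) v4 = v5"
    unfolding v5_def by (rule cs) (use JN(2) IV in \<open>simp_all add: k0 v1_def v2_def v3_def v4_def upd_apply\<close>)
  moreover have "dsem m.orc (WS ''lam'' (WConst 0) (clamp (wpow E))) v5 = u"
    unfolding u_def by (rule cs) (use LV in \<open>simp_all add: k0 vs upd_apply wpow_simps Lm_def\<close>)
  ultimately have six: "dsem m.orc ?six (strip s3) = u" by (simp only: dsem.simps(6) v0_def[symmetric])
  have u: "u = wset ''lam'' 0 Lm (wset ''I'' 0 In (wset ''J'' 0 Jn (wset ''N'' 0 Nn (wset ''M'' 0 (479232 * ell) (wset ''m'' 0 (7488 * ell) (strip s3))))))"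
    by (simp only: u_def vs v0_def)
  have s4u: "strip s4 = dsem m.orc ?ini u" unfolding s4(2) param_prog_def six[symmetric] by (simp only: dsem.simps(6))
  have w4: "words s4 a = words u a" if "a \<noteq> ''x''" "a \<noteq> ''D''" for a
    using that arg_cong[OF s4u, of "\<lambda>s. words s a"] by (simp add: dsem_words del: dsem.simps)
  have "words u ''n'' 0 = n" using p3 by (simp add: u upd_apply params_def \<rho>_def)
  then have D4: "\<forall>x<n. reals s4 ''D'' x = real Lm"
    using init_spec[of u n m.orc] unfolding s4u[symmetric] by (simp add: u upd_apply)
  have par4: "m.par s4"
    using s4(3) by (auto simp: params_def param_names_def m.rho_def \<rho>_def w4 u upd_apply MM)
  have old: "words s4 a = words s0 a" if "a \<in> {''A'', ''t'', ''w'', ''F''}" for a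
    using that by (auto simp: w4 u upd_other w2 w3 w1 fun_eq_iff)
  have "m.loop_inv [] s4"
    using par4 D4 old by (auto simp: m.loop_inv_def m.hist_def m.holds_symbols_def s0_def initial_state_def upd_other)
  moreover have "exec m.orc (prog E) s0 = exec m.orc (Seq main_loop (comp cluster_prog)) s4"
    unfolding prog_def using s1(1) b s2(1) s3(1) s4(1) by (simp del: exec.simps(2))
  moreover have "spends start_time 0 0 s0 s4"
  proof -
    have sc: "spends (9 * ?BL) 0 0 s1 ?s1" using c by (simp add: spends_def)
    have z0: "nweak (\<rho> (n + n)) size_prog = 0" "nstrong (\<rho> (n + n)) size_prog = 0"
      "nweak (\<rho> Vn) (param_prog E) = 0" "nstrong (\<rho> Vn) (param_prog E) = 0"
      by (simp_all add: size_prog_def param_prog_def)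
    have nst: "nest (\<rho> (n + n)) size_prog = n + 1" "nest (\<rho> Vn) (param_prog E) = n + 1"
      by (simp_all add: size_prog_def param_prog_def \<rho>_def)
    have "spends (?BL * 27 + 9 * ?BL + ?BL * (kap size_prog * (n + 1)) + ?BL * (1 + (wsz (cap_exp E))\<^sup>2 + 1)
        + ?BL * (kap (param_prog E) * (n + 1))) 0 0 s0 s4"
      using spends_trans[OF spends_trans[OF spends_trans[OF spends_trans[OF s1(4) sc] s2(4)] s3(4)] s4(4)]
      by (simp add: z0 nst power2_eq_square)
    then show ?thesis
      by (rule spends_mono) (simp_all add: start_time_def algebra_simps)
  qed
  ultimately show ?thesis by blast
qed

end

text \<open>Costs depend on the assignment restricted to the n points only, so the infimum ranges
  over finitely many values.\<close>

lemma optimal_cost_attained: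
  assumes "1 \<le> n" "1 \<le> k"
  obtains ctr asg where "clustering_solution n k ctr asg" "optimal_cost z d n k = clustering_cost z d n asg"
proof -
  let ?X = "{clustering_cost z d n asg | ctr asg. clustering_solution n k ctr asg}"
  have "?X \<subseteq> clustering_cost z d n ` (PiE {..<n} (\<lambda>_. {..<n}))"
  proof
    fix v assume "v \<in> ?X"
    then obtain ctr asg where *: "clustering_solution n k ctr asg" "v = clustering_cost z d n asg" by auto
    then have "asg ` {..<n} \<subseteq> {..<n}" unfolding clustering_solution_def by blast
    then have "restrict asg {..<n} \<in> PiE {..<n} (\<lambda>_. {..<n})" by auto
    moreover have "v = clustering_cost z d n (restrict asg {..<n})" using *(2) by (simp add: clustering_cost_def)
    ultimately show "v \<in> clustering_cost z d n ` (PiE {..<n} (\<lambda>_. {..<n}))" by blast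
  qed
  then have fin: "finite ?X" by (rule finite_subset) (intro finite_imageI finite_PiE; simp)
  have "clustering_solution n k (\<lambda>_. 0) (\<lambda>_. 0)"
    using assms by (auto simp: clustering_solution_def intro!: image_eqI[of _ _ 0])
  then have ne: "?X \<noteq> {}" by blast
  have "optimal_cost z d n k = Min ?X" unfolding optimal_cost_def using ne fin by (rule cInf_eq_Min[rotated])
  moreover have "Min ?X \<in> ?X" using fin ne by (rule Min_in)
  ultimately show ?thesis using that by auto
qed

lemma exp_le_half_power: "exp (- real j) \<le> (1 / 2) ^ j"
proof -
  have "exp (- 1) \<le> (1 / 2 :: real)"
    using exp_ge_add_one_self[of 1] by (simp add: exp_minus inverse_eq_divide divide_simps)
  then have "exp (- 1) ^ j \<le> (1 / 2 :: real) ^ j" by (intro power_mono) auto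
  then show ?thesis by (simp flip: exp_of_nat_mult)
qed

section \<open>Probability of an atypical corrupted set\<close>

context problem
begin

text \<open>479232 * ell is the value of \<open>M\<close>, as 64 * 2 * 3744 = 479232.\<close>

definition atypical :: "nat set set set" where
  "atypical = {S. \<exists>q<n. \<exists>q'<n. \<exists>x<n. 479232 * ell \<le> card {y. y < n \<and> d q y \<le> d q q'} \<and>
     3 * card {y. y < n \<and> d q y \<le> d q q'} < 8 * card {y \<in> {y. y < n \<and> d q y \<le> d q q'}. {x, y} \<in> S}}"

lemma n_le_power: "real n \<le> 2 ^ ell"
proof -
  have "real n \<le> real (2 ^ ell)" using ell(1) by (simp only: of_nat_le_iff)
  then show ?thesis by simp
qed

lemma inverse_cube: "1 / real n ^ 3 \<le> 1 / (4 * real n)"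
proof -
  have "4 * real n \<le> real n ^ 3"
    using n2 mult_mono[of 2 "real n" 2 "real n"] by (simp add: power3_eq_cube mult_right_mono)
  then show ?thesis using n2 by (intro divide_left_mono) auto
qed

lemma six_ell: "real n ^ 3 * (1 / 2) ^ (6 * ell) \<le> 1 / (4 * real n)"
proof -
  have "real n ^ 6 \<le> (2 ^ ell) ^ 6" using n_le_power by (intro power_mono) auto
  then have "1 / (2 ^ ell) ^ 6 \<le> 1 / real n ^ 6" using n2 by (intro divide_left_mono) auto
  then have "real n ^ 3 * (1 / 2) ^ (6 * ell) \<le> real n ^ 3 * (1 / real n ^ 6)"
    by (intro mult_left_mono) (simp_all add: power_divide power_mult[symmetric] mult.commute)
  also have "\<dots> = 1 / real n ^ 3" using n2 by (simp add: field_simps flip: power_add)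
  finally show ?thesis using inverse_cube by linarith
qed

text \<open>Union bound over n^3 triples. For balls with at least \<open>M\<close> points the
  exponent is at least 1664 * ell, and 6 * ell suffices to leave n^3 * n^(-6).\<close>

lemma prob_atypical: "measure (corrupted_pairs_pmf (1 / 3) n) atypical \<le> 1 / (4 * real n)"
proof -
  let ?B = "\<lambda>p. {y. y < n \<and> d (fst p) y \<le> d (fst p) (fst (snd p))}"
  let ?I = "{p \<in> {..<n} \<times> {..<n} \<times> {..<n}. 479232 * ell \<le> card (?B p)}"
  let ?E = "\<lambda>p. {S. 3 * card (?B p) < 8 * card {y \<in> ?B p. {snd (snd p), y} \<in> S}}"
  have finI: "finite ?I" by (rule finite_subset[of _ "{..<n} \<times> {..<n} \<times> {..<n}"]) auto
  have cI: "card ?I \<le> n ^ 3"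
    using card_mono[of "{..<n} \<times> {..<n} \<times> {..<n}" ?I] by (simp add: card_cartesian_product power3_eq_cube)
  have "atypical \<subseteq> (\<Union>p\<in>?I. ?E p)"
  proof
    fix S assume "S \<in> atypical"
    then obtain q q' x where "(q, q', x) \<in> ?I" "S \<in> ?E (q, q', x)" unfolding atypical_def by auto
    then show "S \<in> (\<Union>p\<in>?I. ?E p)" by blast
  qed
  then have "measure (corrupted_pairs_pmf (1 / 3) n) atypical \<le> measure (corrupted_pairs_pmf (1 / 3) n) (\<Union>p\<in>?I. ?E p)"
    by (intro measure_pmf.finite_measure_mono) auto
  also have "\<dots> \<le> (\<Sum>p\<in>?I. measure (corrupted_pairs_pmf (1 / 3) n) (?E p))"
    using finI by (intro measure_pmf.finite_measure_subadditive_finite) auto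
  also have "\<dots> \<le> (\<Sum>p\<in>?I. (1 / 2) ^ (6 * ell))"
  proof (rule sum_mono)
    fix p assume p: "p \<in> ?I"
    then have "measure (corrupted_pairs_pmf (1 / 3) n) (?E p) \<le> exp (- real (card (?B p)) / 288)"
      by (intro prob_corrupted_neighbours) auto
    also have "\<dots> \<le> exp (- real (6 * ell))"
    proof -
      have "479232 * ell \<le> card (?B p)" using p by simp
      then have "479232 * real ell \<le> real (card (?B p))" by (simp flip: of_nat_le_iff[where 'a = real])
      then show ?thesis by simp
    qed
    also have "\<dots> \<le> (1 / 2) ^ (6 * ell)" by (rule exp_le_half_power)
    finally show "measure (corrupted_pairs_pmf (1 / 3) n) (?E p) \<le> (1 / 2) ^ (6 * ell)" .
  qed
  also have "\<dots> = real (card ?I) * (1 / 2) ^ (6 * ell)" by simp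
  also have "\<dots> \<le> real n ^ 3 * (1 / 2) ^ (6 * ell)"
    using cI by (intro mult_right_mono) (auto simp flip: of_nat_power)
  finally show ?thesis using six_ell by linarith
qed

lemma ell_le_log: "real ell \<le> 2 * log 2 (real n)" "1 \<le> log 2 (real n)"
proof -
  show 1: "1 \<le> log 2 (real n)" using n2 by (simp add: le_log_iff)
  have "(2::real) ^ ell < 2 * real n" using ell(2) by (metis of_nat_less_iff of_nat_mult of_nat_numeral of_nat_power)
  then have "real ell < log 2 (2 * real n)" using n2 by (simp add: less_log_iff powr_realpow)
  also have "\<dots> = 1 + log 2 (real n)" using n2 by (simp add: log_mult)
  finally show "real ell \<le> 2 * log 2 (real n)" using 1 by simp
qed

definition Zn :: nat where "Zn = n * k + k ^ 3"

end

section \<open>Running time and numbers of queries\<close>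

definition time_const :: "nat \<Rightarrow> nat" where
  "time_const E = (47 + (wsz (cap_exp E))\<^sup>2) + 2 * (kap size_prog + kap (param_prog E))
    + kap weights_prog * (cN * 2 * (8 * E + 21)) + kap step_prog * (cN * (cN + 1)^2 + 2 * cN * 7489^2) + 40 * cN
    + kap cluster_prog * (4 + (4 * E + 3) * (cN + 1)^2)"

definition bits_const :: "nat \<Rightarrow> nat" where "bits_const E = bit_length (10 ^ 9 * (E + 1)) + 8 * E + 2"

lemma (in problem) bit_length_Vn: "bit_length Vn \<le> bits_const E * ell"
proof -
  let ?b = "bit_length (10 ^ 9 * (E + 1))"
  have "Vn < 2 ^ ?b * (2 ^ ell) ^ (8 * E + 2)"
    unfolding Vn_def by (intro mult_strict_right_mono less_two_power_bit_length) auto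
  also have "\<dots> = 2 ^ (?b + ell * (8 * E + 2))" by (simp only: power_add power_mult)
  finally have "bit_length Vn \<le> ?b + ell * (8 * E + 2)"
    by (rule bit_length_le) (use bit_length_ge_1[of "10 ^ 9 * (E + 1)"] in simp)
  also have "\<dots> \<le> bits_const E * ell" using ell(3) by (simp add: bits_const_def algebra_simps)
  finally show ?thesis .
qed

context corrupted_problem
begin

definition total_time :: nat where
  "total_time = start_time + (Nn * m.body_time + 9 * bit_length Vn + bit_length Vn * (kap cluster_prog * nest m.rho cluster_prog))"

lemma k_le_Nn: "k \<le> Nn"
  using ell(3) by (simp add: Nn_def cN_def)

lemma m_numbers: "m.m = 7488 * ell" "m.M = 479232 * ell"
  by (simp_all add: m.m_def m.M_def)

text \<open>The products that matter are N^2 per draw for the radius, n * m^2 per draw for the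
  medians, and N^2 per swap for the local search.\<close>

lemma nest_bounds:
  "nest m.rho weights_prog = (n + 1) * (Jn + 1)"
  "nest m.rho step_prog \<le> (Nn + 1) * (Nn + 1) + (n + 1) * ((m.m + 1) * (m.m + 1))"
  "nest m.rho cluster_prog \<le> (n + 1) * (k + 1) + (In + 1) * ((Nn + 1) * (Nn + 1))"
proof -
  show "nest m.rho weights_prog = (n + 1) * (Jn + 1)"
    by (simp add: weights_prog_def round_prog_def m.rho_def)
  have "nest m.rho scan_prog = n + 1" "nest m.rho query_prog = n + 1" "nest m.rho radius_prog = (Nn + 1) * (Nn + 1)"
    "nest m.rho witness_prog = Nn + 1" "nest m.rho relax_prog = (m.m + 1) * (m.m + 1)"
    by (simp_all add: scan_prog_def query_prog_def radius_prog_def count_prog_def witness_prog_def relax_prog_def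
        rank_prog_def m.rho_def)
  then have "nest m.rho step_prog \<le> Max {n + 1, (Nn + 1) * (Nn + 1), Nn + 1, (n + 1) * ((m.m + 1) * (m.m + 1)), 1}"
    by (simp add: step_prog_def m.rho_def)
  also have "\<dots> \<le> (Nn + 1) * (Nn + 1) + (n + 1) * ((m.m + 1) * (m.m + 1))" by auto
  finally show "nest m.rho step_prog \<le> (Nn + 1) * (Nn + 1) + (n + 1) * ((m.m + 1) * (m.m + 1))" .
  have "nest m.rho near_prog = (Nn + 1) * (k + 1)" "nest m.rho cost_prog = Nn + 1"
    "nest m.rho swap_cost_prog = max (k + 1) (Nn + 1)" "nest m.rho choose_prog = k + 1"
    by (simp_all add: near_prog_def near1_prog_def near2_prog_def cost_prog_def swap_cost_prog_def clear_prog_def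
        min_prog_def choose_prog_def m.rho_def)
  note nests = this
  have "(Nn + 1) * (k + 1) \<le> (Nn + 1) * (Nn + 1)" using k_le_Nn by (intro mult_le_mono2) simp
  moreover have "(m.rho ''N'' + 1) * max (nest m.rho swap_cost_prog) (nest m.rho choose_prog) \<le> (Nn + 1) * (Nn + 1)"
    unfolding nests using k_le_Nn by (intro mult_le_mono) (simp_all add: m.rho_def)
  ultimately have imp: "nest m.rho improve_prog \<le> (Nn + 1) * (Nn + 1)"
    unfolding improve_prog_def nest.simps max.bounded_iff nests(1,2) by simp
  have "nest m.rho count_points_prog = n + 1" "nest m.rho centers_prog = k + 1" "nest m.rho assign_prog = k + 1"
    by (simp_all add: count_points_prog_def centers_prog_def assign_prog_def m.rho_def)
  then have "nest m.rho cluster_prog \<le> Max {n + 1, (In + 1) * nest m.rho improve_prog, k + 1, (n + 1) * (k + 1)}"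
    by (simp add: cluster_prog_def m.rho_def)
  also have "\<dots> \<le> (n + 1) * (k + 1) + (In + 1) * nest m.rho improve_prog" by auto
  also have "(In + 1) * nest m.rho improve_prog \<le> (In + 1) * ((Nn + 1) * (Nn + 1))"
    using imp by (rule mult_le_mono2)
  finally show "nest m.rho cluster_prog \<le> (n + 1) * (k + 1) + (In + 1) * ((Nn + 1) * (Nn + 1))" by simp
qed

text \<open>Draws and swaps are both O(k * ell) in number, so N^2 for each gives k^3 * ell^3, and
  the medians give n * k * ell^3. The bit length contributes the fourth logarithm.\<close>

lemma total_time_le: "total_time \<le> bit_length Vn * (time_const E * (ell ^ 3 * Zn))"
proof -
  let ?X = "ell ^ 3 * Zn"
  have l1: "1 \<le> ell" "ell ^ 2 \<le> ell ^ 3" using ell(3) by (auto intro: power_increasing)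
  have nk: "n * k \<le> Zn" "k ^ 3 \<le> Zn" by (simp_all add: Zn_def)
  have X1: "n * k * ell ^ 2 \<le> ?X" "n * k * ell ^ 3 \<le> ?X" "k ^ 3 * ell ^ 3 \<le> ?X"
    using nk l1 by (simp_all add: mult_le_mono mult.commute[of "ell ^ 3"])
  have "n * 1 \<le> n * k" using k1 by (rule mult_le_mono2)
  moreover have "n * k * 1 \<le> n * k * ell ^ 3" using l1 by (intro mult_le_mono2) simp
  ultimately have nX: "n \<le> ?X" "n * k \<le> ?X" using X1(2) by linarith+
  have n1: "n + 1 \<le> 2 * n" "k + 1 \<le> 2 * k" using n2 k1 by auto
  have J1: "Jn + 1 \<le> (8 * E + 21) * ell" using l1 by (simp add: Jn_def algebra_simps)
  have kl: "1 \<le> ell * k" using l1 k1 by simp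
  have N1: "Nn + 1 \<le> (cN + 1) * (ell * k)" using kl by (simp add: Nn_def)
  have I1: "In + 1 \<le> (4 * E + 3) * (ell * k)" using kl by (simp add: In_def algebra_simps)
  have m1: "m.m + 1 \<le> 7489 * ell" using l1 by (simp add: m_numbers)
  have a: "Nn * ((n + 1) * (Jn + 1)) \<le> cN * 2 * (8 * E + 21) * ?X"
  proof -
    have "Nn * ((n + 1) * (Jn + 1)) \<le> cN * (ell * k) * (2 * n * ((8 * E + 21) * ell))"
      unfolding Nn_def by (intro mult_le_mono n1 J1) simp_all
    also have "\<dots> = cN * 2 * (8 * E + 21) * (n * k * ell ^ 2)" by (simp add: power2_eq_square mult_ac)
    also have "\<dots> \<le> cN * 2 * (8 * E + 21) * ?X" by (intro mult_le_mono2 X1)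
    finally show ?thesis .
  qed
  have b: "Nn * ((Nn + 1) * (Nn + 1)) \<le> cN * (cN + 1)^2 * ?X"
  proof -
    have "Nn * ((Nn + 1) * (Nn + 1)) \<le> cN * (ell * k) * ((cN + 1) * (ell * k) * ((cN + 1) * (ell * k)))"
      by (intro mult_le_mono N1) (simp_all add: Nn_def)
    also have "\<dots> = cN * (cN + 1)^2 * (k ^ 3 * ell ^ 3)" by (simp only: power2_eq_square power3_eq_cube mult_ac)
    also have "\<dots> \<le> cN * (cN + 1)^2 * ?X" by (intro mult_le_mono2 X1)
    finally show ?thesis .
  qed
  have c: "Nn * ((n + 1) * ((m.m + 1) * (m.m + 1))) \<le> 2 * cN * 7489^2 * ?X"
  proof -
    have "Nn * ((n + 1) * ((m.m + 1) * (m.m + 1))) \<le> cN * (ell * k) * (2 * n * (7489 * ell * (7489 * ell)))"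
      by (intro mult_le_mono n1 m1) (simp_all add: Nn_def)
    also have "\<dots> = 2 * cN * 7489^2 * (n * k * ell ^ 3)" by (simp only: power2_eq_square power3_eq_cube mult_ac)
    also have "\<dots> \<le> 2 * cN * 7489^2 * ?X" by (intro mult_le_mono2 X1)
    finally show ?thesis .
  qed
  have e: "Nn \<le> cN * ?X"
  proof -
    have "ell * k \<le> ell ^ 3 * (n * k)"
      using l1 n2 by (intro mult_le_mono) (auto simp: power3_eq_cube)
    also have "\<dots> \<le> ?X" using nk by simp
    finally show ?thesis unfolding Nn_def by (rule mult_le_mono2)
  qed
  have f: "(n + 1) * (k + 1) \<le> 4 * ?X"
  proof -
    have "(n + 1) * (k + 1) \<le> 2 * n * (2 * k)" by (intro mult_le_mono n1)
    also have "\<dots> = 4 * (n * k)" by simp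
    finally show ?thesis using nX by linarith
  qed
  have g: "(In + 1) * ((Nn + 1) * (Nn + 1)) \<le> (4 * E + 3) * (cN + 1)^2 * ?X"
  proof -
    have "(In + 1) * ((Nn + 1) * (Nn + 1)) \<le> (4 * E + 3) * (ell * k) * ((cN + 1) * (ell * k) * ((cN + 1) * (ell * k)))"
      by (intro mult_le_mono N1 I1)
    also have "\<dots> = (4 * E + 3) * (cN + 1)^2 * (k ^ 3 * ell ^ 3)" by (simp only: power2_eq_square power3_eq_cube mult_ac)
    also have "\<dots> \<le> (4 * E + 3) * (cN + 1)^2 * ?X" by (intro mult_le_mono2 X1)
    finally show ?thesis .
  qed
  have h: "n + 1 \<le> 2 * ?X" "1 \<le> ?X" using nX(1) n2 by linarith+
  have w: "Nn * (kap weights_prog * nest m.rho weights_prog) \<le> kap weights_prog * (cN * 2 * (8 * E + 21)) * ?X"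
    using mult_le_mono2[OF a, of "kap weights_prog"] unfolding nest_bounds(1) by (simp only: mult_ac)
  have st: "Nn * (kap step_prog * nest m.rho step_prog) \<le> kap step_prog * (cN * (cN + 1)^2 + 2 * cN * 7489^2) * ?X"
  proof -
    have "Nn * nest m.rho step_prog \<le> Nn * ((Nn + 1) * (Nn + 1) + (n + 1) * ((m.m + 1) * (m.m + 1)))"
      by (intro mult_le_mono2 nest_bounds)
    also have "\<dots> \<le> (cN * (cN + 1)^2 + 2 * cN * 7489^2) * ?X"
      using b c by (simp only: distrib_left distrib_right)
    finally have "Nn * nest m.rho step_prog \<le> (cN * (cN + 1)^2 + 2 * cN * 7489^2) * ?X" .
    from mult_le_mono2[OF this, of "kap step_prog"] show ?thesis by (simp only: mult_ac)
  qed
  have cl: "kap cluster_prog * nest m.rho cluster_prog \<le> kap cluster_prog * (4 + (4 * E + 3) * (cN + 1)^2) * ?X"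
  proof -
    have "nest m.rho cluster_prog \<le> (4 + (4 * E + 3) * (cN + 1)^2) * ?X"
      using nest_bounds(3) f g by (simp only: distrib_right)
    then show ?thesis unfolding mult.assoc by (rule mult_le_mono2)
  qed
  have s: "(kap size_prog + kap (param_prog E)) * (n + 1) \<le> 2 * (kap size_prog + kap (param_prog E)) * ?X"
    using mult_le_mono2[OF h(1), of "kap size_prog + kap (param_prog E)"] by (simp only: mult_ac)
  have ov: "47 + (wsz (cap_exp E))\<^sup>2 \<le> (47 + (wsz (cap_exp E))\<^sup>2) * ?X" using h(2) by simp
  have q: "Nn * 40 \<le> 40 * cN * ?X" using e by simp
  have "total_time = bit_length Vn * ((47 + (wsz (cap_exp E))\<^sup>2) + (kap size_prog + kap (param_prog E)) * (n + 1)
     + Nn * (kap weights_prog * nest m.rho weights_prog) + Nn * (kap step_prog * nest m.rho step_prog) + Nn * 40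
     + kap cluster_prog * nest m.rho cluster_prog)"
    unfolding total_time_def start_time_def m.body_time_def by (simp only: distrib_left distrib_right) simp
  also have "\<dots> \<le> bit_length Vn * (time_const E * ?X)"
    unfolding time_const_def using w st cl s ov q by (intro mult_le_mono2) (simp only: distrib_right)
  finally show ?thesis .
qed

text \<open>Queries occur in \<open>query_prog\<close> only: one strong query and n weak ones per
  draw.\<close>

lemma queries: "Nn * m.body_weak + nweak m.rho cluster_prog = Nn * n"
  "Nn * m.body_strong + nstrong m.rho cluster_prog = Nn"
proof -
  have "nweak m.rho weights_prog = 0" "nweak m.rho step_prog = n" "nweak m.rho cluster_prog = 0"
    "nstrong m.rho weights_prog = 0" "nstrong m.rho step_prog = 1" "nstrong m.rho cluster_prog = 0"
    by (simp_all add: weights_prog_def round_prog_def step_prog_def scan_prog_def query_prog_def radius_prog_def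
        count_prog_def witness_prog_def relax_prog_def rank_prog_def cluster_prog_def count_points_prog_def
        improve_prog_def near_prog_def near1_prog_def near2_prog_def cost_prog_def swap_cost_prog_def clear_prog_def
        min_prog_def choose_prog_def centers_prog_def assign_prog_def m.rho_def)
  then show "Nn * m.body_weak + nweak m.rho cluster_prog = Nn * n"
    "Nn * m.body_strong + nstrong m.rho cluster_prog = Nn"
    by (simp_all add: m.body_weak_def m.body_strong_def)
qed

section \<open>Success probability of the whole run\<close>

lemma prog_rel:
  "rel_spmf (\<lambda>s h. m.tail_rel s h \<and> time s \<le> total_time \<and> weak_queries s \<le> Nn * n \<and> strong_queries s \<le> Nn)
    (exec m.orc (prog E) (initial_state n k z)) (spmf_of_pmf (m.process Nn))"
proof -
  obtain t where t: "exec m.orc (prog E) (initial_state n k z) = exec m.orc (Seq main_loop (comp cluster_prog)) t"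
    "m.loop_inv [] t" "spends start_time 0 0 (initial_state n k z) t" using startup by blast
  have z0: "time (initial_state n k z :: 'a state) = 0" "weak_queries (initial_state n k z :: 'a state) = 0"
    "strong_queries (initial_state n k z :: 'a state) = 0"
    by (simp_all add: initial_state_def)
  show ?thesis
    unfolding t(1)
    by (rule rel_spmf_mono[OF m.run_rel[OF t(2)]])
      (use t(3) z0 in \<open>auto simp: spends_def queries total_time_def\<close>)
qed

lemma typical_sampler:
  assumes "S \<notin> atypical"
  shows "typical_sampler n z (3744 * ell) Jn d (weak_answers d S A) (real Lm)"
proof unfold_locales
  fix q q' x assume *: "q < n" "q' < n" "x < n" "m.M \<le> card (m.mball q (d q q'))"
  let ?B = "{y. y < n \<and> d q y \<le> d q q'}"
  have "8 * card {y \<in> ?B. {x, y} \<in> S} \<le> 3 * card ?B"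
  proof (rule ccontr)
    assume "\<not> ?thesis"
    then have "S \<in> atypical"
      unfolding atypical_def using *
      by (intro CollectI exI[of _ q] exI[of _ q'] exI[of _ x] conjI) (simp_all add: m.mball_def m_numbers not_le)
    with assms show False by simp
  qed
  moreover have "card {y \<in> ?B. weak_answers d S A x y \<noteq> d x y} \<le> card {y \<in> ?B. {x, y} \<in> S}"
    by (intro card_mono) (auto simp: weak_answers_def)
  ultimately show "8 * card {y \<in> m.mball q (d q q'). weak_answers d S A x y \<noteq> d x y} \<le> 3 * card (m.mball q (d q q'))"
    unfolding m.mball_def by linarith
qed

text \<open>With an optimal solution as comparison, failure implies that the history is not
  \<open>good\<close> or is still \<open>stalled\<close>, each of probability at most 1 / (4 *
  n).\<close>

lemma prob_failure:
  assumes S: "S \<notin> atypical"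
  shows "measure (measure_spmf (exec m.orc (prog E) (initial_state n k z)))
    {s. \<not> approx_solution 8000000000 z d n k (words s ''centers'') (words s ''assignment'')} \<le> 1 / (2 * real n)"
proof -
  interpret ty: typical_sampler n z "3744 * ell" Jn d "weak_answers d S A" "real Lm" by (rule typical_sampler[OF S])
  obtain co ao where sol: "clustering_solution n k co ao" and opt: "optimal_cost z d n k = clustering_cost z d n ao"
    using optimal_cost_attained[of n k z d] n2 k1 by auto
  have co: "\<And>i. i < k \<Longrightarrow> co i < n" and aco: "\<And>x. x < n \<Longrightarrow> ao x \<in> co ` {..<k}"
    using sol by (auto simp: clustering_solution_def)
  have ao: "\<And>x. x < n \<Longrightarrow> ao x < n" using co aco by fastforce
  have "card (ao ` {..<n}) \<le> card (co ` {..<k})" using aco by (intro card_mono) auto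
  also have "\<dots> \<le> k" using card_image_le[of "{..<k}" co] by simp
  finally have cmp: "comparison n z (3744 * ell) Jn d (real Lm) ao k"
    using ao by unfold_locales auto
  interpret c: comparison n z "3744 * ell" Jn d "weak_answers d S A" "real Lm" ao k by (rule cmp)
  have opt_sum: "clustering_cost z d n ao = (\<Sum>x<n. d x (ao x) ^ z)" by (simp add: clustering_cost_def)
  have opt1: "1 \<le> (\<Sum>x<n. d x (ao x) ^ z)"
  proof -
    \<comment> \<open>As k < n, some point is not a center and pays at least 1.\<close>
    have "card (co ` {..<k}) < card {..<n}" using card_image_le[of "{..<k}" co] kn by simp
    then have "\<not> {..<n} \<subseteq> co ` {..<k}" using card_mono[of "co ` {..<k}" "{..<n}"] by auto
    then obtain x where x: "x < n" "x \<notin> co ` {..<k}" by auto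
    then have "1 \<le> d x (ao x)" using aco[of x] ao d_ge_1 by fastforce
    then have "1 \<le> d x (ao x) ^ z" by simp
    also have "\<dots> \<le> (\<Sum>x<n. d x (ao x) ^ z)"
      using x(1) m.d_nonneg by (intro member_le_sum) auto
    finally show ?thesis .
  qed
  have decay: "(1 - 1 / real (2 * k)) ^ In * (real n * real Lm ^ z) \<le> 1"
  proof -
    have "(1 - 1 / real (2 * k)) ^ In = ((1 - 1 / real (2 * k)) ^ (2 * k)) ^ (ell * (2 * E + 1))"
      by (simp only: In_def power_mult)
    also have "\<dots> \<le> (1 / 2) ^ (ell * (2 * E + 1))"
      using k1 by (intro power_mono one_minus_inverse_power_le_half) (auto simp: divide_le_eq)
    finally have q: "(1 - 1 / real (2 * k)) ^ In \<le> (1 / 2) ^ (ell * (2 * E + 1))" .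
    have "1 \<le> real Lm" using m.Lam by linarith
    then have "real Lm ^ z \<le> real Lm ^ 2" using z by (intro power_increasing) auto
    then have "real n * real Lm ^ z \<le> 2 ^ ell * real Lm ^ 2" using n_le_power by (intro mult_mono) auto
    also have "\<dots> = 2 ^ (ell * (2 * E + 1))"
      unfolding Lm_def by (simp add: algebra_simps power_add flip: power_mult)
    finally have "(1 - 1 / real (2 * k)) ^ In * (real n * real Lm ^ z) \<le> (1 / 2) ^ (ell * (2 * E + 1)) * 2 ^ (ell * (2 * E + 1))"
      using q by (intro mult_mono) auto
    then show ?thesis by (simp add: power_divide)
  qed
  let ?p = "exec m.orc (prog E) (initial_state n k z)"
  let ?bad = "{s. \<not> approx_solution 8000000000 z d n k (words s ''centers'') (words s ''assignment'')}"
  have "measure (measure_spmf ?p) ?bad \<le> measure (measure_spmf (spmf_of_pmf (m.process Nn)))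
     {h. \<exists>s\<in>?bad. m.tail_rel s h \<and> time s \<le> total_time \<and> weak_queries s \<le> Nn * n \<and> strong_queries s \<le> Nn}"
    by (rule rel_spmf_measureD[OF prog_rel])
  also have "\<dots> = measure (m.process Nn)
     {h. \<exists>s\<in>?bad. m.tail_rel s h \<and> time s \<le> total_time \<and> weak_queries s \<le> Nn * n \<and> strong_queries s \<le> Nn}"
    by simp
  also have "\<dots> \<le> measure (m.process Nn) ({h. \<not> m.good h} \<union> {h. c.stalled h})"
  proof (rule measure_pmf.finite_measure_mono)
    show "{h. \<exists>s\<in>?bad. m.tail_rel s h \<and> time s \<le> total_time \<and> weak_queries s \<le> Nn * n \<and> strong_queries s \<le> Nn}
        \<subseteq> {h. \<not> m.good h} \<union> {h. c.stalled h}"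
    proof
      fix h assume "h \<in> {h. \<exists>s\<in>?bad. m.tail_rel s h \<and> time s \<le> total_time \<and> weak_queries s \<le> Nn * n \<and> strong_queries s \<le> Nn}"
      then obtain s where s: "s \<in> ?bad" "m.tail_rel s h" by blast
      have False if g: "m.good h" and st: "\<not> c.stalled h"
      proof -
        have "(\<Sum>x<n. m.est h x ^ z) \<le> 1400000 * (\<Sum>x<n. d x (ao x) ^ z)"
          using g st by (simp add: c.stalled_def c.uncovered_def c.opt_def)
        then have "approx_solution 8000000000 z d n k (words s ''centers'') (words s ''assignment'')"
          using m.approximation[OF cmp co aco s(2) g _ opt1 decay] opt opt_sum by (simp add: approx_solution_def)
        then show False using s(1) by simp
      qed
      then show "h \<in> {h. \<not> m.good h} \<union> {h. c.stalled h}" by blast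
    qed
  qed auto
  also have "\<dots> \<le> measure (m.process Nn) {h. \<not> m.good h} + measure (m.process Nn) {h. c.stalled h}"
    by (rule measure_Un_le) auto
  also have "measure (m.process Nn) {h. \<not> m.good h} \<le> 1 / (4 * real n)"
  proof -
    \<comment> \<open>Bernoulli's inequality; the exponent 3744 = 6 * 624 then gives 2^(6 *
      ell).\<close>
    have "(2::real) \<le> (625 / 624) ^ 624"
      using Bernoulli_inequality[of "1 / 624" 624] by simp
    then have "2 ^ (6 * ell) \<le> ((625 / 624 :: real) ^ 624) ^ (6 * ell)" by (intro power_mono) auto
    also have "\<dots> = (625 / 624) ^ (3744 * ell)" by (simp flip: power_mult)
    finally have "real n ^ 3 / (625 / 624) ^ (3744 * ell) \<le> real n ^ 3 / 2 ^ (6 * ell)"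
      by (intro divide_left_mono) auto
    then show ?thesis using ty.prob_not_good[of Nn] six_ell by (simp add: power_divide)
  qed
  also have "measure (m.process Nn) {h. c.stalled h} \<le> 1 / (4 * real n)"
  proof -
    \<comment> \<open>Each of the 5 * M * k blocks of 288 draws halves the bound, against the factor
      2^(4 * M * k) for the possible progress draws; 2^-(M * k) remains.\<close>
    have N: "Nn = 288 * (5 * (m.M * k))" by (simp add: Nn_def cN_def m_numbers)
    have "(287 / 288 :: real) ^ Nn = ((287 / 288) ^ 288) ^ (5 * (m.M * k))" unfolding N by (rule power_mult)
    also have "\<dots> \<le> (1 / 2) ^ (5 * (m.M * k))"
      using one_minus_inverse_power_le_half[of 288] by (intro power_mono) auto
    finally have "2 ^ (4 * m.M * k) * (287 / 288) ^ Nn \<le> 2 ^ (4 * m.M * k) * (1 / 2 :: real) ^ (5 * (m.M * k))"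
      by (intro mult_left_mono) auto
    also have "\<dots> = (1 / 2) ^ (m.M * k)"
    proof -
      have e: "5 * (m.M * k) = 4 * m.M * k + m.M * k" by simp
      show ?thesis unfolding e power_add by (simp add: power_divide)
    qed
    also have "\<dots> \<le> (1 / 2) ^ (6 * ell)"
    proof (rule power_decreasing)
      have "6 * ell \<le> m.M * 1" by (simp add: m_numbers)
      also have "\<dots> \<le> m.M * k" using k1 by (rule mult_le_mono2)
      finally show "6 * ell \<le> m.M * k" .
    qed auto
    also have "\<dots> \<le> real n ^ 3 * (1 / 2) ^ (6 * ell)" using n2 by simp
    finally show ?thesis using c.prob_stalled[of Nn] six_ell by linarith
  qed
  finally show ?thesis using n2 by (simp add: field_simps)
qed

end

lemma rel_spmf_setD1: "rel_spmf R p q \<Longrightarrow> x \<in> set_spmf p \<Longrightarrow> \<exists>y. R x y"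
  by (erule rel_spmfE) fastforce

context corrupted_problem
begin

lemma outcome:
  assumes C: "16 * real (bits_const E) * real (time_const E) + 2 * real cN \<le> C"
  defines "p \<equiv> exec \<lparr>weak_oracle = weak_answers d S A, strong_oracle = SO, symbol_dist = sd\<rparr> (prog E) (initial_state n k z)"
  shows "lossless_spmf p"
    "\<forall>s\<in>set_spmf p. real (strong_queries s) \<le> C * (real k * (log 2 n)\<^sup>2) \<and>
       real (weak_queries s) \<le> C * (real n * real k * (log 2 n)\<^sup>2) \<and>
       real (time s) \<le> C * ((real n * real k + real k ^ 3) * (log 2 n) ^ 4)"
    "S \<notin> atypical \<Longrightarrow> measure (measure_spmf p)
       {s. \<not> approx_solution 8000000000 z d n k (words s ''centers'') (words s ''assignment'')} \<le> 1 / (2 * real n)"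
proof -
  have p: "p = exec m.orc (prog E) (initial_state n k z)" by (simp add: p_def m.orc_def)
  note rel = prog_rel[folded p]
  show "lossless_spmf p" using rel_spmf_weightD[OF rel] by (simp add: lossless_spmf_def)
  let ?l = "log 2 (real n)"
  have l: "1 \<le> ?l" "real ell \<le> 2 * ?l" by (rule ell_le_log)+
  have "0 \<le> 16 * real (bits_const E) * real (time_const E)" "0 \<le> 2 * real cN" by simp_all
  then have CC: "2 * real cN \<le> C" "16 * real (bits_const E) * real (time_const E) \<le> C" using C by linarith+
  have lsq: "?l \<le> ?l\<^sup>2" using l(1) by (simp add: power2_eq_square)
  have strong: "real Nn \<le> C * (real k * ?l\<^sup>2)"
  proof -
    have "real Nn = real cN * real k * real ell" by (simp add: Nn_def)
    also have "\<dots> \<le> real cN * real k * (2 * ?l\<^sup>2)" using l lsq by (intro mult_left_mono) auto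
    also have "\<dots> = 2 * real cN * (real k * ?l\<^sup>2)" by simp
    also have "\<dots> \<le> C * (real k * ?l\<^sup>2)" using CC(1) by (rule mult_right_mono) simp
    finally show ?thesis .
  qed
  show "\<forall>s\<in>set_spmf p. real (strong_queries s) \<le> C * (real k * ?l\<^sup>2) \<and>
       real (weak_queries s) \<le> C * (real n * real k * ?l\<^sup>2) \<and>
       real (time s) \<le> C * ((real n * real k + real k ^ 3) * ?l ^ 4)"
  proof
    fix s assume "s \<in> set_spmf p"
    then have b: "time s \<le> total_time" "weak_queries s \<le> Nn * n" "strong_queries s \<le> Nn"
      using rel_spmf_setD1[OF rel] by blast+
    have "real (weak_queries s) \<le> real Nn * real n" using b(2) by (simp flip: of_nat_mult)
    also have "\<dots> \<le> C * (real k * ?l\<^sup>2) * real n" using strong by (intro mult_right_mono) auto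
    finally have weak: "real (weak_queries s) \<le> C * (real n * real k * ?l\<^sup>2)" by (simp add: mult_ac)
    have "time s \<le> bit_length Vn * (time_const E * (ell ^ 3 * Zn))" using b(1) total_time_le by (rule le_trans)
    also have "\<dots> \<le> bits_const E * ell * (time_const E * (ell ^ 3 * Zn))"
      using bit_length_Vn by (rule mult_le_mono1)
    also have "\<dots> = bits_const E * time_const E * Zn * ell ^ 4" by (simp add: numeral_eq_Suc mult_ac)
    finally have "real (time s) \<le> real (bits_const E * time_const E * Zn * ell ^ 4)" by (simp only: of_nat_le_iff)
    also have "\<dots> = real (bits_const E) * real (time_const E) * real Zn * real ell ^ 4" by simp
    also have "\<dots> \<le> real (bits_const E) * real (time_const E) * real Zn * (2 * ?l) ^ 4"
      using l by (intro mult_left_mono power_mono) auto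
    also have "\<dots> = 16 * real (bits_const E) * real (time_const E) * (real Zn * ?l ^ 4)" by (simp add: power_mult_distrib)
    also have "\<dots> \<le> C * (real Zn * ?l ^ 4)"
      using CC(2) l by (intro mult_right_mono) auto
    finally have "real (time s) \<le> C * ((real n * real k + real k ^ 3) * ?l ^ 4)" by (simp add: Zn_def)
    moreover have "real (strong_queries s) \<le> C * (real k * ?l\<^sup>2)" using b(3) strong by linarith
    ultimately show "real (strong_queries s) \<le> C * (real k * ?l\<^sup>2) \<and>
       real (weak_queries s) \<le> C * (real n * real k * ?l\<^sup>2) \<and>
       real (time s) \<le> C * ((real n * real k + real k ^ 3) * ?l ^ 4)" using weak by blast
  qed
  show "S \<notin> atypical \<Longrightarrow> measure (measure_spmf p)
       {s. \<not> approx_solution 8000000000 z d n k (words s ''centers'') (words s ''assignment'')} \<le> 1 / (2 * real n)"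
    unfolding p by (rule prob_failure)
qed

end

context problem
begin

text \<open>The corrupted set is drawn first. Atypical sets, of probability at most 1 / (4 * n), are
  counted as failures; for the others the coins fail with probability at most 1 / (2 * n).\<close>

lemma run_outcome:
  assumes C: "16 * real (bits_const E) * real (time_const E) + 2 * real cN \<le> C"
  defines "R \<equiv> oracle_run (1 / 3) d A SO sd (prog E) n k z"
  shows "lossless_spmf R"
    "\<forall>s\<in>set_spmf R. real (strong_queries s) \<le> C * (real k * (log 2 n)\<^sup>2) \<and>
       real (weak_queries s) \<le> C * (real n * real k * (log 2 n)\<^sup>2) \<and>
       real (time s) \<le> C * ((real n * real k + real k ^ 3) * (log 2 n) ^ 4)"
    "1 - 1 / real n \<le> measure (measure_spmf R)
       {s. approx_solution 8000000000 z d n k (words s ''centers'') (words s ''assignment'')}"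
proof -
  let ?c = "corrupted_pairs_pmf (1 / 3) n"
  let ?p = "\<lambda>S. exec \<lparr>weak_oracle = weak_answers d S A, strong_oracle = SO, symbol_dist = sd\<rparr> (prog E) (initial_state n k z)"
  let ?good = "{s :: 's state. approx_solution 8000000000 z d n k (words s ''centers'') (words s ''assignment'')}"
  have cp: "corrupted_problem n k z E d SO sd" by (rule corrupted_problem.intro) unfold_locales
  note out = corrupted_problem.outcome[OF cp C, where A = A]
  have R: "R = bind_spmf (spmf_of_pmf ?c) ?p" by (simp add: R_def oracle_run_def)
  show ll: "lossless_spmf R" unfolding R using out(1) by (simp add: lossless_bind_spmf del: bind_spmf_of_pmf)
  show "\<forall>s\<in>set_spmf R. real (strong_queries s) \<le> C * (real k * (log 2 n)\<^sup>2) \<and>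
       real (weak_queries s) \<le> C * (real n * real k * (log 2 n)\<^sup>2) \<and>
       real (time s) \<le> C * ((real n * real k + real k ^ 3) * (log 2 n) ^ 4)"
    unfolding R using out(2) by (auto simp: set_bind_spmf Set.bind_def simp del: bind_spmf_of_pmf)
  \<comment> \<open>Stated for the underlying \<open>pmf\<close> on options, where the probability
    after a bind is an integral over \<open>S\<close>.\<close>
  have fail: "measure (measure_pmf (?p S)) (Some ` (- ?good)) \<le> indicator atypical S + 1 / (2 * real n)" for S
  proof (cases "S \<in> atypical")
    case True
    have "measure (measure_pmf (?p S)) (Some ` (- ?good)) \<le> 1" by (rule measure_pmf.prob_le_1)
    then show ?thesis using True by (simp add: add_increasing2)
  next
    case False
    have "measure (measure_pmf (?p S)) (Some ` (- ?good)) \<le> 1 / (2 * real n)"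
      using out(3)[OF False] by (simp only: measure_measure_spmf_conv_measure_pmf Collect_neg_eq)
    then show ?thesis using False by (simp only: indicator_simps(2) not_False_eq_True add_0)
  qed
  have "emeasure (measure_pmf R) (Some ` (- ?good)) = (\<integral>\<^sup>+ S. emeasure (measure_pmf (?p S)) (Some ` (- ?good)) \<partial>?c)"
    unfolding R by (simp add: emeasure_bind_pmf)
  also have "\<dots> \<le> (\<integral>\<^sup>+ S. indicator atypical S + ennreal (1 / (2 * real n)) \<partial>?c)"
  proof (rule nn_integral_mono)
    fix S
    have "emeasure (measure_pmf (?p S)) (Some ` (- ?good)) = ennreal (measure (measure_pmf (?p S)) (Some ` (- ?good)))"
      by (rule measure_pmf.emeasure_eq_measure)
    also have "\<dots> \<le> ennreal (indicator atypical S + 1 / (2 * real n))" using fail by (rule ennreal_leI)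
    also have "\<dots> = indicator atypical S + ennreal (1 / (2 * real n))"
      by (simp add: ennreal_plus ennreal_indicator)
    finally show "emeasure (measure_pmf (?p S)) (Some ` (- ?good)) \<le> indicator atypical S + ennreal (1 / (2 * real n))" .
  qed
  also have "\<dots> = emeasure ?c atypical + ennreal (1 / (2 * real n))"
    by (simp add: nn_integral_add measure_pmf.emeasure_space_1)
  also have "\<dots> = ennreal (measure ?c atypical + 1 / (2 * real n))"
    by (simp add: measure_pmf.emeasure_eq_measure ennreal_plus)
  also have "\<dots> \<le> ennreal (1 / real n)"
  proof (rule ennreal_leI)
    have "1 / (4 * real n) + 1 / (2 * real n) \<le> 1 / real n" using n2 by (simp add: field_simps)
    then show "measure ?c atypical + 1 / (2 * real n) \<le> 1 / real n" using prob_atypical by linarith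
  qed
  finally have "measure (measure_pmf R) (Some ` (- ?good)) \<le> 1 / real n"
    by (simp add: measure_pmf.emeasure_eq_measure)
  then have "measure (measure_spmf R) (- ?good) \<le> 1 / real n" by (simp add: measure_measure_spmf_conv_measure_pmf)
  \<comment> \<open>The run has total mass 1, so nothing is lost to non-termination when passing to
    the complement.\<close>
  moreover have "measure (measure_spmf R) (- ?good) = 1 - measure (measure_spmf R) ?good"
    using measure_spmf.finite_measure_compl[of ?good R] ll
    by (simp add: Compl_eq_Diff_UNIV lossless_spmf_def weight_spmf_def space_measure_spmf)
  ultimately show "1 - 1 / real n \<le> measure (measure_spmf R) ?good" by linarith
qed

end

section \<open>The case n <= k, where every point is its own center\<close>

lemma trivial_run:
  fixes orc :: "'s oracles"
  assumes n: "2 \<le> n" "n \<le> k" and z: "z \<in> {1, 2}"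
  shows "\<exists>t. exec orc (prog E) (initial_state n k z) = return_spmf t \<and>
    (\<forall>x<n. words t ''centers'' x = x \<and> words t ''assignment'' x = x) \<and> (\<forall>x\<ge>n. words t ''centers'' x = 0) \<and>
    time t \<le> (144 + 8 * kap trivial_prog) * k ^ 3 \<and> weak_queries t = 0 \<and> strong_queries t = 0"
proof -
  define V where "V = 2 * k + 2"
  define s0 :: "'s state" where "s0 = initial_state n k z"
  let ?BL = "bit_length V"
  let ?X = "{''n'', ''k'', ''z''}" let ?Y = "insert ''cap'' ?X"
  define \<rho> where "\<rho> c = (\<lambda>_. 0)(''n'' := n, ''k'' := k, ''z'' := z, ''cap'' := c)" for c :: nat
  have V2: "2 \<le> V" by (simp add: V_def)
  have p0: "params ?X V (\<rho> 0) s0"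
    using n z by (auto simp: params_def bnd_def s0_def initial_state_def upd_apply \<rho>_def V_def)
  have "wval s0 (WPlus (var ''n'') (var ''n'')) = n + n" by (simp add: s0_def initial_state_def upd_apply)
  then obtain s1 where s1: "exec orc (WSet ''cap'' (WConst 0) (WPlus (var ''n'') (var ''n''))) s0 = return_spmf s1"
    "strip s1 = wset ''cap'' 0 (n + n) (strip s0)" "params ?X V (\<rho> 0) s1"
    "spends (?BL * ((wsz (WConst 0))\<^sup>2 + (wsz (WPlus (var ''n'') (var ''n'')))\<^sup>2 + 1)) 0 0 s0 s1"
    using exec_WSet[OF p0 V2, of "WConst 0" "WPlus (var ''n'') (var ''n'')" "''cap''" orc] n
    by (auto simp: V_def simp del: exec.simps)
  have w1: "words s1 a i = (if a = ''cap'' \<and> i = 0 then n + n else words s0 a i)" for a i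
    using arg_cong[OF s1(2), of words] by (simp add: upd_apply)
  let ?c = "bcost s1 (WLess (var ''k'') (var ''n''))"
  have c: "?c \<le> 9 * ?BL" by (rule loop_test_cost[OF s1(3) V2])
  have b: "\<not> bval orc s1 (WLess (var ''k'') (var ''n''))"
    using n by (simp add: w1 s0_def initial_state_def upd_apply)
  let ?s1 = "charge ?c s1"
  have "params ?Y V (\<rho> (n + n)) s1"
    using s1(3) by (auto simp: params_def w1 \<rho>_def)
  then have p1: "params ?Y V (\<rho> (n + n)) ?s1" by simp
  have ok: "ok ?Y V trivial_prog" by (simp add: trivial_prog_def)
  obtain t where t: "exec orc (comp trivial_prog) ?s1 = return_spmf t" "strip t = dsem orc trivial_prog (strip s1)"
    "spends (?BL * (kap trivial_prog * nest (\<rho> (n + n)) trivial_prog)) (nweak (\<rho> (n + n)) trivial_prog) (nstrong (\<rho> (n + n)) trivial_prog) ?s1 t"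
    using exec_comp[OF V2 ok p1, of orc] by auto
  have "words (strip s1) ''n'' 0 = n" by (simp add: w1 s0_def initial_state_def upd_apply)
  note tr = trivial_spec[OF this, of orc, folded t(2)]
  have z0: "time s0 = 0" "weak_queries s0 = 0" "strong_queries s0 = 0" by (simp_all add: s0_def initial_state_def)
  have sc: "spends (9 * ?BL) 0 0 s1 ?s1" using c by (simp add: spends_def)
  have nn: "nest (\<rho> (n + n)) trivial_prog = n + 1" "nweak (\<rho> (n + n)) trivial_prog = 0" "nstrong (\<rho> (n + n)) trivial_prog = 0"
    by (simp_all add: trivial_prog_def \<rho>_def)
  have sp: "spends (?BL * 27 + 9 * ?BL + ?BL * (kap trivial_prog * (n + 1))) 0 0 s0 t"
    using spends_trans[OF spends_trans[OF s1(4) sc] t(3)] by (simp add: nn power2_eq_square)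
  \<comment> \<open>k is not bounded in terms of n here, so its bit length need not be logarithmic
    in n. It is bounded by 4 * k instead, for which the k^3 in the time bound pays.\<close>
  have "V < 2 ^ V" by simp
  then have "?BL \<le> V" using V2 by (intro bit_length_le) auto
  also have "V \<le> 4 * k" using n by (simp add: V_def)
  finally have BL: "?BL \<le> 4 * k" .
  have "?BL * 27 + 9 * ?BL + ?BL * (kap trivial_prog * (n + 1)) = ?BL * (36 + kap trivial_prog * (n + 1))"
    by (simp add: algebra_simps)
  also have "\<dots> \<le> 4 * k * (36 * k + kap trivial_prog * (2 * k))"
    using BL n by (intro mult_le_mono add_mono) auto
  also have "\<dots> = (144 + 8 * kap trivial_prog) * k ^ 2" by (simp add: power2_eq_square algebra_simps)
  also have "\<dots> \<le> (144 + 8 * kap trivial_prog) * k ^ 3" using n by (intro mult_le_mono2 power_increasing) auto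
  finally have "time t \<le> (144 + 8 * kap trivial_prog) * k ^ 3" "weak_queries t = 0" "strong_queries t = 0"
    using sp z0 by (auto simp: spends_def)
  moreover have "exec orc (prog E) s0 = return_spmf t"
    unfolding prog_def using s1(1) b t(1) by (simp del: exec.simps(2))
  moreover have "\<forall>x\<ge>n. words t ''centers'' x = 0"
    using tr(2) by (simp add: w1 s0_def initial_state_def upd_apply)
  ultimately show ?thesis using tr(1) unfolding s0_def by (intro exI[of _ t]) simp
qed

lemma run_trivial:
  fixes SO :: "nat \<Rightarrow> 's" and sd :: "'s \<Rightarrow> 's \<Rightarrow> real" and E :: nat and A :: "nat set set \<Rightarrow> nat set \<Rightarrow> real"
  assumes n: "2 \<le> n" "n \<le> k" and z: "z \<in> {1, 2}" and metric: "Metric_space {..<n} d"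
    and C: "144 + 8 * real (kap trivial_prog) \<le> C" and \<alpha>: "0 \<le> \<alpha>"
  defines "R \<equiv> oracle_run (1 / 3) d A SO sd (prog E) n k z"
  shows "lossless_spmf R"
    "\<forall>s\<in>set_spmf R. real (strong_queries s) \<le> C * (real k * (log 2 n)\<^sup>2) \<and>
       real (weak_queries s) \<le> C * (real n * real k * (log 2 n)\<^sup>2) \<and>
       real (time s) \<le> C * ((real n * real k + real k ^ 3) * (log 2 n) ^ 4)"
    "measure (measure_spmf R) {s. approx_solution \<alpha> z d n k (words s ''centers'') (words s ''assignment'')} = 1"
proof -
  let ?P = "\<lambda>s :: 's state. (\<forall>x<n. words s ''centers'' x = x \<and> words s ''assignment'' x = x) \<and> (\<forall>x\<ge>n. words s ''centers'' x = 0) \<and>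
    time s \<le> (144 + 8 * kap trivial_prog) * k ^ 3 \<and> weak_queries s = 0 \<and> strong_queries s = 0"
  let ?e = "\<lambda>S. exec \<lparr>weak_oracle = weak_answers d S A, strong_oracle = SO, symbol_dist = sd\<rparr> (prog E) (initial_state n k z)"
  have "\<forall>S. \<exists>t. ?e S = return_spmf t \<and> ?P t" by (rule allI, rule trivial_run[OF n z])
  from choice[OF this] obtain t where t': "\<forall>S. ?e S = return_spmf (t S) \<and> ?P (t S)" by blast
  then have t: "?e S = return_spmf (t S)" "?P (t S)" for S by blast+
  have R: "R = spmf_of_pmf (map_pmf t (corrupted_pairs_pmf (1 / 3) n))"
    unfolding R_def oracle_run_def t(1) by (simp add: bind_pmf_return_spmf)
  show ll: "lossless_spmf R" by (simp add: R)
  have P: "?P s" if "s \<in> set_spmf R" for s using that t(2) unfolding R by auto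
  have l: "1 \<le> log 2 (real n)" using n by (simp add: le_log_iff)
  have C0: "0 \<le> C" using C by linarith
  show "\<forall>s\<in>set_spmf R. real (strong_queries s) \<le> C * (real k * (log 2 n)\<^sup>2) \<and>
       real (weak_queries s) \<le> C * (real n * real k * (log 2 n)\<^sup>2) \<and>
       real (time s) \<le> C * ((real n * real k + real k ^ 3) * (log 2 n) ^ 4)"
  proof
    fix s assume "s \<in> set_spmf R"
    note s = P[OF this]
    have "real (time s) \<le> real ((144 + 8 * kap trivial_prog) * k ^ 3)" using s by (simp only: of_nat_le_iff)
    also have "\<dots> = (144 + 8 * real (kap trivial_prog)) * real k ^ 3" by simp
    also have "\<dots> \<le> C * ((real n * real k + real k ^ 3) * 1)" using C by (intro mult_mono) auto
    also have "\<dots> \<le> C * ((real n * real k + real k ^ 3) * (log 2 n) ^ 4)"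
      using C0 l by (intro mult_left_mono one_le_power) auto
    finally show "real (strong_queries s) \<le> C * (real k * (log 2 n)\<^sup>2) \<and>
       real (weak_queries s) \<le> C * (real n * real k * (log 2 n)\<^sup>2) \<and>
       real (time s) \<le> C * ((real n * real k + real k ^ 3) * (log 2 n) ^ 4)" using s C0 by simp
  qed
  have sol: "approx_solution \<alpha> z d n k (words s ''centers'') (words s ''assignment'')" if "s \<in> set_spmf R" for s
  proof -
    note s = P[OF that]
    \<comment> \<open>Slots from n on keep their initial content 0, which is a point.\<close>
    have "words s ''centers'' x < n" for x using s n by (cases "x < n") auto
    moreover have "words s ''assignment'' x \<in> words s ''centers'' ` {..<k}" if "x < n" for x
      using s n that by (intro image_eqI[of _ _ x]) auto
    ultimately have "clustering_solution n k (words s ''centers'') (words s ''assignment'')"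
      by (auto simp: clustering_solution_def)
    moreover have "clustering_cost z d n (words s ''assignment'') = 0"
      unfolding clustering_cost_def using s z Metric_space.zero[OF metric] by (intro sum.neutral) auto
    moreover have "0 \<le> optimal_cost z d n k"
    proof -
      obtain ctr asg where "optimal_cost z d n k = clustering_cost z d n asg"
        using optimal_cost_attained[of n k z d] n by auto
      then show ?thesis using Metric_space.nonneg[OF metric] by (simp add: clustering_cost_def sum_nonneg)
    qed
    ultimately show ?thesis using \<alpha> by (simp add: approx_solution_def)
  qed
  interpret prob_space "measure_spmf R"
    using ll by (auto simp: lossless_spmf_def weight_spmf_def measure_spmf.emeasure_eq_measure intro!: prob_spaceI)
  have "AE s in measure_spmf R. s \<in> {s. approx_solution \<alpha> z d n k (words s ''centers'') (words s ''assignment'')}"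
    using sol by (simp add: AE_measure_spmf_iff)
  then show "measure (measure_spmf R) {s. approx_solution \<alpha> z d n k (words s ''centers'') (words s ''assignment'')} = 1"
    by (subst prob_eq_1) auto
qed

theorem theorem4p1:
  fixes c :: real
  shows "\<exists>(P :: com) (\<alpha> :: real) (C :: real) (a :: nat) (b :: nat). a \<ge> 1 \<and>
    (\<forall>z \<in> {1, 2 :: nat}. \<forall>n k :: nat. \<forall>d :: nat \<Rightarrow> nat \<Rightarrow> real. \<forall>\<Delta> :: real.
     \<forall>(SO :: nat \<Rightarrow> 's) (sd :: 's \<Rightarrow> 's \<Rightarrow> real).
     \<forall>A :: nat set set \<Rightarrow> nat set \<Rightarrow> real.
       n \<ge> 2 \<longrightarrow> k \<ge> 1 \<longrightarrow>
       Metric_space {..<n} d \<longrightarrow>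
       (\<forall>x<n. \<forall>y<n. x \<noteq> y \<longrightarrow> 1 \<le> d x y \<and> d x y \<le> \<Delta>) \<longrightarrow>
       \<Delta> \<le> real n powr c \<longrightarrow>
       valid_symbols n d SO sd \<longrightarrow>
       (let R = oracle_run (1/3) d A SO sd P n k z in
          lossless_spmf R \<and>
          (\<forall>s \<in> set_spmf R.
             real (strong_queries s) \<le> C * (real k * (log 2 n)\<^sup>2) \<and>
             real (weak_queries s) \<le> C * (real n * real k * (log 2 n)\<^sup>2) \<and>
             real (time s) \<le> C * ((real n * real k + real k ^ 3) * (log 2 n) ^ b)) \<and>
          measure (measure_spmf R)
            {s. approx_solution \<alpha> z d n k (words s ''centers'') (words s ''assignment'')}
          \<ge> 1 - 1 / real n ^ a))"
proof -
  \<comment> \<open>A natural exponent above c; the program depends on c through \<open>E\<close>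
    only. Adding 7 ensures the condition 7 <= E of \<open>problem\<close>.\<close>
  define E where "E = nat \<lceil>\<bar>c\<bar>\<rceil> + 7"
  define C where "C = 16 * real (bits_const E) * real (time_const E) + 2 * real cN + (144 + 8 * real (kap trivial_prog))"
  have C: "16 * real (bits_const E) * real (time_const E) + 2 * real cN \<le> C" "144 + 8 * real (kap trivial_prog) \<le> C"
    by (simp_all add: C_def)
  \<comment> \<open>The time exponent 4 consists of three logarithms from the loop nests and one
    from the word lengths; the failure probability is 1 / n, hence a = 1.\<close>
  show ?thesis
  proof (rule exI[of _ "prog E"], rule exI[of _ 8000000000], rule exI[of _ C], rule exI[of _ 1], rule exI[of _ 4],
      intro conjI ballI allI impI)
    fix z n k :: nat and d :: "nat \<Rightarrow> nat \<Rightarrow> real" and \<Delta> :: real and SO :: "nat \<Rightarrow> 's" and sd :: "'s \<Rightarrow> 's \<Rightarrow> real"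
      and A :: "nat set set \<Rightarrow> nat set \<Rightarrow> real"
    assume z: "z \<in> {1, 2}" and n: "2 \<le> n" and k: "1 \<le> k" and metric: "Metric_space {..<n} d"
      and d: "\<forall>x<n. \<forall>y<n. x \<noteq> y \<longrightarrow> 1 \<le> d x y \<and> d x y \<le> \<Delta>" and \<Delta>: "\<Delta> \<le> real n powr c"
      and valid: "valid_symbols n d SO sd"
    let ?R = "oracle_run (1 / 3) d A SO sd (prog E) n k z"
    show "let R = ?R in lossless_spmf R \<and>
          (\<forall>s \<in> set_spmf R.
             real (strong_queries s) \<le> C * (real k * (log 2 n)\<^sup>2) \<and>
             real (weak_queries s) \<le> C * (real n * real k * (log 2 n)\<^sup>2) \<and>
             real (time s) \<le> C * ((real n * real k + real k ^ 3) * (log 2 n) ^ 4)) \<and>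
          measure (measure_spmf R)
            {s. approx_solution 8000000000 z d n k (words s ''centers'') (words s ''assignment'')}
          \<ge> 1 - 1 / real n ^ 1"
    proof (cases "k < n")
      case True
      have "real n powr c \<le> real n ^ E"
      proof -
        have "c \<le> \<bar>c\<bar>" by simp
        also have "\<dots> \<le> real (nat \<lceil>\<bar>c\<bar>\<rceil>)" by (rule real_nat_ceiling_ge)
        also have "\<dots> \<le> real E" by (simp add: E_def)
        finally have "real n powr c \<le> real n powr real E" using n by (intro powr_mono) auto
        then show ?thesis using n by (simp add: powr_realpow)
      qed
      then have "problem n k z E d SO sd"
        using z n k True metric d \<Delta> valid unfolding problem_def E_def by force
      from problem.run_outcome[OF this C(1), of A] show ?thesis by (simp add: Let_def)
    next
      case False
      then have "n \<le> k" by simp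
      from run_trivial[OF n this z metric C(2), of 8000000000 A SO sd E] show ?thesis
        by (simp add: Let_def)
    qed
  qed simp
qed

end
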